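(* Let $x_*=(145\sqrt{145}-1729)/36\approx0.47309$. On $\Omega_4$, the function $\mathrm{JB}_4$ has exactly $50$ stationary points, all nondegenerate: (a) $12$ minima at the permutations of $2^{-1/2}(0,0,1,-1)'$, where $\mathrm{JB}_4=1/6$ and the Hessian has eigenvalues $8/3$ and $32/3$; (b) $24$ saddle points, where $\mathrm{JB}_4=x_*$ and the Hessian has determinant $\det H_*=(5286656\sqrt{145}-63660800)/27\approx-38.2137$; (c) $6$ local maxima at the permutations of $\frac12(1,1,-1,-1)'$, where $\mathrm{JB}_4=2/3$ and the Hessian is $-\frac{16}3$ times the identity; (d) $8$ global maxima, at the single-outlier directions $\pm12^{-1/2}(3,-1,-1,-1)'$ and their coordinate permutations, where $\mathrm{JB}_4=26/27$ and the Hessian is $-\frac{256}{27}$ times the identity. Consequently the density $f_{\mathrm{JB}_4}$ of $\mathrm{JB}_4(U)$, with $U$ uniformly distributed on $\Omega_4$, is infinitely differentiable on $(1/6,26/27)$ except at $x_*$ and $2/3$, and $$f_{\mathrm{JB}_4}(\tfrac16+)=\tfrac98,\qquad f_{\mathrm{JB}_4}(\tfrac23-)-f_{\mathrm{JB}_4}(\tfrac23+)=\tfrac9{16},\qquad f_{\mathrm{JB}_4}(\tfrac{26}{27}-)=\tfrac{27}{64},$$ $$f_{\mathrm{JB}_4}(x)=-\frac{12}{\pi\,|\det H_*|^{1/2}}\,\log|x-x_*|+O(1)\approx-0.618\log|x-x_*|\qquad(x\to x_* ).$$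
   Context: For $u\in\mathbb{R}^4$ write $p_r(u)=\sum_{i=1}^4u_i^r$. $\Omega_4=\{u\in\mathbb{R}^4:\ p_1(u)=0,\ p_2(u)=1\}$ is a two-dimensional unit sphere with the metric induced from $\mathbb{R}^4$, and for $u\in\Omega_4$, $\mathrm{JB}_4(u)=\frac83p_3(u)^2+\frac16(4p_4(u)-3)^2$. Hessians are Riemannian Hessians on $\Omega_4$. (Under independent normal sampling with four observations, the Jarque--Bera statistic is distributed as $\mathrm{JB}_4(U)$.) $f(x\pm)$ denote one-sided limits. *)

theory Defs
  imports "HOL-Probability.Probability"
begin

definition power_sum :: "nat \<Rightarrow> real^4 \<Rightarrow> real" where
  "power_sum r u = (\<Sum>i\<in>UNIV. (u $ i) ^ r)"

definition Omega4 :: "(real^4) set" where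
  "Omega4 = {u. power_sum 1 u = 0 \<and> power_sum 2 u = 1}"

text \<open>The formula is used on all of \<open>real^4\<close>; only its restriction to \<^const>\<open>Omega4\<close> matters.\<close>

definition JB4 :: "real^4 \<Rightarrow> real" where
  "JB4 u = 8/3 * (power_sum 3 u)\<^sup>2 + 1/6 * (4 * power_sum 4 u - 3)\<^sup>2"

definition perms :: "real^4 \<Rightarrow> (real^4) set" where
  "perms u = {(\<chi> i. u $ \<pi> i) |\<pi>. \<pi> permutes UNIV}"

text \<open>The tangent space at a point of \<^const>\<open>Omega4\<close> is the common kernel of the differentials of
  \<open>power_sum 1\<close> and \<open>power_sum 2\<close>.\<close>

definition tangent4 :: "real^4 \<Rightarrow> (real^4) set" where
  "tangent4 u = {v. (\<Sum>i\<in>UNIV. v $ i) = 0 \<and> u \<bullet> v = 0}"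

text \<open>For \<open>u \<in> Omega4\<close>, the vectors \<open>u\<close> and \<open>(1/2,1/2,1/2,1/2)\<close> form an orthonormal basis of the normal
  space, so that this is the orthogonal projection onto \<open>tangent4 u\<close> (see \<open>tangent_proj4\<close> below).\<close>

definition tangent_proj :: "real^4 \<Rightarrow> real^4 \<Rightarrow> real^4" where
  "tangent_proj u w = w - ((\<Sum>i\<in>UNIV. w $ i) / 4) *\<^sub>R 1 - (u \<bullet> w) *\<^sub>R u"

definition gradient :: "('a::euclidean_space \<Rightarrow> real) \<Rightarrow> 'a \<Rightarrow> 'a" where
  "gradient f x = (\<Sum>b\<in>Basis. frechet_derivative f (at x) b *\<^sub>R b)"

definition riem_grad :: "(real^4 \<Rightarrow> real) \<Rightarrow> real^4 \<Rightarrow> real^4" where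
  "riem_grad f u = tangent_proj u (gradient f u)"

text \<open>The Levi-Civita connection of the metric induced from \<open>real^4\<close> is the tangential part of the
  ambient directional derivative, so the Hessian operator is \<open>v \<mapsto> \<nabla>\<^sub>v (grad f)\<close> as below.
  It is meaningful for \<open>v \<in> tangent4 u\<close> only, and then does not depend on how \<open>f\<close> and its gradient
  field are extended off \<^const>\<open>Omega4\<close>.\<close>

definition riem_hess :: "(real^4 \<Rightarrow> real) \<Rightarrow> real^4 \<Rightarrow> real^4 \<Rightarrow> real^4" where
  "riem_hess f u v = tangent_proj u (frechet_derivative (riem_grad f) (at u) v)"

definition stationary_points :: "(real^4 \<Rightarrow> real) \<Rightarrow> (real^4) set" where
  "stationary_points f = {u \<in> Omega4. riem_grad f u = 0}"

definition nondegenerate :: "(real^4 \<Rightarrow> real) \<Rightarrow> real^4 \<Rightarrow> bool" where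
  "nondegenerate f u \<longleftrightarrow> (\<forall>v\<in>tangent4 u. riem_hess f u v = 0 \<longrightarrow> v = 0)"

definition hess_eigenvalues :: "(real^4 \<Rightarrow> real) \<Rightarrow> real^4 \<Rightarrow> real set" where
  "hess_eigenvalues f u = {k. \<exists>v\<in>tangent4 u. v \<noteq> 0 \<and> riem_hess f u v = k *\<^sub>R v}"

definition tangent_frame :: "real^4 \<Rightarrow> (2 \<Rightarrow> real^4) \<Rightarrow> bool" where
  "tangent_frame u e \<longleftrightarrow>
     (\<forall>i j. e i \<bullet> e j = (if i = j then 1 else 0)) \<and> span (range e) = tangent4 u"

text \<open>The determinant of the Hessian operator: the common value of the determinants of its matrices
  with respect to the orthonormal bases of the tangent plane.\<close>

definition hess_det :: "(real^4 \<Rightarrow> real) \<Rightarrow> real^4 \<Rightarrow> real" where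
  "hess_det f u =
     (THE d. \<forall>e. tangent_frame u e \<longrightarrow> d = det ((\<chi> i j. e i \<bullet> riem_hess f u (e j)) :: real^2^2))"

definition local_min_on :: "('a::topological_space) set \<Rightarrow> ('a \<Rightarrow> real) \<Rightarrow> 'a \<Rightarrow> bool" where
  "local_min_on S f u \<longleftrightarrow> u \<in> S \<and> (\<forall>\<^sub>F w in at u within S. f u \<le> f w)"

definition local_max_on :: "('a::topological_space) set \<Rightarrow> ('a \<Rightarrow> real) \<Rightarrow> 'a \<Rightarrow> bool" where
  "local_max_on S f u \<longleftrightarrow> u \<in> S \<and> (\<forall>\<^sub>F w in at u within S. f w \<le> f u)"

definition saddle_points :: "(real^4 \<Rightarrow> real) \<Rightarrow> (real^4) set" where
  "saddle_points f =
     {u \<in> stationary_points f. \<not> local_min_on Omega4 f u \<and> \<not> local_max_on Omega4 f u}"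

text \<open>A linear isometry of \<open>real^3\<close> onto the hyperplane \<open>power_sum 1 u = 0\<close>; it maps the unit
  sphere of \<open>real^3\<close> isometrically onto \<^const>\<open>Omega4\<close>.\<close>

definition hyperplane_iso :: "real^3 \<Rightarrow> real^4" where
  "hyperplane_iso x =
     (1/2) *\<^sub>R vector [x$1 + x$2 + x$3, x$1 - x$2 - x$3, - x$1 + x$2 - x$3, - x$1 - x$2 + x$3]"

text \<open>Normalised surface area on the unit sphere of \<open>real^3\<close> is the cone measure, that is, the law of
  the direction of a uniformly distributed point of the unit ball.\<close>

definition uniform_Omega4 :: "(real^4) measure" where
  "uniform_Omega4 =
     distr (uniform_measure lborel (ball (0::real^3) 1)) borel (\<lambda>x. hyperplane_iso (sgn x))"

definition x_star :: real where
  "x_star = (145 * sqrt 145 - 1729) / 36"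

definition det_H_star :: real where
  "det_H_star = (5286656 * sqrt 145 - 63660800) / 27"

text \<open>Adequate for open \<open>S\<close> only, since the derivatives are two-sided.\<close>

definition infinitely_differentiable_on :: "(real \<Rightarrow> real) \<Rightarrow> real set \<Rightarrow> bool" where
  "infinitely_differentiable_on f S \<longleftrightarrow> (\<forall>n. \<forall>x\<in>S. (deriv ^^ n) f differentiable (at x))"

lemma vector_4_nth [simp]:
  "(vector [a,b,c,d] :: real^4) $ 1 = a"
  "(vector [a,b,c,d] :: real^4) $ 2 = b"
  "(vector [a,b,c,d] :: real^4) $ 3 = c"
  "(vector [a,b,c,d] :: real^4) $ 4 = d"
  unfolding vector_def by simp_all

lemma Omega4_iff: "u \<in> Omega4 \<longleftrightarrow> (\<Sum>i\<in>UNIV. u $ i) = 0 \<and> u \<bullet> u = 1"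
  by (simp add: Omega4_def power_sum_def inner_vec_def power2_eq_square)

lemma tangent_proj4:
  assumes "u \<in> Omega4"
  shows "tangent_proj u w \<in> tangent4 u"
    and "v \<in> tangent4 u \<Longrightarrow> (w - tangent_proj u w) \<bullet> v = 0"
proof -
  have s: "(\<Sum>i\<in>UNIV. u $ i) = 0" and n: "u \<bullet> u = 1"
    using assms by (auto simp: Omega4_iff)
  have one: "1 \<bullet> x = (\<Sum>i\<in>UNIV. x $ i)" "x \<bullet> 1 = (\<Sum>i\<in>UNIV. x $ i)" for x :: "real^4"
    by (simp_all add: inner_vec_def)
  show "tangent_proj u w \<in> tangent4 u"
    using s n by (simp add: tangent4_def tangent_proj_def inner_diff_right one sum_subtractf
        flip: sum_distrib_left)
  show "(w - tangent_proj u w) \<bullet> v = 0" if "v \<in> tangent4 u"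
    using that by (simp add: tangent4_def tangent_proj_def inner_add_left one)
qed

lemma hyperplane_iso_inner: "hyperplane_iso x \<bullet> hyperplane_iso y = x \<bullet> y"
  by (simp add: hyperplane_iso_def inner_vec_def sum_3 sum_4 field_simps)

lemma hyperplane_iso_sphere: "hyperplane_iso ` sphere 0 1 = Omega4"
proof (intro equalityI subsetI)
  fix u assume "u \<in> hyperplane_iso ` sphere 0 1"
  then obtain x where u: "u = hyperplane_iso x" and x: "norm x = 1" by auto
  have "u \<bullet> u = 1" using x unfolding u hyperplane_iso_inner by (simp add: dot_square_norm)
  moreover have "(\<Sum>i\<in>UNIV. u $ i) = 0"
    by (simp add: u hyperplane_iso_def sum_4 field_simps)
  ultimately show "u \<in> Omega4" by (simp add: Omega4_iff)
next
  fix u assume u: "u \<in> Omega4"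
  define x :: "real^3" where "x = vector [u$1 + u$2, u$1 + u$3, u$1 + u$4]"
  have s: "u$4 = - u$1 - u$2 - u$3" using u by (simp add: Omega4_iff sum_4)
  have eq: "hyperplane_iso x = u"
    unfolding vec_eq_iff forall_4 by (simp add: hyperplane_iso_def x_def s)
  have "x \<bullet> x = 1" using u hyperplane_iso_inner[of x x] by (simp add: eq Omega4_iff)
  then have "norm x = 1" by (simp add: norm_eq_sqrt_inner)
  then show "u \<in> hyperplane_iso ` sphere 0 1" using eq by (intro image_eqI[of _ _ x]) auto
qed

lemma prob_space_uniform_Omega4: "prob_space uniform_Omega4"
proof -
  have "emeasure lborel (ball (0::real^3) 1) \<noteq> 0" "emeasure lborel (ball (0::real^3) 1) \<noteq> \<infinity>"
    using content_ball_pos[of 1 "0::real^3"] emeasure_bounded_finite[of "ball (0::real^3) 1"]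
    by (auto simp: measure_def)
  then have P: "prob_space (uniform_measure lborel (ball (0::real^3) 1))"
    by (rule prob_space_uniform_measure)
  have "linear hyperplane_iso"
    by (rule linearI; unfold vec_eq_iff forall_4)
      (simp_all add: hyperplane_iso_def algebra_simps)
  then have "hyperplane_iso \<in> borel_measurable borel"
    by (simp add: linear_continuous_on linear_linear borel_measurable_continuous_onI)
  moreover have "(sgn :: real^3 \<Rightarrow> real^3) \<in> borel_measurable borel"
    unfolding sgn_div_norm by measurable
  ultimately have "(\<lambda>x. hyperplane_iso (sgn x)) \<in> borel_measurable borel"
    by measurable
  then show ?thesis
    unfolding uniform_Omega4_def by (intro prob_space.prob_space_distr P) simp
qed

lemma JB4_measurable [measurable]: "JB4 \<in> borel_measurable borel"
  unfolding JB4_def power_sum_def by (intro borel_measurable_continuous_onI continuous_intros)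

text \<open>A density of \<^const>\<open>JB4\<close> under \<^const>\<open>uniform_Omega4\<close> is the same as a density of \<open>JB4(U)\<close> for
  any random vector \<open>U\<close> with that law.\<close>

lemma distributed_JB4_iff:
  assumes "U \<in> borel_measurable M" and "distr M borel U = uniform_Omega4"
  shows "distributed M lborel (\<lambda>\<omega>. JB4 (U \<omega>)) f \<longleftrightarrow> distributed uniform_Omega4 lborel JB4 f"
proof -
  have "distr uniform_Omega4 lborel JB4 = distr M lborel (\<lambda>\<omega>. JB4 (U \<omega>))"
    using assms(1) by (simp add: distr_distr comp_def flip: assms(2))
  moreover have "JB4 \<in> measurable uniform_Omega4 lborel"
    by (simp add: uniform_Omega4_def)
  moreover have "(\<lambda>\<omega>. JB4 (U \<omega>)) \<in> measurable M lborel"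
    using assms(1) by simp
  ultimately show ?thesis by (simp add: distributed_def)
qed

end

theory Submission
  imports Defs "HOL-Complex_Analysis.Conformal_Mappings"
begin

text \<open>In the coordinates of \<^const>\<open>hyperplane_iso\<close> the statistic on the unit sphere is
  \<open>24 a b c + 2/3 (a\<^sup>2 + b\<^sup>2 + c\<^sup>2)\<^sup>2\<close>, where \<open>a, b, c\<close> are the squared coordinates. At a critical point two of
  them agree, which leaves four types \<open>(s, s, 1 - 2 s)\<close> up to order; at each of them an explicit tangent frame
  diagonalises the Hessian.

  For the density, pass to the elementary symmetric functions of \<open>a, b, c\<close>. The Jacobian of this map is the
  square root of the product of \<open>a b c\<close> with the discriminant of the cubic with roots \<open>a, b, c\<close>; so the density
  at \<open>x\<close> is a complete integral \<open>\<integral> dm / sqrt P\<close> for a polynomial \<open>P\<close> of degree six in \<open>m = a\<^sup>2 + b\<^sup>2 + c\<^sup>2\<close>, over the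
  intervals on which the three roots are real and positive. After an arcsine substitution it is a proper integral
  that depends analytically on the end points, hence on \<open>x\<close>, as long as the roots of \<open>P\<close> involved stay
  distinct. At \<open>1/6\<close>, \<open>2/3\<close> and \<open>26/27\<close> an interval shrinks to a point, which gives the one-sided limits. At
  \<open>x_star\<close> two adjacent intervals merge, that is, two roots of \<open>P\<close> collide, and this gives the logarithm.\<close>

section \<open>Gradient and Hessian in isometric coordinates\<close>

text \<open>The discriminant locus is a rational curve: squared coordinates
  \<open>1/3 - t, 1/3 - t, 1/3 + 2 t\<close> give \<open>m = 1/3 + 6 t\<^sup>2\<close>, the same for
  \<open>t\<close> and \<open>- t\<close>, and at this \<open>m\<close> the discriminant is a
  constant multiple of \<open>(c - hpoly (- t)) * (hpoly t - c)\<close>. Existence, order and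
  regularity of the roots of \<open>P\<close> are therefore read off from the monotone branches of
  one quartic, with no formula for the roots. Smoothness goes through holomorphic extension, which
  is inherited by inverse functions and, by Morera's theorem, by parameter integrals, so that no
  higher derivative is ever computed. The uniform law is lifted to the solid ball, where the
  statistic is constant on rays: the radius splits off as a constant factor and a one-dimensional
  integral over \<open>m\<close> remains. The delicate point is the bounded error at
  \<open>x_star\<close>, where the domain is one interval on one side and two on the other. The
  coordinate \<open>v\<close> with \<open>v\<^sup>2 = hpoly t - x_star\<close> treats both alike,
  since near the saddle the domain becomes \<open>v\<^sup>2 > c - x_star\<close>. The saddle
  determinant enters only at the end, through an algebraic identity in
  \<open>sqrt 145\<close>.\<close>

abbreviation "hyp \<equiv> hyperplane_iso"

lemmas has_derivative_vec_nth [derivative_intros] = bounded_linear.has_derivative[OF bounded_linear_vec_nth]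

lemma differentiable_vec_nth: "(\<lambda>u. u $ i) differentiable (at u)"
  by (intro bounded_linear_imp_differentiable bounded_linear_vec_nth)

lemma linear_hyperplane_iso: "linear hyp"
  by (rule linearI; unfold vec_eq_iff forall_4) (simp_all add: hyperplane_iso_def algebra_simps)

lemma hyperplane_iso_nth:
  "hyp x $ 1 = (x$1 + x$2 + x$3) / 2" "hyp x $ 2 = (x$1 - x$2 - x$3) / 2"
  "hyp x $ 3 = (- x$1 + x$2 - x$3) / 2" "hyp x $ 4 = (- x$1 - x$2 + x$3) / 2"
  by (simp_all add: hyperplane_iso_def)

lemma inj_hyperplane_iso: "inj hyp"
proof (rule injI)
  fix x y assume "hyp x = hyp y"
  then have "hyp (x - y) = 0" by (simp add: linear_diff[OF linear_hyperplane_iso])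
  then have "(x - y) \<bullet> (x - y) = 0" by (metis hyperplane_iso_inner inner_zero_left)
  then show "x = y" by simp
qed

text \<open>The sign patterns of \<open>hyp\<close> together with the constant vector form a
  Hadamard matrix, so the preimage consists of the pair sums \<open>u$1 + u$2\<close>,
  \<open>u$1 + u$3\<close>, \<open>u$1 + u$4\<close>.\<close>

lemma hyperplane_iso_surj:
  assumes "(\<Sum>i\<in>UNIV. u $ i) = 0"
  obtains x where "hyp x = u"
proof
  have s: "u$4 = - u$1 - u$2 - u$3" using assms by (simp add: sum_4)
  show "hyp (vector [u$1 + u$2, u$1 + u$3, u$1 + u$4]) = u"
    unfolding vec_eq_iff forall_4 by (simp add: hyperplane_iso_def s)
qed

lemma hyperplane_iso_sum: "(\<Sum>i\<in>UNIV. hyp x $ i) = 0"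
  by (simp add: hyperplane_iso_nth sum_4 field_simps)

lemma Omega4_hyperplane_iso: "hyp x \<in> Omega4 \<longleftrightarrow> x \<bullet> x = 1"
  by (simp add: Omega4_iff hyperplane_iso_sum hyperplane_iso_inner)

lemma tangent4_hyperplane_iso: "tangent4 (hyp x) = hyp ` {z. x \<bullet> z = 0}"
proof (intro equalityI subsetI)
  fix v assume v: "v \<in> tangent4 (hyp x)"
  then obtain z where z: "hyp z = v" using hyperplane_iso_surj by (auto simp: tangent4_def)
  then show "v \<in> hyp ` {z. x \<bullet> z = 0}"
    using v by (auto simp: tangent4_def hyperplane_iso_inner intro!: image_eqI[of _ _ z])
qed (auto simp: tangent4_def hyperplane_iso_sum hyperplane_iso_inner)

lemma tangent_proj_hyperplane_iso: "tangent_proj (hyp x) (hyp w) = hyp (w - (x \<bullet> w) *\<^sub>R x)"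
  by (simp add: tangent_proj_def hyperplane_iso_sum hyperplane_iso_inner
      linear_diff[OF linear_hyperplane_iso] linear_scale[OF linear_hyperplane_iso])

section \<open>The statistic and its Euclidean derivatives in three coordinates\<close>

definition sq_sum :: "real^3 \<Rightarrow> real" where
  "sq_sum x = (x$1)\<^sup>2 + (x$2)\<^sup>2 + (x$3)\<^sup>2"

text \<open>On the unit sphere this is \<open>- 2\<close> times the sum of the fourth powers
  (\<open>kurt_sphere\<close>). The form valid off the sphere is kept because it is differentiated
  in the ambient space.\<close>

definition kurt :: "real^3 \<Rightarrow> real" where
  "kurt x = (sq_sum x)\<^sup>2 + 4 * ((x$1)\<^sup>2 * (x$2)\<^sup>2 + (x$1)\<^sup>2 * (x$3)\<^sup>2 + (x$2)\<^sup>2 * (x$3)\<^sup>2) - 3"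

lemma power_sum_3_iso: "power_sum 3 (hyp x) = 3 * (x$1 * x$2 * x$3)"
  by (simp add: power_sum_def sum_4 hyperplane_iso_nth field_simps power3_eq_cube)

lemma power_sum_4_iso: "4 * power_sum 4 (hyp x) - 3 = kurt x"
  by (simp add: power_sum_def sum_4 hyperplane_iso_nth kurt_def sq_sum_def power4_eq_xxxx
      power2_eq_square field_simps)

lemma JB4_iso: "JB4 (hyp x) = 24 * (x$1 * x$2 * x$3)\<^sup>2 + 1/6 * (kurt x)\<^sup>2"
  by (simp add: JB4_def power_sum_3_iso power_sum_4_iso power_mult_distrib)

definition ambient_grad :: "real^4 \<Rightarrow> real^4" where
  "ambient_grad u = (\<chi> i. 16 * power_sum 3 u * (u$i)\<^sup>2 + 16/3 * (4 * power_sum 4 u - 3) * (u$i)^3)"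

lemma has_derivative_power_sum:
  "(power_sum n has_derivative (\<lambda>v. \<Sum>i\<in>UNIV. of_nat n * (u$i)^(n-1) * v$i)) (at u)"
  unfolding power_sum_def by (auto intro!: derivative_eq_intros sum.cong simp: mult_ac)

lemma JB4_has_derivative: "(JB4 has_derivative (\<lambda>v. ambient_grad u \<bullet> v)) (at u)"
proof -
  have "(JB4 has_derivative (\<lambda>v. 8/3 * (2 * power_sum 3 u * (\<Sum>i\<in>UNIV. 3 * (u$i)\<^sup>2 * v$i))
     + 1/6 * (2 * (4 * power_sum 4 u - 3) * (4 * (\<Sum>i\<in>UNIV. 4 * (u$i)^3 * v$i))))) (at u)"
    unfolding JB4_def
    by (auto intro!: derivative_eq_intros has_derivative_power_sum[THEN has_derivative_eq_rhs])
  moreover have "8/3 * (2 * power_sum 3 u * (\<Sum>i\<in>UNIV. 3 * (u$i)\<^sup>2 * v$i))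
     + 1/6 * (2 * (4 * power_sum 4 u - 3) * (4 * (\<Sum>i\<in>UNIV. 4 * (u$i)^3 * v$i))) = ambient_grad u \<bullet> v" for v
    by (simp add: ambient_grad_def inner_vec_def sum_4 algebra_simps)
  ultimately show ?thesis by simp
qed

lemma gradient_JB4: "gradient JB4 = ambient_grad"
proof
  fix u show "gradient JB4 u = ambient_grad u"
    using frechet_derivative_at[OF JB4_has_derivative, of u] euclidean_representation[of "ambient_grad u"]
    by (simp add: gradient_def fun_eq_iff flip: frechet_derivative_at[OF JB4_has_derivative])
qed

text \<open>Euclidean gradient on \<open>real^3\<close> of the polynomial in \<open>JB4_iso\<close>;
  the components are cyclic instances of one formula.\<close>

definition jb_grad :: "real^3 \<Rightarrow> real^3" where
  "jb_grad x = vector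
    [48 * x$1 * (x$2)\<^sup>2 * (x$3)\<^sup>2 + 4/3 * kurt x * x$1 * (3 * sq_sum x - 2 * (x$1)\<^sup>2),
     48 * x$2 * (x$3)\<^sup>2 * (x$1)\<^sup>2 + 4/3 * kurt x * x$2 * (3 * sq_sum x - 2 * (x$2)\<^sup>2),
     48 * x$3 * (x$1)\<^sup>2 * (x$2)\<^sup>2 + 4/3 * kurt x * x$3 * (3 * sq_sum x - 2 * (x$3)\<^sup>2)]"

definition kurt_deriv :: "real^3 \<Rightarrow> real^3 \<Rightarrow> real" where
  "kurt_deriv x z = 4 * sq_sum x * (x \<bullet> z) + 8 * (x$1 * z$1 * (sq_sum x - (x$1)\<^sup>2)
     + x$2 * z$2 * (sq_sum x - (x$2)\<^sup>2) + x$3 * z$3 * (sq_sum x - (x$3)\<^sup>2))"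

text \<open>Derivative of one component of \<open>jb_grad\<close> in direction \<open>z\<close>,
  with the indices abstracted so that one differentiation serves all three components.\<close>

definition grad_deriv :: "real \<Rightarrow> real \<Rightarrow> real \<Rightarrow> real \<Rightarrow> real \<Rightarrow> real \<Rightarrow> real^3 \<Rightarrow> real^3 \<Rightarrow> real" where
  "grad_deriv xi xj xk zi zj zk x z =
     48 * (zi * xj\<^sup>2 * xk\<^sup>2 + 2 * xi * xj * zj * xk\<^sup>2 + 2 * xi * xk * zk * xj\<^sup>2)
     + 4/3 * (kurt_deriv x z * xi * (3 * sq_sum x - 2 * xi\<^sup>2) + kurt x * zi * (3 * sq_sum x - 2 * xi\<^sup>2)
       + kurt x * xi * (6 * (x \<bullet> z) - 4 * xi * zi))"

definition jb_hess :: "real^3 \<Rightarrow> real^3 \<Rightarrow> real^3" where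
  "jb_hess x z = vector
    [grad_deriv (x$1) (x$2) (x$3) (z$1) (z$2) (z$3) x z,
     grad_deriv (x$2) (x$3) (x$1) (z$2) (z$3) (z$1) x z,
     grad_deriv (x$3) (x$1) (x$2) (z$3) (z$1) (z$2) x z]"

lemma has_derivative_vec3I:
  fixes f :: "'a::real_normed_vector \<Rightarrow> real^3"
  assumes "((\<lambda>x. f x $ 1) has_derivative (\<lambda>z. f' z $ 1)) (at a within S)"
    "((\<lambda>x. f x $ 2) has_derivative (\<lambda>z. f' z $ 2)) (at a within S)"
    "((\<lambda>x. f x $ 3) has_derivative (\<lambda>z. f' z $ 3)) (at a within S)"
  shows "(f has_derivative f') (at a within S)"
proof -
  have "((\<lambda>x. f x \<bullet> i) has_derivative (\<lambda>z. f' z \<bullet> i)) (at a within S)" if "i \<in> Basis" for i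
    using that assms by (auto simp: Basis_vec_def inner_axis exhaust_3 UNIV_3)
  then show ?thesis by (subst has_derivative_componentwise_within) auto
qed

lemma sq_sum_deriv: "(sq_sum has_derivative (\<lambda>z. 2 * (x \<bullet> z))) (at x)"
  unfolding sq_sum_def
  by (auto intro!: derivative_eq_intros simp: inner_vec_def sum_3 fun_eq_iff algebra_simps)

lemma kurt_has_deriv: "(kurt has_derivative kurt_deriv x) (at x)"
  unfolding kurt_def
  by (auto intro!: derivative_eq_intros sq_sum_deriv[THEN has_derivative_eq_rhs]
      simp: kurt_deriv_def sq_sum_def fun_eq_iff inner_vec_def sum_3) (simp add: algebra_simps power2_eq_square)

lemma jb_grad_has_deriv: "(jb_grad has_derivative jb_hess x) (at x)"
proof -
  have *: "((\<lambda>x. 48 * x$i * (x$j)\<^sup>2 * (x$k)\<^sup>2 + 4/3 * kurt x * x$i * (3 * sq_sum x - 2 * (x$i)\<^sup>2))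
    has_derivative (\<lambda>z. grad_deriv (x$i) (x$j) (x$k) (z$i) (z$j) (z$k) x z)) (at x)" for i j k
    apply (rule derivative_eq_intros sq_sum_deriv kurt_has_deriv refl)+
    apply (rule ext)
    apply (simp only: grad_deriv_def)
    apply (simp add: power2_eq_square)
    apply (simp add: field_simps)
    done
  show ?thesis
    by (rule has_derivative_vec3I; use *[of 1 2 3] *[of 2 3 1] *[of 3 1 2] in
      \<open>simp add: jb_grad_def[abs_def] jb_hess_def mult_ac\<close>)
qed

section \<open>Riemannian gradient and Hessian on the sphere in \<open>real^3\<close>\<close>

lemma riem_grad_iso: "riem_grad JB4 (hyp x) = hyp (jb_grad x - (x \<bullet> jb_grad x) *\<^sub>R x)"
proof -
  define p q where "p = x$1 * x$2 * x$3" and "q = kurt x"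
  have "ambient_grad (hyp x) = hyp (jb_grad x) + (12 * p * sq_sum x + 4 * q * p) *\<^sub>R 1"
    unfolding ambient_grad_def power_sum_3_iso power_sum_4_iso vec_eq_iff forall_4 jb_grad_def
      p_def[symmetric] q_def[symmetric]
    by (simp add: hyperplane_iso_nth sq_sum_def; unfold p_def;
        simp add: power2_eq_square power3_eq_cube field_simps)
  moreover have "tangent_proj (hyp x) (w + c *\<^sub>R 1) = tangent_proj (hyp x) w" for w c
    using hyperplane_iso_sum[of x] by (simp add: tangent_proj_def vec_eq_iff inner_vec_def sum.distrib algebra_simps flip: sum_distrib_left)
  ultimately show ?thesis by (simp add: riem_grad_def gradient_JB4 tangent_proj_hyperplane_iso)
qed

lemma riem_grad_differentiable: "riem_grad JB4 differentiable (at u)"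
proof -
  have ps: "(\<lambda>u. power_sum n u) differentiable (at u)" for n u
    using has_derivative_power_sum differentiable_def by blast
  show ?thesis
    unfolding riem_grad_def gradient_JB4 tangent_proj_def
    by (subst differentiable_componentwise_within)
      (auto simp: Basis_vec_def inner_axis inner_vec_def ambient_grad_def intro!: derivative_intros ps differentiable_vec_nth)
qed

text \<open>Differentiating the tangential gradient of a function on a sphere gives the usual
  formula: the projected Euclidean Hessian minus the radial derivative times the identity.\<close>

lemma riem_hess_iso:
  assumes "x \<bullet> x = 1" "x \<bullet> z = 0"
  shows "riem_hess JB4 (hyp x) (hyp z) =
    hyp (jb_hess x z - (x \<bullet> jb_hess x z) *\<^sub>R x - (x \<bullet> jb_grad x) *\<^sub>R z)"
proof -
  \<comment> \<open>Two derivatives of one composite are compared: through the unknown ambient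
    \<open>?D\<close>, and explicitly. Uniqueness determines \<open>?D\<close> on the image of
    \<open>hyp\<close>, which contains every tangent vector.\<close>
  let ?D = "frechet_derivative (riem_grad JB4) (at (hyp x))"
  have "(riem_grad JB4 has_derivative ?D) (at (hyp x))"
    using riem_grad_differentiable frechet_derivative_works by blast
  then have 1: "((\<lambda>x. riem_grad JB4 (hyp x)) has_derivative (\<lambda>z. ?D (hyp z))) (at x)"
    by (rule has_derivative_compose[rotated])
      (use linear_hyperplane_iso in \<open>simp add: linear_imp_has_derivative\<close>)
  have 2: "((\<lambda>x. riem_grad JB4 (hyp x)) has_derivative
     (\<lambda>z. hyp (jb_hess x z - ((x \<bullet> jb_grad x) *\<^sub>R z + (x \<bullet> jb_hess x z + z \<bullet> jb_grad x) *\<^sub>R x)))) (at x)"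
    unfolding riem_grad_iso
    by (rule has_derivative_compose[where f="\<lambda>x. jb_grad x - (x \<bullet> jb_grad x) *\<^sub>R x" and g=hyp])
      (auto intro!: derivative_eq_intros jb_grad_has_deriv[THEN has_derivative_eq_rhs]
        linear_imp_has_derivative linear_hyperplane_iso)
  have "?D (hyp z) = hyp (jb_hess x z - ((x \<bullet> jb_grad x) *\<^sub>R z + (x \<bullet> jb_hess x z + z \<bullet> jb_grad x) *\<^sub>R x))"
    using fun_cong[OF has_derivative_unique[OF 1 2]] .
  then show ?thesis
    using assms by (simp add: riem_hess_def tangent_proj_hyperplane_iso inner_diff_right inner_add_right algebra_simps)
qed

section \<open>Critical points and their Hessians\<close>

lemma index3_cases:
  fixes i j k :: 3
  assumes "i \<noteq> j" "i \<noteq> k" "j \<noteq> k"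
  shows "(i = 1 \<and> j = 2 \<and> k = 3) \<or> (i = 1 \<and> j = 3 \<and> k = 2) \<or> (i = 2 \<and> j = 1 \<and> k = 3) \<or>
    (i = 2 \<and> j = 3 \<and> k = 1) \<or> (i = 3 \<and> j = 1 \<and> k = 2) \<or> (i = 3 \<and> j = 2 \<and> k = 1)"
  using assms exhaust_3[of i] exhaust_3[of j] exhaust_3[of k] by auto

text \<open>All formulas are symmetric in the coordinates. Stating them for arbitrary distinct
  indices lets one computation stand for a whole orbit of critical points.\<close>

lemma index3:
  fixes i j k :: 3
  assumes d: "i \<noteq> j" "i \<noteq> k" "j \<noteq> k"
  shows all_index3: "(\<forall>l. P l) \<longleftrightarrow> P i \<and> P j \<and> P k"
    and inner_index3: "x \<bullet> z = x$i * z$i + x$j * z$j + x$k * z$k"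
    and kurt_index3: "kurt x = (sq_sum x)\<^sup>2 + 4 * ((x$i)\<^sup>2 * (x$j)\<^sup>2 + (x$i)\<^sup>2 * (x$k)\<^sup>2 + (x$j)\<^sup>2 * (x$k)\<^sup>2) - 3"
    and kurt_deriv_index3: "kurt_deriv x z = 4 * sq_sum x * (x \<bullet> z) + 8 * (x$i * z$i * (sq_sum x - (x$i)\<^sup>2)
     + x$j * z$j * (sq_sum x - (x$j)\<^sup>2) + x$k * z$k * (sq_sum x - (x$k)\<^sup>2))"
    and jb_grad_index3: "jb_grad x $ i = 48 * x$i * (x$j)\<^sup>2 * (x$k)\<^sup>2 + 4/3 * kurt x * x$i * (3 * sq_sum x - 2 * (x$i)\<^sup>2)"
    and jb_hess_index3: "jb_hess x z $ i = grad_deriv (x$i) (x$j) (x$k) (z$i) (z$j) (z$k) x z"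
  using index3_cases[OF d]
  by (auto simp: forall_3 inner_vec_def sum_3 sq_sum_def kurt_def kurt_deriv_def jb_grad_def
      jb_hess_def grad_deriv_def)

lemma sq_sum_inner: "sq_sum x = x \<bullet> x"
  by (simp add: sq_sum_def inner_vec_def sum_3 power2_eq_square)

section \<open>Hessians diagonalised by an orthonormal tangent frame\<close>

definition sq_type :: "real \<Rightarrow> real \<Rightarrow> (real^3) set" where
  "sq_type s t = {x. \<exists>i j k. i \<noteq> j \<and> i \<noteq> k \<and> j \<noteq> k \<and> (x$i)\<^sup>2 = s \<and> (x$j)\<^sup>2 = s \<and> (x$k)\<^sup>2 = t}"

text \<open>Eigenvalues, determinant and nondegeneracy are all read off from such a frame, so each
  critical type needs only one explicit computation.\<close>

definition hess_diag :: "(real^4 \<Rightarrow> real) \<Rightarrow> real^4 \<Rightarrow> real^4 \<Rightarrow> real^4 \<Rightarrow> real \<Rightarrow> real \<Rightarrow> bool" where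
  "hess_diag f u v1 v2 l1 l2 \<longleftrightarrow> v1 \<bullet> v1 = 1 \<and> v2 \<bullet> v2 = 1 \<and> v1 \<bullet> v2 = 0 \<and>
     tangent4 u = {a *\<^sub>R v1 + b *\<^sub>R v2 |a b. True} \<and>
     (\<forall>a b. riem_hess f u (a *\<^sub>R v1 + b *\<^sub>R v2) = (a * l1) *\<^sub>R v1 + (b * l2) *\<^sub>R v2)"

context
  fixes f u v1 v2 l1 l2
  assumes D: "hess_diag f u v1 v2 l1 l2"
begin

lemma hess_diag_inner:
  "(a *\<^sub>R v1 + b *\<^sub>R v2) \<bullet> (c *\<^sub>R v1 + d *\<^sub>R v2) = a * c + b * d"
  using D by (simp add: hess_diag_def inner_add_left inner_add_right inner_commute)

lemma hess_diag_eq: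
  "a *\<^sub>R v1 + b *\<^sub>R v2 = c *\<^sub>R v1 + d *\<^sub>R v2 \<longleftrightarrow> a = c \<and> b = d"
proof
  assume eq: "a *\<^sub>R v1 + b *\<^sub>R v2 = c *\<^sub>R v1 + d *\<^sub>R v2"
  show "a = c \<and> b = d"
    using arg_cong[OF eq, of "\<lambda>x. x \<bullet> v1"] arg_cong[OF eq, of "\<lambda>x. x \<bullet> v2"] D
    by (simp add: hess_diag_def inner_add_left inner_commute[of v2 v1])
qed auto

lemma hess_diag_eq_0: "a *\<^sub>R v1 + b *\<^sub>R v2 = 0 \<longleftrightarrow> a = 0 \<and> b = 0"
  using hess_diag_eq[of a b 0 0] by simp

lemma tangent_hess_diag: "tangent4 u = {a *\<^sub>R v1 + b *\<^sub>R v2 |a b. True}"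
  using D by (simp add: hess_diag_def)

lemma riem_hess_diag: "riem_hess f u (a *\<^sub>R v1 + b *\<^sub>R v2) = (a * l1) *\<^sub>R v1 + (b * l2) *\<^sub>R v2"
  using D by (simp add: hess_diag_def)

lemma nondegenerate_hess_diag: "l1 \<noteq> 0 \<Longrightarrow> l2 \<noteq> 0 \<Longrightarrow> nondegenerate f u"
  by (auto simp: nondegenerate_def tangent_hess_diag riem_hess_diag hess_diag_eq_0)

lemma riem_hess_scalar: "l1 = l2 \<Longrightarrow> v \<in> tangent4 u \<Longrightarrow> riem_hess f u v = l1 *\<^sub>R v"
  by (auto simp: tangent_hess_diag riem_hess_diag algebra_simps)

lemma hess_eigenvalues_diag: "hess_eigenvalues f u = {l1, l2}"
proof -
  have "k \<in> hess_eigenvalues f u \<longleftrightarrow> k = l1 \<or> k = l2" for k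
  proof -
    have "k \<in> hess_eigenvalues f u \<longleftrightarrow>
      (\<exists>a b. a *\<^sub>R v1 + b *\<^sub>R v2 \<noteq> 0 \<and>
        riem_hess f u (a *\<^sub>R v1 + b *\<^sub>R v2) = k *\<^sub>R (a *\<^sub>R v1 + b *\<^sub>R v2))"
      unfolding hess_eigenvalues_def tangent_hess_diag by blast
    also have "\<dots> \<longleftrightarrow>
      (\<exists>a b. (a \<noteq> 0 \<or> b \<noteq> 0) \<and> (a * l1) *\<^sub>R v1 + (b * l2) *\<^sub>R v2 = (k * a) *\<^sub>R v1 + (k * b) *\<^sub>R v2)"
      by (simp add: riem_hess_diag hess_diag_eq_0 scaleR_add_right)
    also have "\<dots> \<longleftrightarrow> (\<exists>a b. (a \<noteq> 0 \<or> b \<noteq> 0) \<and> a * l1 = k * a \<and> b * l2 = k * b)"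
      by (simp only: hess_diag_eq)
    also have "\<dots> \<longleftrightarrow> k = l1 \<or> k = l2"
      by (auto intro: exI[of _ "1::real"] exI[of _ "0::real"])
    finally show ?thesis .
  qed
  then show ?thesis by auto
qed

text \<open>The determinant of an orthonormal change of frame is \<open>1\<close> or
  \<open>- 1\<close>, and it enters squared.\<close>

lemma hess_det_diag: "hess_det f u = l1 * l2"
proof -
  have frame: "det ((\<chi> i j. e i \<bullet> riem_hess f u (e j)) :: real^2^2) = l1 * l2" if e: "tangent_frame u e" for e
  proof -
    have "e i \<in> tangent4 u" for i
      using e span_superset[of "range e"] by (auto simp: tangent_frame_def)
    then have "\<exists>a b. e i = a *\<^sub>R v1 + b *\<^sub>R v2" for i
      unfolding tangent_hess_diag by blast
    then obtain a b where ab: "\<And>i. e i = a i *\<^sub>R v1 + b i *\<^sub>R v2" by metis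
    have o: "a i * a j + b i * b j = (if i = j then 1 else 0)" for i j
      using e unfolding tangent_frame_def ab hess_diag_inner by blast
    \<comment> \<open>Lagrange's identity; orthonormality makes the right-hand side
      \<open>1\<close>.\<close>
    have "(a 1 * b 2 - a 2 * b 1)\<^sup>2 = (a 1 * a 1 + b 1 * b 1) * (a 2 * a 2 + b 2 * b 2) - (a 1 * a 2 + b 1 * b 2)\<^sup>2"
      by algebra
    then have 1: "(a 1 * b 2 - a 2 * b 1)\<^sup>2 = 1" by (simp add: o)
    have "det ((\<chi> i j. e i \<bullet> riem_hess f u (e j)) :: real^2^2) =
      (a 1 * (a 1 * l1) + b 1 * (b 1 * l2)) * (a 2 * (a 2 * l1) + b 2 * (b 2 * l2)) -
      (a 1 * (a 2 * l1) + b 1 * (b 2 * l2)) * (a 2 * (a 1 * l1) + b 2 * (b 1 * l2))"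
      by (simp add: det_2 ab riem_hess_diag hess_diag_inner)
    also have "\<dots> = l1 * l2 * (a 1 * b 2 - a 2 * b 1)\<^sup>2" by algebra
    finally show ?thesis using 1 by simp
  qed
  \<comment> \<open>A frame has to be exhibited: without one every number would satisfy the
    description in \<open>hess_det\<close> vacuously, and uniqueness would fail.\<close>
  define e :: "2 \<Rightarrow> real^4" where "e = (\<lambda>i. if i = 1 then v1 else v2)"
  have "range e = {v1, v2}" by (auto simp: e_def UNIV_2)
  then have "span (range e) = tangent4 u"
    unfolding tangent_hess_diag by (auto simp: span_insert algebra_simps)
  moreover have "e i \<bullet> e j = (if i = j then 1 else 0)" for i j
    using D exhaust_2[of i] exhaust_2[of j] by (auto simp: e_def hess_diag_def inner_commute)
  ultimately have "tangent_frame u e" by (simp add: tangent_frame_def)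
  then show ?thesis unfolding hess_det_def using frame by (intro the_equality) auto
qed

end

text \<open>Eigenvalue at \<open>(s, s, 1 - 2 s)\<close> along the direction that moves the two
  equal squares apart.\<close>

definition eig1 :: "real \<Rightarrow> real" where
  "eig1 s = (let t = 1 - 2 * s; m = 2 * s\<^sup>2 + t\<^sup>2 in -48* s*t + 16*m* s - 144* s\<^sup>2*t - 16/3*m\<^sup>2)"

text \<open>Eigenvalue along the direction that keeps the two squares equal. For the vector
  \<open>f2\<close> of the next proof, \<open>g\<close> is the factor by which the Euclidean Hessian
  multiplies its first two components, \<open>d\<close> is the third component of the image, and
  \<open>l\<close> is the radial derivative.\<close>

definition eig2 :: "real \<Rightarrow> real" where
  "eig2 s = (let t = 1 - 2 * s; m = 2 * s\<^sup>2 + t\<^sup>2;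
     d = 48*(-2 * s^3+4*t* s\<^sup>2)+4/3*(-16* s*t*(s-t)*(3-2*t)+4*m* s*(3-2*t)-16*m* s*t);
     g = 48*(s*t+2 * s*(t-2 * s)) + 4/3*(-16* s*(s-t)*(3-2 * s) - 2*m*(3-2 * s) + 8*m* s);
     l = 144* s\<^sup>2*t - 8*m + 16/3*m\<^sup>2 in t * g - d - l)"

lemma hess_diag_iso:
  assumes v: "v1 \<bullet> v1 = 1" "v2 \<bullet> v2 = 1" "v1 \<bullet> v2 = 0" "x \<bullet> v1 = 0" "x \<bullet> v2 = 0" and x: "x \<bullet> x = 1"
    and span: "\<And>z. x \<bullet> z = 0 \<Longrightarrow> z = (z \<bullet> v1) *\<^sub>R v1 + (z \<bullet> v2) *\<^sub>R v2"
    and h1: "jb_hess x v1 - (x \<bullet> jb_hess x v1) *\<^sub>R x - (x \<bullet> jb_grad x) *\<^sub>R v1 = l1 *\<^sub>R v1"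
    and h2: "jb_hess x v2 - (x \<bullet> jb_hess x v2) *\<^sub>R x - (x \<bullet> jb_grad x) *\<^sub>R v2 = l2 *\<^sub>R v2"
  shows "hess_diag JB4 (hyp x) (hyp v1) (hyp v2) l1 l2"
proof -
  have lin: "linear (jb_hess x)" using jb_grad_has_deriv has_derivative_linear by blast
  have comb: "a *\<^sub>R hyp v1 + b *\<^sub>R hyp v2 = hyp (a *\<^sub>R v1 + b *\<^sub>R v2)" for a b
    by (simp add: linear_add linear_scale linear_hyperplane_iso)
  have "{z. x \<bullet> z = 0} = {a *\<^sub>R v1 + b *\<^sub>R v2 |a b. True}"
    using span v by (auto simp: inner_add_right)
  then have T: "tangent4 (hyp x) = {a *\<^sub>R hyp v1 + b *\<^sub>R hyp v2 |a b. True}"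
    unfolding tangent4_hyperplane_iso comb by auto
  have "riem_hess JB4 (hyp x) (a *\<^sub>R hyp v1 + b *\<^sub>R hyp v2) = (a * l1) *\<^sub>R hyp v1 + (b * l2) *\<^sub>R hyp v2" for a b
  proof -
    have "riem_hess JB4 (hyp x) (a *\<^sub>R hyp v1 + b *\<^sub>R hyp v2) =
       hyp (a *\<^sub>R (jb_hess x v1 - (x \<bullet> jb_hess x v1) *\<^sub>R x - (x \<bullet> jb_grad x) *\<^sub>R v1) +
            b *\<^sub>R (jb_hess x v2 - (x \<bullet> jb_hess x v2) *\<^sub>R x - (x \<bullet> jb_grad x) *\<^sub>R v2))"
      unfolding comb using x v
      by (subst riem_hess_iso) (auto simp: inner_add_right linear_add[OF lin] linear_scale[OF lin] algebra_simps)
    then show ?thesis unfolding h1 h2 comb by simp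
  qed
  then show ?thesis unfolding hess_diag_def using v T by (simp add: hyperplane_iso_inner)
qed

lemma jb_hess_scale: "jb_hess x (c *\<^sub>R z) = c *\<^sub>R jb_hess x z"
  using jb_grad_has_deriv has_derivative_linear linear_scale by blast

lemma vec3_exists:
  assumes d: "i \<noteq> j" "i \<noteq> k" "j \<noteq> (k::3)"
  obtains z :: "real^3" where "z$i = a" "z$j = b" "z$k = c"
proof
  show "(\<chi> l. if l = i then a else if l = j then b else c) $ i = a"
    "(\<chi> l. if l = i then a else if l = j then b else c) $ j = b"
    "(\<chi> l. if l = i then a else if l = j then b else c) $ k = c" using d by auto
qed

text \<open>The reflection that exchanges the two equal squares fixes \<open>x\<close> and preserves
  the statistic, so its two eigenlines in the tangent plane are invariant under the Hessian. They
  are spanned by \<open>f1\<close>, which changes the two squares oppositely, and \<open>f2\<close>,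
  which changes them equally. Both vectors have squared length \<open>2 * s\<close>, whence the
  normalisation \<open>r\<close>.\<close>

lemma hess_diag_sq_type:
  assumes x: "x \<in> sq_type s (1 - 2 * s)" and s: "s > 0"
  obtains v1 v2 where "hess_diag JB4 (hyp x) v1 v2 (eig1 s) (eig2 s)"
proof -
  obtain i j k where d: "i \<noteq> j" "i \<noteq> k" "j \<noteq> k" and xs: "(x$i)\<^sup>2 = s" "(x$j)\<^sup>2 = s" "(x$k)\<^sup>2 = 1 - 2 * s"
    using x by (auto simp: sq_type_def)
  note d' = d(1)[symmetric] d(2)[symmetric] d(3)[symmetric]
  obtain f1 where f1: "f1$i = x$j" "f1$j = - x$i" "f1$k = 0" using vec3_exists[OF d] by metis
  obtain f2 where f2: "f2$i = x$i * x$k" "f2$j = x$j * x$k" "f2$k = - 2 * s" using vec3_exists[OF d] by metis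
  define r where "r = 1 / sqrt (2 * s)"
  have r: "r * r = 1 / (2 * s)" using s by (simp add: r_def)
  note inn = inner_index3[OF d]
  have xx: "x \<bullet> x = 1" using xs by (simp add: inn power2_eq_square)
  have s1: "sq_sum x = 1" using xx by (simp add: sq_sum_inner)
  define t m where "t = 1 - 2 * s" and "m = 2 * s\<^sup>2 + t\<^sup>2"
  have xs': "(x$k)\<^sup>2 = t" using xs t_def by simp
  have e: "(x$i)\<^sup>2 - s = 0" "(x$j)\<^sup>2 - s = 0" "(x$k)\<^sup>2 - t = 0" and e4: "2 * s + t - 1 = 0"
    using xs xs' t_def by simp_all
  have q: "kurt x = - 2 * m"
    by (simp add: kurt_index3[OF d] s1 xs m_def t_def) (simp add: power2_eq_square algebra_simps)
  have o: "x \<bullet> f1 = 0" "x \<bullet> f2 = 0" "f1 \<bullet> f2 = 0" "f1 \<bullet> f1 = 2 * s" "f2 \<bullet> f2 = 2 * s"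
    unfolding inn f1 f2
    subgoal by simp
    subgoal using e by algebra
    subgoal by simp
    subgoal using e by algebra
    subgoal using e e4 by algebra
    done
  have kd1: "kurt_deriv x f1 = 0"
    unfolding kurt_deriv_index3[OF d] s1 o f1 using e by algebra
  have kd2: "kurt_deriv x f2 = -16 * s * (s - t) * x$k"
    unfolding kurt_deriv_index3[OF d] s1 o f2 using e e4 by algebra
  have h: "jb_hess x z $ i = grad_deriv (x$i) (x$j) (x$k) (z$i) (z$j) (z$k) x z"
     "jb_hess x z $ j = grad_deriv (x$j) (x$i) (x$k) (z$j) (z$i) (z$k) x z"
     "jb_hess x z $ k = grad_deriv (x$k) (x$i) (x$j) (z$k) (z$i) (z$j) x z" for z
    using jb_hess_index3[OF d] jb_hess_index3[OF d'(1) d(3,2)] jb_hess_index3[OF d'(2,3) d(1)] by auto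
  have lam: "x \<bullet> jb_grad x = 144* s\<^sup>2*t - 8*m + 16/3*m\<^sup>2"
  proof -
    have "x \<bullet> jb_grad x = 144 * s * s * t - 8/3 * m * (s * (3 - 2 * s) + s * (3 - 2 * s) + t * (3 - 2 * t))"
      unfolding inn jb_grad_index3[OF d] jb_grad_index3[OF d'(1) d(3,2)] jb_grad_index3[OF d'(2,3) d(1)] q s1
      using e by algebra
    then show ?thesis unfolding m_def t_def by (simp add: field_simps power2_eq_square)
  qed
  have H1: "jb_hess x f1 - (x \<bullet> jb_hess x f1) *\<^sub>R x - (x \<bullet> jb_grad x) *\<^sub>R f1 = eig1 s *\<^sub>R f1"
  proof -
    define mu where "mu = -48* s*t - 8*m + 16*m* s"
    have "jb_hess x f1 = mu *\<^sub>R f1"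
      unfolding vec_eq_iff all_index3[OF d] h grad_deriv_def kd1 s1 q o vector_scaleR_component f1 mu_def real_scaleR_def
      using e by (intro conjI; algebra)
    moreover have "eig1 s = mu - (144 * s\<^sup>2 * t - 8 * m + 16/3 * m\<^sup>2)"
      by (simp add: mu_def eig1_def Let_def t_def m_def)
    ultimately show ?thesis by (simp add: o lam scaleR_diff_left)
  qed
  have H2: "jb_hess x f2 - (x \<bullet> jb_hess x f2) *\<^sub>R x - (x \<bullet> jb_grad x) *\<^sub>R f2 = eig2 s *\<^sub>R f2"
  proof -
    define dd g where "dd = 48 * (-2 * s^3 + 4 * t * s\<^sup>2) + 4/3 * (-16 * s * t * (s - t) * (3 - 2 * t) + 4 * m * s * (3 - 2 * t) - 16 * m * s * t)"
      and "g = 48 * (s * t + 2 * s * (t - 2 * s)) + 4/3 * (-16 * s * (s - t) * (3 - 2 * s) - 2 * m * (3 - 2 * s) + 8 * m * s)"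
    define L where "L = 144 * s\<^sup>2 * t - 8 * m + 16/3 * m\<^sup>2"
    have es: "s = (x$i)\<^sup>2" "t = (x$k)\<^sup>2" and ej: "(x$j)\<^sup>2 - (x$i)\<^sup>2 = 0" using e by simp_all
    have H: "jb_hess x f2 $ i = g * (x$i * x$k)" "jb_hess x f2 $ j = g * (x$j * x$k)" "jb_hess x f2 $ k = dd"
      unfolding h grad_deriv_def kd2 s1 q o f2 g_def dd_def
      subgoal unfolding es using ej by algebra
      subgoal unfolding es using ej by algebra
      subgoal unfolding es using ej by algebra
      done
    have xD: "x \<bullet> jb_hess x f2 = (2 * s * g + dd) * x$k"
      unfolding inn H using e(1,2) by algebra
    have e2: "eig2 s = t * g - dd - L"
      unfolding eig2_def Let_def g_def dd_def m_def t_def L_def by (rule refl)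
    have kk: "(2 * s * g + dd) * x$k * x$k = (2 * s * g + dd) * t"
      using e(3) by (simp add: power2_eq_square)
    show ?thesis
      unfolding vec_eq_iff all_index3[OF d] vector_minus_component vector_scaleR_component xD lam L_def[symmetric] e2 H f2 real_scaleR_def kk
      unfolding t_def by (intro conjI; simp add: algebra_simps)
  qed
  have C: "jb_hess x (r *\<^sub>R f) - (x \<bullet> jb_hess x (r *\<^sub>R f)) *\<^sub>R x - (x \<bullet> jb_grad x) *\<^sub>R (r *\<^sub>R f) = l *\<^sub>R (r *\<^sub>R f)"
    if "jb_hess x f - (x \<bullet> jb_hess x f) *\<^sub>R x - (x \<bullet> jb_grad x) *\<^sub>R f = l *\<^sub>R f" for f l
    using arg_cong[OF that, of "scaleR r"]
    by (simp add: jb_hess_scale scaleR_diff_right mult.commute)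
  have rs: "r * (r * (2 * s)) = 1" using r s by (simp add: mult.assoc[symmetric])
  show thesis
  proof (rule that, rule hess_diag_iso[where ?v1.0="r *\<^sub>R f1" and ?v2.0="r *\<^sub>R f2"])
    fix z assume "x \<bullet> z = 0"
    then have z: "x$i * z$i + x$j * z$j + x$k * z$k = 0" by (simp add: inn)
    have A: "z \<bullet> f1 = x$j * z$i - x$i * z$j" by (simp add: inn f1 mult.commute)
    have "z \<bullet> f2 = x$k * (x$i * z$i + x$j * z$j) - 2 * s * z$k" by (simp add: inn f2 algebra_simps)
    also have "x$i * z$i + x$j * z$j = - (x$k * z$k)" using z by simp
    also have "x$k * - (x$k * z$k) - 2 * s * z$k = - ((x$k)\<^sup>2 + 2 * s) * z$k"
      by (simp add: power2_eq_square algebra_simps)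
    finally have B: "z \<bullet> f2 = - (z$k)" using xs by simp
    have "(x$j * z$i - x$i * z$j) * x$j - z$k * (x$i * x$k) =
      (x$j)\<^sup>2 * z$i - x$i * (x$j * z$j + x$k * z$k)" by (simp add: power2_eq_square algebra_simps)
    also have "x$j * z$j + x$k * z$k = - (x$i * z$i)" using z by simp
    also have "(x$j)\<^sup>2 * z$i - x$i * - (x$i * z$i) = ((x$j)\<^sup>2 + (x$i)\<^sup>2) * z$i"
      by (simp add: power2_eq_square algebra_simps)
    finally have I: "(x$j * z$i - x$i * z$j) * x$j - z$k * (x$i * x$k) = 2 * s * z$i" using xs by simp
    have "- (x$j * z$i - x$i * z$j) * x$i - z$k * (x$j * x$k) =
      (x$i)\<^sup>2 * z$j - x$j * (x$i * z$i + x$k * z$k)" by (simp add: power2_eq_square algebra_simps)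
    also have "x$i * z$i + x$k * z$k = - (x$j * z$j)" using z by simp
    also have "(x$i)\<^sup>2 * z$j - x$j * - (x$j * z$j) = ((x$i)\<^sup>2 + (x$j)\<^sup>2) * z$j"
      by (simp add: power2_eq_square algebra_simps)
    finally have J: "- (x$j * z$i - x$i * z$j) * x$i - z$k * (x$j * x$k) = 2 * s * z$j" using xs by simp
    \<comment> \<open>Multiplied by \<open>2 * s\<close>, the expansion in the unnormalised frame is
      polynomial; \<open>I\<close> and \<open>J\<close> are its components along \<open>i\<close>
      and \<open>j\<close>.\<close>
    have "(2 * s) *\<^sub>R z = (z \<bullet> f1) *\<^sub>R f1 + (z \<bullet> f2) *\<^sub>R f2"
      unfolding vec_eq_iff all_index3[OF d] A B vector_add_component vector_scaleR_component f1 f2 real_scaleR_def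
      using I J by (simp add: algebra_simps)
    then have "(1/(2 * s)) *\<^sub>R (2 * s) *\<^sub>R z = (r*r) *\<^sub>R ((z \<bullet> f1) *\<^sub>R f1 + (z \<bullet> f2) *\<^sub>R f2)"
      by (simp only: r)
    then show "z = (z \<bullet> r *\<^sub>R f1) *\<^sub>R r *\<^sub>R f1 + (z \<bullet> r *\<^sub>R f2) *\<^sub>R r *\<^sub>R f2"
      using s by (simp add: algebra_simps)
  qed (use o rs xx C[OF H1] C[OF H2] in simp_all)
qed

section \<open>The four critical types\<close>

lemma sq_type_iff: "x \<in> sq_type s t \<longleftrightarrow>
    (x$1)\<^sup>2 = s \<and> (x$2)\<^sup>2 = s \<and> (x$3)\<^sup>2 = t \<or> (x$1)\<^sup>2 = s \<and> (x$3)\<^sup>2 = s \<and> (x$2)\<^sup>2 = t \<or>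
    (x$2)\<^sup>2 = s \<and> (x$3)\<^sup>2 = s \<and> (x$1)\<^sup>2 = t" (is "_ \<longleftrightarrow> ?R")
proof
  assume "x \<in> sq_type s t"
  then obtain i j k where d: "i \<noteq> j" "i \<noteq> k" "j \<noteq> k" "(x$i)\<^sup>2 = s" "(x$j)\<^sup>2 = s" "(x$k)\<^sup>2 = t"
    by (auto simp: sq_type_def)
  then show ?R using index3_cases[OF d(1-3)] by auto
next
  assume ?R
  moreover have "(1::3) \<noteq> 2" "(1::3) \<noteq> 3" "(2::3) \<noteq> 3" "(2::3) \<noteq> 1" "(3::3) \<noteq> 1" "(3::3) \<noteq> 2" by simp_all
  ultimately show "x \<in> sq_type s t" unfolding sq_type_def by blast
qed

lemma sq_type_sphere: "x \<in> sq_type s (1 - 2 * s) \<Longrightarrow> x \<bullet> x = 1"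
  by (auto simp: sq_type_iff inner_vec_def sum_3 power2_eq_square)

text \<open>Smaller root of \<open>6 s\<^sup>2 - 13 s + 1\<close>, which is the equation
  \<open>9 s = m\<close> at weights \<open>(s, s, 1 - 2 s)\<close>. The other root exceeds
  \<open>1\<close> and is impossible for a weight.\<close>

definition s_saddle :: real where "s_saddle = (13 - sqrt 145) / 12"

lemma sqrt_145: "12.04159457 < sqrt 145" "sqrt 145 < 12.04159458"
  by (rule real_less_rsqrt, simp add: power2_eq_square) (rule real_less_lsqrt; simp add: power2_eq_square)

lemma s_saddle_bounds: "0.0798671 < s_saddle" "s_saddle < 0.0798672"
  using sqrt_145 by (simp_all add: s_saddle_def)

lemma s_saddle_root: "6 * s_saddle\<^sup>2 - 13 * s_saddle + 1 = 0"
  by (simp add: s_saddle_def power2_eq_square field_simps)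

lemma s_saddle_unique:
  assumes "6 * s\<^sup>2 - 13 * s + 1 = 0" "s < 1"
  shows "s = s_saddle"
proof -
  have "(s - s_saddle) * (6 * (s + s_saddle) - 13) = 0"
    using assms(1) s_saddle_root by algebra
  then show ?thesis using assms(2) s_saddle_bounds by auto
qed

text \<open>If no weight vanishes and \<open>a\<close> differs from both others, then
  \<open>9 * c = m\<close> and \<open>9 * b = m\<close> force \<open>b = c\<close>; so two weights
  always agree. If a weight vanishes, its alternative \<open>9 * a = m\<close> is excluded by
  \<open>m \<noteq> 0\<close>, and the remaining two are equal or one of them is zero.\<close>

lemma critical_weights:
  fixes a b c :: real
  assumes nn: "a \<ge> 0" "b \<ge> 0" "c \<ge> 0" and sum: "a + b + c = 1" and m: "m = a\<^sup>2 + b\<^sup>2 + c\<^sup>2"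
    and ab: "a = 0 \<or> b = 0 \<or> a = b \<or> 9 * c = m"
    and ac: "a = 0 \<or> c = 0 \<or> a = c \<or> 9 * b = m"
    and bc: "b = 0 \<or> c = 0 \<or> b = c \<or> 9 * a = m"
  shows "\<exists>s\<in>{1/2, 0, 1/3, s_saddle}. a = s \<and> b = s \<and> c = 1 - 2 * s \<or> a = s \<and> c = s \<and> b = 1 - 2 * s \<or>
    b = s \<and> c = s \<and> a = 1 - 2 * s"
proof -
  have root: "s = s_saddle" if "9 * s = 2 * s\<^sup>2 + (1 - 2 * s)\<^sup>2" "s \<le> 1/2" for s
    using that by (intro s_saddle_unique) (auto simp: power2_eq_square algebra_simps)
  have m0: "m \<noteq> 0" using sum by (auto simp: m add_nonneg_eq_0_iff)
  consider "a = 0" | "b = 0" | "c = 0" | "a \<noteq> 0" "b \<noteq> 0" "c \<noteq> 0" by blast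
  then show ?thesis
  proof cases
    case 4
    show ?thesis
    proof (cases "a = b")
      case True
      show ?thesis
      proof (cases "a = c")
        case False
        then have "9 * b = m" using ac 4 by auto
        then have "b = s_saddle" using True sum m nn by (intro root) (auto simp: algebra_simps)
        then show ?thesis using True sum by auto
      qed (use True sum in auto)
    next
      case False
      then have c: "9 * c = m" using ab 4 by auto
      show ?thesis
      proof (cases "a = c")
        case True
        then have "b = 1 - 2 * c" using sum by simp
        then have "c = s_saddle" using True c m nn by (intro root) (auto simp: algebra_simps)
        then show ?thesis using True sum by auto
      next
        case ac': False
        then have b: "9 * b = m" using ac 4 by auto
        then have "a = 1 - 2 * c" using c sum by simp
        have "b = c" using b c by simp
        then have "9 * c = 2 * c\<^sup>2 + (1 - 2 * c)\<^sup>2" using c \<open>a = 1 - 2 * c\<close> unfolding m by simp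
        then have "c = s_saddle" using nn \<open>a = 1 - 2 * c\<close> by (intro root) auto
        then show ?thesis using b c sum by auto
      qed
    qed
  next
    case 1
    then have "b = 0 \<or> c = 0 \<or> b = c" using bc m0 by auto
    then show ?thesis using 1 sum by (elim disjE) auto
  next
    case 2
    then have "a = 0 \<or> c = 0 \<or> a = c" using ac m0 by auto
    then show ?thesis using 2 sum by (elim disjE) auto
  next
    case 3
    then have "a = 0 \<or> b = 0 \<or> a = b" using ab m0 by auto
    then show ?thesis using 3 sum by (elim disjE) auto
  qed
qed

lemma kurt_sphere: "x \<bullet> x = 1 \<Longrightarrow> kurt x = - 2 * ((x$1)^4 + (x$2)^4 + (x$3)^4)"
proof -
  assume "x \<bullet> x = 1"
  then have s: "sq_sum x = 1" by (simp add: sq_sum_inner)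
  have "kurt x = (sq_sum x)\<^sup>2 + 2 * ((sq_sum x)\<^sup>2 - ((x$1)^4 + (x$2)^4 + (x$3)^4)) - 3"
    unfolding kurt_def sq_sum_def by algebra
  then show ?thesis unfolding s by simp
qed

lemma JB4_sphere: "x \<bullet> x = 1 \<Longrightarrow> JB4 (hyp x) =
    24 * ((x$1)\<^sup>2 * (x$2)\<^sup>2 * (x$3)\<^sup>2) + 2/3 * (((x$1)\<^sup>2)\<^sup>2 + ((x$2)\<^sup>2)\<^sup>2 + ((x$3)\<^sup>2)\<^sup>2)\<^sup>2"
  by (simp add: JB4_iso kurt_sphere power2_eq_square power4_eq_xxxx algebra_simps)

text \<open>The tangential gradient vanishes exactly when the Euclidean gradient is a multiple of
  \<open>x\<close>. Cancelling nonzero coordinates and subtracting two components leaves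
  \<open>((x$i)\<^sup>2 - (x$j)\<^sup>2) * (9 * (x$k)\<^sup>2 - m) = 0\<close>.\<close>

lemma jb_critical_iff:
  assumes x: "x \<bullet> x = 1"
  shows "riem_grad JB4 (hyp x) = 0 \<longleftrightarrow> (\<exists>s\<in>{1/2, 0, 1/3, s_saddle}. x \<in> sq_type s (1 - 2 * s))"
proof -
  have hyp0: "hyp z = 0 \<longleftrightarrow> z = 0" for z
    using inj_hyperplane_iso linear_0[OF linear_hyperplane_iso] by (metis injD)
  have grad0: "riem_grad JB4 (hyp x) = 0 \<longleftrightarrow> jb_grad x = (x \<bullet> jb_grad x) *\<^sub>R x"
    by (simp add: riem_grad_iso hyp0)
  have s1: "sq_sum x = 1" using x by (simp add: sq_sum_inner)
  define m where "m = ((x$1)\<^sup>2)\<^sup>2 + ((x$2)\<^sup>2)\<^sup>2 + ((x$3)\<^sup>2)\<^sup>2"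
  have q: "kurt x = - 2 * m" using kurt_sphere[OF x] by (simp add: m_def flip: power_mult)
  have g: "jb_grad x $ i = x$i * (48 * ((x$j)\<^sup>2 * (x$k)\<^sup>2) - 8/3 * m * (3 - 2 * (x$i)\<^sup>2))"
    if "i \<noteq> j" "i \<noteq> k" "j \<noteq> k" for i j k
    unfolding jb_grad_index3[OF that] s1 q by (simp add: field_simps)
  show ?thesis
  proof
    assume "riem_grad JB4 (hyp x) = 0"
    then obtain l where l: "jb_grad x = l *\<^sub>R x" unfolding grad0 by blast
    have pair: "(x$i)\<^sup>2 = 0 \<or> (x$j)\<^sup>2 = 0 \<or> (x$i)\<^sup>2 = (x$j)\<^sup>2 \<or> 9 * (x$k)\<^sup>2 = m"
      if d: "i \<noteq> j" "i \<noteq> k" "j \<noteq> k" for i j k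
    proof (cases "x$i = 0 \<or> x$j = 0")
      case False
      have "48 * ((x$j)\<^sup>2 * (x$k)\<^sup>2) - 8/3 * m * (3 - 2 * (x$i)\<^sup>2) = l"
        using False g[OF d] by (simp add: l)
      moreover have "48 * ((x$i)\<^sup>2 * (x$k)\<^sup>2) - 8/3 * m * (3 - 2 * (x$j)\<^sup>2) = l"
        using False g[of j i k] d by (simp add: l)
      ultimately have "((x$i)\<^sup>2 - (x$j)\<^sup>2) * (9 * (x$k)\<^sup>2 - m) = 0"
        by (simp add: algebra_simps)
      then show ?thesis by auto
    qed auto
    show "\<exists>s\<in>{1/2, 0, 1/3, s_saddle}. x \<in> sq_type s (1 - 2 * s)"
      unfolding sq_type_iff
      by (rule critical_weights[where m=m])
        (use s1 pair[of 1 2 3] pair[of 1 3 2] pair[of 2 3 1] in \<open>auto simp: sq_sum_def m_def\<close>)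
  next
    assume "\<exists>s\<in>{1/2, 0, 1/3, s_saddle}. x \<in> sq_type s (1 - 2 * s)"
    then obtain s where s: "s \<in> {1/2, 0, 1/3, s_saddle}" "x \<in> sq_type s (1 - 2 * s)" by blast
    define t where "t = 1 - 2 * s"
    obtain i j k where d: "i \<noteq> j" "i \<noteq> k" "j \<noteq> k" and xs: "(x$i)\<^sup>2 = s" "(x$j)\<^sup>2 = s" "(x$k)\<^sup>2 = t"
      using s(2) unfolding t_def by (auto simp: sq_type_def)
    have m: "m = 2 * s\<^sup>2 + t\<^sup>2" using s(2) unfolding t_def[symmetric] sq_type_iff m_def
      by (elim disjE conjE; simp only:; simp)
    note d' = d(1)[symmetric] d(2)[symmetric] d(3)[symmetric]
    have gi: "jb_grad x $ i = (48 * (s * t) - 8/3 * m * (3 - 2 * s)) * x$i"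
      "jb_grad x $ j = (48 * (s * t) - 8/3 * m * (3 - 2 * s)) * x$j"
      "jb_grad x $ k = (48 * (s * s) - 8/3 * m * (3 - 2 * t)) * x$k"
      using g[OF d] g[OF d'(1) d(3,2)] g[OF d'(2,3) d(1)] by (simp_all add: xs mult_ac)
    have "s = 0 \<or> t = 0 \<or> 48 * (s * t) - 8/3 * m * (3 - 2 * s) = 48 * (s * s) - 8/3 * m * (3 - 2 * t)"
    proof (cases "s = s_saddle")
      case True
      \<comment> \<open>This relation is what makes the two multipliers coincide when
        \<open>s\<close> and \<open>t\<close> are distinct and nonzero.\<close>
      have "m = 9 * s" using s_saddle_root unfolding m t_def True by algebra
      then show ?thesis by (simp add: algebra_simps)
    next
      case False
      then have "s = 1/2 \<or> s = 0 \<or> s = 1/3" using s(1) by blast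
      then have "t = 0 \<or> s = 0 \<or> s = t" by (auto simp: t_def)
      then show ?thesis by (auto simp: mult_ac)
    qed
    then have "\<exists>l. jb_grad x = l *\<^sub>R x"
      unfolding vec_eq_iff all_index3[OF d] vector_scaleR_component real_scaleR_def gi using xs by auto
    then obtain l where l: "jb_grad x = l *\<^sub>R x" by blast
    then have "x \<bullet> jb_grad x = l" using x by simp
    then show "riem_grad JB4 (hyp x) = 0" unfolding grad0 using l by simp
  qed
qed

lemma stationary_points_JB4:
  "stationary_points JB4 = (\<Union>s\<in>{1/2, 0, 1/3, s_saddle}. hyp ` sq_type s (1 - 2 * s))"
proof (intro equalityI subsetI)
  fix u assume u: "u \<in> stationary_points JB4"
  then obtain x where x: "hyp x = u"
    using hyperplane_iso_surj by (auto simp: stationary_points_def Omega4_iff)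
  then show "u \<in> (\<Union>s\<in>{1/2, 0, 1/3, s_saddle}. hyp ` sq_type s (1 - 2 * s))"
    using u jb_critical_iff[of x] by (auto simp: stationary_points_def Omega4_hyperplane_iso)
next
  fix u assume "u \<in> (\<Union>s\<in>{1/2, 0, 1/3, s_saddle}. hyp ` sq_type s (1 - 2 * s))"
  then obtain s x where "s \<in> {1/2, 0, 1/3, s_saddle}" "x \<in> sq_type s (1 - 2 * s)" "u = hyp x" by blast
  moreover from this have "riem_grad JB4 (hyp x) = 0" "x \<bullet> x = 1"
    using jb_critical_iff[of x] sq_type_sphere[of x s] by blast+
  ultimately show "u \<in> stationary_points JB4"
    by (simp add: stationary_points_def Omega4_hyperplane_iso)
qed

section \<open>Global bounds, corner maxima and saddles\<close>

definition jb :: "real \<Rightarrow> real \<Rightarrow> real \<Rightarrow> real" where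
  "jb a b c = 24 * (a * b * c) + 2/3 * (a\<^sup>2 + b\<^sup>2 + c\<^sup>2)\<^sup>2"

lemma JB4_jb: "x \<bullet> x = 1 \<Longrightarrow> JB4 (hyp x) = jb ((x$1)\<^sup>2) ((x$2)\<^sup>2) ((x$3)\<^sup>2)"
  by (simp add: jb_def JB4_sphere)

lemma jb_index3:
  assumes "x \<bullet> x = 1" "i \<noteq> j" "i \<noteq> k" "j \<noteq> (k::3)"
  shows "JB4 (hyp x) = jb ((x$i)\<^sup>2) ((x$j)\<^sup>2) ((x$k)\<^sup>2)"
  using index3_cases[OF assms(2-4)] unfolding JB4_jb[OF assms(1)]
  by (elim disjE conjE; hypsubst; simp add: jb_def; simp add: add_ac mult_ac)

text \<open>Schur's inequality written in elementary symmetric functions. For ordered variables the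
  left side is a sum of visibly nonnegative terms, and symmetry covers the six orders.\<close>

lemma schur_deg1:
  fixes a b c :: real
  assumes "a \<ge> 0" "b \<ge> 0" "c \<ge> 0"
  shows "(a + b + c)^3 - 4 * (a + b + c) * (a * b + a * c + b * c) + 9 * (a * b * c) \<ge> 0"
proof -
  have S: "(a + b + c)^3 - 4 * (a + b + c) * (a * b + a * c + b * c) + 9 * (a * b * c) \<ge> 0"
    if "a \<ge> b" "b \<ge> c" "c \<ge> 0" for a b c :: real
  proof -
    have "(a + b + c)^3 - 4 * (a + b + c) * (a * b + a * c + b * c) + 9 * (a * b * c)
       = (a - b)\<^sup>2 * (a + b - c) + c * ((a - c) * (b - c))"
      by algebra
    then show ?thesis using that by simp
  qed
  consider "a \<ge> b" "b \<ge> c" | "a \<ge> c" "c \<ge> b" | "b \<ge> a" "a \<ge> c" | "b \<ge> c" "c \<ge> a" | "c \<ge> a" "a \<ge> b" | "c \<ge> b" "b \<ge> a"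
    by linarith
  then show ?thesis
    by cases (use assms S[of a b c] S[of a c b] S[of b a c] S[of b c a] S[of c a b] S[of c b a]
      in \<open>simp_all add: algebra_simps\<close>)
qed

text \<open>In \<open>e\<close> and \<open>p\<close> the function is
  \<open>24 * p + 2/3 * (1 - 2 * e)\<^sup>2\<close>. The upper bound uses
  \<open>3 * p \<le> e\<^sup>2\<close> and \<open>e \<le> 1/3\<close>, sharp at equal weights. The
  lower bound uses \<open>p \<ge> 0\<close> up to \<open>e = 1/4\<close> and Schur's inequality
  beyond; both are sharp at \<open>e = 1/4\<close>, the minimum.\<close>

lemma jb_bounds:
  assumes nn: "a \<ge> 0" "b \<ge> 0" "c \<ge> 0" and sum: "a + b + c = 1"
  shows "1/6 \<le> jb a b c" "jb a b c \<le> 26/27"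
proof -
  define e p where "e = a * b + a * c + b * c" and "p = a * b * c"
  have "(a + b + c)\<^sup>2 = a\<^sup>2 + b\<^sup>2 + c\<^sup>2 + 2 * e" unfolding e_def by algebra
  then have m: "a\<^sup>2 + b\<^sup>2 + c\<^sup>2 = 1 - 2 * e" using sum by simp
  have F: "jb a b c = 24 * p + 2/3 * (1 - 2 * e)\<^sup>2" by (simp add: jb_def m p_def)
  have p0: "p \<ge> 0" "e \<ge> 0" using nn by (simp_all add: p_def e_def)
  have schur: "9 * p \<ge> 4 * e - 1" using schur_deg1[OF nn] unfolding sum by (simp add: p_def e_def)
  have "3 * e \<le> (a + b + c)\<^sup>2"
    using sum_squares_ge_zero[of "a - b" 0] zero_le_square[of "a - b"] zero_le_square[of "a - c"] zero_le_square[of "b - c"]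
    unfolding e_def by (simp add: power2_eq_square algebra_simps)
  then have e3: "e \<le> 1/3" by (simp add: sum)
  have "e\<^sup>2 - 3 * ((a + b + c) * p) = ((a*b - a*c)\<^sup>2 + (a*b - b*c)\<^sup>2 + (a*c - b*c)\<^sup>2) / 2"
    unfolding e_def p_def by (simp add: power2_eq_square field_simps)
  also have "\<dots> \<ge> 0" by simp
  finally have e2: "3 * p \<le> e\<^sup>2" unfolding sum by linarith
  have "e\<^sup>2 \<le> e * (1/3)" using mult_left_mono[OF e3 p0(2)] by (simp add: power2_eq_square)
  then show "jb a b c \<le> 26/27" using e2 e3 unfolding F by (simp add: power2_eq_square algebra_simps)
  show "1/6 \<le> jb a b c"
  proof (cases "e \<le> 1/4")
    case True
    then have "(1/2)\<^sup>2 \<le> (1 - 2 * e)\<^sup>2" by (intro power_mono) auto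
    then show ?thesis using p0 unfolding F by (simp add: power2_eq_square)
  next
    case False
    have id: "2/3 * (1 - 2 * e)\<^sup>2 + 24/9 * (4 * e - 1) = 1/6 + (e - 1/4) * (8/3 * e + 26/3)"
      by (simp add: power2_eq_square field_simps)
    have "(e - 1/4) * (8/3 * e + 26/3) \<ge> 0" using False by simp
    then have "2/3 * (1 - 2 * e)\<^sup>2 + 24/9 * (4 * e - 1) \<ge> 1/6" unfolding id by linarith
    moreover have "24 * p \<ge> 24/9 * (4 * e - 1)" using schur by simp
    ultimately show ?thesis unfolding F by linarith
  qed
qed

lemma JB4_bounds: "w \<in> Omega4 \<Longrightarrow> 1/6 \<le> JB4 w \<and> JB4 w \<le> 26/27"
proof -
  assume w: "w \<in> Omega4"
  then obtain x where x: "hyp x = w" using hyperplane_iso_surj by (auto simp: Omega4_iff)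
  then have "x \<bullet> x = 1" using w Omega4_hyperplane_iso by auto
  then show ?thesis
    using JB4_jb jb_bounds[of "(x$1)\<^sup>2" "(x$2)\<^sup>2" "(x$3)\<^sup>2"] x
    by (auto simp: inner_vec_def sum_3 power2_eq_square)
qed

lemma jb_type_vals:
  "jb (1/2) (1/2) 0 = 1/6" "jb 0 0 1 = 2/3" "jb (1/3) (1/3) (1/3) = 26/27"
  by (simp_all add: jb_def power2_eq_square)

lemma s_saddle_jb: "jb s_saddle s_saddle (1 - 2 * s_saddle) = x_star"
proof -
  define s r where "s = s_saddle" and "r = sqrt 145"
  have s: "s = (13 - r) / 12" and r: "r\<^sup>2 - 145 = 0" by (simp_all add: s_def r_def s_saddle_def)
  have "jb s s (1 - 2 * s) = (145 * r - 1729) / 36"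
    unfolding jb_def s using r by algebra
  then show ?thesis by (simp add: s_def r_def x_star_def)
qed

lemma eig_vals:
  "eig1 (1/2) = 8/3" "eig2 (1/2) = 32/3" "eig1 (1/3) = - 256/27" "eig2 (1/3) = - 256/27"
  by (simp_all add: eig1_def eig2_def Let_def power2_eq_square power3_eq_cube)

text \<open>Each eigenvalue is reduced modulo the quadratic satisfied by \<open>s\<close> before
  \<open>sqrt 145\<close> is inserted.\<close>

lemma s_saddle_eig: "eig1 s_saddle * eig2 s_saddle = det_H_star"
proof -
  define s r where "s = s_saddle" and "r = sqrt 145"
  have s: "6 * s\<^sup>2 - 13 * s + 1 = 0" using s_saddle_root by (simp add: s_def)
  have 1: "eig1 s = - 96 * s * (1 - 3 * s)"
    unfolding eig1_def Let_def using s by algebra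
  have 2: "eig2 s = (1664 - 20096 * s) / 9"
    unfolding eig2_def Let_def using s by algebra
  have sr: "s = (13 - r) / 12" and r: "r\<^sup>2 - 145 = 0" by (simp_all add: s_def r_def s_saddle_def)
  have "eig1 s * eig2 s = (5286656 * r - 63660800) / 27"
    unfolding 1 2 unfolding sr using r by algebra
  then show ?thesis by (simp add: s_def r_def det_H_star_def)
qed

text \<open>The coefficient of \<open>sqrt 145\<close> in \<open>det_H_star\<close> is about
  \<open>2 * 10^5\<close>, so an error below \<open>5 / 10^5\<close> there calls for ten decimals of
  the root.\<close>

lemma sqrt_145': "12.0415945787 < sqrt 145" "sqrt 145 < 12.0415945788"
  by (rule real_less_rsqrt, simp add: power2_eq_square) (rule real_less_lsqrt; simp add: power2_eq_square)

lemma det_H_star_approx: "\<bar>det_H_star - (- 38.2137)\<bar> < 5 / 10^5"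
  using sqrt_145' by (simp add: det_H_star_def abs_if field_simps)

lemma x_star_approx: "\<bar>x_star - 0.47309\<bar> < 5 / 10^6"
  using sqrt_145' by (simp add: x_star_def abs_if field_simps)

text \<open>At \<open>s = 0\<close> the vectors spanning the general frame vanish; two coordinate
  axes replace them, and every tangent vector is an eigenvector.\<close>

lemma hess_diag_corner:
  assumes "x \<in> sq_type 0 1"
  obtains v1 v2 where "hess_diag JB4 (hyp x) v1 v2 (- 16/3) (- 16/3)"
proof -
  obtain i j k where d: "i \<noteq> j" "i \<noteq> k" "j \<noteq> k" and xs: "x$i = 0" "x$j = 0" "(x$k)\<^sup>2 = 1"
    using assms by (auto simp: sq_type_def)
  note d' = d(1)[symmetric] d(2)[symmetric] d(3)[symmetric]
  note inn = inner_index3[OF d]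
  have k: "x$k * x$k = 1" using xs by (simp add: power2_eq_square)
  have xx: "x \<bullet> x = 1" by (simp add: inn xs k)
  have s1: "sq_sum x = 1" using xx by (simp add: sq_sum_inner)
  have q: "kurt x = - 2" by (simp add: kurt_index3[OF d] s1 xs)
  have h: "jb_hess x z $ i = grad_deriv (x$i) (x$j) (x$k) (z$i) (z$j) (z$k) x z"
     "jb_hess x z $ j = grad_deriv (x$j) (x$i) (x$k) (z$j) (z$i) (z$k) x z"
     "jb_hess x z $ k = grad_deriv (x$k) (x$i) (x$j) (z$k) (z$i) (z$j) x z" for z
    using jb_hess_index3[OF d] jb_hess_index3[OF d'(1) d(3,2)] jb_hess_index3[OF d'(2,3) d(1)] by auto
  have lam: "x \<bullet> jb_grad x = - 8/3"
    by (simp add: inn xs jb_grad_index3[OF d'(2,3) d(1)] q s1) (use k xs in simp)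
  have H: "jb_hess x z - (x \<bullet> jb_hess x z) *\<^sub>R x - (x \<bullet> jb_grad x) *\<^sub>R z = (- 16/3) *\<^sub>R z" if "z$k = 0" for z
  proof -
    have kd: "kurt_deriv x z = 0" by (simp add: kurt_deriv_index3[OF d] inn xs that)
    have xz: "x \<bullet> z = 0" by (simp add: inn xs that)
    have "jb_hess x z = - 8 *\<^sub>R z"
      unfolding vec_eq_iff all_index3[OF d] h grad_deriv_def kd q s1 xz using xs that by simp
    then show ?thesis by (simp add: lam xz) (simp add: algebra_simps flip: scaleR_left.add)
  qed
  have ax: "axis l (1::real) $ l' = (if l' = l then 1 else 0)" for l l' :: 3 by (simp add: axis_def)
  show thesis
  proof (rule that, rule hess_diag_iso[where ?v1.0="axis i 1" and ?v2.0="axis j 1"])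
    fix z assume "x \<bullet> z = 0"
    then have "z$k = 0" using k by (auto simp: inn xs)
    then show "z = (z \<bullet> axis i 1) *\<^sub>R axis i 1 + (z \<bullet> axis j 1) *\<^sub>R axis j 1"
      unfolding vec_eq_iff all_index3[OF d] using d d' by (simp add: inner_axis) (simp add: axis_def)
  qed (use d d' xx xs in \<open>simp_all add: inner_axis ax H\<close>)
qed

text \<open>With \<open>e = a + b\<close>, the estimates
  \<open>a * b * c \<le> e\<^sup>2 / 4\<close> and
  \<open>m\<^sup>2 \<le> m \<le> 1 - 2 * e + 2 * e\<^sup>2\<close> for the sum of squares
  \<open>m\<close> bound the function by \<open>2/3 - 4/3 * e + 22/3 * e\<^sup>2\<close>. For
  \<open>e \<ge> 0\<close> this is at most \<open>2/3\<close> exactly when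
  \<open>e \<le> 2/11\<close>, which is the origin of \<open>9/11\<close>.\<close>

lemma jb_corner:
  fixes a b c :: real
  assumes nn: "a \<ge> 0" "b \<ge> 0" "c > 9/11" and sum: "a + b + c = 1"
  shows "jb a b c \<le> 2/3"
proof -
  define e where "e = a + b"
  have e: "0 \<le> e" "e \<le> 2/11" "c = 1 - e" using assms by (auto simp: e_def)
  have "4 * (a * b) \<le> e\<^sup>2" using zero_le_square[of "a - b"] by (simp add: e_def power2_eq_square algebra_simps)
  moreover have "a * b \<ge> 0" using nn by simp
  ultimately have "a * b * c \<le> e\<^sup>2 / 4 * 1"
    using e by (intro mult_mono) auto
  moreover have "a\<^sup>2 + b\<^sup>2 + c\<^sup>2 \<le> 1 - 2 * e + 2 * e\<^sup>2"
    using \<open>a * b \<ge> 0\<close> unfolding e(3) by (simp add: e_def power2_eq_square algebra_simps)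
  moreover have ee: "e\<^sup>2 \<le> e * (2/11)" using mult_left_mono[OF e(2,1)] by (simp add: power2_eq_square)
  moreover have "(a\<^sup>2 + b\<^sup>2 + c\<^sup>2)\<^sup>2 \<le> a\<^sup>2 + b\<^sup>2 + c\<^sup>2"
  proof -
    have "a\<^sup>2 + b\<^sup>2 + c\<^sup>2 \<le> 1" using calculation(2) ee e by linarith
    then have "(a\<^sup>2 + b\<^sup>2 + c\<^sup>2) * (a\<^sup>2 + b\<^sup>2 + c\<^sup>2) \<le> (a\<^sup>2 + b\<^sup>2 + c\<^sup>2) * 1"
      by (intro mult_left_mono) auto
    then show ?thesis by (simp add: power2_eq_square)
  qed
  ultimately show ?thesis using e(1) unfolding jb_def by linarith
qed

lemma local_max_corner:
  assumes x: "x \<in> sq_type 0 1"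
  shows "local_max_on Omega4 JB4 (hyp x)" "JB4 (hyp x) = 2/3"
proof -
  obtain i j k where d: "i \<noteq> j" "i \<noteq> k" "j \<noteq> k" and xs: "x$i = 0" "x$j = 0" "(x$k)\<^sup>2 = 1"
    using x by (auto simp: sq_type_def)
  have xx: "x \<bullet> x = 1" using x sq_type_sphere[of x 0] by simp
  show val: "JB4 (hyp x) = 2/3"
    using jb_index3[OF xx d] by (simp add: xs jb_type_vals)
  \<comment> \<open>A continuous function on \<open>real^4\<close> that returns the squared
    coordinate, so the neighbourhood is described without inverting \<open>hyp\<close>.\<close>
  define f where "f w = (hyp (axis k 1) \<bullet> w)\<^sup>2" for w
  have fh: "f (hyp z) = (z$k)\<^sup>2" for z by (simp add: f_def hyperplane_iso_inner inner_axis')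
  have "(f \<longlongrightarrow> f (hyp x)) (at (hyp x) within Omega4)"
    unfolding f_def by (intro tendsto_intros)
  then have "\<forall>\<^sub>F w in at (hyp x) within Omega4. 9/11 < f w"
    by (rule order_tendstoD) (simp add: fh xs)
  moreover have "\<forall>\<^sub>F w in at (hyp x) within Omega4. w \<in> Omega4"
    by (simp add: eventually_at_topological, blast)
  ultimately have "\<forall>\<^sub>F w in at (hyp x) within Omega4. JB4 w \<le> JB4 (hyp x)"
  proof eventually_elim
    case (elim w)
    then obtain z where z: "hyp z = w" using hyperplane_iso_surj by (auto simp: Omega4_iff)
    then have zz: "z \<bullet> z = 1" using elim Omega4_hyperplane_iso by auto
    have "jb ((z$i)\<^sup>2) ((z$j)\<^sup>2) ((z$k)\<^sup>2) \<le> 2/3"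
      using elim zz z fh[of z] by (intro jb_corner) (auto simp: inner_index3[OF d] power2_eq_square)
    then show ?case using jb_index3[OF zz d] z val by simp
  qed
  then show "local_max_on Omega4 JB4 (hyp x)"
    using xx by (simp add: local_max_on_def Omega4_hyperplane_iso)
qed

lemma eventually_curve:
  fixes p :: "real \<Rightarrow> 'a::topological_space"
  assumes "(p \<longlongrightarrow> u) (at_right 0)" and "\<forall>\<^sub>F e in at_right 0. p e \<in> S \<and> p e \<noteq> u"
    and "\<forall>\<^sub>F w in at u within S. P w"
  shows "\<forall>\<^sub>F e in at_right 0. P (p e)"
proof -
  have "filterlim p (at u within S) (at_right 0)"
    using assms(1,2) by (simp add: filterlim_at)
  then show ?thesis using assms(3) by (rule filterlim_iff[THEN iffD1, rule_format])
qed

lemma not_local_extremum: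
  fixes p :: "real \<Rightarrow> real^4" and f :: "real^4 \<Rightarrow> real"
  assumes p: "(p \<longlongrightarrow> u) (at_right 0)"
  shows not_local_minI: "\<forall>\<^sub>F e in at_right 0. p e \<in> S \<and> f (p e) < f u \<Longrightarrow> \<not> local_min_on S f u"
    and not_local_maxI: "\<forall>\<^sub>F e in at_right 0. p e \<in> S \<and> f (p e) > f u \<Longrightarrow> \<not> local_max_on S f u"
proof -
  show "\<not> local_min_on S f u" if lt: "\<forall>\<^sub>F e in at_right 0. p e \<in> S \<and> f (p e) < f u"
  proof
    have ne: "\<forall>\<^sub>F e in at_right 0. p e \<in> S \<and> p e \<noteq> u" using lt by eventually_elim auto
    assume m: "local_min_on S f u"
    have "\<forall>\<^sub>F e in at_right 0. f u \<le> f (p e)"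
      by (rule eventually_curve[OF p ne, where P="\<lambda>w. f u \<le> f w"]) (use m in \<open>simp add: local_min_on_def\<close>)
    then have "\<forall>\<^sub>F e in at_right (0::real). False" using lt by eventually_elim auto
    then show False by simp
  qed
  show "\<not> local_max_on S f u" if lt: "\<forall>\<^sub>F e in at_right 0. p e \<in> S \<and> f (p e) > f u"
  proof
    have ne: "\<forall>\<^sub>F e in at_right 0. p e \<in> S \<and> p e \<noteq> u" using lt by eventually_elim auto
    assume m: "local_max_on S f u"
    have "\<forall>\<^sub>F e in at_right 0. f (p e) \<le> f u"
      by (rule eventually_curve[OF p ne, where P="\<lambda>w. f w \<le> f u"]) (use m in \<open>simp add: local_max_on_def\<close>)
    then have "\<forall>\<^sub>F e in at_right (0::real). False" using lt by eventually_elim auto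
    then show False by simp
  qed
qed

text \<open>Two curves through the point suffice: splitting the two equal squares lowers the
  statistic, increasing them together raises it.\<close>

lemma saddle_not_extremum:
  assumes x: "x \<in> sq_type s_saddle (1 - 2 * s_saddle)"
  shows "\<not> local_min_on Omega4 JB4 (hyp x)" "\<not> local_max_on Omega4 JB4 (hyp x)" "JB4 (hyp x) = x_star"
proof -
  define s t where "s = s_saddle" and "t = 1 - 2 * s"
  obtain i j k where d: "i \<noteq> j" "i \<noteq> k" "j \<noteq> k" and xs: "(x$i)\<^sup>2 = s" "(x$j)\<^sup>2 = s" "(x$k)\<^sup>2 = t"
    using x unfolding s_def t_def by (auto simp: sq_type_def)
  note d' = d(1)[symmetric] d(2)[symmetric] d(3)[symmetric]
  have b: "0.0798671 < s" "s < 0.0798672" using s_saddle_bounds by (simp_all add: s_def)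
  have root: "6 * s\<^sup>2 - 13 * s + 1 = 0" using s_saddle_root by (simp add: s_def)
  have xx: "x \<bullet> x = 1" using x sq_type_sphere by blast
  have val: "JB4 (hyp x) = jb s s t" using jb_index3[OF xx d] by (simp add: xs)
  then show "JB4 (hyp x) = x_star" using s_saddle_jb by (simp add: s_def t_def)
  \<comment> \<open>The squares are multiplied by \<open>1 + \<alpha> * e\<close>,
    \<open>1 + \<beta> * e\<close>, \<open>1 + \<gamma> * e\<close>; the curve stays on the sphere
    when \<open>s * \<alpha> + s * \<beta> + t * \<gamma> = 0\<close>.\<close>
  define z where "z \<alpha> \<beta> \<gamma> e = (\<chi> l. x$l * sqrt (1 + (if l = i then \<alpha> else if l = j then \<beta> else \<gamma>) * e))"
    for \<alpha> \<beta> \<gamma> e :: real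
  have lim: "((\<lambda>e. hyp (z \<alpha> \<beta> \<gamma> e)) \<longlongrightarrow> hyp x) (at_right 0)" for \<alpha> \<beta> \<gamma>
  proof -
    have 1: "hyp \<midarrow>x\<rightarrow> hyp x"
      using linear_continuous_at[of hyp x] linear_hyperplane_iso by (simp add: isCont_def linear_linear)
    have "((\<lambda>e. z \<alpha> \<beta> \<gamma> e) \<longlongrightarrow> (\<chi> l. x$l * sqrt (1 + (if l = i then \<alpha> else if l = j then \<beta> else \<gamma>) * 0))) (at_right 0)"
      unfolding z_def by (intro tendsto_intros)
    then have "((\<lambda>e. z \<alpha> \<beta> \<gamma> e) \<longlongrightarrow> x) (at_right 0)" by simp
    then show ?thesis by (rule tendsto_compose[OF 1])
  qed
  have sq: "(z \<alpha> \<beta> \<gamma> e $ i)\<^sup>2 = s * (1 + \<alpha> * e)" "(z \<alpha> \<beta> \<gamma> e $ j)\<^sup>2 = s * (1 + \<beta> * e)"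
    "(z \<alpha> \<beta> \<gamma> e $ k)\<^sup>2 = t * (1 + \<gamma> * e)"
    if "1 + \<alpha> * e \<ge> 0" "1 + \<beta> * e \<ge> 0" "1 + \<gamma> * e \<ge> 0" for \<alpha> \<beta> \<gamma> e
    using that d d' by (simp_all add: z_def power_mult_distrib xs)
  have z1: "z \<alpha> \<beta> \<gamma> e \<bullet> z \<alpha> \<beta> \<gamma> e = 1" "JB4 (hyp (z \<alpha> \<beta> \<gamma> e)) = jb (s * (1 + \<alpha> * e)) (s * (1 + \<beta> * e)) (t * (1 + \<gamma> * e))"
    if "1 + \<alpha> * e \<ge> 0" "1 + \<beta> * e \<ge> 0" "1 + \<gamma> * e \<ge> 0" "s * \<alpha> + s * \<beta> + t * \<gamma> = 0" for \<alpha> \<beta> \<gamma> e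
  proof -
    have "z \<alpha> \<beta> \<gamma> e \<bullet> z \<alpha> \<beta> \<gamma> e = 2 * s + t + (s * \<alpha> + s * \<beta> + t * \<gamma>) * e"
      unfolding inner_index3[OF d] power2_eq_square[symmetric] sq[OF that(1-3)] by (simp add: algebra_simps)
    then show one: "z \<alpha> \<beta> \<gamma> e \<bullet> z \<alpha> \<beta> \<gamma> e = 1" unfolding that(4) by (simp add: t_def)
    show "JB4 (hyp (z \<alpha> \<beta> \<gamma> e)) = jb (s * (1 + \<alpha> * e)) (s * (1 + \<beta> * e)) (t * (1 + \<gamma> * e))"
      unfolding jb_index3[OF one d] sq[OF that(1-3)] ..
  qed
  have ev: "\<forall>\<^sub>F e in at_right (0::real). 0 < e \<and> e < 1/10"
    using eventually_at_right_real[of 0 "1/10::real"] by (auto elim: eventually_mono)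
  show "\<not> local_min_on Omega4 JB4 (hyp x)"
  proof (rule not_local_minI[OF lim[of 1 "-1" 0]], use ev in eventually_elim)
    case (elim e)
    have "jb (s * (1 + 1 * e)) (s * (1 + - 1 * e)) (t * (1 + 0 * e)) - jb s s t =
       (s * e)\<^sup>2 * (- 24 * t + 8/3 * (2 * s\<^sup>2 + t\<^sup>2) + 8/3 * (s * e)\<^sup>2)"
      unfolding jb_def by (simp add: power2_eq_square field_simps)
    \<comment> \<open>Criticality turns the leading coefficient into \<open>24 * (s - t)\<close>,
      which is negative because \<open>s < t\<close>.\<close>
    also have "2 * s\<^sup>2 + t\<^sup>2 = 9 * s" using root unfolding t_def by (simp add: power2_eq_square algebra_simps)
    also have "(s * e)\<^sup>2 * (- 24 * t + 8/3 * (9 * s) + 8/3 * (s * e)\<^sup>2) < 0"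
    proof (rule mult_pos_neg)
      have "s * e \<le> 1 * 1" using elim b by (intro mult_mono) auto
      then have "(s * e)\<^sup>2 \<le> 1" using elim b by (simp add: power_le_one)
      then show "- 24 * t + 8/3 * (9 * s) + 8/3 * (s * e)\<^sup>2 < 0" using b by (simp add: t_def)
    qed (use elim b in simp)
    finally show ?case using z1[of 1 e "-1" 0] elim by (simp add: Omega4_hyperplane_iso val)
  qed
  show "\<not> local_max_on Omega4 JB4 (hyp x)"
  proof (rule not_local_maxI[OF lim[of 1 1 "- 2 * s / t"]], use ev in eventually_elim)
    case (elim e)
    have t: "t > 0" using b by (simp add: t_def)
    have e': "2 * s / t * e \<le> 1 * 1" using elim b by (intro mult_mono) (auto simp: t_def)
    define D where "D = s * e"
    have D: "0 < D" "D < 1/100" using elim b mult_strict_mono[of s "1/10" e "1/10"] by (auto simp: D_def)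
    have tt: "t * (1 + (- 2 * s / t) * e) = 1 - 2 * (s + D)" using t by (simp add: D_def t_def field_simps)
    \<comment> \<open>The linear term carries the quadratic that vanishes at \<open>s\<close>, so
      the sign is decided at second order.\<close>
    have J: "jb (s + D) (s + D) (1 - 2 * (s + D)) - jb s s (1 - 2 * s) =
       D * (16/3 * (1 - 3 * s) * (- (6 * s\<^sup>2 - 13 * s + 1))) +
       D\<^sup>2 * (144 * s\<^sup>2 - 240 * s + 128/3 + (96 * s - 80) * D + 24 * D\<^sup>2)"
      unfolding jb_def by (simp add: power2_eq_square field_simps)
    have b': "7/100 < s" "s < 8/100" using b by simp_all
    have sD: "s * D \<ge> 0" using b' D by simp
    have "s * s \<ge> 0" by simp
    then have "144 * s\<^sup>2 - 240 * s + 128/3 + (96 * s - 80) * D + 24 * D\<^sup>2 > 0"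
      using b' D sD zero_le_power2[of D] unfolding power2_eq_square[of s] left_diff_distrib by linarith
    then have "jb (s + D) (s + D) (1 - 2 * (s + D)) - jb s s (1 - 2 * s) > 0"
      unfolding J root using D by simp
    then show ?case
      using z1[of 1 e 1 "- 2 * s / t"] elim e' t b tt by (simp add: Omega4_hyperplane_iso val D_def t_def distrib_left)
  qed
qed

lemma exists_4: "(\<exists>a::4. P a) \<longleftrightarrow> P 1 \<or> P 2 \<or> P 3 \<or> P 4"
  using forall_4[of "\<lambda>a. \<not> P a"] by blast

text \<open>Trades permutations for quadruples of distinct indices, which turns an orbit into a
  finite case distinction for the simplifier.\<close>

lemma perms_iff:
  "w \<in> perms u \<longleftrightarrow> (\<exists>a b c d. distinct [a, b, c, d] \<and> w = vector [u$a, u$b, u$c, u$d])"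
proof
  assume "w \<in> perms u"
  then obtain p where p: "p permutes UNIV" and w: "w = (\<chi> i. u $ p i)" by (auto simp: perms_def)
  have "inj p" using p permutes_inj by blast
  then have "distinct [p 1, p 2, p 3, p 4]" by (simp add: inj_eq)
  moreover have "w = vector [u $ p 1, u $ p 2, u $ p 3, u $ p 4]"
    by (simp add: w vec_eq_iff forall_4)
  ultimately show "\<exists>a b c d. distinct [a, b, c, d] \<and> w = vector [u$a, u$b, u$c, u$d]" by blast
next
  assume "\<exists>a b c d. distinct [a, b, c, d] \<and> w = vector [u$a, u$b, u$c, u$d]"
  then obtain a b c d where d: "distinct [a, b, c, d]" and w: "w = vector [u$a, u$b, u$c, u$d]" by blast
  define p :: "4 \<Rightarrow> 4" where "p i = (if i = 1 then a else if i = 2 then b else if i = 3 then c else d)" for i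
  have "inj p"
  proof (rule injI)
    fix i j show "p i = p j \<Longrightarrow> i = j"
      using d exhaust_4[of i] exhaust_4[of j] by (auto simp: p_def)
  qed
  then have "bij p" by (simp add: bij_def finite_UNIV_inj_surj)
  then have "p permutes UNIV" by (auto intro: bij_imp_permutes)
  moreover have "w = (\<chi> i. u $ p i)" by (simp add: w vec_eq_iff forall_4 p_def)
  ultimately show "w \<in> perms u" by (auto simp: perms_def)
qed

section \<open>Permutation orbits\<close>

lemma perms_scaleR: "perms (c *\<^sub>R u) = (*\<^sub>R) c ` perms u"
proof -
  have "(\<chi> i. (c *\<^sub>R u) $ p i) = c *\<^sub>R (\<chi> i. u $ p i)" for p :: "4 \<Rightarrow> 4" by (simp add: vec_eq_iff)
  then show ?thesis unfolding perms_def by auto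
qed

lemma card_perms_scaleR: "c \<noteq> 0 \<Longrightarrow> card (perms (c *\<^sub>R u)) = card (perms u)"
  unfolding perms_scaleR by (intro card_image) (simp add: inj_on_def)

lemma vector_4_eq_iff: "(vector [a, b, c, d] :: real^4) = vector [a', b', c', d'] \<longleftrightarrow>
    a = a' \<and> b = b' \<and> c = c' \<and> d = d'"
  by (simp add: vec_eq_iff forall_4)

lemma vector_3_eq_iff: "(vector [a, b, c] :: real^3) = vector [a', b', c'] \<longleftrightarrow> a = a' \<and> b = b' \<and> c = c'"
  by (simp add: vec_eq_iff forall_3)

lemma perms_0011: "perms (vector [0, 0, 1, -1]) =
  {vector [0, 0, 1, -1], vector [0, 0, -1, 1], vector [0, 1, 0, -1], vector [0, -1, 0, 1],
   vector [0, 1, -1, 0], vector [0, -1, 1, 0], vector [1, 0, 0, -1], vector [-1, 0, 0, 1],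
   vector [1, 0, -1, 0], vector [-1, 0, 1, 0], vector [1, -1, 0, 0], vector [-1, 1, 0, 0]}"
proof (rule set_eqI)
  fix w show "w \<in> perms (vector [0, 0, 1, -1]) \<longleftrightarrow> w \<in> {vector [0, 0, 1, -1], vector [0, 0, -1, 1], vector [0, 1, 0, -1], vector [0, -1, 0, 1],
   vector [0, 1, -1, 0], vector [0, -1, 1, 0], vector [1, 0, 0, -1], vector [-1, 0, 0, 1],
   vector [1, 0, -1, 0], vector [-1, 0, 1, 0], vector [1, -1, 0, 0], vector [-1, 1, 0, 0]}"
    by (simp add: perms_iff exists_4; rule iffI; elim disjE; simp)
qed

lemma perms_1111: "perms (vector [1, 1, -1, -1]) =
  {vector [1, 1, -1, -1], vector [1, -1, 1, -1], vector [1, -1, -1, 1],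
   vector [-1, -1, 1, 1], vector [-1, 1, -1, 1], vector [-1, 1, 1, -1]}"
proof (rule set_eqI)
  fix w show "w \<in> perms (vector [1, 1, -1, -1]) \<longleftrightarrow> w \<in>
  {vector [1, 1, -1, -1], vector [1, -1, 1, -1], vector [1, -1, -1, 1],
   vector [-1, -1, 1, 1], vector [-1, 1, -1, 1], vector [-1, 1, 1, -1]}"
    by (simp add: perms_iff exists_4; rule iffI; elim disjE; simp)
qed

lemma perms_3111: "perms (vector [3, -1, -1, -1]) =
  {vector [3, -1, -1, -1], vector [-1, 3, -1, -1], vector [-1, -1, 3, -1], vector [-1, -1, -1, 3]}"
proof (rule set_eqI)
  fix w show "w \<in> perms (vector [3, -1, -1, -1]) \<longleftrightarrow> w \<in>
  {vector [3, -1, -1, -1], vector [-1, 3, -1, -1], vector [-1, -1, 3, -1], vector [-1, -1, -1, 3]}"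
    by (simp add: perms_iff exists_4; rule iffI; elim disjE; simp)
qed

text \<open>The list has repetitions when \<open>q = 0\<close>, \<open>p = 0\<close> or
  \<open>p = q\<close>; these collapse the 24 entries to 12, 6 and 8 in
  \<open>card_sq_type\<close>.\<close>

lemma sq_type_explicit: "sq_type (p\<^sup>2) (q\<^sup>2) =
  {vector [p, p, q], vector [p, p, - q], vector [p, - p, q], vector [p, - p, - q],
   vector [- p, p, q], vector [- p, p, - q], vector [- p, - p, q], vector [- p, - p, - q],
   vector [p, q, p], vector [p, - q, p], vector [p, q, - p], vector [p, - q, - p],
   vector [- p, q, p], vector [- p, - q, p], vector [- p, q, - p], vector [- p, - q, - p],
   vector [q, p, p], vector [- q, p, p], vector [q, p, - p], vector [- q, p, - p],
   vector [q, - p, p], vector [- q, - p, p], vector [q, - p, - p], vector [- q, - p, - p]}"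
  (is "_ = ?S")
proof (rule set_eqI)
  fix x :: "real^3" show "x \<in> sq_type (p\<^sup>2) (q\<^sup>2) \<longleftrightarrow> x \<in> ?S"
    unfolding sq_type_iff power2_eq_iff insert_iff empty_iff
    by (simp only: vec_eq_iff forall_3 vector_3; rule iffI; elim disjE conjE; simp)
qed

lemma card_sq_type:
  shows "card (sq_type (1/2) 0) = 12" "card (sq_type 0 1) = 6" "card (sq_type (1/3) (1/3)) = 8"
    and "card (sq_type s_saddle (1 - 2 * s_saddle)) = 24"
proof -
  have E: "card (sq_type (1/2) 0) = 12" if "p > 0" "p\<^sup>2 = 1/2" for p :: real
    using sq_type_explicit[of p 0] that by (simp add: card_insert_if vector_3_eq_iff)
  show "card (sq_type (1/2) 0) = 12" by (rule E[of "sqrt (1/2)"]) (simp_all only: real_sqrt_pow2, simp_all)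
  show "card (sq_type 0 1) = 6"
    using sq_type_explicit[of 0 1] by (simp add: card_insert_if vector_3_eq_iff)
  have E: "card (sq_type (1/3) (1/3)) = 8" if "p > 0" "p\<^sup>2 = 1/3" for p :: real
    using sq_type_explicit[of p p] that by (simp add: card_insert_if vector_3_eq_iff)
  show "card (sq_type (1/3) (1/3)) = 8" by (rule E[of "sqrt (1/3)"]) (simp_all only: real_sqrt_pow2, simp_all)
  have E: "card (sq_type (p\<^sup>2) (q\<^sup>2)) = 24" if "p > 0" "q > 0" "p \<noteq> q" for p q :: real
    using sq_type_explicit[of p q] that by (simp add: card_insert_if vector_3_eq_iff)
  show "card (sq_type s_saddle (1 - 2 * s_saddle)) = 24"
    using E[of "sqrt s_saddle" "sqrt (1 - 2 * s_saddle)"] s_saddle_bounds by simp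
qed

lemma finite_sq_type: "finite (sq_type s t)" if "s \<ge> 0" "t \<ge> 0"
  using sq_type_explicit[of "sqrt s" "sqrt t"] that by simp

lemma hyp_image_iff:
  "u \<in> hyp ` T \<longleftrightarrow> u$1 + u$2 + u$3 + u$4 = 0 \<and> vector [u$1 + u$2, u$1 + u$3, u$1 + u$4] \<in> T"
proof
  assume "u \<in> hyp ` T"
  then obtain x where "x \<in> T" and u: "u = hyp x" by blast
  moreover have "vector [u$1 + u$2, u$1 + u$3, u$1 + u$4] = x"
    by (simp add: vec_eq_iff forall_3 u hyperplane_iso_nth field_simps)
  ultimately show "u$1 + u$2 + u$3 + u$4 = 0 \<and> vector [u$1 + u$2, u$1 + u$3, u$1 + u$4] \<in> T"
    by (simp add: hyperplane_iso_nth field_simps)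
next
  assume a: "u$1 + u$2 + u$3 + u$4 = 0 \<and> vector [u$1 + u$2, u$1 + u$3, u$1 + u$4] \<in> T"
  then have s: "u$4 = - u$1 - u$2 - u$3" by simp
  have "hyp (vector [u$1 + u$2, u$1 + u$3, u$1 + u$4]) = u"
    unfolding vec_eq_iff forall_4 by (simp add: hyperplane_iso_nth s)
  then show "u \<in> hyp ` T" using a by force
qed

lemma card_hyp_image: "card (hyp ` T) = card T"
  using inj_hyperplane_iso by (intro card_image) (auto simp: inj_on_def)

text \<open>One inclusion is enough, since both sets are finite of the same cardinality; the same
  argument serves the other two orbits.\<close>

lemma perms_minima: "perms ((1 / sqrt 2) *\<^sub>R vector [0, 0, 1, -1]) = hyp ` sq_type (1/2) 0"
  and card_perms_minima: "card (perms ((1 / sqrt 2) *\<^sub>R vector [0, 0, 1, -1])) = 12"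
proof -
  show c: "card (perms ((1 / sqrt 2) *\<^sub>R vector [0, 0, 1, -1])) = 12"
    by (simp add: card_perms_scaleR perms_0011 card_insert_if vector_4_eq_iff)
  have "perms ((1 / sqrt 2) *\<^sub>R vector [0, 0, 1, -1]) \<subseteq> hyp ` sq_type (1/2) 0"
  proof
    fix u assume u: "u \<in> perms ((1 / sqrt 2) *\<^sub>R vector [0, 0, 1, -1])"
    define r where "r = 1 / sqrt 2"
    have r: "r\<^sup>2 = 1/2" by (simp add: r_def power_divide)
    show "u \<in> hyp ` sq_type (1/2) 0"
      using u unfolding perms_scaleR perms_0011 hyp_image_iff r_def[symmetric] sq_type_iff
      by (auto simp: r)
  qed
  then show "perms ((1 / sqrt 2) *\<^sub>R vector [0, 0, 1, -1]) = hyp ` sq_type (1/2) 0"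
    by (rule card_subset_eq[rotated]) (simp_all add: c card_hyp_image card_sq_type finite_sq_type)
qed

lemma perms_local_maxima: "perms ((1/2) *\<^sub>R vector [1, 1, -1, -1]) = hyp ` sq_type 0 1"
  and card_perms_local_maxima: "card (perms ((1/2) *\<^sub>R vector [1, 1, -1, -1])) = 6"
proof -
  show c: "card (perms ((1/2) *\<^sub>R vector [1, 1, -1, -1])) = 6"
    by (simp add: card_perms_scaleR perms_1111 card_insert_if vector_4_eq_iff)
  have "perms ((1/2) *\<^sub>R vector [1, 1, -1, -1]) \<subseteq> hyp ` sq_type 0 1"
    unfolding perms_scaleR perms_1111 subset_iff hyp_image_iff sq_type_iff by auto
  then show "perms ((1/2) *\<^sub>R vector [1, 1, -1, -1]) = hyp ` sq_type 0 1"
    by (rule card_subset_eq[rotated]) (simp_all add: c card_hyp_image card_sq_type finite_sq_type)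
qed

lemma perms_maxima: "perms ((1 / sqrt 12) *\<^sub>R vector [3, -1, -1, -1]) \<union>
    perms (- ((1 / sqrt 12) *\<^sub>R vector [3, -1, -1, -1])) = hyp ` sq_type (1/3) (1/3)" (is "?P = _")
  and card_perms_maxima: "card (perms ((1 / sqrt 12) *\<^sub>R vector [3, -1, -1, -1]) \<union>
    perms (- ((1 / sqrt 12) *\<^sub>R vector [3, -1, -1, -1]))) = 8"
proof -
  define r where "r = 1 / sqrt 12"
  have r: "r\<^sup>2 = 1/12" "r > 0" by (simp_all add: r_def power_divide)
  have P: "?P = (*\<^sub>R) r ` perms (vector [3, -1, -1, -1]) \<union> (*\<^sub>R) (- r) ` perms (vector [3, -1, -1, -1])"
    unfolding scaleR_minus_left[symmetric] perms_scaleR r_def ..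
  show c: "card ?P = 8"
    unfolding P perms_3111 using r(2) by (simp add: card_insert_if vec_eq_iff forall_4)
  have "?P \<subseteq> hyp ` sq_type (1/3) (1/3)"
    unfolding P perms_3111 subset_iff hyp_image_iff sq_type_iff by (auto simp: power2_eq_square r(1)[unfolded power2_eq_square])
  then show "?P = hyp ` sq_type (1/3) (1/3)"
    by (rule card_subset_eq[rotated]) (simp_all add: c card_hyp_image card_sq_type finite_sq_type)
qed

section \<open>Assembling the classification\<close>

lemma sq_type_values:
  assumes "x \<in> sq_type s (1 - 2 * s)"
  shows "JB4 (hyp x) = jb s s (1 - 2 * s)"
proof -
  obtain i j k where d: "i \<noteq> j" "i \<noteq> k" "j \<noteq> k" and xs: "(x$i)\<^sup>2 = s" "(x$j)\<^sup>2 = s" "(x$k)\<^sup>2 = 1 - 2 * s"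
    using assms by (auto simp: sq_type_def)
  show ?thesis using jb_index3[OF sq_type_sphere[OF assms] d] by (simp add: xs)
qed

text \<open>The other three types are extrema: two attain the global bounds, and the corners are
  covered by \<open>local_max_corner\<close>.\<close>

lemma saddle_points_JB4: "saddle_points JB4 = hyp ` sq_type s_saddle (1 - 2 * s_saddle)"
proof (intro equalityI subsetI)
  fix u assume u: "u \<in> saddle_points JB4"
  then have O: "u \<in> Omega4" by (simp add: saddle_points_def stationary_points_def)
  obtain s x where s: "s \<in> {1/2, 0, 1/3, s_saddle}" and x: "x \<in> sq_type s (1 - 2 * s)" "u = hyp x"
    using u unfolding saddle_points_def stationary_points_JB4 by blast
  have W: "\<forall>\<^sub>F w in at u within Omega4. w \<in> Omega4"
    by (simp add: eventually_at_topological, blast)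
  have "s = s_saddle"
  proof (rule ccontr)
    assume "s \<noteq> s_saddle"
    then consider "s = 1/2" | "s = 0" | "s = 1/3" using s by auto
    then have "local_min_on Omega4 JB4 u \<or> local_max_on Omega4 JB4 u"
    proof cases
      case 1
      have "JB4 u = 1/6" using sq_type_values[OF x(1)] x(2) jb_type_vals unfolding 1 by simp
      then show ?thesis
        using O JB4_bounds by (metis (mono_tags, lifting) local_min_on_def eventually_mono[OF W])
    next
      case 2
      then show ?thesis using local_max_corner[of x] x by simp
    next
      case 3
      have "JB4 u = 26/27" using sq_type_values[OF x(1)] x(2) jb_type_vals unfolding 3 by simp
      then show ?thesis
        using O JB4_bounds by (metis (mono_tags, lifting) local_max_on_def eventually_mono[OF W])
    qed
    then show False using u by (simp add: saddle_points_def)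
  qed
  then show "u \<in> hyp ` sq_type s_saddle (1 - 2 * s_saddle)" using x by blast
next
  fix u assume "u \<in> hyp ` sq_type s_saddle (1 - 2 * s_saddle)"
  moreover from this have "u \<in> stationary_points JB4" unfolding stationary_points_JB4 by blast
  ultimately show "u \<in> saddle_points JB4" using saddle_not_extremum by (auto simp: saddle_points_def)
qed

lemma det_H_star_neg: "det_H_star < 0"
  using det_H_star_approx by (simp add: abs_if split: if_splits)

lemma card_stationary_points: "card (stationary_points JB4) = 50"
proof -
  let ?T = "\<lambda>s. hyp ` sq_type s (1 - 2 * s)"
  \<comment> \<open>The four types are told apart by the value of the statistic.\<close>
  have disj: "?T s \<inter> ?T s' = {}" if "jb s s (1 - 2 * s) \<noteq> jb s' s' (1 - 2 * s')" for s s'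
  proof (rule equals0I)
    fix u assume "u \<in> ?T s \<inter> ?T s'"
    then obtain x x' where "x \<in> sq_type s (1 - 2 * s)" "x' \<in> sq_type s' (1 - 2 * s')" "u = hyp x" "u = hyp x'"
      by blast
    then show False using sq_type_values[of x s] sq_type_values[of x' s'] that by simp
  qed
  have xs: "0.47 < x_star" "x_star < 0.48" using x_star_approx by (simp_all add: abs_if split: if_splits)
  have fin: "finite (?T s)" if "0 \<le> s" "s \<le> 1/2" for s
    using that by (intro finite_imageI finite_sq_type) auto
  have "stationary_points JB4 = ?T (1/2) \<union> (?T 0 \<union> (?T (1/3) \<union> ?T s_saddle))"
    unfolding stationary_points_JB4 by auto
  also have "card \<dots> = card (?T (1/2)) + (card (?T 0) + (card (?T (1/3)) + card (?T s_saddle)))"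
    using disj[of "1/2" 0] disj[of "1/2" "1/3"] disj[of "1/2" s_saddle] disj[of 0 "1/3"] disj[of 0 s_saddle]
      disj[of "1/3" s_saddle] fin[of "1/2"] fin[of 0] fin[of "1/3"] fin[of s_saddle] xs s_saddle_bounds
    by (simp add: card_Un_disjoint Int_Un_distrib jb_type_vals s_saddle_jb)
  finally show ?thesis by (simp add: card_hyp_image card_sq_type)
qed

lemma hess_sq_type:
  assumes "s \<in> {1/2, 0, 1/3, s_saddle}" and "x \<in> sq_type s (1 - 2 * s)"
  shows "\<exists>v1 v2 l1 l2. hess_diag JB4 (hyp x) v1 v2 l1 l2 \<and> l1 \<noteq> 0 \<and> l2 \<noteq> 0 \<and>
    (s = 1/2 \<longrightarrow> l1 = 8/3 \<and> l2 = 32/3) \<and> (s = s_saddle \<longrightarrow> l1 * l2 = det_H_star)"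
proof (cases "s = 0")
  case True
  with assms obtain v1 v2 where "hess_diag JB4 (hyp x) v1 v2 (- 16/3) (- 16/3)"
    using hess_diag_corner[of x] by auto
  then show ?thesis using s_saddle_bounds True by (intro exI[of _ v1] exI[of _ v2] exI[of _ "- 16/3"]) auto
next
  case False
  have s: "s > 0" using False assms(1) s_saddle_bounds by auto
  obtain v1 v2 where D: "hess_diag JB4 (hyp x) v1 v2 (eig1 s) (eig2 s)"
    using hess_diag_sq_type[OF assms(2) s] by blast
  have "eig1 s \<noteq> 0 \<and> eig2 s \<noteq> 0"
  proof -
    have "s = 1/2 \<or> s = 1/3 \<or> s = s_saddle" using assms(1) False by blast
    then show ?thesis using eig_vals s_saddle_eig det_H_star_neg by (elim disjE; hypsubst) auto
  qed
  moreover have "s = 1/2 \<Longrightarrow> eig1 s = 8/3 \<and> eig2 s = 32/3" "s = s_saddle \<Longrightarrow> eig1 s * eig2 s = det_H_star"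
    using eig_vals s_saddle_eig by (hypsubst, blast)+
  ultimately show ?thesis using D by blast
qed

lemma nondegenerate_stationary:
  assumes "u \<in> stationary_points JB4"
  shows "nondegenerate JB4 u"
proof -
  obtain s x where s: "s \<in> {1/2, 0, 1/3, s_saddle}" and x: "x \<in> sq_type s (1 - 2 * s)" "u = hyp x"
    using assms unfolding stationary_points_JB4 by blast
  obtain v1 v2 l1 l2 where "hess_diag JB4 (hyp x) v1 v2 l1 l2" "l1 \<noteq> 0" "l2 \<noteq> 0"
    using hess_sq_type[OF s x(1)] by blast
  then show ?thesis using nondegenerate_hess_diag x(2) by blast
qed

lemma minima_JB4:
  assumes "u \<in> hyp ` sq_type (1/2) 0"
  shows "(\<forall>w\<in>Omega4. JB4 u \<le> JB4 w) \<and> JB4 u = 1/6 \<and> hess_eigenvalues JB4 u = {8/3, 32/3}"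
proof -
  obtain x where x: "x \<in> sq_type (1/2) (1 - 2 * (1/2))" "u = hyp x" using assms by auto
  have "hess_eigenvalues JB4 u = {8/3, 32/3}"
  proof -
    obtain v1 v2 l1 l2 where "hess_diag JB4 (hyp x) v1 v2 l1 l2" "l1 = 8/3 \<and> l2 = 32/3"
      using hess_sq_type[OF _ x(1)] by blast
    then show ?thesis using hess_eigenvalues_diag x(2) by blast
  qed
  moreover have "JB4 u = 1/6" using sq_type_values[OF x(1)] jb_type_vals x(2) by simp
  ultimately show ?thesis using JB4_bounds by metis
qed

lemma saddles_JB4:
  assumes "u \<in> saddle_points JB4"
  shows "JB4 u = x_star \<and> hess_det JB4 u = det_H_star"
proof -
  obtain x where x: "x \<in> sq_type s_saddle (1 - 2 * s_saddle)" "u = hyp x"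
    using assms saddle_points_JB4 by auto
  obtain v1 v2 l1 l2 where "hess_diag JB4 (hyp x) v1 v2 l1 l2" "l1 * l2 = det_H_star"
    using hess_sq_type[OF _ x(1)] by blast
  then have "hess_det JB4 (hyp x) = det_H_star" using hess_det_diag by fastforce
  then show ?thesis using saddle_not_extremum(3)[OF x(1)] x(2) by simp
qed

lemma local_maxima_JB4:
  assumes "u \<in> hyp ` sq_type 0 1"
  shows "local_max_on Omega4 JB4 u \<and> JB4 u = 2/3 \<and> (\<forall>v\<in>tangent4 u. riem_hess JB4 u v = (- 16/3) *\<^sub>R v)"
proof -
  obtain x where x: "x \<in> sq_type 0 1" "u = hyp x" using assms by auto
  obtain v1 v2 where "hess_diag JB4 (hyp x) v1 v2 (- 16/3) (- 16/3)" using hess_diag_corner[OF x(1)] .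
  then show ?thesis using local_max_corner[OF x(1)] riem_hess_scalar x(2) by blast
qed

lemma maxima_JB4:
  assumes "u \<in> hyp ` sq_type (1/3) (1/3)"
  shows "(\<forall>w\<in>Omega4. JB4 w \<le> JB4 u) \<and> JB4 u = 26/27 \<and>
    (\<forall>v\<in>tangent4 u. riem_hess JB4 u v = (- 256/27) *\<^sub>R v)"
proof -
  obtain x where x: "x \<in> sq_type (1/3) (1 - 2 * (1/3))" "u = hyp x" using assms by auto
  obtain v1 v2 where "hess_diag JB4 (hyp x) v1 v2 (eig1 (1/3)) (eig2 (1/3))"
    using hess_diag_sq_type[OF x(1)] by auto
  then have "\<forall>v\<in>tangent4 u. riem_hess JB4 u v = (- 256/27) *\<^sub>R v"
    using riem_hess_scalar x(2) unfolding eig_vals by blast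
  moreover have "JB4 u = 26/27" using sq_type_values[OF x(1)] jb_type_vals x(2) by simp
  ultimately show ?thesis using JB4_bounds by metis
qed

section \<open>Elementary symmetric functions of the squared coordinates\<close>

text \<open>Taken on the solid ball rather than on the sphere, so that it maps between open sets of
  the same dimension and has a Jacobian.\<close>

definition elem_map :: "real^3 \<Rightarrow> real^3" where
  "elem_map x = vector
    [(x$1)\<^sup>2 + (x$2)\<^sup>2 + (x$3)\<^sup>2,
     (x$1)\<^sup>2 * (x$2)\<^sup>2 + (x$1)\<^sup>2 * (x$3)\<^sup>2 + (x$2)\<^sup>2 * (x$3)\<^sup>2,
     (x$1)\<^sup>2 * (x$2)\<^sup>2 * (x$3)\<^sup>2]"

text \<open>Discriminant of the cubic \<open>X^3 - a * X^2 + b * X - c\<close>.\<close>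

definition disc3 :: "real \<Rightarrow> real \<Rightarrow> real \<Rightarrow> real" where
  "disc3 a b c = a\<^sup>2 * b\<^sup>2 - 4 * b^3 - 4 * a^3 * c + 18 * a * b * c - 27 * c\<^sup>2"

text \<open>One of the 48 chambers of the signed permutation group, under which
  \<open>elem_map\<close> is invariant, cut off by the unit ball.\<close>

definition chamber :: "(real^3) set" where
  "chamber = {x. 0 < x$1 \<and> x$1 < x$2 \<and> x$2 < x$3 \<and> (x$1)\<^sup>2 + (x$2)\<^sup>2 + (x$3)\<^sup>2 < 1}"

definition elem_region :: "(real^3) set" where
  "elem_region = {E. 0 < E$1 \<and> E$1 < 1 \<and> 0 < E$2 \<and> 0 < E$3 \<and> 0 < disc3 (E$1) (E$2) (E$3)}"

lemma elem_map_nth [simp]: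
  "elem_map x $ 1 = (x$1)\<^sup>2 + (x$2)\<^sup>2 + (x$3)\<^sup>2"
  "elem_map x $ 2 = (x$1)\<^sup>2 * (x$2)\<^sup>2 + (x$1)\<^sup>2 * (x$3)\<^sup>2 + (x$2)\<^sup>2 * (x$3)\<^sup>2"
  "elem_map x $ 3 = (x$1)\<^sup>2 * (x$2)\<^sup>2 * (x$3)\<^sup>2"
  by (simp_all add: elem_map_def)

lemma disc3_elem:
  "disc3 (a + b + c) (a * b + a * c + b * c) (a * b * c) = ((a - b) * (a - c) * (b - c))\<^sup>2"
  unfolding disc3_def by algebra

lemma chamber_squares:
  assumes "x \<in> chamber"
  shows "0 < (x$1)\<^sup>2" "(x$1)\<^sup>2 < (x$2)\<^sup>2" "(x$2)\<^sup>2 < (x$3)\<^sup>2"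
  using assms by (auto simp: chamber_def intro!: power_strict_mono)

text \<open>Equal symmetric functions mean the same cubic, hence the same set of roots; the strict
  order and the positivity in the chamber then identify the coordinates.\<close>

lemma inj_on_elem_map: "inj_on elem_map chamber"
proof (rule inj_onI)
  fix x z assume x: "x \<in> chamber" and z: "z \<in> chamber" and eq: "elem_map x = elem_map z"
  define a b c where "a = (x$1)\<^sup>2" "b = (x$2)\<^sup>2" "c = (x$3)\<^sup>2"
  define a' b' c' where "a' = (z$1)\<^sup>2" "b' = (z$2)\<^sup>2" "c' = (z$3)\<^sup>2"
  note defs = a_b_c_def a'_b'_c'_def
  have e: "a + b + c = a' + b' + c'" "a * b + a * c + b * c = a' * b' + a' * c' + b' * c'" "a * b * c = a' * b' * c'"
    using arg_cong[OF eq, of "\<lambda>v. v $ 1"] arg_cong[OF eq, of "\<lambda>v. v $ 2"] arg_cong[OF eq, of "\<lambda>v. v $ 3"]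
    by (simp_all add: defs)
  have r: "(t - a') * (t - b') * (t - c') = (t - a) * (t - b) * (t - c)" for t
  proof -
    have "(t - a') * (t - b') * (t - c') = t^3 - (a' + b' + c') * t\<^sup>2 + (a' * b' + a' * c' + b' * c') * t - a' * b' * c'"
      by algebra
    also have "\<dots> = (t - a) * (t - b) * (t - c)" unfolding e[symmetric] by algebra
    finally show ?thesis .
  qed
  have "a = a' \<or> a = b' \<or> a = c'" "b = a' \<or> b = b' \<or> b = c'" "c = a' \<or> c = b' \<or> c = c'"
    using r[of a] r[of b] r[of c] by auto
  moreover have "a < b" "b < c" "a' < b'" "b' < c'"
    using chamber_squares[OF x] chamber_squares[OF z] by (simp_all add: defs)
  ultimately have "a = a'" "b = b'" "c = c'" by auto
  then have "x$1 = z$1" "x$2 = z$2" "x$3 = z$3"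
    using x z by (auto simp: defs chamber_def intro: power2_eq_imp_eq)
  then show "x = z" by (simp add: vec_eq_iff forall_3)
qed

lemma elem_map_chamber_subset: "elem_map ` chamber \<subseteq> elem_region"
proof safe
  fix x assume x: "x \<in> chamber"
  note s = chamber_squares[OF x]
  have "disc3 (elem_map x $ 1) (elem_map x $ 2) (elem_map x $ 3) > 0"
    unfolding elem_map_nth disc3_elem using s by simp
  then show "elem_map x \<in> elem_region"
    unfolding elem_region_def mem_Collect_eq using x s
    by (simp add: chamber_def add_pos_pos)
qed

text \<open>Vieta's trigonometric solution of the cubic.\<close>

lemma cubic_roots:
  assumes D: "disc3 a b c > 0"
  obtains r1 r2 r3 where "r1 < r2" "r2 < r3" "r1 + r2 + r3 = a" "r1 * r2 + r1 * r3 + r2 * r3 = b" "r1 * r2 * r3 = c"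
proof -
  \<comment> \<open>A positive discriminant is exactly the condition that \<open>w\<close> below
    lies strictly between \<open>- 1\<close> and \<open>1\<close>, which makes it a cosine.\<close>
  have id: "27 * disc3 a b c = 4 * (a\<^sup>2 - 3 * b)^3 - (2 * a^3 - 9 * a * b + 27 * c)\<^sup>2"
    unfolding disc3_def by algebra
  have "4 * (a\<^sup>2 - 3 * b)^3 > 0" using D id zero_le_power2[of "2 * a^3 - 9 * a * b + 27 * c"] by linarith
  then have pos: "a\<^sup>2 - 3 * b > 0" by (simp add: zero_less_power_eq)
  define t where "t = sqrt (a\<^sup>2 - 3 * b) / 3"
  have t: "t > 0" using pos by (simp add: t_def)
  have t2: "9 * t\<^sup>2 = a\<^sup>2 - 3 * b" using pos by (simp add: t_def power_divide)
  define w where "w = (2 * a^3 - 9 * a * b + 27 * c) / (54 * t^3)"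
  have w: "2 * a^3 - 9 * a * b + 27 * c = 54 * t^3 * w" using t by (simp add: w_def)
  have "27 * disc3 a b c = 4 * (9 * t\<^sup>2)^3 - (54 * t^3 * w)\<^sup>2" unfolding id w t2 ..
  also have "\<dots> = 2916 * t^6 * (1 - w\<^sup>2)" by algebra
  finally have "0 < 2916 * t^6 * (1 - w\<^sup>2)" using D by simp
  then have "w\<^sup>2 < 1" using t by (simp add: zero_less_mult_iff)
  then have w1: "-1 < w" "w < 1" using abs_square_less_1[of w] by (simp_all add: abs_less_iff)
  define \<psi> C S where "\<psi> = arccos w / 3" and "C = cos \<psi>" and "S = sin \<psi>"
  have "0 < arccos w" "arccos w < pi" using arccos_lt_bounded[of w] w1 by auto
  then have \<psi>: "0 < \<psi>" "\<psi> < pi / 3" by (simp_all add: \<psi>_def)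
  have CS: "C\<^sup>2 + S\<^sup>2 - 1 = 0" by (simp add: C_def S_def)
  have S: "S > 0" unfolding S_def using \<psi> by (intro sin_gt_zero) auto
  have "sin (pi / 3 - \<psi>) > 0" using \<psi> by (intro sin_gt_zero) auto
  then have CS3: "sqrt 3 * C > S" by (simp add: sin_diff sin_60 cos_60 C_def S_def)
  have "w = cos (3 * \<psi>)" using w1 by (simp add: \<psi>_def cos_arccos)
  also have "\<dots> = 4 * C^3 - 3 * C" unfolding C_def by (rule cos_treble_cos)
  finally have wC: "w = 4 * C^3 - 3 * C" .
  define q where "q = sqrt 3"
  have q: "q\<^sup>2 - 3 = 0" "q > 0" by (simp_all add: q_def)
  define p where "p = a / 3"
  have ap: "a = 3 * p" by (simp add: p_def)
  \<comment> \<open>These are \<open>p + 2 * t * cos (\<psi> + 2 * k * pi / 3)\<close> expanded by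
    the addition theorem; \<open>\<psi> < pi / 3\<close> gives \<open>sqrt 3 * C > S\<close> and
    hence the order.\<close>
  define r1 r2 r3 where "r1 = p - t * C - q * t * S" and "r2 = p - t * C + q * t * S" and "r3 = p + 2 * t * C"
  show thesis
  proof
    show "r1 < r2" using q(2) t S by (simp add: r1_def r2_def)
    have "q * (q * C) > q * S" using CS3 q by (simp add: q_def)
    then have "3 * C > q * S" using q(1) by (simp add: power2_eq_square flip: mult.assoc)
    then have "t * (3 * C) > t * (q * S)" using t by simp
    then show "r2 < r3" by (simp add: r2_def r3_def algebra_simps)
    show "r1 + r2 + r3 = a" by (simp add: r1_def r2_def r3_def ap)
    have "r1 * r2 = (p - t * C)\<^sup>2 - q\<^sup>2 * t\<^sup>2 * S\<^sup>2"
      unfolding r1_def r2_def by algebra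
    also have "q\<^sup>2 = 3" using q(1) by simp
    also have "S\<^sup>2 = 1 - C\<^sup>2" using CS by simp
    finally have r12: "r1 * r2 = (p - t * C)\<^sup>2 - 3 * t\<^sup>2 * (1 - C\<^sup>2)" .
    have "r1 * r2 + r1 * r3 + r2 * r3 = r1 * r2 + (r1 + r2) * r3" by algebra
    also have "\<dots> = 3 * p\<^sup>2 - 3 * t\<^sup>2"
      unfolding r12 unfolding r1_def r2_def r3_def by algebra
    finally show "r1 * r2 + r1 * r3 + r2 * r3 = b" using t2 by (simp add: ap power_mult_distrib)
    have "r1 * r2 * r3 = p^3 - 3 * p * t\<^sup>2 + 2 * t^3 * w"
      unfolding r12 unfolding r3_def wC by algebra
    moreover have "27 * (p^3 - 3 * p * t\<^sup>2 + 2 * t^3 * w) = 27 * p^3 - 9 * p * (9 * t\<^sup>2) + 54 * t^3 * w"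
      by algebra
    moreover have "27 * p^3 - 9 * p * (9 * t\<^sup>2) + 54 * t^3 * w = 27 * c"
      unfolding t2 w[symmetric] ap by algebra
    ultimately show "r1 * r2 * r3 = c" by simp
  qed
qed

text \<open>For surjectivity the roots must be positive: at a nonpositive argument every term of the
  cubic is nonpositive and the constant term is strictly negative.\<close>

lemma elem_map_chamber: "elem_map ` chamber = elem_region"
proof (rule antisym[OF elem_map_chamber_subset], rule subsetI)
  fix E assume E: "E \<in> elem_region"
  then obtain r1 r2 r3 where r: "r1 < r2" "r2 < r3" "r1 + r2 + r3 = E$1"
    "r1 * r2 + r1 * r3 + r2 * r3 = E$2" "r1 * r2 * r3 = E$3"
    using cubic_roots[of "E$1" "E$2" "E$3"] by (auto simp: elem_region_def)
  have pos: "E$1 > 0" "E$2 > 0" "E$3 > 0" "E$1 < 1" using E by (auto simp: elem_region_def)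
  have "(r1 - r1) * (r1 - r2) * (r1 - r3) = r1^3 - (r1 + r2 + r3) * r1\<^sup>2 + (r1 * r2 + r1 * r3 + r2 * r3) * r1 - r1 * r2 * r3"
    by algebra
  then have root: "r1^3 - E$1 * r1\<^sup>2 + E$2 * r1 - E$3 = 0" by (simp add: r)
  have "r1 > 0"
  proof (rule ccontr)
    assume "\<not> r1 > 0"
    then have "r1^3 \<le> 0" "E$1 * r1\<^sup>2 \<ge> 0" "E$2 * r1 \<le> 0"
      using pos by (simp_all add: power3_eq_cube mult_le_0_iff mult_nonneg_nonpos zero_le_mult_iff)
    then show False using root pos by linarith
  qed
  then have rp: "r1 > 0" "r2 > 0" "r3 > 0" using r by auto
  define x :: "real^3" where "x = vector [sqrt r1, sqrt r2, sqrt r3]"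
  have sq: "(x$1)\<^sup>2 = r1" "(x$2)\<^sup>2 = r2" "(x$3)\<^sup>2 = r3" using rp by (simp_all add: x_def)
  have "x \<in> chamber"
    unfolding chamber_def mem_Collect_eq sq using rp r pos by (simp add: x_def)
  moreover have "elem_map x = E" using r by (simp add: vec_eq_iff forall_3 sq)
  ultimately show "E \<in> elem_map ` chamber" by blast
qed

section \<open>Jacobian of the symmetric functions\<close>

definition elem_deriv :: "real^3 \<Rightarrow> real^3^3" where
  "elem_deriv x = vector
    [vector [2 * x$1, 2 * x$2, 2 * x$3],
     vector [2 * x$1 * ((x$2)\<^sup>2 + (x$3)\<^sup>2), 2 * x$2 * ((x$1)\<^sup>2 + (x$3)\<^sup>2), 2 * x$3 * ((x$1)\<^sup>2 + (x$2)\<^sup>2)],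
     vector [2 * x$1 * ((x$2)\<^sup>2 * (x$3)\<^sup>2), 2 * x$2 * ((x$1)\<^sup>2 * (x$3)\<^sup>2), 2 * x$3 * ((x$1)\<^sup>2 * (x$2)\<^sup>2)]]"

lemma elem_map_has_derivative: "(elem_map has_derivative (\<lambda>h. elem_deriv x *v h)) (at x within S)"
proof -
  have *: "((\<lambda>y. elem_map y $ k) has_derivative (\<lambda>h. (elem_deriv x *v h) $ k)) (at x within S)" for k
  proof -
    have "k = 1 \<or> k = 2 \<or> k = 3" using exhaust_3 by blast
    then show ?thesis
      by (elim disjE; hypsubst; unfold elem_map_nth matrix_vector_mult_def elem_deriv_def)
        (rule derivative_eq_intros refl | simp add: sum_3 fun_eq_iff power2_eq_square | simp add: algebra_simps)+
  qed
  have "((\<lambda>y. elem_map y \<bullet> i) has_derivative (\<lambda>h. (elem_deriv x *v h) \<bullet> i)) (at x within S)" if "i \<in> Basis" for i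
    using that * by (auto simp: Basis_vec_def inner_axis)
  then show ?thesis by (subst has_derivative_componentwise_within) auto
qed

text \<open>A Vandermonde determinant in the squares, times the chain rule factors
  \<open>2 * x$i\<close>.\<close>

lemma det_elem_deriv:
  "det (elem_deriv x) = 8 * (x$1 * x$2 * x$3) * (((x$1)\<^sup>2 - (x$2)\<^sup>2) * ((x$1)\<^sup>2 - (x$3)\<^sup>2) * ((x$2)\<^sup>2 - (x$3)\<^sup>2))"
  unfolding det_3 elem_deriv_def by simp algebra

lemma abs_det_elem_deriv:
  assumes "x \<in> chamber"
  shows "\<bar>det (elem_deriv x)\<bar> = 8 * sqrt (elem_map x $ 3 * disc3 (elem_map x $ 1) (elem_map x $ 2) (elem_map x $ 3))"
proof -
  have "elem_map x $ 3 * disc3 (elem_map x $ 1) (elem_map x $ 2) (elem_map x $ 3) = (det (elem_deriv x) / 8)\<^sup>2"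
    unfolding elem_map_nth disc3_elem det_elem_deriv by algebra
  then show ?thesis by simp
qed

lemma chamber_borel [measurable]: "chamber \<in> sets borel"
proof -
  have "open chamber"
    unfolding chamber_def by (intro open_Collect_conj open_Collect_less continuous_intros)
  then show ?thesis by simp
qed

lemma elem_map_measurable [measurable]: "elem_map \<in> borel_measurable borel"
proof (rule borel_measurable_continuous_onI)
  show "continuous_on UNIV elem_map"
    unfolding continuous_on_componentwise[of _ elem_map] Basis_vec_def
    by (auto simp: inner_axis forall_3 intro!: continuous_intros)
qed

lemma chamber_norm: "x \<in> chamber \<Longrightarrow> norm x < 1"
  by (simp add: chamber_def norm_eq_sqrt_inner inner_vec_def sum_3 power2_eq_square)

text \<open>The weight is the reciprocal Jacobian, so its pull-back is the constant \<open>1\<close>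
  on a bounded set; integrability over the image is then part of the change of variables theorem and
  needs no estimate.\<close>

lemma chamber_change_of_variables:
  assumes B: "B \<in> sets borel"
  shows "emeasure lborel (chamber \<inter> elem_map -` B) =
    (\<integral>\<^sup>+E. ennreal (indicator (elem_region \<inter> B) E * (1 / (8 * sqrt (E$3 * disc3 (E$1) (E$2) (E$3))))) \<partial>lborel)"
proof -
  define T where "T = chamber \<inter> elem_map -` B"
  define w where "w E = 1 / (8 * sqrt (E$3 * disc3 (E$1) (E$2) (E$3)))" for E :: "real^3"
  have T: "T \<in> sets borel" unfolding T_def using B by measurable
  have "T \<subseteq> ball 0 1" using chamber_norm by (auto simp: T_def)
  then have lm: "T \<in> lmeasurable"
    using T by (intro bounded_set_imp_lmeasurable) (auto intro: bounded_subset[OF bounded_ball])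
  have img: "elem_map ` T = elem_region \<inter> B"
    unfolding T_def elem_map_chamber[symmetric] by auto
  \<comment> \<open>Values lie in \<open>real^1\<close> because the change of variables theorem
    speaks of functions into a Cartesian space.\<close>
  have one: "\<bar>det (matrix ((*v) (elem_deriv x)))\<bar> *\<^sub>R (vec (w (elem_map x)) :: real^1) = vec 1" if "x \<in> T" for x
  proof -
    have x: "x \<in> chamber" using that by (simp add: T_def)
    have "det (elem_deriv x) \<noteq> 0"
      using x chamber_squares[OF x] unfolding det_elem_deriv by (auto simp: chamber_def)
    moreover have "w (elem_map x) = 1 / \<bar>det (elem_deriv x)\<bar>"
      unfolding w_def abs_det_elem_deriv[OF x] ..
    ultimately show ?thesis by (simp add: matrix_of_matrix_vector_mul vec_eq_iff)
  qed
  have c1: "(\<lambda>x. vec 1 :: real^1) absolutely_integrable_on T"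
    using lm by (simp add: absolutely_integrable_on_const)
  have ai: "(\<lambda>x. \<bar>det (matrix ((*v) (elem_deriv x)))\<bar> *\<^sub>R (vec (w (elem_map x)) :: real^1)) absolutely_integrable_on T"
    using set_integrable_cong[OF refl refl one, THEN iffD2, OF _ c1] .
  have ig: "integral T (\<lambda>x. \<bar>det (matrix ((*v) (elem_deriv x)))\<bar> *\<^sub>R (vec (w (elem_map x)) :: real^1)) = integral T (\<lambda>x. vec 1)"
    using one by (rule integral_cong)
  have TL: "T \<in> sets lebesgue" using T by auto
  have inj: "inj_on elem_map T" using inj_on_elem_map by (rule inj_on_subset) (simp add: T_def)
  have "(\<lambda>E. vec (w E) :: real^1) absolutely_integrable_on (elem_map ` T) \<and>
      integral (elem_map ` T) (\<lambda>E. vec (w E) :: real^1) = integral T (\<lambda>x. vec 1)"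
    using has_absolute_integral_change_of_variables[OF TL elem_map_has_derivative inj] ai ig by blast
  then have "((\<lambda>E. vec (w E) :: real^1) has_integral integral T (\<lambda>x. vec 1)) (elem_region \<inter> B)"
    unfolding img by (metis set_lebesgue_integral_eq_integral(1) has_integral_integral)
  then have "((\<lambda>E. (vec (w E) :: real^1) $ 1) has_integral (integral T (\<lambda>x. vec 1 :: real^1) $ 1)) (elem_region \<inter> B)"
    by (rule has_integral_linear[OF _ bounded_linear_vec_nth, unfolded o_def])
  moreover have "integral T (\<lambda>x. vec 1 :: real^1) $ 1 = measure lebesgue T"
    using integral_component_eq_cart[of "\<lambda>x. vec 1 :: real^1" T 1] lm c1
    by (simp add: lmeasure_integral set_lebesgue_integral_eq_integral)
  ultimately have "(w has_integral measure lebesgue T) (elem_region \<inter> B)" by simp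
  then have "(\<integral>\<^sup>+E. ennreal (indicator (elem_region \<inter> B) E * w E) \<partial>lborel) = ennreal (measure lebesgue T)"
    by (rule nn_integral_has_integral_lebesgue[rotated]) (simp add: w_def elem_region_def)
  also have "\<dots> = emeasure lborel T"
    using lm T by (simp add: emeasure_eq_measure2[symmetric] fmeasurable_def)
  finally show ?thesis by (simp add: T_def w_def)
qed

section \<open>The law of the statistic as an integral over fibres\<close>

lemma Basis_real3: "(Basis :: (real^3) set) = (\<lambda>i. axis i 1) ` UNIV"
  by (auto simp: Basis_vec_def)

lemma prod_Basis_real3: "(\<Prod>b\<in>Basis. f b) = f (axis 1 1) * f (axis 2 1) * f (axis 3 (1::real) :: real^3)"
proof -
  have B: "(Basis :: (real^3) set) = {axis 1 1, axis 2 1, axis 3 1}"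
    unfolding Basis_real3 UNIV_3 by simp
  show ?thesis unfolding B by (simp add: axis_eq_axis mult.assoc)
qed

lemma vector_measurable [measurable]:
  "(\<lambda>(x, y, z). vector [x, y, z] :: real^3) \<in> borel_measurable (lborel \<Otimes>\<^sub>M (lborel \<Otimes>\<^sub>M lborel))"
proof -
  have "continuous_on UNIV (\<lambda>p. vector [fst p, fst (snd p), snd (snd p)] :: real^3)"
  proof -
    have "continuous_on UNIV (\<lambda>p. (vector [fst p, fst (snd p), snd (snd p)] :: real^3) \<bullet> i)" if i: "i \<in> Basis" for i
    proof -
      obtain k :: 3 where k: "i = axis k 1" using i unfolding Basis_real3 by blast
      have "k = 1 \<or> k = 2 \<or> k = 3" using exhaust_3 by blast
      then show ?thesis unfolding k inner_axis by (elim disjE; hypsubst; simp; intro continuous_intros)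
    qed
    then show ?thesis by (subst continuous_on_componentwise) blast
  qed
  then have "(\<lambda>p. vector [fst p, fst (snd p), snd (snd p)] :: real^3) \<in> borel_measurable borel"
    by (rule borel_measurable_continuous_onI)
  then show ?thesis
    by (simp add: case_prod_beta' borel_prod lborel_prod)
qed

text \<open>Lebesgue measure is characterised by its values on boxes, and these are products of
  lengths.\<close>

lemma lborel_real3: "lborel = distr (lborel \<Otimes>\<^sub>M (lborel \<Otimes>\<^sub>M lborel)) borel (\<lambda>(x, y, z). vector [x, y, z] :: real^3)"
proof (rule lborel_eqI)
  fix l u :: "real^3"
  assume le: "\<And>b. b \<in> Basis \<Longrightarrow> l \<bullet> b \<le> u \<bullet> b"
  have le': "l $ i \<le> u $ i" for i using le[of "axis i 1"] by (simp add: inner_axis)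
  have L: "sigma_finite_measure (lborel :: real measure)" by (rule sigma_finite_lborel)
  have LL: "sigma_finite_measure (lborel \<Otimes>\<^sub>M lborel :: (real \<times> real) measure)"
    by (simp add: lborel_prod sigma_finite_lborel)
  have "(\<lambda>(x, y, z). vector [x, y, z] :: real^3) -` box l u \<inter> space (lborel \<Otimes>\<^sub>M (lborel \<Otimes>\<^sub>M lborel)) =
     {l$1<..<u$1} \<times> ({l$2<..<u$2} \<times> {l$3<..<u$3})"
    by (auto simp: mem_box_cart forall_3 space_pair_measure)
  then have "emeasure (distr (lborel \<Otimes>\<^sub>M (lborel \<Otimes>\<^sub>M lborel)) borel (\<lambda>(x, y, z). vector [x, y, z] :: real^3)) (box l u)
     = emeasure (lborel \<Otimes>\<^sub>M (lborel \<Otimes>\<^sub>M lborel)) ({l$1<..<u$1} \<times> ({l$2<..<u$2} \<times> {l$3<..<u$3}))"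
    by (subst emeasure_distr) auto
  also have "\<dots> = ennreal (u$1 - l$1) * (ennreal (u$2 - l$2) * ennreal (u$3 - l$3))"
    using le' by (simp add: sigma_finite_measure.emeasure_pair_measure_Times[OF LL] sigma_finite_measure.emeasure_pair_measure_Times[OF L])
  also have "\<dots> = ennreal (prod ((\<bullet>) (u - l)) Basis)"
    unfolding prod_Basis_real3 using le' by (simp add: inner_axis ennreal_mult' mult_ac)
  finally show "emeasure (distr (lborel \<Otimes>\<^sub>M (lborel \<Otimes>\<^sub>M lborel)) borel (\<lambda>(x, y, z). vector [x, y, z] :: real^3)) (box l u)
     = ennreal (prod ((\<bullet>) (u - l)) Basis)" .
qed simp

lemma nn_integral_lborel_real3:
  fixes f :: "real^3 \<Rightarrow> ennreal"
  assumes f: "f \<in> borel_measurable borel"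
  shows "(\<integral>\<^sup>+v. f v \<partial>lborel) = (\<integral>\<^sup>+x. \<integral>\<^sup>+y. \<integral>\<^sup>+z. f (vector [x, y, z]) \<partial>lborel \<partial>lborel \<partial>lborel)"
proof -
  have L: "sigma_finite_measure (lborel :: real measure)" by (rule sigma_finite_lborel)
  have LL: "sigma_finite_measure (lborel \<Otimes>\<^sub>M lborel :: (real \<times> real) measure)"
    by (simp add: lborel_prod sigma_finite_lborel)
  have m: "(\<lambda>(x, y, z). f (vector [x, y, z])) \<in> borel_measurable (lborel \<Otimes>\<^sub>M (lborel \<Otimes>\<^sub>M lborel))"
    using measurable_compose[OF vector_measurable f] by (simp add: case_prod_beta')
  have "(\<integral>\<^sup>+v. f v \<partial>lborel) = (\<integral>\<^sup>+p. (case p of (x, y, z) \<Rightarrow> f (vector [x, y, z])) \<partial>(lborel \<Otimes>\<^sub>M (lborel \<Otimes>\<^sub>M lborel)))"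
    by (subst lborel_real3, subst nn_integral_distr[OF vector_measurable]) (use f in \<open>auto simp: case_prod_beta'\<close>)
  also have "\<dots> = (\<integral>\<^sup>+x. \<integral>\<^sup>+q. (case q of (y, z) \<Rightarrow> f (vector [x, y, z])) \<partial>(lborel \<Otimes>\<^sub>M lborel) \<partial>lborel)"
    using sigma_finite_measure.nn_integral_fst[OF LL m] by (simp add: case_prod_beta')
  also have "\<dots> = (\<integral>\<^sup>+x. \<integral>\<^sup>+y. \<integral>\<^sup>+z. f (vector [x, y, z]) \<partial>lborel \<partial>lborel \<partial>lborel)"
  proof (rule nn_integral_cong)
    fix x
    have "(\<lambda>(y, z). f (vector [x, y, z])) \<in> borel_measurable (lborel \<Otimes>\<^sub>M lborel)"
      using measurable_compose[OF measurable_Pair1' m, of x] by (simp add: case_prod_beta')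
    from sigma_finite_measure.nn_integral_fst[OF L this]
    show "(\<integral>\<^sup>+q. (case q of (y, z) \<Rightarrow> f (vector [x, y, z])) \<partial>(lborel \<Otimes>\<^sub>M lborel)) = (\<integral>\<^sup>+y. \<integral>\<^sup>+z. f (vector [x, y, z]) \<partial>lborel \<partial>lborel)"
      by simp
  qed
  finally show ?thesis .
qed

text \<open>For squared coordinates with sum \<open>1\<close>, sum of squares \<open>m\<close> and statistic \<open>c\<close>, the second elementary symmetric
  function is \<open>(1 - m) / 2\<close> and the third is \<open>cubic_b c m\<close>.\<close>

definition cubic_b :: "real \<Rightarrow> real \<Rightarrow> real" where
  "cubic_b c m = (3 * c / 2 - m\<^sup>2) / 36"

definition cubic_disc :: "real \<Rightarrow> real \<Rightarrow> real" where
  "cubic_disc c m = disc3 1 ((1 - m) / 2) (cubic_b c m)"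

text \<open>The integrand \<open>1 / sqrt P\<close> with \<open>P = cubic_b * cubic_disc\<close>,
  set to zero where the three weights fail to be real, distinct and positive, so that every integral
  over \<open>m\<close> can be taken over the whole line.\<close>

definition kern :: "real \<Rightarrow> real \<Rightarrow> real" where
  "kern c m = (if m < 1 \<and> 0 < cubic_b c m \<and> 0 < cubic_disc c m then 1 / sqrt (cubic_b c m * cubic_disc c m) else 0)"

lemma kern_measurable [measurable]: "(\<lambda>(c, m). kern c m) \<in> borel_measurable (borel \<Otimes>\<^sub>M borel)"
  unfolding kern_def cubic_disc_def disc3_def cubic_b_def by measurable

lemma kern_measurable' [measurable]: "(\<lambda>(c, m). kern c m) \<in> borel_measurable (lborel \<Otimes>\<^sub>M lborel)"
proof -
  have "sets (lborel \<Otimes>\<^sub>M lborel :: (real \<times> real) measure) = sets (borel \<Otimes>\<^sub>M borel)"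
    by (intro sets_pair_measure_cong) auto
  from measurable_cong_sets[OF this refl] show ?thesis using kern_measurable by blast
qed

lemma kern_nonneg: "0 \<le> kern c m"
  by (simp add: kern_def)

section \<open>Separation of the radial variable\<close>

definition elem_jb :: "real^3 \<Rightarrow> real" where
  "elem_jb E = 24 * E$3 / (E$1)^3 + 2/3 * (1 - 2 * E$2 / (E$1)\<^sup>2)\<^sup>2"

lemma vec_nth_measurable [measurable]: "(\<lambda>v::real^'n. v $ i) \<in> borel_measurable borel"
  by (intro borel_measurable_continuous_onI continuous_intros)

lemma elem_jb_measurable [measurable]: "elem_jb \<in> borel_measurable borel"
  unfolding elem_jb_def by measurable

lemma elem_region_measurable [measurable]: "elem_region \<in> sets borel"
proof -
  have "open elem_region"
    unfolding elem_region_def disc3_def by (intro open_Collect_conj open_Collect_less continuous_intros)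
  then show ?thesis by simp
qed

lemma disc3_scale: "disc3 r (r\<^sup>2 * a) (r^3 * b) = r^6 * disc3 1 a b"
proof -
  have "disc3 (r * x) (r\<^sup>2 * a) (r^3 * b) = r^6 * disc3 x a b" for x unfolding disc3_def by algebra
  from this[of 1] show ?thesis by simp
qed

text \<open>With sum \<open>r\<close>, the symmetric functions are \<open>r\<close>,
  \<open>r\<^sup>2 * (1 - m) / 2\<close> and \<open>r^3 * cubic_b c m\<close>. The product under the
  root has weight \<open>9\<close> in \<open>r\<close> and the two affine substitutions contribute
  \<open>r^5 / 48\<close>, so \<open>r\<close> occurs only in the factor
  \<open>sqrt r / 384\<close>.\<close>

lemma elem_integrand_scale:
  fixes r c m :: real and A :: "real set"
  assumes r: "0 < r"
  defines "E \<equiv> vector [r, r\<^sup>2 / 2 + - (r\<^sup>2 / 2) * m, - (r^3 * m\<^sup>2 / 36) + r^3 / 24 * c] :: real^3"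
  shows "r\<^sup>2 / 2 * (r^3 / 24 * (indicator (elem_region \<inter> elem_jb -` A) E * (1 / (8 * sqrt (E$3 * disc3 (E$1) (E$2) (E$3))))))
    = indicator {0<..<1} r * (sqrt r / 384) * (indicator A c * kern c m)"
proof -
  have E1: "E$1 = r" by (simp add: E_def)
  have E2: "E$2 = r\<^sup>2 * ((1 - m) / 2)" by (simp add: E_def field_simps)
  have E3: "E$3 = r^3 * cubic_b c m" by (simp add: E_def cubic_b_def field_simps)
  have d: "disc3 (E$1) (E$2) (E$3) = r^6 * cubic_disc c m"
    unfolding E1 E2 E3 disc3_scale cubic_disc_def ..
  have jb: "elem_jb E = c"
  proof -
    have "elem_jb E = 24 * cubic_b c m + 2/3 * (1 - (1 - m))\<^sup>2"
      using r by (simp add: elem_jb_def E1 E2 E3)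
    then show ?thesis by (simp add: cubic_b_def field_simps)
  qed
  have reg: "E \<in> elem_region \<longleftrightarrow> r < 1 \<and> m < 1 \<and> 0 < cubic_b c m \<and> 0 < cubic_disc c m"
    using r unfolding elem_region_def mem_Collect_eq d unfolding E1 E2 E3 by (simp add: zero_less_mult_iff)
  show ?thesis
  proof (cases "r < 1 \<and> m < 1 \<and> 0 < cubic_b c m \<and> 0 < cubic_disc c m")
    case True
    define q y where "q = sqrt (cubic_b c m * cubic_disc c m)" and "y = sqrt r"
    have e1: "E$3 * disc3 (E$1) (E$2) (E$3) = (r^4)\<^sup>2 * r * (cubic_b c m * cubic_disc c m)"
      by (simp only: d, simp only: E3) algebra
    have "sqrt (P\<^sup>2 * r * X) = P * sqrt r * sqrt X" if "P > 0" for P X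
      using that by (simp add: real_sqrt_mult)
    from this[of "r^4"] have sq: "sqrt (E$3 * disc3 (E$1) (E$2) (E$3)) = r^4 * y * q"
      unfolding e1 q_def y_def using r by auto
    have yq: "y > 0" "q > 0" "r = y * y" using r True by (simp_all add: y_def q_def)
    have calc: "(y * y)\<^sup>2 / 2 * ((y * y)^3 / 24 * (1 / (8 * ((y * y)^4 * y * q)))) = y / 384 * (1 / q)"
      using yq(1,2) by (simp add: power2_eq_square power3_eq_cube power4_eq_xxxx)
    have ind: "indicator (elem_region \<inter> elem_jb -` A) E = (indicator A c :: real)"
      using True reg jb by (simp add: indicator_def)
    have k: "kern c m = 1 / q" using True by (simp add: kern_def q_def)
    have "r\<^sup>2 / 2 * (r^3 / 24 * (indicator A c * (1 / (8 * (r^4 * y * q))))) =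
      indicator A c * (r\<^sup>2 / 2 * (r^3 / 24 * (1 / (8 * (r^4 * y * q)))))" by simp
    also have "\<dots> = indicator A c * (y / 384 * (1 / q))"
      using calc by (simp only: yq(3)[symmetric])
    finally show ?thesis unfolding sq ind k using True r by (simp add: y_def)
  next
    case False
    then have "E \<notin> elem_region" "kern c m = 0 \<or> \<not> r < 1" using reg by (auto simp: kern_def)
    then show ?thesis by auto
  qed
qed

lemma nn_integral_sqrt: "(\<integral>\<^sup>+r. ennreal (indicator {0<..<1} r * (sqrt r / 384)) \<partial>lborel) = ennreal (1 / 576)"
proof -
  have "(\<integral>\<^sup>+r. ennreal (indicator {0<..<1} r * (sqrt r / 384)) \<partial>lborel) =
     (\<integral>\<^sup>+r. ennreal (sqrt r / 384) * indicator {0..1} r \<partial>lborel)"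
  proof (rule nn_integral_cong_AE)
    have "AE r in lborel. r \<noteq> (0::real) \<and> r \<noteq> 1"
      using AE_lborel_singleton by auto
    then show "AE r in lborel. ennreal (indicator {0<..<1} r * (sqrt r / 384)) = ennreal (sqrt r / 384) * indicator {0..1} r"
      by eventually_elim (auto simp: indicator_def)
  qed
  also have "\<dots> = ennreal (1 / 576)"
  proof -
    have "((\<lambda>r. sqrt r / 384) has_integral 1 * sqrt 1 / 576 - 0 * sqrt 0 / 576) {0..1}"
    proof (rule fundamental_theorem_of_calculus_interior)
      fix x :: real assume "x \<in> {0<..<1}"
      then have "((\<lambda>r. r * sqrt r / 576) has_real_derivative sqrt x / 384) (at x)"
        by (auto intro!: derivative_eq_intros simp: field_simps)
      then show "((\<lambda>r. r * sqrt r / 576) has_vector_derivative sqrt x / 384) (at x)"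
        by (simp add: has_real_derivative_iff_has_vector_derivative)
    qed (auto intro!: continuous_intros)
    then have "(\<integral>\<^sup>+r. ennreal (indicator {0..1} r * (sqrt r / 384)) \<partial>lborel) = ennreal (1 / 576)"
      by (subst nn_integral_has_integral_lebesgue) auto
    moreover have "ennreal (sqrt r / 384) * indicator {0..1} r = ennreal (indicator {0..1} r * (sqrt r / 384))" for r :: real
      by (simp add: indicator_def)
    ultimately show ?thesis by simp
  qed
  finally show ?thesis by simp
qed

lemma vector_measurable_12:
  fixes f :: "real^3 \<Rightarrow> 'b::topological_space"
  assumes f: "f \<in> borel_measurable borel"
  shows "(\<lambda>(y, z). f (vector [x, y, z])) \<in> borel_measurable (borel \<Otimes>\<^sub>M borel)"
    and "(\<lambda>z. f (vector [x, y, z])) \<in> borel_measurable borel"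
proof -
  have s1: "sets (lborel \<Otimes>\<^sub>M (lborel \<Otimes>\<^sub>M lborel) :: (real \<times> real \<times> real) measure) = sets (borel \<Otimes>\<^sub>M (borel \<Otimes>\<^sub>M borel))"
    by (intro sets_pair_measure_cong) auto
  have m: "(\<lambda>(x, y, z). f (vector [x, y, z])) \<in> borel_measurable (borel \<Otimes>\<^sub>M (borel \<Otimes>\<^sub>M borel))"
    using measurable_compose[OF vector_measurable f] measurable_cong_sets[OF s1 refl]
    by (simp add: case_prod_beta')
  show m2: "(\<lambda>(y, z). f (vector [x, y, z])) \<in> borel_measurable (borel \<Otimes>\<^sub>M borel)"
    using measurable_compose[OF measurable_Pair1' m, of x] by (simp add: case_prod_beta')
  show "(\<lambda>z. f (vector [x, y, z])) \<in> borel_measurable borel"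
    using measurable_compose[OF measurable_Pair1' m2, of y] by simp
qed

definition fiber_integral :: "real \<Rightarrow> ennreal" where
  "fiber_integral c = (\<integral>\<^sup>+m. ennreal (kern c m) \<partial>lborel)"

lemma fiber_integral_measurable [measurable]: "fiber_integral \<in> borel_measurable borel"
proof -
  have "(\<lambda>(c, m). ennreal (kern c m)) \<in> borel_measurable (borel \<Otimes>\<^sub>M lborel)"
  proof -
    have "sets (borel \<Otimes>\<^sub>M lborel :: (real \<times> real) measure) = sets (borel \<Otimes>\<^sub>M borel)"
      by (intro sets_pair_measure_cong) auto
    from measurable_cong_sets[OF this refl] have "(\<lambda>(c, m). kern c m) \<in> borel_measurable (borel \<Otimes>\<^sub>M lborel)"
      using kern_measurable by blast
    then show ?thesis by (simp add: case_prod_beta')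
  qed
  from sigma_finite_measure.borel_measurable_nn_integral[OF sigma_finite_lborel this]
  show ?thesis by (simp add: fiber_integral_def[abs_def])
qed

text \<open>The radius contributes the integral of \<open>sqrt r / 384\<close> over the unit
  interval, that is \<open>1 / 576\<close>, whatever \<open>A\<close> is; the rest is Tonelli's
  theorem in \<open>m\<close> and \<open>c\<close>.\<close>

lemma chamber_law:
  assumes A: "A \<in> sets borel"
  shows "emeasure lborel (chamber \<inter> (\<lambda>x. elem_jb (elem_map x)) -` A) =
    ennreal (1 / 576) * (\<integral>\<^sup>+c. indicator A c * fiber_integral c \<partial>lborel)"
proof -
  define B where "B = elem_jb -` A"
  have B: "B \<in> sets borel" using measurable_sets[OF elem_jb_measurable A] by (simp add: B_def)
  define F where "F E = indicator (elem_region \<inter> B) E * (1 / (8 * sqrt (E$3 * disc3 (E$1) (E$2) (E$3))))" for E :: "real^3"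
  have F: "F \<in> borel_measurable borel"
    unfolding F_def disc3_def using B elem_region_measurable by measurable
  then have F': "(\<lambda>E. ennreal (F E)) \<in> borel_measurable borel" by simp
  define K where "K = (\<integral>\<^sup>+m. \<integral>\<^sup>+c. ennreal (indicator A c * kern c m) \<partial>lborel \<partial>lborel)"
  have inner: "(\<integral>\<^sup>+y. \<integral>\<^sup>+z. ennreal (F (vector [r, y, z])) \<partial>lborel \<partial>lborel) =
    ennreal (indicator {0<..<1} r * (sqrt r / 384)) * K" for r
  proof (cases "r > 0")
    case False
    then show ?thesis by (simp add: F_def elem_region_def)
  next
    case r: True
    define G where "G y = (\<integral>\<^sup>+z. ennreal (F (vector [r, y, z])) \<partial>lborel)" for y
    have m2: "(\<lambda>(y, z). ennreal (F (vector [r, y, z]))) \<in> borel_measurable (borel \<Otimes>\<^sub>M lborel)"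
    proof -
      have "sets (borel \<Otimes>\<^sub>M lborel :: (real \<times> real) measure) = sets (borel \<Otimes>\<^sub>M borel)"
        by (intro sets_pair_measure_cong) auto
      from measurable_cong_sets[OF this refl] show ?thesis using vector_measurable_12(1)[OF F', of r] by blast
    qed
    have G: "G \<in> borel_measurable borel"
      unfolding G_def[abs_def] using sigma_finite_measure.borel_measurable_nn_integral[OF sigma_finite_lborel m2] .
    \<comment> \<open>The shift \<open>t\<close> is left free because the one needed depends on
      \<open>m\<close>.\<close>
    have zsub: "G y = ennreal (r^3 / 24) * (\<integral>\<^sup>+c. ennreal (F (vector [r, y, t + r^3 / 24 * c])) \<partial>lborel)" for y t
      unfolding G_def using r vector_measurable_12(2)[OF F', of r y]
      by (subst nn_integral_real_affine[where c="r^3 / 24" and t=t]) auto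
    have "(\<integral>\<^sup>+y. G y \<partial>lborel) = ennreal (r\<^sup>2 / 2) * (\<integral>\<^sup>+m. G (r\<^sup>2 / 2 + - (r\<^sup>2 / 2) * m) \<partial>lborel)"
      using r G by (subst nn_integral_real_affine[where c="- (r\<^sup>2 / 2)" and t="r\<^sup>2 / 2"]) auto
    also have "\<dots> = (\<integral>\<^sup>+m. ennreal (r\<^sup>2 / 2) * G (r\<^sup>2 / 2 + - (r\<^sup>2 / 2) * m) \<partial>lborel)"
    proof -
      have "(\<lambda>m. G (r\<^sup>2 / 2 + - (r\<^sup>2 / 2) * m)) \<in> borel_measurable borel"
        by (rule measurable_compose[OF _ G]) simp
      then show ?thesis by (simp add: nn_integral_cmult)
    qed
    also have "\<dots> = (\<integral>\<^sup>+m. ennreal (indicator {0<..<1} r * (sqrt r / 384)) * (\<integral>\<^sup>+c. ennreal (indicator A c * kern c m) \<partial>lborel) \<partial>lborel)"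
    proof (rule nn_integral_cong)
      fix m
      define v where "v c = (vector [r, r\<^sup>2 / 2 + - (r\<^sup>2 / 2) * m, - (r^3 * m\<^sup>2 / 36) + r^3 / 24 * c] :: real^3)" for c
      have vm: "(\<lambda>c. ennreal (F (v c))) \<in> borel_measurable borel"
        unfolding v_def using measurable_compose[OF _ vector_measurable_12(2)[OF F', of r "r\<^sup>2 / 2 + - (r\<^sup>2 / 2) * m"], of "\<lambda>c. - (r^3 * m\<^sup>2 / 36) + r^3 / 24 * c" borel]
        by simp
      have km: "(\<lambda>c. ennreal (indicator A c * kern c m)) \<in> borel_measurable borel"
        using A measurable_compose[OF measurable_Pair2'[of m borel borel] kern_measurable] by simp
      have "ennreal (r\<^sup>2 / 2) * G (r\<^sup>2 / 2 + - (r\<^sup>2 / 2) * m) =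
         ennreal (r\<^sup>2 / 2) * (ennreal (r^3 / 24) * (\<integral>\<^sup>+c. ennreal (F (v c)) \<partial>lborel))"
        unfolding v_def by (subst zsub[where t="- (r^3 * m\<^sup>2 / 36)"]) simp
      also have "\<dots> = (\<integral>\<^sup>+c. ennreal (r\<^sup>2 / 2 * (r^3 / 24 * F (v c))) \<partial>lborel)"
      proof -
        have "ennreal (a * (b * y)) = ennreal a * (ennreal b * ennreal y)" if "a \<ge> 0" "b \<ge> 0" for a b y :: real
          using that by (simp add: ennreal_mult')
        then have "(\<integral>\<^sup>+c. ennreal (a * (b * F (v c))) \<partial>lborel) = ennreal a * (ennreal b * (\<integral>\<^sup>+c. ennreal (F (v c)) \<partial>lborel))"
          if "a \<ge> 0" "b \<ge> 0" for a b :: real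
          using vm that by (simp add: nn_integral_cmult)
        note eq = this
        show ?thesis by (rule eq[symmetric]) (use r in simp_all)
      qed
      also have "\<dots> = (\<integral>\<^sup>+c. ennreal (indicator {0<..<1} r * (sqrt r / 384)) * ennreal (indicator A c * kern c m) \<partial>lborel)"
        unfolding F_def v_def B_def elem_integrand_scale[OF r]
        by (intro nn_integral_cong ennreal_mult') (simp add: r less_imp_le)
      also have "\<dots> = ennreal (indicator {0<..<1} r * (sqrt r / 384)) * (\<integral>\<^sup>+c. ennreal (indicator A c * kern c m) \<partial>lborel)"
        using km by (intro nn_integral_cmult) simp
      finally show "ennreal (r\<^sup>2 / 2) * G (r\<^sup>2 / 2 + - (r\<^sup>2 / 2) * m) =
        ennreal (indicator {0<..<1} r * (sqrt r / 384)) * (\<integral>\<^sup>+c. ennreal (indicator A c * kern c m) \<partial>lborel)" .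
    qed
    also have "\<dots> = ennreal (indicator {0<..<1} r * (sqrt r / 384)) * K"
      unfolding K_def
    proof (rule nn_integral_cmult)
      have "(\<lambda>(m, c). ennreal (indicator A c * kern c m)) \<in> borel_measurable (lborel \<Otimes>\<^sub>M lborel)"
        using measurable_compose[OF measurable_pair_swap' kern_measurable'] A
        by (auto simp: case_prod_beta')
      from sigma_finite_measure.borel_measurable_nn_integral[OF sigma_finite_lborel this]
      show "(\<lambda>m. \<integral>\<^sup>+c. ennreal (indicator A c * kern c m) \<partial>lborel) \<in> borel_measurable lborel" .
    qed
    finally show ?thesis by (simp add: G_def)
  qed
  have "emeasure lborel (chamber \<inter> (\<lambda>x. elem_jb (elem_map x)) -` A) = emeasure lborel (chamber \<inter> elem_map -` B)"
    by (simp add: B_def vimage_def)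
  also have "\<dots> = (\<integral>\<^sup>+E. ennreal (F E) \<partial>lborel)"
    unfolding F_def by (rule chamber_change_of_variables[OF B])
  also have "\<dots> = (\<integral>\<^sup>+r. ennreal (indicator {0<..<1} r * (sqrt r / 384)) * K \<partial>lborel)"
    unfolding nn_integral_lborel_real3[OF F'] inner ..
  also have "\<dots> = ennreal (1 / 576) * K"
    by (subst nn_integral_multc) (simp, simp only: nn_integral_sqrt)
  also have "K = (\<integral>\<^sup>+c. \<integral>\<^sup>+m. ennreal (indicator A c * kern c m) \<partial>lborel \<partial>lborel)"
    unfolding K_def
    by (rule lborel_pair.Fubini') (use kern_measurable' A in \<open>auto simp: case_prod_beta'\<close>)
  also have "\<dots> = (\<integral>\<^sup>+c. indicator A c * fiber_integral c \<partial>lborel)"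
    unfolding fiber_integral_def by (intro nn_integral_cong) (auto simp: indicator_def)
  finally show ?thesis .
qed

section \<open>Reduction of the ball to one chamber\<close>

lemma measure_orthogonal_cover:
  fixes T :: "'i \<Rightarrow> real^'n::{finite,wellorder} \<Rightarrow> real^'n::{finite,wellorder}"
  assumes I: "finite I" and C: "C \<in> lmeasurable" and T: "\<And>i. i \<in> I \<Longrightarrow> orthogonal_transformation (T i)"
    and disj: "\<And>i j. i \<in> I \<Longrightarrow> j \<in> I \<Longrightarrow> i \<noteq> j \<Longrightarrow> T i ` C \<inter> T j ` C = {}"
    and sub: "\<And>i. i \<in> I \<Longrightarrow> T i ` C \<subseteq> S" and neg: "negligible (S - (\<Union>i\<in>I. T i ` C))"
  shows "measure lebesgue S = card I * measure lebesgue C"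
proof -
  have lm: "T i ` C \<in> lmeasurable" if "i \<in> I" for i
    using measurable_orthogonal_image[OF T[OF that] C] .
  have "measure lebesgue S = measure lebesgue (\<Union>i\<in>I. T i ` C)"
  proof (rule measure_negligible_symdiff)
    show "(\<Union>i\<in>I. T i ` C) \<in> lmeasurable" using I lm by (intro fmeasurable.finite_UN) auto
    have "sym_diff (\<Union>i\<in>I. T i ` C) S = S - (\<Union>i\<in>I. T i ` C)" using sub by auto
    then show "negligible (sym_diff (\<Union>i\<in>I. T i ` C) S)" using neg by simp
  qed
  also have "\<dots> = (\<Sum>i\<in>I. measure lebesgue (T i ` C))"
    using I lm disj by (intro measure_UNION') (auto simp: pairwise_def disjnt_def)
  also have "\<dots> = (\<Sum>i\<in>I. measure lebesgue C)"
    using T measure_orthogonal_image[OF _ C] by (intro sum.cong) auto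
  finally show ?thesis by simp
qed

lemma negligible_coordinates_eq: "negligible {x::real^3. x$i = x$j}" if "i \<noteq> j"
proof -
  have "(axis i 1 - axis j 1 :: real^3) \<noteq> 0"
    using that by (auto simp: axis_eq_axis)
  then have "negligible {x. (axis i 1 - axis j 1 :: real^3) \<bullet> x = 0}"
    by (intro negligible_hyperplane) auto
  then show ?thesis by (simp add: inner_diff_left inner_axis')
qed

text \<open>The cone over the event that the statistic lies in \<open>A\<close>, written through
  \<open>elem_map\<close> so that its invariance under signed permutations is evident.\<close>

definition weyl_set :: "real set \<Rightarrow> (real^3) set" where
  "weyl_set A = {x. (x$1)\<^sup>2 + (x$2)\<^sup>2 + (x$3)\<^sup>2 < 1 \<and> elem_jb (elem_map x) \<in> A}"

lemma weyl_set_measurable: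
  assumes "A \<in> sets borel"
  shows "weyl_set A \<in> sets borel" "weyl_set A \<subseteq> ball 0 1"
proof -
  have "(\<lambda>x. elem_jb (elem_map x)) \<in> borel_measurable borel" by measurable
  then show "weyl_set A \<in> sets borel"
    unfolding weyl_set_def using assms by measurable
  show "weyl_set A \<subseteq> ball 0 1"
    by (auto simp: weyl_set_def norm_eq_sqrt_inner inner_vec_def sum_3 power2_eq_square)
qed

lemma weyl_set_signs:
  assumes "a\<^sup>2 = 1" "b\<^sup>2 = 1" "c\<^sup>2 = 1"
  shows "vector [a * x$1, b * x$2, c * x$3] \<in> weyl_set A \<longleftrightarrow> x \<in> weyl_set A"
  using assms by (simp add: weyl_set_def elem_map_def power_mult_distrib)

lemma elem_map_perm:
  assumes "i \<noteq> j" "i \<noteq> k" "j \<noteq> (k::3)" and "x$1 = z$i" "x$2 = z$j" "x$3 = z$k"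
  shows "elem_map x = elem_map z"
  using assms exhaust_3[of i] exhaust_3[of j] exhaust_3[of k]
  by (auto simp: elem_map_def algebra_simps)

text \<open>The group of order 48 is used in two stages, eight sign changes and six permutations.
  The points missed lie in the coordinate planes and in the planes where two coordinates
  agree.\<close>

lemma weyl_measure:
  assumes A: "A \<in> sets borel"
  shows "measure lebesgue (weyl_set A) = 48 * measure lebesgue (chamber \<inter> (\<lambda>x. elem_jb (elem_map x)) -` A)"
proof -
  define C1 where "C1 = weyl_set A \<inter> {x. x$1 > 0 \<and> x$2 > 0 \<and> x$3 > 0}"
  define C2 where "C2 = chamber \<inter> (\<lambda>x. elem_jb (elem_map x)) -` A"
  have C2: "C2 = C1 \<inter> {x. x$1 < x$2 \<and> x$2 < x$3}"
    by (auto simp: C1_def C2_def weyl_set_def chamber_def)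
  have lm: "X \<in> lmeasurable" if "X \<in> sets borel" "X \<subseteq> weyl_set A" for X
    using that weyl_set_measurable(2)[OF A]
    by (intro bounded_set_imp_lmeasurable) (auto intro: bounded_subset[OF bounded_ball])
  have C1m: "C1 \<in> sets borel"
    unfolding C1_def using weyl_set_measurable(1)[OF A] by measurable
  have C2m: "C2 \<in> sets borel" unfolding C2 using C1m by measurable
  define I1 where "I1 = {-1, 1::real} \<times> {-1, 1::real} \<times> {-1, 1::real}"
  define T1 where "T1 = (\<lambda>(a, b, c). \<lambda>x :: real^3. vector [a * x$1, b * x$2, c * x$3] :: real^3)"
  have I1: "fst t * fst t = 1" "fst (snd t) * fst (snd t) = 1" "snd (snd t) * snd (snd t) = 1" if "t \<in> I1" for t
    using that by (auto simp: I1_def)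
  have T1i: "T1 t (T1 t x) = x" if "t \<in> I1" for t x
    using I1[OF that] by (cases t) (simp add: T1_def vec_eq_iff forall_3 flip: mult.assoc)
  have img1: "T1 t ` C1 = weyl_set A \<inter> {x. fst t * x$1 > 0 \<and> fst (snd t) * x$2 > 0 \<and> snd (snd t) * x$3 > 0}" if t: "t \<in> I1" for t
  proof -
    have W: "T1 t x \<in> weyl_set A \<longleftrightarrow> x \<in> weyl_set A" for x
      using weyl_set_signs[of "fst t" "fst (snd t)" "snd (snd t)"] I1[OF t]
      by (cases t) (simp add: T1_def power2_eq_square)
    have T1n: "T1 t x $ 1 = fst t * x$1" "T1 t x $ 2 = fst (snd t) * x$2" "T1 t x $ 3 = snd (snd t) * x$3" for x
      by (simp_all add: T1_def case_prod_beta')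
    have im: "x \<in> T1 t ` C1 \<longleftrightarrow> T1 t x \<in> C1" for x
    proof
      assume "x \<in> T1 t ` C1" then show "T1 t x \<in> C1" using T1i[OF t] by auto
    next
      assume "T1 t x \<in> C1" then show "x \<in> T1 t ` C1" using T1i[OF t, of x] by (metis imageI)
    qed
    show ?thesis
      unfolding set_eq_iff im unfolding C1_def Int_iff W mem_Collect_eq T1n by blast
  qed
  have "measure lebesgue (weyl_set A) = card I1 * measure lebesgue C1"
  proof (rule measure_orthogonal_cover)
    show "orthogonal_transformation (T1 t)" if "t \<in> I1" for t
      unfolding orthogonal_transformation_def
    proof
      show "linear (T1 t)"
        by (cases t, rule linearI) (simp_all add: T1_def vec_eq_iff forall_3 algebra_simps)
      show "\<forall>v w. T1 t v \<bullet> T1 t w = v \<bullet> w"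
      proof (intro allI)
        fix v w
        have "T1 t v \<bullet> T1 t w = (fst t * fst t) * (v$1 * w$1) + (fst (snd t) * fst (snd t)) * (v$2 * w$2) + (snd (snd t) * snd (snd t)) * (v$3 * w$3)"
          by (cases t) (simp add: T1_def inner_vec_def sum_3)
        then show "T1 t v \<bullet> T1 t w = v \<bullet> w" unfolding I1[OF that] by (simp add: inner_vec_def sum_3)
      qed
    qed
    show "T1 s ` C1 \<inter> T1 t ` C1 = {}" if "s \<in> I1" "t \<in> I1" "s \<noteq> t" for s t
      using that unfolding img1[OF that(1)] img1[OF that(2)] by (auto simp: I1_def)
    show "T1 t ` C1 \<subseteq> weyl_set A" if "t \<in> I1" for t unfolding img1[OF that] by auto
    have "weyl_set A - (\<Union>t\<in>I1. T1 t ` C1) \<subseteq> {x. x$1 = 0} \<union> ({x. x$2 = 0} \<union> {x. x$3 = 0})"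
    proof
      fix x assume x: "x \<in> weyl_set A - (\<Union>t\<in>I1. T1 t ` C1)"
      show "x \<in> {x. x$1 = 0} \<union> ({x. x$2 = 0} \<union> {x. x$3 = 0})"
      proof (rule ccontr)
        assume nz: "x \<notin> {x. x$1 = 0} \<union> ({x. x$2 = 0} \<union> {x. x$3 = 0})"
        define t where "t = (sgn (x$1), sgn (x$2), sgn (x$3))"
        have "t \<in> I1" using nz by (auto simp: t_def I1_def sgn_if)
        moreover have "x \<in> T1 t ` C1" unfolding img1[OF \<open>t \<in> I1\<close>] using x nz by (auto simp: t_def sgn_if)
        ultimately show False using x by blast
      qed
    qed
    then show "negligible (weyl_set A - (\<Union>t\<in>I1. T1 t ` C1))"
      by (rule negligible_subset[rotated]) (intro negligible_Un negligible_standard_hyperplane_cart)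
    show "C1 \<in> lmeasurable" by (rule lm[OF C1m]) (simp add: C1_def)
    show "finite I1" by (simp add: I1_def)
  qed
  also have "card I1 = 8" by (simp add: I1_def card_cartesian_product)
  finally have 1: "measure lebesgue (weyl_set A) = 8 * measure lebesgue C1" by simp
  define I2 :: "(3 \<times> 3 \<times> 3) set" where "I2 = {(1,2,3), (1,3,2), (2,1,3), (2,3,1), (3,1,2), (3,2,1)}"
  define T2 where "T2 = (\<lambda>(i, j, k :: 3) (z :: real^3). (\<chi> l. if l = i then z$1 else if l = j then z$2 else z$3) :: real^3)"
  have I2: "fst t \<noteq> fst (snd t)" "fst t \<noteq> snd (snd t)" "fst (snd t) \<noteq> snd (snd t)" if "t \<in> I2" for t
    using that by (auto simp: I2_def)
  have T2n: "T2 t z $ fst t = z$1" "T2 t z $ fst (snd t) = z$2" "T2 t z $ snd (snd t) = z$3" if "t \<in> I2" for t z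
    using I2[OF that] by (cases t; simp add: T2_def)+
  have T2e: "elem_map (T2 t z) = elem_map z" if "t \<in> I2" for t z
    using elem_map_perm[OF I2[OF that], of z "T2 t z"] T2n[OF that] by simp
  have pos_iff: "x \<in> C1 \<longleftrightarrow> elem_map x $ 1 < 1 \<and> elem_jb (elem_map x) \<in> A \<and> (\<forall>l. x$l > 0)" for x
    by (auto simp: C1_def weyl_set_def forall_3)
  have img2: "T2 t ` C2 = C1 \<inter> {x. x $ fst t < x $ fst (snd t) \<and> x $ fst (snd t) < x $ snd (snd t)}" if t: "t \<in> I2" for t
  proof (intro equalityI subsetI)
    fix x assume "x \<in> T2 t ` C2"
    then obtain z where z: "z \<in> C2" "x = T2 t z" by blast
    have zC: "z \<in> C1" "z$1 < z$2" "z$2 < z$3" using z(1) unfolding C2 by auto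
    then have zp: "elem_map z $ 1 < 1" "elem_jb (elem_map z) \<in> A" "\<And>l. z$l > 0" using pos_iff[of z] by blast+
    have "\<forall>l. x$l > 0" unfolding z(2) using zp(3) by (cases t) (simp add: T2_def)
    then have "x \<in> C1" using zp(1,2) pos_iff[of x] T2e[OF t, of z] unfolding z(2) by metis
    then show "x \<in> C1 \<inter> {x. x $ fst t < x $ fst (snd t) \<and> x $ fst (snd t) < x $ snd (snd t)}"
      unfolding z(2) using zC T2n[OF t] by simp
  next
    fix x assume x: "x \<in> C1 \<inter> {x. x $ fst t < x $ fst (snd t) \<and> x $ fst (snd t) < x $ snd (snd t)}"
    define z :: "real^3" where "z = vector [x $ fst t, x $ fst (snd t), x $ snd (snd t)]"
    have "T2 t z = x"
      using t by (auto simp: I2_def T2_def z_def vec_eq_iff forall_3)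
    then have "elem_map z = elem_map x" using T2e[OF t] by metis
    moreover have "\<And>l. x$l > 0" using x pos_iff[of x] by blast
    then have "\<forall>l. z$l > 0" by (simp add: forall_3 z_def)
    ultimately have "z \<in> C1" using x pos_iff[of x] pos_iff[of z] by simp
    then have "z \<in> C2" using x unfolding C2 by (simp add: z_def)
    then show "x \<in> T2 t ` C2" using \<open>T2 t z = x\<close> by blast
  qed
  have "measure lebesgue C1 = card I2 * measure lebesgue C2"
  proof (rule measure_orthogonal_cover)
    show "orthogonal_transformation (T2 t)" if "t \<in> I2" for t
      unfolding orthogonal_transformation_def
    proof
      show "linear (T2 t)"
        by (cases t, rule linearI) (simp_all add: T2_def vec_eq_iff)
      show "\<forall>v w. T2 t v \<bullet> T2 t w = v \<bullet> w"
        using that by (auto simp: I2_def T2_def inner_vec_def sum_3)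
    qed
    show "T2 s ` C2 \<inter> T2 t ` C2 = {}" if "s \<in> I2" "t \<in> I2" "s \<noteq> t" for s t
      using that unfolding img2[OF that(1)] img2[OF that(2)] by (auto simp: I2_def)
    show "T2 t ` C2 \<subseteq> C1" if "t \<in> I2" for t unfolding img2[OF that] by auto
    have "C1 - (\<Union>t\<in>I2. T2 t ` C2) \<subseteq> {x. x$1 = x$2} \<union> ({x. x$1 = x$3} \<union> {x. x$2 = x$3})"
    proof
      fix x assume x: "x \<in> C1 - (\<Union>t\<in>I2. T2 t ` C2)"
      have "\<exists>t\<in>I2. x \<in> T2 t ` C2" if nz: "x \<notin> {x. x$1 = x$2} \<union> ({x. x$1 = x$3} \<union> {x. x$2 = x$3})"
      proof -
        have "\<exists>t\<in>I2. x $ fst t < x $ fst (snd t) \<and> x $ fst (snd t) < x $ snd (snd t)"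
          using nz unfolding I2_def by (simp; linarith)
        then show ?thesis using x img2 by auto
      qed
      then show "x \<in> {x. x$1 = x$2} \<union> ({x. x$1 = x$3} \<union> {x. x$2 = x$3})" using x by blast
    qed
    then show "negligible (C1 - (\<Union>t\<in>I2. T2 t ` C2))"
      by (rule negligible_subset[rotated]) (intro negligible_Un negligible_coordinates_eq; simp)
    show "C2 \<in> lmeasurable" by (rule lm[OF C2m]) (auto simp: C2 C1_def)
    show "finite I2" by (simp add: I2_def)
  qed
  also have "card I2 = 6" by (simp add: I2_def)
  finally show ?thesis using 1 by (simp add: C2_def)
qed

text \<open>Forty-eight chambers times the radial constant \<open>1 / 576\<close>.\<close>

lemma ball_law:
  assumes A: "A \<in> sets borel"
  shows "emeasure lborel (weyl_set A) = ennreal (1 / 12) * (\<integral>\<^sup>+c. indicator A c * fiber_integral c \<partial>lborel)"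
proof -
  define C2 where "C2 = chamber \<inter> (\<lambda>x. elem_jb (elem_map x)) -` A"
  have "(\<lambda>x. elem_jb (elem_map x)) \<in> borel_measurable borel" by measurable
  then have C2m: "C2 \<in> sets borel"
    unfolding C2_def using A chamber_borel by measurable
  have em: "emeasure lborel X = ennreal (measure lebesgue X)" if "X \<in> sets borel" "X \<subseteq> ball 0 1" for X :: "(real^3) set"
  proof -
    have "X \<in> lmeasurable"
      using that by (intro bounded_set_imp_lmeasurable) (auto intro: bounded_subset[OF bounded_ball])
    then show ?thesis using that by (simp add: emeasure_eq_measure2[symmetric] fmeasurable_def)
  qed
  have sub: "C2 \<subseteq> ball 0 1" using chamber_norm by (auto simp: C2_def)
  have "emeasure lborel (weyl_set A) = ennreal (48 * measure lebesgue C2)"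
    using em[OF weyl_set_measurable[OF A]] weyl_measure[OF A] by (simp add: C2_def)
  also have "\<dots> = 48 * emeasure lborel C2" unfolding em[OF C2m sub] by (simp add: ennreal_mult')
  also have "emeasure lborel C2 = ennreal (1 / 576) * (\<integral>\<^sup>+c. indicator A c * fiber_integral c \<partial>lborel)"
    unfolding C2_def by (rule chamber_law[OF A])
  also have "48 * (ennreal (1 / 576) * (\<integral>\<^sup>+c. indicator A c * fiber_integral c \<partial>lborel)) =
     ennreal (48 * (1 / 576)) * (\<integral>\<^sup>+c. indicator A c * fiber_integral c \<partial>lborel)"
    by (simp only: ennreal_mult' mult.assoc) simp
  finally show ?thesis by simp
qed

section \<open>Real analytic functions\<close>

text \<open>Morera's theorem: the integral along a triangle is exchanged with the one over the
  parameter, and Cauchy's theorem makes the inner contour integral zero.\<close>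

lemma holomorphic_on_parametric_integral:
  fixes F :: "complex \<Rightarrow> real \<Rightarrow> complex"
  assumes U: "open U" and cont: "continuous_on (U \<times> {a..b}) (\<lambda>(z, t). F z t)"
    and hol: "\<And>t. t \<in> {a..b} \<Longrightarrow> (\<lambda>z. F z t) holomorphic_on U"
  shows "(\<lambda>z. integral {a..b} (F z)) holomorphic_on U"
proof -
  have cI: "continuous_on U (\<lambda>z. integral {a..b} (F z))"
    using integral_continuous_on_param[of U a b F] cont by simp
  have "contour_integral (linepath p q) (\<lambda>z. integral {a..b} (F z)) +
       contour_integral (linepath q r) (\<lambda>z. integral {a..b} (F z)) +
       contour_integral (linepath r p) (\<lambda>z. integral {a..b} (F z)) = 0"
    if tri: "convex hull {p, q, r} \<subseteq> U" for p q r :: complex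
  proof -
    define J where "J x y t = contour_integral (linepath x y) (\<lambda>z. F z t)" for x y t
    have side: "contour_integral (linepath x y) (\<lambda>z. integral {a..b} (F z)) = integral {a..b} (J x y)"
      and Jint: "J x y integrable_on {a..b}"
      if seg: "closed_segment x y \<subseteq> U" for x y
    proof -
      have lp: "linepath x y s \<in> U" if "s \<in> {0..1}" for s
        using seg linepath_in_path[OF that, of x y] by blast
      have c2: "continuous_on (cbox (0, a) (1, b)) (\<lambda>(s, t). F (linepath x y s) t * (y - x))"
      proof -
        have "continuous_on ({0..1} \<times> {a..b}) (\<lambda>w. (\<lambda>(z, t). F z t) (linepath x y (fst w), snd w))"
          by (rule continuous_on_compose2[OF cont])
            (use lp in \<open>auto intro!: continuous_intros simp: linepath_def\<close>)
        then have "continuous_on ({0..1} \<times> {a..b}) (\<lambda>w. F (linepath x y (fst w)) (snd w) * (y - x))"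
          by (intro continuous_intros) simp
        then show ?thesis by (simp add: cbox_Pair_eq case_prod_beta')
      qed
      have J: "J x y t = integral {0..1} (\<lambda>s. F (linepath x y s) t * (y - x))" for t
        by (simp add: J_def contour_integral_integral)
      have "contour_integral (linepath x y) (\<lambda>z. integral {a..b} (F z)) =
          integral {0..1} (\<lambda>s. integral {a..b} (F (linepath x y s)) * (y - x))"
        by (simp add: contour_integral_integral)
      also have "\<dots> = integral {0..1} (\<lambda>s. integral {a..b} (\<lambda>t. F (linepath x y s) t * (y - x)))"
        by simp
      also have "\<dots> = integral {a..b} (\<lambda>t. integral {0..1} (\<lambda>s. F (linepath x y s) t * (y - x)))"
        using integral_swap_continuous[OF c2] by simp
      finally show "contour_integral (linepath x y) (\<lambda>z. integral {a..b} (F z)) = integral {a..b} (J x y)"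
        unfolding J[abs_def] .
      have "continuous_on ({a..b} \<times> cbox 0 1) (\<lambda>(t, s). F (linepath x y s) t * (y - x))"
      proof -
        have "continuous_on ({a..b} \<times> cbox 0 1) (\<lambda>w. (\<lambda>(s, t). F (linepath x y s) t * (y - x)) (snd w, fst w))"
          by (rule continuous_on_compose2[OF c2[unfolded cbox_Pair_eq]]) (auto intro!: continuous_intros)
        then show ?thesis by (simp only: case_prod_beta' fst_conv snd_conv)
      qed
      from integral_continuous_on_param[OF this]
      have "continuous_on {a..b} (\<lambda>t. integral {0..1} (\<lambda>s. F (linepath x y s) t * (y - x)))" by simp
      then show "J x y integrable_on {a..b}"
        unfolding J[abs_def] by (rule integrable_continuous_real)
    qed
    have seg: "closed_segment p q \<subseteq> U" "closed_segment q r \<subseteq> U" "closed_segment r p \<subseteq> U"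
      using tri hull_mono[of "{p, q}" "{p, q, r}" convex] hull_mono[of "{q, r}" "{p, q, r}" convex]
        hull_mono[of "{r, p}" "{p, q, r}" convex]
      unfolding segment_convex_hull by auto
    have zero: "J p q t + J q r t + J r p t = 0" if t: "t \<in> {a..b}" for t
    proof -
      have h: "(\<lambda>z. F z t) holomorphic_on U" by (rule hol[OF t])
      have ci: "(\<lambda>z. F z t) contour_integrable_on linepath x y" if "closed_segment x y \<subseteq> U" for x y
        using that h by (intro contour_integrable_continuous_linepath continuous_on_subset[OF holomorphic_on_imp_continuous_on])
      have "((\<lambda>z. F z t) has_contour_integral 0) (linepath p q +++ linepath q r +++ linepath r p)"
        using h tri by (intro Cauchy_theorem_triangle holomorphic_on_subset[OF h]) auto
      then have "contour_integral (linepath p q +++ linepath q r +++ linepath r p) (\<lambda>z. F z t) = 0"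
        by (rule contour_integral_unique)
      then show ?thesis
        using ci[OF seg(1)] ci[OF seg(2)] ci[OF seg(3)] by (simp add: J_def add.assoc)
    qed
    have "integral {a..b} (J p q) + integral {a..b} (J q r) + integral {a..b} (J r p) =
       integral {a..b} (\<lambda>t. J p q t + J q r t + J r p t)"
      using Jint[OF seg(1)] Jint[OF seg(2)] Jint[OF seg(3)] by (simp add: integral_add integrable_add)
    also have "\<dots> = integral {a..b} (\<lambda>t. 0)" using zero by (intro integral_cong) auto
    finally have sum0: "integral {a..b} (J p q) + integral {a..b} (J q r) + integral {a..b} (J r p) = 0" by simp
    show "contour_integral (linepath p q) (\<lambda>z. integral {a..b} (F z)) +
       contour_integral (linepath q r) (\<lambda>z. integral {a..b} (F z)) +
       contour_integral (linepath r p) (\<lambda>z. integral {a..b} (F z)) = 0"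
      unfolding side[OF seg(1)] side[OF seg(2)] side[OF seg(3)] by (rule sum0)
  qed
  from Morera_triangle[OF cI U impI[OF this]] show ?thesis by (rule analytic_imp_holomorphic)
qed

section \<open>Germs that extend holomorphically\<close>

definition real_analytic_at :: "(real \<Rightarrow> real) \<Rightarrow> real \<Rightarrow> bool" where
  "real_analytic_at f x \<longleftrightarrow> (\<exists>e>0. \<exists>g. g holomorphic_on ball (of_real x) e \<and>
     (\<forall>y. dist x y < e \<longrightarrow> g (of_real y) = complex_of_real (f y)))"

lemma real_analytic_at_cong:
  assumes f: "real_analytic_at f x" and eq: "\<forall>\<^sub>F y in nhds x. f y = g y"
  shows "real_analytic_at g x"
proof -
  obtain e h where e: "e > 0" "h holomorphic_on ball (of_real x) e"
    "\<And>y. dist x y < e \<Longrightarrow> h (of_real y) = complex_of_real (f y)"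
    using f by (auto simp: real_analytic_at_def)
  obtain d where d: "d > 0" "\<And>y. dist y x < d \<Longrightarrow> f y = g y"
    using eq by (auto simp: eventually_nhds_metric)
  show ?thesis unfolding real_analytic_at_def
  proof (intro exI[of _ "min e d"] exI[of _ h] conjI allI impI)
    show "h holomorphic_on ball (of_real x) (min e d)"
      using e(2) by (rule holomorphic_on_subset) auto
    show "h (of_real y) = of_real (g y)" if "dist x y < min e d" for y
      using that e(3)[of y] d(2)[of y] by (simp add: dist_commute)
  qed (use e d in auto)
qed

text \<open>The derivative of the extension extends the real derivative: its imaginary part vanishes
  on the axis because the extension is real there.\<close>

lemma real_analytic_at_deriv:
  assumes "real_analytic_at f x"
  shows "f differentiable (at x)" "real_analytic_at (deriv f) x"
proof -
  obtain e g where e: "e > 0" and g: "g holomorphic_on ball (of_real x) e"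
    and eq: "\<And>y. dist x y < e \<Longrightarrow> g (of_real y) = complex_of_real (f y)"
    using assms by (auto simp: real_analytic_at_def)
  have D: "(f has_real_derivative Re (deriv g (of_real y))) (at y)" "Im (deriv g (of_real y)) = 0"
    if y: "dist x y < e" for y
  proof -
    have "(g has_field_derivative deriv g (of_real y)) (at (of_real y))"
      using g y by (intro holomorphic_derivI[OF g]) auto
    then have v: "((\<lambda>y. g (of_real y)) has_vector_derivative deriv g (of_real y)) (at y)"
      by (rule has_vector_derivative_real_field)
    have ev: "\<forall>\<^sub>F z in nhds y. g (of_real z) = complex_of_real (f z)"
    proof -
      have "\<forall>\<^sub>F z in nhds y. z \<in> ball x e"
        using y by (intro eventually_nhds_in_open) auto
      then show ?thesis by eventually_elim (simp add: eq)
    qed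
    have "((\<lambda>z. Re (g (of_real z))) has_vector_derivative Re (deriv g (of_real y))) (at y)"
      using v by (rule bounded_linear.has_vector_derivative[OF bounded_linear_Re])
    then have "((\<lambda>z. Re (g (of_real z))) has_real_derivative Re (deriv g (of_real y))) (at y)"
      by (simp add: has_real_derivative_iff_has_vector_derivative)
    then show "(f has_real_derivative Re (deriv g (of_real y))) (at y)"
      by (rule DERIV_cong_ev[THEN iffD1, rotated -1]) (use ev in \<open>auto elim: eventually_mono\<close>)
    have "((\<lambda>z. Im (g (of_real z))) has_vector_derivative Im (deriv g (of_real y))) (at y)"
      using v by (rule bounded_linear.has_vector_derivative[OF bounded_linear_Im])
    then have "((\<lambda>z. Im (g (of_real z))) has_real_derivative Im (deriv g (of_real y))) (at y)"
      by (simp add: has_real_derivative_iff_has_vector_derivative)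
    then have "((\<lambda>z. 0) has_real_derivative Im (deriv g (of_real y))) (at y)"
      by (rule DERIV_cong_ev[THEN iffD1, rotated -1]) (use ev in \<open>auto elim: eventually_mono\<close>)
    then show "Im (deriv g (of_real y)) = 0" using DERIV_const DERIV_unique by blast
  qed
  show "f differentiable (at x)"
    using D(1)[of x] e real_differentiable_def by auto
  have "deriv g holomorphic_on ball (of_real x) e" by (intro holomorphic_deriv g) simp
  moreover have "deriv g (of_real y) = complex_of_real (deriv f y)" if "dist x y < e" for y
    using D[OF that] DERIV_imp_deriv[OF D(1)[OF that]] by (simp add: complex_eq_iff)
  ultimately show "real_analytic_at (deriv f) x" unfolding real_analytic_at_def using e by blast
qed

lemma infinitely_differentiable_onI:
  assumes "\<And>x. x \<in> S \<Longrightarrow> real_analytic_at f x"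
  shows "infinitely_differentiable_on f S"
proof -
  have "real_analytic_at ((deriv ^^ n) f) x" if "x \<in> S" for x n
    by (induction n) (use assms that real_analytic_at_deriv(2) in auto)
  then show ?thesis unfolding infinitely_differentiable_on_def using real_analytic_at_deriv(1) by blast
qed

lemma real_analytic_at_add:
  assumes "real_analytic_at f x" "real_analytic_at g x"
  shows "real_analytic_at (\<lambda>y. f y + g y) x"
proof -
  obtain e f' where f: "e > 0" "f' holomorphic_on ball (of_real x) e"
    "\<And>y. dist x y < e \<Longrightarrow> f' (of_real y) = complex_of_real (f y)"
    using assms(1) by (auto simp: real_analytic_at_def)
  obtain d g' where g: "d > 0" "g' holomorphic_on ball (of_real x) d"
    "\<And>y. dist x y < d \<Longrightarrow> g' (of_real y) = complex_of_real (g y)"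
    using assms(2) by (auto simp: real_analytic_at_def)
  show ?thesis unfolding real_analytic_at_def
  proof (intro exI[of _ "min e d"] exI[of _ "\<lambda>z. f' z + g' z"] conjI allI impI)
    show "(\<lambda>z. f' z + g' z) holomorphic_on ball (of_real x) (min e d)"
      by (intro holomorphic_intros holomorphic_on_subset[OF f(2)] holomorphic_on_subset[OF g(2)]) auto
  qed (use f g in auto)
qed

lemma real_analytic_at_compose:
  assumes f: "real_analytic_at f x" and G: "G holomorphic_on S" "open S" "of_real (f x) \<in> S"
    and gG: "\<And>y. of_real y \<in> S \<Longrightarrow> G (of_real y) = complex_of_real (g y)"
  shows "real_analytic_at (\<lambda>y. g (f y)) x"
proof -
  obtain e f' where f: "e > 0" "f' holomorphic_on ball (of_real x) e"
    "\<And>y. dist x y < e \<Longrightarrow> f' (of_real y) = complex_of_real (f y)"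
    using assms(1) by (auto simp: real_analytic_at_def)
  have "open (ball (of_real x) e \<inter> f' -` S)"
    using f(2) G(2) by (intro continuous_open_preimage holomorphic_on_imp_continuous_on) auto
  moreover have "of_real x \<in> ball (of_real x) e \<inter> f' -` S"
    using f(1) f(3)[of x] G(3) by simp
  ultimately obtain d where d: "d > 0" "ball (of_real x) d \<subseteq> ball (of_real x) e \<inter> f' -` S"
    using open_contains_ball by blast
  show ?thesis unfolding real_analytic_at_def
  proof (intro exI[of _ d] exI[of _ "\<lambda>z. G (f' z)"] conjI allI impI)
    have "(G \<circ> f') holomorphic_on ball (of_real x) d"
      using d(2) by (intro holomorphic_on_compose_gen[OF _ G(1)] holomorphic_on_subset[OF f(2)]) auto
    then show "(\<lambda>z. G (f' z)) holomorphic_on ball (of_real x) d" by (simp add: o_def)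
    fix y assume "dist x y < d"
    then have "complex_of_real y \<in> ball (of_real x) d" by simp
    then have "complex_of_real y \<in> ball (of_real x) e \<inter> f' -` S" using d(2) by blast
    then show "G (f' (of_real y)) = of_real (g (f y))" using f(3)[of y] gG[of "f y"] by simp
  qed (rule d(1))
qed

lemma real_analytic_at_ident: "real_analytic_at (\<lambda>x. x) x"
  unfolding real_analytic_at_def by (intro exI[of _ 1] exI[of _ "\<lambda>z. z"]) (auto intro!: holomorphic_intros)

text \<open>The nonzero real derivative is also the complex one, so \<open>P\<close> has a
  holomorphic local inverse. Continuity of \<open>s\<close> keeps \<open>s\<close> on the branch
  through \<open>s c\<close>, where it agrees with that inverse.\<close>

lemma real_analytic_at_local_inverse:
  fixes p s :: "real \<Rightarrow> real" and P :: "complex \<Rightarrow> complex"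
  assumes P: "P holomorphic_on UNIV" "\<And>t. P (of_real t) = of_real (p t)"
    and d: "(p has_real_derivative d) (at (s c))" "d \<noteq> 0"
    and s: "isCont s c" "\<forall>\<^sub>F x in nhds c. p (s x) = x"
  shows "real_analytic_at s c"
proof -
  have pc: "p (s c) = c" using s(2) by (rule eventually_nhds_x_imp_x)
  have PD: "(P has_field_derivative deriv P (of_real (s c))) (at (of_real (s c)))"
    using P(1) by (intro holomorphic_derivI[OF P(1)]) auto
  have "((\<lambda>y. P (of_real y)) has_vector_derivative deriv P (of_real (s c))) (at (s c))"
    using PD by (rule has_vector_derivative_real_field)
  moreover have "((\<lambda>y. P (of_real y)) has_vector_derivative of_real d) (at (s c))"
    unfolding P(2) using d(1)
    by (auto intro!: derivative_eq_intros simp: has_real_derivative_iff_has_vector_derivative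
        has_vector_derivative_of_real)
  ultimately have "deriv P (of_real (s c)) = of_real d"
    by (rule vector_derivative_unique_at)
  then have "deriv P (of_real (s c)) \<noteq> 0" using d(2) by simp
  then obtain r where r: "r > 0" "open (P ` ball (of_real (s c)) r)" "inj_on P (ball (of_real (s c)) r)"
    using has_complex_derivative_locally_invertible[OF P(1), of "of_real (s c)"] by auto
  obtain g where g: "g holomorphic_on P ` ball (of_real (s c)) r" "\<And>z. z \<in> ball (of_real (s c)) r \<Longrightarrow> g (P z) = z"
    using holomorphic_has_inverse[OF holomorphic_on_subset[OF P(1) subset_UNIV] open_ball r(3)] by blast
  have "of_real c \<in> P ` ball (of_real (s c)) r"
    using r(1) P(2)[of "s c"] pc by (intro image_eqI[of _ _ "of_real (s c)"]) auto
  then obtain e where e: "e > 0" "ball (of_real c) e \<subseteq> P ` ball (of_real (s c)) r"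
    using r(2) open_contains_ball by blast
  have "\<forall>\<^sub>F x in nhds c. \<bar>s x - s c\<bar> < r"
  proof -
    have "(s \<longlongrightarrow> s c) (nhds c)"
      using s(1) by (simp add: isCont_def tendsto_at_iff_tendsto_nhds)
    from tendstoD[OF this r(1)] show ?thesis by (simp add: dist_real_def)
  qed
  then have "\<forall>\<^sub>F x in nhds c. p (s x) = x \<and> \<bar>s x - s c\<bar> < r" using s(2) by eventually_elim auto
  then obtain d where d: "d > 0" "\<And>x. dist x c < d \<Longrightarrow> p (s x) = x \<and> \<bar>s x - s c\<bar> < r"
    unfolding eventually_nhds_metric by blast
  show ?thesis unfolding real_analytic_at_def
  proof (intro exI[of _ "min e d"] exI[of _ g] conjI allI impI)
    show "g holomorphic_on ball (of_real c) (min e d)"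
      using e(2) by (intro holomorphic_on_subset[OF g(1)]) auto
    fix x assume "dist c x < min e d"
    then have "p (s x) = x" "\<bar>s x - s c\<bar> < r" using d(2)[of x] by (auto simp: dist_commute)
    moreover from this have "dist (s c) (s x) < r" by (simp add: dist_real_def abs_minus_commute)
    ultimately show "g (of_real x) = of_real (s x)" using g(2)[of "of_real (s x)"] P(2)[of "s x"] by simp
  qed (use e d in auto)
qed

text \<open>Positivity is assumed only at the point \<open>c\<close>. By compactness of the range of
  \<open>\<theta>\<close>, the tube lemma spreads it to a complex disc on which the radicand has
  positive real part.\<close>

lemma real_analytic_at_arcsine_integral:
  fixes a1 a2 a3 :: "real \<Rightarrow> real" and q :: "complex \<Rightarrow> complex \<Rightarrow> complex \<Rightarrow> complex \<Rightarrow> complex"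
    and qr :: "real \<Rightarrow> real \<Rightarrow> real \<Rightarrow> real \<Rightarrow> real"
  assumes a: "real_analytic_at a1 c" "real_analytic_at a2 c" "real_analytic_at a3 c"
    and cont: "continuous_on UNIV (\<lambda>(w1, w2, w3, u). q w1 w2 w3 u)"
    and hol: "\<And>h1 h2 h3 u S. h1 holomorphic_on S \<Longrightarrow> h2 holomorphic_on S \<Longrightarrow> h3 holomorphic_on S \<Longrightarrow>
      (\<lambda>z. q (h1 z) (h2 z) (h3 z) u) holomorphic_on S"
    and real: "\<And>x y z u. q (of_real x) (of_real y) (of_real z) (of_real u) = of_real (qr x y z u)"
    and pos: "\<And>\<theta>. 0 \<le> \<theta> \<Longrightarrow> \<theta> \<le> pi \<Longrightarrow> qr (a1 c) (a2 c) (a3 c) (cos \<theta>) > 0"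
  shows "real_analytic_at (\<lambda>x. integral {0..pi} (\<lambda>\<theta>. 1 / sqrt (qr (a1 x) (a2 x) (a3 x) (cos \<theta>)))) c"
proof -
  obtain e1 h1 where 1: "e1 > 0" "h1 holomorphic_on ball (of_real c) e1"
    "\<And>y. dist c y < e1 \<Longrightarrow> h1 (of_real y) = complex_of_real (a1 y)" using a(1) by (auto simp: real_analytic_at_def)
  obtain e2 h2 where 2: "e2 > 0" "h2 holomorphic_on ball (of_real c) e2"
    "\<And>y. dist c y < e2 \<Longrightarrow> h2 (of_real y) = complex_of_real (a2 y)" using a(2) by (auto simp: real_analytic_at_def)
  obtain e3 h3 where 3: "e3 > 0" "h3 holomorphic_on ball (of_real c) e3"
    "\<And>y. dist c y < e3 \<Longrightarrow> h3 (of_real y) = complex_of_real (a3 y)" using a(3) by (auto simp: real_analytic_at_def)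
  define e where "e = min e1 (min e2 e3)"
  let ?B = "ball (complex_of_real c) e"
  have h: "h1 holomorphic_on ?B" "h2 holomorphic_on ?B" "h3 holomorphic_on ?B"
    by (auto simp: e_def intro: holomorphic_on_subset[OF 1(2)] holomorphic_on_subset[OF 2(2)] holomorphic_on_subset[OF 3(2)])
  define F where "F z \<theta> = q (h1 z) (h2 z) (h3 z) (of_real (cos \<theta>))" for z and \<theta> :: real
  have Fr: "F (of_real y) \<theta> = of_real (qr (a1 y) (a2 y) (a3 y) (cos \<theta>))" if "dist c y < e" for y \<theta>
    using that unfolding F_def by (simp add: 1(3) 2(3) 3(3) e_def real)
  have Fc: "continuous_on (?B \<times> UNIV) (\<lambda>w. F (fst w) (snd w))"
  proof -
    have "continuous_on (?B \<times> UNIV) (\<lambda>w :: complex \<times> real. (h1 (fst w), h2 (fst w), h3 (fst w), complex_of_real (cos (snd w))))"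
      by (intro continuous_intros continuous_on_compose2[OF holomorphic_on_imp_continuous_on[OF h(1)]]
          continuous_on_compose2[OF holomorphic_on_imp_continuous_on[OF h(2)]]
          continuous_on_compose2[OF holomorphic_on_imp_continuous_on[OF h(3)]]) auto
    from continuous_on_compose2[OF cont this] show ?thesis by (simp add: F_def)
  qed
  define W where "W = (?B \<times> UNIV) \<inter> (\<lambda>w. F (fst w) (snd w)) -` {v. Re v > 0}"
  have "open W" unfolding W_def
    by (intro continuous_open_preimage Fc open_Times) (auto simp: open_halfspace_Re_gt)
  then have "open ((\<lambda>w. (snd w, fst w)) -` W)"
    by (intro open_vimage) (auto intro!: continuous_intros)
  then have op: "openin (top_of_set ({0..pi} \<times> UNIV)) (({0..pi} \<times> UNIV) \<inter> (\<lambda>w. (snd w, fst w)) -` W)"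
    by (rule openin_open_Int)
  have sub: "(\<lambda>\<theta>. (\<theta>, complex_of_real c)) ` {0..pi} \<subseteq> ({0..pi} \<times> UNIV) \<inter> (\<lambda>w. (snd w, fst w)) -` W"
    using pos Fr[of c] 1(1) 2(1) 3(1) by (auto simp: W_def e_def)
  obtain X where X: "openin (top_of_set UNIV) X" "of_real c \<in> X"
    "{0..pi} \<times> X \<subseteq> ({0..pi} \<times> UNIV) \<inter> (\<lambda>w. (snd w, fst w)) -` W"
    using tube_lemma[OF compact_Icc _ sub op] by auto
  then have "open X" by simp
  then obtain d where d: "d > 0" "ball (of_real c) d \<subseteq> X" using X(2) open_contains_ball by blast
  let ?D = "ball (complex_of_real c) d"
  have DW: "z \<in> ?B \<and> Re (F z \<theta>) > 0" if "z \<in> ?D" "\<theta> \<in> {0..pi}" for z \<theta>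
  proof -
    have "(\<theta>, z) \<in> {0..pi} \<times> X" using that d(2) by blast
    from subsetD[OF X(3) this] have "(z, \<theta>) \<in> W" by simp
    then show ?thesis by (simp add: W_def)
  qed
  have DB: "?D \<subseteq> ?B" using DW[of _ 0] by auto
  \<comment> \<open>Positive real part keeps the radicand off the cut of \<open>csqrt\<close> and
    away from zero.\<close>
  have nonp: "F z \<theta> \<notin> \<real>\<^sub>\<le>\<^sub>0" "csqrt (F z \<theta>) \<noteq> 0" if "z \<in> ?D" "\<theta> \<in> {0..pi}" for z \<theta>
    using DW[OF that] by (auto simp: complex_nonpos_Reals_iff)
  have Dc: "continuous_on (?D \<times> {0..pi}) (\<lambda>w. 1 / csqrt (F (fst w) (snd w)))"
      using nonp DB by (intro continuous_intros continuous_on_compose2[OF continuous_on_csqrt, where f="\<lambda>w. F (fst w) (snd w)"]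
          continuous_on_subset[OF Fc]) auto
  have "(\<lambda>z. integral {0..pi} (\<lambda>\<theta>. 1 / csqrt (F z \<theta>))) holomorphic_on ?D"
  proof (rule holomorphic_on_parametric_integral)
    show "continuous_on (?D \<times> {0..pi}) (\<lambda>(z, \<theta>). 1 / csqrt (F z \<theta>))" using Dc by (simp add: case_prod_beta')
    fix \<theta> assume \<theta>: "\<theta> \<in> {0..pi}"
    have "(\<lambda>z. F z \<theta>) holomorphic_on ?D"
      unfolding F_def by (intro hol holomorphic_on_subset[OF h(1) DB] holomorphic_on_subset[OF h(2) DB] holomorphic_on_subset[OF h(3) DB])
    then show "(\<lambda>z. 1 / csqrt (F z \<theta>)) holomorphic_on ?D"
      using nonp \<theta> by (intro holomorphic_intros) auto
  qed auto
  moreover have "integral {0..pi} (\<lambda>\<theta>. 1 / csqrt (F (of_real y) \<theta>)) =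
     of_real (integral {0..pi} (\<lambda>\<theta>. 1 / sqrt (qr (a1 y) (a2 y) (a3 y) (cos \<theta>))))" if y: "dist c y < d" for y
  proof -
    have yD: "of_real y \<in> ?D" using y by simp
    then have "of_real y \<in> ?B" using DB by blast
    then have ye: "dist c y < e" by simp
    have p: "qr (a1 y) (a2 y) (a3 y) (cos \<theta>) > 0" if "\<theta> \<in> {0..pi}" for \<theta>
      using DW[OF yD that] Fr[OF ye, of \<theta>] by simp
    have eq: "1 / csqrt (F (of_real y) \<theta>) = complex_of_real (1 / sqrt (qr (a1 y) (a2 y) (a3 y) (cos \<theta>)))"
      if "\<theta> \<in> {0..pi}" for \<theta>
      using p[OF that] by (simp add: Fr[OF ye] less_imp_le)
    have "continuous_on {0..pi} (\<lambda>\<theta>. (\<lambda>w. 1 / csqrt (F (fst w) (snd w))) (of_real y, \<theta>))"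
      by (rule continuous_on_compose2[OF Dc]) (use yD in \<open>auto intro!: continuous_intros\<close>)
    then have "continuous_on {0..pi} (\<lambda>\<theta>. 1 / csqrt (F (of_real y) \<theta>))" by simp
    then have "continuous_on {0..pi} (\<lambda>\<theta>. complex_of_real (1 / sqrt (qr (a1 y) (a2 y) (a3 y) (cos \<theta>))))"
      using eq by (simp only: continuous_on_cong[OF refl eq])
    then have "continuous_on {0..pi} (\<lambda>\<theta>. Re (complex_of_real (1 / sqrt (qr (a1 y) (a2 y) (a3 y) (cos \<theta>)))))"
      by (rule continuous_on_Re)
    then have "(\<lambda>\<theta>. 1 / sqrt (qr (a1 y) (a2 y) (a3 y) (cos \<theta>))) integrable_on {0..pi}"
      unfolding Re_complex_of_real by (rule integrable_continuous_real)
    then have "((\<lambda>\<theta>. complex_of_real (1 / sqrt (qr (a1 y) (a2 y) (a3 y) (cos \<theta>)))) has_integral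
        complex_of_real (integral {0..pi} (\<lambda>\<theta>. 1 / sqrt (qr (a1 y) (a2 y) (a3 y) (cos \<theta>))))) {0..pi}"
      by (intro has_integral_of_real integrable_integral)
    then show ?thesis by (subst integral_cong[OF eq]) (simp_all only: integral_unique)
  qed
  ultimately show ?thesis unfolding real_analytic_at_def using d(1) by blast
qed

section \<open>The discriminant locus\<close>

text \<open>\<open>hpoly t\<close> is the statistic at squared coordinates \<open>1/3 - t, 1/3 - t, 1/3 + 2 t\<close>, where the discriminant
  vanishes; its critical points \<open>0\<close> and \<open>tau_star\<close> and the ends \<open>- 1/6\<close> and \<open>1/3\<close> are the four critical types.\<close>

definition hpoly :: "'a::real_normed_field \<Rightarrow> 'a" where
  "hpoly t = 26/27 - 64/3 * t^2 + 48 * t^3 + 24 * t^4"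

text \<open>Positive zero of \<open>18 t\<^sup>2 + 27 t - 8\<close>, the quadratic factor of the
  derivative of \<open>hpoly\<close>; it equals \<open>1/3 - s_saddle\<close>.\<close>

definition tau_star :: real where "tau_star = (sqrt 145 - 9) / 12"

lemma tau_star_bounds: "0.2534 < tau_star" "tau_star < 0.2535"
proof -
  have "12.0408 < sqrt 145" by (rule real_less_rsqrt, simp add: power2_eq_square)
  moreover have "sqrt 145 < 12.042" by (rule real_less_lsqrt; simp add: power2_eq_square)
  ultimately show "0.2534 < tau_star" "tau_star < 0.2535" by (simp_all add: tau_star_def)
qed

lemma tau_star_root: "18 * tau_star\<^sup>2 + 27 * tau_star - 8 = 0"
proof -
  have "12 * tau_star - sqrt 145 + 9 = 0" "(sqrt 145)\<^sup>2 - 145 = 0"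
    by (simp add: tau_star_def field_simps, simp)
  then show ?thesis by algebra
qed

lemma hpoly_vals: "hpoly 0 = (26/27 :: real)" "hpoly (1/3) = (2/3 :: real)" "hpoly (- (1/6)) = (1/6 :: real)"
  by (simp_all add: hpoly_def power2_eq_square power3_eq_cube power4_eq_xxxx)

lemma hpoly_tau_star: "hpoly tau_star = x_star"
proof -
  have "12 * tau_star - sqrt 145 + 9 = 0" "(sqrt 145)\<^sup>2 - 145 = 0"
    by (simp add: tau_star_def field_simps, simp)
  then show ?thesis unfolding x_star_def hpoly_def by algebra
qed

lemma x_star_bounds: "0.473 < x_star" "x_star < 0.474"
proof -
  have "12.04159 < sqrt 145" by (rule real_less_rsqrt, simp add: power2_eq_square)
  moreover have "sqrt 145 < 12.0416" by (rule real_less_lsqrt; simp add: power2_eq_square)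
  ultimately show "0.473 < x_star" "x_star < 0.474" by (simp_all add: x_star_def)
qed

text \<open>Factored so that signs are visible; the third zero \<open>- (tau_star + 3/2)\<close>
  lies left of every argument that occurs.\<close>

definition hpoly' :: "real \<Rightarrow> real" where
  "hpoly' t = 96 * t * (t - tau_star) * (t + tau_star + 3/2)"

lemma hpoly'_eq: "hpoly' t = - (128/3) * t + 144 * t\<^sup>2 + 96 * t^3"
proof -
  have "hpoly' t = 96 * t^3 + 144 * t\<^sup>2 - 96 * t * (tau_star\<^sup>2 + 3/2 * tau_star)"
    unfolding hpoly'_def by algebra
  also have "tau_star\<^sup>2 + 3/2 * tau_star = 4/9" using tau_star_root by simp
  finally show ?thesis by simp
qed

lemma hpoly_deriv: "(hpoly has_real_derivative hpoly' t) (at t)"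
  unfolding hpoly_def hpoly'_eq by (auto intro!: derivative_eq_intros simp: power2_eq_square power3_eq_cube)

lemma hpoly_isCont: "isCont hpoly (t::real)"
  using hpoly_deriv DERIV_isCont by blast

lemma hpoly_continuous: "continuous_on S (hpoly :: real \<Rightarrow> real)"
  using hpoly_isCont continuous_at_imp_continuous_on by blast

lemma hpoly'_sign:
  "- (1/3) \<le> t \<Longrightarrow> t < 0 \<Longrightarrow> hpoly' t > 0" "0 < t \<Longrightarrow> t < tau_star \<Longrightarrow> hpoly' t < 0" "tau_star < t \<Longrightarrow> hpoly' t > 0"
  using tau_star_bounds unfolding hpoly'_def
  by (simp_all add: mult_pos_pos mult_neg_neg mult_pos_neg mult_neg_pos)

lemma hpoly_increasing_neg:
  fixes s t :: real
  assumes "- (1/3) \<le> s" "s < t" "t \<le> 0" shows "hpoly s < hpoly t"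
  using assms hpoly'_sign(1) hpoly_deriv
  by (intro DERIV_pos_imp_increasing_open[OF assms(2)]) (auto intro!: exI[of _ "hpoly' _"] hpoly_continuous)

lemma hpoly_decreasing:
  fixes s t :: real
  assumes "0 \<le> s" "s < t" "t \<le> tau_star" shows "hpoly t < hpoly s"
  using assms hpoly'_sign(2) hpoly_deriv
  by (intro DERIV_neg_imp_decreasing_open[OF assms(2)]) (auto intro!: exI[of _ "hpoly' _"] hpoly_continuous)

lemma hpoly_increasing:
  fixes s t :: real
  assumes "tau_star \<le> s" "s < t" shows "hpoly s < hpoly t"
  using assms hpoly'_sign(3) hpoly_deriv
  by (intro DERIV_pos_imp_increasing_open[OF assms(2)]) (auto intro!: exI[of _ "hpoly' _"] hpoly_continuous)

lemma hpoly_mono: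
  fixes s t :: real
  shows "- (1/3) \<le> s \<Longrightarrow> s \<le> t \<Longrightarrow> t \<le> 0 \<Longrightarrow> hpoly s \<le> hpoly t"
    "0 \<le> s \<Longrightarrow> s \<le> t \<Longrightarrow> t \<le> tau_star \<Longrightarrow> hpoly t \<le> hpoly s"
    "tau_star \<le> s \<Longrightarrow> s \<le> t \<Longrightarrow> hpoly s \<le> hpoly t"
  using hpoly_increasing_neg[of s t] hpoly_decreasing[of s t] hpoly_increasing[of s t]
  by (cases "s = t"; simp)+

text \<open>Only the cubic term is odd, and the difference is \<open>96 * t^3\<close>.\<close>

lemma hpoly_minus_less: "0 < t \<Longrightarrow> hpoly (- t) < hpoly (t::real)"
  by (simp add: hpoly_def)

section \<open>Inverse branches of \<open>hpoly\<close>\<close>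

definition rootC :: "real \<Rightarrow> real" where "rootC = the_inv_into {- (1/6)..0} hpoly"
definition rootB :: "real \<Rightarrow> real" where "rootB = the_inv_into {0..tau_star} hpoly"
definition rootA :: "real \<Rightarrow> real" where "rootA = the_inv_into {tau_star..1/3} hpoly"

lemma hpoly_inj:
  "inj_on (hpoly :: real \<Rightarrow> real) {- (1/6)..0}" "inj_on hpoly {0..tau_star}" "inj_on hpoly {tau_star..1/3}"
proof -
  show "inj_on (hpoly :: real \<Rightarrow> real) {- (1/6)..0}"
    by (rule linorder_inj_onI', rule less_imp_neq) (auto intro: hpoly_increasing_neg)
  show "inj_on hpoly {0..tau_star}"
    by (rule linorder_inj_onI', rule less_imp_neq[THEN not_sym]) (auto intro: hpoly_decreasing)
  show "inj_on hpoly {tau_star..1/3}"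
    by (rule linorder_inj_onI', rule less_imp_neq) (auto intro: hpoly_increasing)
qed

lemma hpoly_image:
  "hpoly ` {- (1/6)..0} = {1/6..26/27 :: real}" "hpoly ` {0..tau_star} = {x_star..26/27}"
  "hpoly ` {tau_star..1/3} = {x_star..2/3}"
proof -
  have IVT: "{min (hpoly a) (hpoly b)..max (hpoly a) (hpoly b)} \<subseteq> hpoly ` {a..b}" if "a \<le> b" for a b :: real
  proof
    fix y assume y: "y \<in> {min (hpoly a) (hpoly b)..max (hpoly a) (hpoly b)}"
    show "y \<in> hpoly ` {a..b}"
      using y that IVT'[of hpoly a y b] IVT2'[of hpoly b y a] hpoly_continuous
      by (cases "hpoly a \<le> hpoly b") (force simp: min_def max_def)+
  qed
  have b: "0 < tau_star" "tau_star < 1/3" using tau_star_bounds by simp_all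
  have xs: "x_star < 2/3" "x_star < 26/27" using x_star_bounds by simp_all
  show "hpoly ` {- (1/6)..0} = {1/6..26/27 :: real}"
  proof (rule antisym)
    show "hpoly ` {- (1/6)..0} \<subseteq> {1/6..26/27 :: real}"
    proof (rule image_subsetI)
      fix t :: real assume "t \<in> {- (1/6)..0}"
      then show "hpoly t \<in> {1/6..26/27}"
        using hpoly_mono(1)[of "- (1/6)" t] hpoly_mono(1)[of t 0] unfolding hpoly_vals by auto
    qed
    show "{1/6..26/27} \<subseteq> hpoly ` {- (1/6)..0 :: real}" using IVT[of "- (1/6)" 0] hpoly_vals by simp
  qed
  show "hpoly ` {0..tau_star} = {x_star..26/27}"
  proof (rule antisym)
    show "hpoly ` {0..tau_star} \<subseteq> {x_star..26/27}"
    proof (rule image_subsetI)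
      fix t :: real assume "t \<in> {0..tau_star}"
      then show "hpoly t \<in> {x_star..26/27}"
        using hpoly_mono(2)[of 0 t] hpoly_mono(2)[of t tau_star] unfolding hpoly_vals hpoly_tau_star by auto
    qed
    show "{x_star..26/27} \<subseteq> hpoly ` {0..tau_star}" using IVT[of 0 tau_star] hpoly_vals hpoly_tau_star b xs by simp
  qed
  show "hpoly ` {tau_star..1/3} = {x_star..2/3}"
  proof (rule antisym)
    show "hpoly ` {tau_star..1/3} \<subseteq> {x_star..2/3}"
    proof (rule image_subsetI)
      fix t :: real assume "t \<in> {tau_star..1/3}"
      then show "hpoly t \<in> {x_star..2/3}"
        using hpoly_mono(3)[of tau_star t] hpoly_mono(3)[of t "1/3"] unfolding hpoly_vals hpoly_tau_star by auto
    qed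
    show "{x_star..2/3} \<subseteq> hpoly ` {tau_star..1/3}" using IVT[of tau_star "1/3"] hpoly_vals hpoly_tau_star b xs by simp
  qed
qed

lemma root_eq:
  "c \<in> {1/6..26/27} \<Longrightarrow> hpoly (rootC c) = c" "c \<in> {x_star..26/27} \<Longrightarrow> hpoly (rootB c) = c"
  "c \<in> {x_star..2/3} \<Longrightarrow> hpoly (rootA c) = c"
  unfolding rootC_def rootB_def rootA_def hpoly_image[symmetric]
  by (auto intro!: f_the_inv_into_f hpoly_inj)

lemma root_of_hpoly:
  "t \<in> {- (1/6)..0} \<Longrightarrow> rootC (hpoly t) = t" "t \<in> {0..tau_star} \<Longrightarrow> rootB (hpoly t) = t"
  "t \<in> {tau_star..1/3} \<Longrightarrow> rootA (hpoly t) = t"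
  unfolding rootC_def rootB_def rootA_def by (auto intro!: the_inv_into_f_f hpoly_inj)

lemma root_range:
  "c \<in> {1/6..26/27} \<Longrightarrow> rootC c \<in> {- (1/6)..0}" "c \<in> {x_star..26/27} \<Longrightarrow> rootB c \<in> {0..tau_star}"
  "c \<in> {x_star..2/3} \<Longrightarrow> rootA c \<in> {tau_star..1/3}"
  unfolding rootC_def rootB_def rootA_def hpoly_image[symmetric]
  by (blast intro!: the_inv_into_into hpoly_inj)+

lemma root_range_open:
  "1/6 < c \<Longrightarrow> c < 26/27 \<Longrightarrow> - (1/6) < rootC c \<and> rootC c < 0"
  "x_star < c \<Longrightarrow> c < 26/27 \<Longrightarrow> 0 < rootB c \<and> rootB c < tau_star"
  "x_star < c \<Longrightarrow> c < 2/3 \<Longrightarrow> tau_star < rootA c \<and> rootA c < 1/3"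
proof -
  show "- (1/6) < rootC c \<and> rootC c < 0" if "1/6 < c" "c < 26/27"
    using that root_range(1)[of c] root_eq(1)[of c] hpoly_vals by (cases "rootC c = - (1/6)"; cases "rootC c = 0") auto
  show "0 < rootB c \<and> rootB c < tau_star" if "x_star < c" "c < 26/27"
    using that root_range(2)[of c] root_eq(2)[of c] hpoly_vals hpoly_tau_star by (cases "rootB c = 0"; cases "rootB c = tau_star") auto
  show "tau_star < rootA c \<and> rootA c < 1/3" if "x_star < c" "c < 2/3"
    using that root_range(3)[of c] root_eq(3)[of c] hpoly_vals hpoly_tau_star by (cases "rootA c = tau_star"; cases "rootA c = 1/3") auto
qed

lemma root_continuous_on:
  "continuous_on {1/6..26/27} rootC" "continuous_on {x_star..26/27} rootB" "continuous_on {x_star..2/3} rootA"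
  unfolding hpoly_image[symmetric]
  by (rule continuous_on_inv[OF hpoly_continuous]; use root_of_hpoly in auto)+

lemma root_real_analytic:
  "1/6 < c \<Longrightarrow> c < 26/27 \<Longrightarrow> real_analytic_at rootC c"
  "x_star < c \<Longrightarrow> c < 26/27 \<Longrightarrow> real_analytic_at rootB c"
  "x_star < c \<Longrightarrow> c < 2/3 \<Longrightarrow> real_analytic_at rootA c"
proof -
  have P: "(hpoly :: complex \<Rightarrow> complex) holomorphic_on UNIV" "hpoly (complex_of_real t) = of_real (hpoly t)" for t
    unfolding hpoly_def by (auto intro!: holomorphic_intros)
  have ev: "\<forall>\<^sub>F x in nhds c. x \<in> {a<..<b}" if "a < c" "c < b" for a b c :: real
    using that by (intro eventually_nhds_in_open) auto
  show "real_analytic_at rootC c" if c: "1/6 < c" "c < 26/27"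
  proof (rule real_analytic_at_local_inverse[OF P hpoly_deriv])
    show "hpoly' (rootC c) \<noteq> 0" using hpoly'_sign(1)[of "rootC c"] root_range_open(1)[OF c] by auto
    show "isCont rootC c"
      using continuous_on_interior[OF root_continuous_on(1)] c by simp
    show "\<forall>\<^sub>F x in nhds c. hpoly (rootC x) = x"
      using ev[OF c] by eventually_elim (auto intro!: root_eq)
  qed
  show "real_analytic_at rootB c" if c: "x_star < c" "c < 26/27"
  proof (rule real_analytic_at_local_inverse[OF P hpoly_deriv])
    show "hpoly' (rootB c) \<noteq> 0" using hpoly'_sign(2)[of "rootB c"] root_range_open(2)[OF c] by auto
    show "isCont rootB c"
      using continuous_on_interior[OF root_continuous_on(2)] c by simp
    show "\<forall>\<^sub>F x in nhds c. hpoly (rootB x) = x"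
      using ev[OF c] by eventually_elim (auto intro!: root_eq)
  qed
  show "real_analytic_at rootA c" if c: "x_star < c" "c < 2/3"
  proof (rule real_analytic_at_local_inverse[OF P hpoly_deriv])
    show "hpoly' (rootA c) \<noteq> 0" using hpoly'_sign(3)[of "rootA c"] root_range_open(3)[OF c] by auto
    show "isCont rootA c"
      using continuous_on_interior[OF root_continuous_on(3)] c by simp
    show "\<forall>\<^sub>F x in nhds c. hpoly (rootA x) = x"
      using ev[OF c] by eventually_elim (auto intro!: root_eq)
  qed
qed

section \<open>Factorisation of the discriminant\<close>

definition mval :: "'a::real_normed_field \<Rightarrow> 'a" where
  "mval t = 1/3 + 6 * t\<^sup>2"

lemma disc3_1: "disc3 1 b c = b\<^sup>2 - 4 * b^3 - 4 * c + 18 * b * c - 27 * c\<^sup>2"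
  by (simp add: disc3_def)

text \<open>For fixed \<open>m\<close> the discriminant is quadratic in \<open>c\<close>. Its zeros
  are the values of the statistic at the two weight triples with a repeated entry and sum of squares
  \<open>mval t\<close>, belonging to \<open>t\<close> and \<open>- t\<close>.\<close>

lemma cubic_disc_mval: "cubic_disc c (mval t) = 3/64 * (c - hpoly (- t)) * (hpoly t - c)"
  unfolding cubic_disc_def disc3_1 cubic_b_def mval_def hpoly_def by algebra

lemma cubic_b_root: "cubic_b (hpoly t) (mval t) = (1/3 - t)\<^sup>2 * (1/3 + 2 * t)"
  unfolding cubic_b_def mval_def hpoly_def by algebra

lemma mval_less_iff: "0 \<le> s \<Longrightarrow> 0 \<le> t \<Longrightarrow> mval s < mval t \<longleftrightarrow> s < (t::real)"
  using power_strict_mono[of s t 2] power2_less_imp_less[of s t] by (auto simp: mval_def)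

lemma mval_cases:
  assumes "1/3 < m" "m < 1"
  obtains t :: real where "0 < t" "t < 1/3" "m = mval t"
proof
  show "0 < sqrt ((m - 1/3) / 6)" using assms by simp
  show "sqrt ((m - 1/3) / 6) < 1/3" using assms by (intro real_less_lsqrt) (auto simp: power2_eq_square)
  show "m = mval (sqrt ((m - 1/3) / 6))" using assms by (simp add: mval_def) (simp add: field_simps)
qed

text \<open>The discriminant is a cube minus a square up to a constant, so its positivity forces the
  base \<open>1 - 3 * a\<close> of the cube to be positive.\<close>

lemma cubic_disc_pos_imp: "cubic_disc c m > 0 \<Longrightarrow> m > 1/3"
proof -
  assume D: "cubic_disc c m > 0"
  define a b where "a = (1 - m) / 2" and "b = cubic_b c m"
  have "27 * cubic_disc c m = 4 * (1 - 3 * a)^3 - (2 - 9 * a + 27 * b)\<^sup>2"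
    unfolding cubic_disc_def a_def[symmetric] b_def[symmetric] disc3_1 by algebra
  then have "4 * (1 - 3 * a)^3 > 0" using D zero_le_power2[of "2 - 9 * a + 27 * b"] by linarith
  then have "1 - 3 * a > 0" by (simp add: zero_less_power_eq)
  then show "m > 1/3" by (simp add: a_def)
qed

lemma cubic_disc_pos_iff:
  assumes "0 < t"
  shows "cubic_disc c (mval t) > 0 \<longleftrightarrow> hpoly (- t) < c \<and> c < hpoly t"
  using hpoly_minus_less[OF assms] unfolding cubic_disc_mval by (auto simp: zero_less_mult_iff)

text \<open>With \<open>\<kappa> = 3 c / 2\<close>, \<open>48 * cubic_disc c m\<close> is the quartic \<open>quart \<kappa> m\<close>; \<open>cofac1\<close> and \<open>- cofac2\<close> are
  its first and second divided differences.\<close>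

definition quart :: "'a::real_normed_field \<Rightarrow> 'a \<Rightarrow> 'a" where
  "quart \<kappa> m = - (m^4) + 36 * m^3 + (2 * \<kappa> - 200/3) * m\<^sup>2 + (48 - 12 * \<kappa>) * m + (- 12 + 20/3 * \<kappa> - \<kappa>\<^sup>2)"

definition cofac1 :: "'a::real_normed_field \<Rightarrow> 'a \<Rightarrow> 'a \<Rightarrow> 'a" where
  "cofac1 \<kappa> m r = - (m^3 + m\<^sup>2 * r + m * r\<^sup>2 + r^3) + 36 * (m\<^sup>2 + m * r + r\<^sup>2) + (2 * \<kappa> - 200/3) * (m + r) + 48 - 12 * \<kappa>"

definition cofac2 :: "'a::real_normed_field \<Rightarrow> 'a \<Rightarrow> 'a \<Rightarrow> 'a \<Rightarrow> 'a" where
  "cofac2 \<kappa> m r r' = m\<^sup>2 + m * (r + r') + r\<^sup>2 + r * r' + r'\<^sup>2 - 36 * (m + r + r') - 2 * \<kappa> + 200/3"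

lemma cubic_disc_quart: "cubic_disc c m = quart (3 * c / 2) m / 48"
proof -
  have "disc3 1 ((1 - m) / 2) ((\<kappa> - m\<^sup>2) / 36) = quart \<kappa> m / 48" for \<kappa>
  proof -
    define a b where "a = (1 - m) / 2" and "b = (\<kappa> - m\<^sup>2) / 36"
    have m: "m = 1 - 2 * a" by (simp add: a_def field_simps)
    have "\<kappa> = 36 * b + m\<^sup>2" by (simp add: b_def field_simps)
    then have k: "\<kappa> = 36 * b + (1 - 2 * a)\<^sup>2" using m by simp
    have "48 * disc3 1 a b = quart (36 * b + (1 - 2 * a)\<^sup>2) (1 - 2 * a)"
      unfolding disc3_1 quart_def by algebra
    then have "disc3 1 a b = quart \<kappa> m / 48" using m k by simp
    then show ?thesis by (simp only: a_def b_def)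
  qed
  then show ?thesis by (simp add: cubic_disc_def cubic_b_def)
qed

lemma quart_diff: "quart \<kappa> m - quart \<kappa> r = (m - r) * cofac1 \<kappa> m r"
  unfolding quart_def cofac1_def by algebra

lemma cofac1_diff: "cofac1 \<kappa> m r - cofac1 \<kappa> r' r = - ((m - r') * cofac2 \<kappa> m r r')"
  unfolding cofac1_def cofac2_def by algebra

lemma cofac2_commute: "cofac2 \<kappa> m r r' = cofac2 \<kappa> m r' r"
  unfolding cofac2_def by algebra

text \<open>On the diagonal \<open>cofac1\<close> is the derivative of the quartic in
  \<open>m\<close>. Differentiating the factored discriminant along \<open>t\<close>, with
  \<open>dm/dt = 12 * t\<close> and \<open>hpoly t - hpoly (- t) = 96 * t^3\<close>, gives the right
  side, whose sign for \<open>t \<noteq> 0\<close> is that of \<open>hpoly' t\<close>.\<close>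

lemma cofac1_double: "cofac1 (3 * hpoly t / 2) (mval t) (mval t) = 18 * t\<^sup>2 * hpoly' t"
  unfolding cofac1_def mval_def hpoly_def hpoly'_eq
  by (simp add: field_simps power2_eq_square power3_eq_cube power4_eq_xxxx)

lemma quart_root: "quart (3 * hpoly t / 2) (mval (t::real)) = 0"
  using cubic_disc_mval[of "hpoly t" t] cubic_disc_quart[of "hpoly t" "mval t"] by simp

section \<open>Order of the end points and support of the integrand\<close>

definition rC where "rC c = mval (rootC c)"
definition rB where "rB c = mval (rootB c)"
definition rA where "rA c = mval (rootA c)"
text \<open>The positive zero of \<open>cubic_b c\<close>, where the product of the three squared
  coordinates vanishes.\<close>

definition kap where "kap c = sqrt (3 * c / 2)"

lemma kap_sq: "c \<ge> 0 \<Longrightarrow> (kap c)\<^sup>2 = 3 * c / 2" and kap_nonneg: "c \<ge> 0 \<Longrightarrow> kap c \<ge> 0"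
  by (simp_all add: kap_def)

lemma mval_minus: "mval (- t) = mval t"
  by (simp add: mval_def)

lemma mval_tau_star: "mval tau_star < 0.72"
proof -
  have "tau_star\<^sup>2 < 0.2535\<^sup>2" using tau_star_bounds by (intro power_strict_mono) auto
  then show ?thesis by (simp add: mval_def power2_eq_square)
qed

lemma cubic_b_pos_iff: "c \<ge> 0 \<Longrightarrow> m \<ge> 0 \<Longrightarrow> cubic_b c m > 0 \<longleftrightarrow> m < kap c"
proof -
  assume "c \<ge> 0" "m \<ge> 0"
  have "cubic_b c m > 0 \<longleftrightarrow> m\<^sup>2 < (kap c)\<^sup>2" using \<open>c \<ge> 0\<close> by (simp add: cubic_b_def kap_sq)
  also have "\<dots> \<longleftrightarrow> m < kap c"
    using \<open>m \<ge> 0\<close> kap_nonneg[OF \<open>c \<ge> 0\<close>] power2_less_imp_less[of m "kap c"] power_strict_mono[of m "kap c" 2] by auto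
  finally show ?thesis .
qed

text \<open>At a double root the product of the weights is
  \<open>(1/3 - t)\<^sup>2 * (1/3 + 2 * t)\<close>, positive in this range, and positivity of
  \<open>cubic_b\<close> means \<open>m < kap c\<close>.\<close>

lemma mval_less_kap:
  assumes "hpoly t = c" "- (1/6) < t" "t < 1/3" "c \<ge> 0"
  shows "mval t < kap c"
proof -
  have "cubic_b c (mval t) > 0"
    using assms(2,3) unfolding assms(1)[symmetric] cubic_b_root by simp
  moreover have "mval t \<ge> 0" by (simp add: mval_def)
  ultimately show ?thesis using cubic_b_pos_iff assms(4) by blast
qed

lemma rC_less_kap: "1/6 < c \<Longrightarrow> c < 26/27 \<Longrightarrow> rC c < kap c"
  unfolding rC_def using root_range_open(1)[of c] root_eq(1)[of c] by (intro mval_less_kap) auto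

lemma rA_less_kap: "x_star < c \<Longrightarrow> c < 2/3 \<Longrightarrow> rA c < kap c"
  unfolding rA_def using root_range_open(3)[of c] root_eq(3)[of c] tau_star_bounds x_star_bounds
  by (intro mval_less_kap) auto

lemma rB_less_kap: "x_star < c \<Longrightarrow> c < 26/27 \<Longrightarrow> rB c < kap c"
  unfolding rB_def using root_range_open(2)[of c] root_eq(2)[of c] tau_star_bounds x_star_bounds
  by (intro mval_less_kap) auto

lemma kap_less_1: "c < 2/3 \<Longrightarrow> kap c < 1"
  by (simp add: kap_def)

text \<open>Since \<open>hpoly (- rootB c)\<close> is below
  \<open>hpoly (rootB c) = c = hpoly (rootC c)\<close>, monotonicity on the negative axis puts
  \<open>- rootB c\<close> left of \<open>rootC c\<close>; \<open>mval\<close> is even.\<close>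

lemma rC_less_rB: "x_star < c \<Longrightarrow> c < 26/27 \<Longrightarrow> rC c < rB c"
proof -
  assume c: "x_star < c" "c < 26/27"
  have C: "- (1/6) < rootC c" "rootC c < 0" "hpoly (rootC c) = c"
    using root_range_open(1)[of c] root_eq(1)[of c] c x_star_bounds by auto
  have B: "0 < rootB c" "rootB c < tau_star" "hpoly (rootB c) = c"
    using root_range_open(2)[of c] root_eq(2)[of c] c by auto
  have "hpoly (- rootB c) < hpoly (rootC c)" using hpoly_minus_less[OF B(1)] B C by simp
  then have "- rootB c < rootC c"
    using hpoly_mono(1)[of "rootC c" "- rootB c"] B C tau_star_bounds by (cases "- rootB c < rootC c") auto
  then have "mval (- rootC c) < mval (rootB c)" using B C by (subst mval_less_iff) auto
  then show ?thesis by (simp add: rC_def rB_def mval_minus)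
qed

lemma hpoly_minus_less_iff:
  assumes c: "1/6 < c" "c < 26/27" and t: "0 < t" "t \<le> 1/3"
  shows "hpoly (- t) < c \<longleftrightarrow> rC c < mval t"
proof -
  have C: "- (1/6) < rootC c" "rootC c < 0" "hpoly (rootC c) = c"
    using root_range_open(1)[of c] root_eq(1)[of c] c by auto
  have "hpoly (- t) < c \<longleftrightarrow> - t < rootC c"
    using hpoly_increasing_neg[of "- t" "rootC c"] hpoly_mono(1)[of "rootC c" "- t"] C t by linarith
  also have "\<dots> \<longleftrightarrow> mval (- rootC c) < mval t" using C t by (subst mval_less_iff) auto
  finally show ?thesis by (simp add: rC_def mval_minus)
qed

text \<open>On the positive range \<open>hpoly\<close> falls from \<open>26/27\<close> to
  \<open>x_star\<close> and then rises to \<open>2/3\<close>. Its superlevel set is therefore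
  everything, a left and a right piece, or a left piece only, according to the level
  \<open>c\<close>.\<close>

lemma less_hpoly_iff:
  assumes t: "0 < t" "t < 1/3"
  shows "c < x_star \<Longrightarrow> c < hpoly t"
    and "x_star < c \<Longrightarrow> c < 2/3 \<Longrightarrow> c < hpoly t \<longleftrightarrow> mval t < rB c \<or> rA c < mval t"
    and "2/3 \<le> c \<Longrightarrow> c < 26/27 \<Longrightarrow> c < hpoly t \<longleftrightarrow> mval t < rB c"
proof -
  show "c < x_star \<Longrightarrow> c < hpoly t"
    using hpoly_mono(2)[of t tau_star] hpoly_mono(3)[of tau_star t] t hpoly_tau_star by (cases "t \<le> tau_star") auto
  have left: "c < hpoly t \<longleftrightarrow> mval t < rB c" if "x_star < c" "c < 26/27" "t \<le> tau_star"
  proof -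
    have B: "0 < rootB c" "rootB c < tau_star" "hpoly (rootB c) = c"
      using root_range_open(2)[of c] root_eq(2)[of c] that by auto
    have "c < hpoly t \<longleftrightarrow> t < rootB c"
      using hpoly_decreasing[of t "rootB c"] hpoly_mono(2)[of "rootB c" t] B t that by linarith
    then show ?thesis using B t mval_less_iff[of t "rootB c"] by (simp add: rB_def)
  qed
  have rB: "rB c < mval tau_star" if "x_star < c" "c < 26/27"
    using root_range_open(2)[OF that] tau_star_bounds unfolding rB_def by (subst mval_less_iff) auto
  have tm: "mval tau_star < mval t" if "tau_star < t"
    using that t tau_star_bounds by (subst mval_less_iff) auto
  have right: "c < hpoly t \<longleftrightarrow> rA c < mval t" if "x_star < c" "c < 2/3" "tau_star < t"
  proof -
    have A: "tau_star < rootA c" "rootA c < 1/3" "hpoly (rootA c) = c"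
      using root_range_open(3)[of c] root_eq(3)[of c] that by auto
    have "c < hpoly t \<longleftrightarrow> rootA c < t"
      using hpoly_increasing[of "rootA c" t] hpoly_mono(3)[of t "rootA c"] A t that by linarith
    then show ?thesis using A t mval_less_iff[of "rootA c" t] tau_star_bounds by (simp add: rA_def)
  qed
  have rA: "mval tau_star < rA c" if "x_star < c" "c < 2/3"
    using root_range_open(3)[OF that] tau_star_bounds unfolding rA_def by (subst mval_less_iff) auto
  have tl: "mval t \<le> mval tau_star" if "t \<le> tau_star"
    using that t tau_star_bounds mval_less_iff[of t tau_star] by (cases "t = tau_star") auto
  show "x_star < c \<Longrightarrow> c < 2/3 \<Longrightarrow> c < hpoly t \<longleftrightarrow> mval t < rB c \<or> rA c < mval t"
    using left right rA tl rB tm by (cases "t \<le> tau_star") force+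
  show "2/3 \<le> c \<Longrightarrow> c < 26/27 \<Longrightarrow> c < hpoly t \<longleftrightarrow> mval t < rB c"
  proof (cases "t \<le> tau_star")
    case True
    then show "2/3 \<le> c \<Longrightarrow> c < 26/27 \<Longrightarrow> c < hpoly t \<longleftrightarrow> mval t < rB c" using left x_star_bounds by auto
  next
    case False
    assume c: "2/3 \<le> c" "c < 26/27"
    have "hpoly t < 2/3" using hpoly_increasing[of t "1/3"] False t hpoly_vals(2) by auto
    then show "c < hpoly t \<longleftrightarrow> mval t < rB c" using c rB tm False x_star_bounds by fastforce
  qed
qed

definition kern_support :: "real \<Rightarrow> real set" where
  "kern_support c = {m. m < 1 \<and> 0 < cubic_b c m \<and> 0 < cubic_disc c m}"

lemma mem_kern_support:
  assumes c: "1/6 < c" "c < 26/27"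
  shows "m \<in> kern_support c \<longleftrightarrow> (\<exists>t. 0 < t \<and> t < 1/3 \<and> m = mval t \<and> rC c < m \<and> m < kap c \<and> c < hpoly t)"
proof
  assume m: "m \<in> kern_support c"
  then have "1/3 < m" "m < 1" using cubic_disc_pos_imp by (auto simp: kern_support_def)
  then obtain t where t: "0 < t" "t < 1/3" "m = mval t" using mval_cases by blast
  then show "\<exists>t. 0 < t \<and> t < 1/3 \<and> m = mval t \<and> rC c < m \<and> m < kap c \<and> c < hpoly t"
    using m cubic_disc_pos_iff[OF t(1)] hpoly_minus_less_iff[OF c t(1)] cubic_b_pos_iff[of c m] c \<open>1/3 < m\<close>
    by (intro exI[of _ t]) (auto simp: kern_support_def)
next
  assume "\<exists>t. 0 < t \<and> t < 1/3 \<and> m = mval t \<and> rC c < m \<and> m < kap c \<and> c < hpoly t"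
  then obtain t where t: "0 < t" "t < 1/3" "m = mval t" "rC c < m" "m < kap c" "c < hpoly t" by blast
  have "mval t < mval (1/3)" using t by (subst mval_less_iff) auto
  then have "m < 1" using t by (simp add: mval_def power2_eq_square)
  moreover have "0 \<le> m" using t by (simp add: mval_def)
  ultimately show "m \<in> kern_support c"
    using t cubic_disc_pos_iff[OF t(1)] hpoly_minus_less_iff[OF c t(1)] cubic_b_pos_iff[of c m] c
    by (auto simp: kern_support_def)
qed

lemma rC_gt: "1/6 < c \<Longrightarrow> c < 26/27 \<Longrightarrow> 1/3 < rC c"
  using root_range_open(1)[of c] by (simp add: rC_def mval_def)

lemma kern_support_low:
  assumes c: "1/6 < c" "c < x_star"
  shows "kern_support c = {rC c<..<kap c}"
proof -
  have c': "1/6 < c" "c < 26/27" "c < 2/3" using c x_star_bounds by auto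
  show ?thesis
  proof (rule set_eqI)
    fix m show "m \<in> kern_support c \<longleftrightarrow> m \<in> {rC c<..<kap c}"
    proof
      assume m: "m \<in> {rC c<..<kap c}"
      then have "1/3 < m" "m < 1" using rC_gt[OF c'(1,2)] kap_less_1[OF c'(3)] by auto
      then obtain t where t: "0 < t" "t < 1/3" "m = mval t" using mval_cases by blast
      then show "m \<in> kern_support c"
        unfolding mem_kern_support[OF c'(1,2)] using m less_hpoly_iff(1)[OF t(1,2) c(2)] by auto
    qed (auto simp: mem_kern_support[OF c'(1,2)])
  qed
qed

text \<open>Above \<open>x_star\<close> a gap opens around \<open>mval tau_star\<close>; this splits
  the support in two.\<close>

lemma kern_support_mid:
  assumes c: "x_star < c" "c < 2/3"
  shows "kern_support c = {rC c<..<rB c} \<union> {rA c<..<kap c}" "rB c < rA c"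
proof -
  have c': "1/6 < c" "c < 26/27" using c x_star_bounds by auto
  have BA: "rB c < mval tau_star" "mval tau_star < rA c"
    using root_range_open(2)[of c] root_range_open(3)[of c] c c' tau_star_bounds unfolding rB_def rA_def
    by (auto simp: mval_less_iff)
  then show "rB c < rA c" by simp
  show "kern_support c = {rC c<..<rB c} \<union> {rA c<..<kap c}"
  proof (rule set_eqI)
    fix m show "m \<in> kern_support c \<longleftrightarrow> m \<in> {rC c<..<rB c} \<union> {rA c<..<kap c}"
    proof
      assume m: "m \<in> {rC c<..<rB c} \<union> {rA c<..<kap c}"
      then have mk: "rC c < m" "m < kap c"
        using rB_less_kap[OF c(1) c'(2)] rC_less_rB[OF c(1) c'(2)] BA by auto
      then have "1/3 < m" "m < 1" using rC_gt[OF c'] kap_less_1[OF c(2)] by auto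
      then obtain t where t: "0 < t" "t < 1/3" "m = mval t" using mval_cases by blast
      then show "m \<in> kern_support c"
        unfolding mem_kern_support[OF c'] using m mk less_hpoly_iff(2)[OF t(1,2) c] by auto
    next
      assume "m \<in> kern_support c"
      then show "m \<in> {rC c<..<rB c} \<union> {rA c<..<kap c}"
        unfolding mem_kern_support[OF c'] using less_hpoly_iff(2)[OF _ _ c] by auto
    qed
  qed
qed

lemma kern_support_high:
  assumes c: "2/3 \<le> c" "c < 26/27"
  shows "kern_support c = {rC c<..<rB c}"
proof -
  have c': "1/6 < c" "c < 26/27" "x_star < c" using c x_star_bounds by auto
  have B: "rB c < mval tau_star"
    using root_range_open(2)[of c] c c' tau_star_bounds unfolding rB_def by (auto simp: mval_less_iff)
  show ?thesis
  proof (rule set_eqI)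
    fix m show "m \<in> kern_support c \<longleftrightarrow> m \<in> {rC c<..<rB c}"
    proof
      assume m: "m \<in> {rC c<..<rB c}"
      then have "1/3 < m" "m < 1" "m < kap c"
        using rC_gt[OF c'(1,2)] rB_less_kap[OF c'(3,2)] B mval_tau_star by auto
      moreover from this obtain t where t: "0 < t" "t < 1/3" "m = mval t" using mval_cases by blast
      ultimately show "m \<in> kern_support c"
        unfolding mem_kern_support[OF c'(1,2)] using m less_hpoly_iff(3)[OF t(1,2) c] by auto
    next
      assume "m \<in> kern_support c"
      then show "m \<in> {rC c<..<rB c}"
        unfolding mem_kern_support[OF c'(1,2)] using less_hpoly_iff(3)[OF _ _ c] by auto
    qed
  qed
qed

text \<open>\<open>single_q\<close> and \<open>double_q\<close> are what remains of \<open>cubic_b * cubic_disc\<close> after the zeros at the end points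
  of the interval of integration have been divided out.\<close>

definition single_q :: "'a::real_normed_field \<Rightarrow> 'a \<Rightarrow> 'a \<Rightarrow> 'a" where
  "single_q r k m = (k + m) * cofac1 (k\<^sup>2) m r / 1728"

definition double_q :: "'a::real_normed_field \<Rightarrow> 'a \<Rightarrow> 'a \<Rightarrow> 'a \<Rightarrow> 'a" where
  "double_q r r' c m = (3 * c / 2 - m\<^sup>2) * cofac2 (3 * c / 2) m r r' / 1728"

lemma single_q_eq:
  assumes "c \<ge> 0" "quart (3 * c / 2) r = 0"
  shows "cubic_b c m * cubic_disc c m = (m - r) * (kap c - m) * single_q r (kap c) m"
proof -
  have q: "quart (3 * c / 2) m = (m - r) * cofac1 (3 * c / 2) m r" using quart_diff[of "3 * c / 2" m r] assms(2) by simp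
  have "cubic_b c m = (kap c - m) * (kap c + m) / 36"
    unfolding cubic_b_def kap_sq[OF assms(1), symmetric] by algebra
  then show ?thesis
    unfolding cubic_disc_quart q single_q_def kap_sq[OF assms(1)] by simp
qed

lemma double_q_eq:
  assumes "quart (3 * c / 2) r = 0" "quart (3 * c / 2) r' = 0" "r \<noteq> r'"
  shows "cubic_b c m * cubic_disc c m = (m - r) * (r' - m) * double_q r r' c m"
    and "cofac1 (3 * c / 2) r' r = 0"
proof -
  have q: "quart (3 * c / 2) m = (m - r) * cofac1 (3 * c / 2) m r" for m
    using quart_diff[of "3 * c / 2" m r] assms(1) by simp
  show z: "cofac1 (3 * c / 2) r' r = 0" using q[of r'] assms(2,3) by simp
  have "cofac1 (3 * c / 2) m r = (r' - m) * cofac2 (3 * c / 2) m r r'"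
    using cofac1_diff[of "3 * c / 2" m r r'] z by (simp add: algebra_simps)
  then show "cubic_b c m * cubic_disc c m = (m - r) * (r' - m) * double_q r r' c m"
    unfolding cubic_disc_quart q double_q_def cubic_b_def by simp
qed

lemma kern_support_pos: "m \<in> kern_support c \<Longrightarrow> cubic_b c m * cubic_disc c m > 0"
  by (simp add: kern_support_def)

lemma quart_roots:
  "c \<in> {1/6..26/27} \<Longrightarrow> quart (3 * c / 2) (rC c) = 0" "c \<in> {x_star..26/27} \<Longrightarrow> quart (3 * c / 2) (rB c) = 0"
  "c \<in> {x_star..2/3} \<Longrightarrow> quart (3 * c / 2) (rA c) = 0"
  using quart_root[of "rootC c"] quart_root[of "rootB c"] quart_root[of "rootA c"] root_eq[of c]
  by (auto simp: rC_def rB_def rA_def)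

section \<open>Positivity of the reduced polynomials\<close>

lemma single_q_pos:
  assumes c: "0 < c" and t: "hpoly t = c" and r: "r = mval t" "t \<noteq> 0" "hpoly' t > 0" and k: "r < kap c" "kap c < 1"
    and supp: "{r<..<kap c} \<subseteq> kern_support c" and end1: "cubic_disc c (kap c) > 0"
    and m: "r \<le> m" "m \<le> kap c"
  shows "single_q r (kap c) m > 0"
proof -
  have q0: "quart (3 * c / 2) r = 0" using quart_root[of t] t r by simp
  have "r > 0" unfolding r(1) mval_def by (simp add: add_pos_nonneg)
  then have pos: "kap c + m > 0" using m k by simp
  have "cofac1 (3 * c / 2) m r > 0"
  proof (cases "m = r")
    case True
    then show ?thesis using cofac1_double[of t] t r by (simp add: zero_less_mult_iff)
  next
    case False
    have "cubic_disc c m > 0"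
    proof (cases "m = kap c")
      case True
      then show ?thesis using end1 by simp
    next
      case False
      then have "m \<in> {r<..<kap c}" using m \<open>m \<noteq> r\<close> by simp
      then show ?thesis using supp by (auto simp: kern_support_def)
    qed
    then have "(m - r) * cofac1 (3 * c / 2) m r > 0"
      unfolding cubic_disc_quart using quart_diff[of "3 * c / 2" m r] q0 by simp
    then show ?thesis using m False by (simp add: zero_less_mult_iff)
  qed
  then show ?thesis using pos c by (simp add: single_q_def kap_sq)
qed

lemma single_q_pos_low:
  assumes c: "1/6 < c" "c < x_star" and m: "rC c \<le> m" "m \<le> kap c"
  shows "single_q (rC c) (kap c) m > 0"
proof (rule single_q_pos[OF _ _ rC_def])
  have c': "c < 26/27" "c < 2/3" using c x_star_bounds by auto
  show k: "rC c < kap c" "kap c < 1" using rC_less_kap[OF c(1) c'(1)] kap_less_1[OF c'(2)] by auto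
  have R: "- (1/6) < rootC c" "rootC c < 0" using root_range_open(1)[OF c(1) c'(1)] by auto
  then show "rootC c \<noteq> 0" "hpoly' (rootC c) > 0" using hpoly'_sign(1)[of "rootC c"] by auto
  have "1/3 < kap c" using k(1) rC_gt[OF c(1) c'(1)] by linarith
  then obtain t where t: "0 < t" "t < 1/3" "kap c = mval t" using mval_cases[of "kap c"] k(2) by blast
  show "cubic_disc c (kap c) > 0"
    unfolding t(3) cubic_disc_pos_iff[OF t(1)]
    using less_hpoly_iff(1)[OF t(1,2) c(2)] hpoly_minus_less_iff[OF c(1) c'(1) t(1)] t(2) k(1) unfolding t(3)
    by simp
qed (use c m kern_support_low[OF c] root_eq(1)[of c] x_star_bounds in auto)

lemma single_q_pos_mid:
  assumes c: "x_star < c" "c < 2/3" and m: "rA c \<le> m" "m \<le> kap c"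
  shows "single_q (rA c) (kap c) m > 0"
proof (rule single_q_pos[OF _ _ rA_def])
  have c': "1/6 < c" "c < 26/27" using c x_star_bounds by auto
  show k: "rA c < kap c" "kap c < 1" using rA_less_kap[OF c] kap_less_1[OF c(2)] by auto
  have R: "tau_star < rootA c" "rootA c < 1/3" using root_range_open(3)[OF c] by auto
  then show "rootA c \<noteq> 0" "hpoly' (rootA c) > 0" using hpoly'_sign(3)[of "rootA c"] tau_star_bounds by auto
  have rr: "rC c < rA c" using kern_support_mid(2)[OF c] rC_less_rB[OF c(1) c'(2)] by simp
  have "1/3 < kap c" using k(1) rC_gt[OF c'] rr by linarith
  then obtain t where t: "0 < t" "t < 1/3" "kap c = mval t" using mval_cases[of "kap c"] k(2) by blast
  show "cubic_disc c (kap c) > 0"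
    unfolding t(3) cubic_disc_pos_iff[OF t(1)]
    using less_hpoly_iff(2)[OF t(1,2) c] hpoly_minus_less_iff[OF c' t(1)] t(2) k(1) rr unfolding t(3) by simp
qed (use c m kern_support_mid[OF c] root_eq(3)[of c] x_star_bounds in auto)

text \<open>Inside, positivity is that of \<open>P\<close> divided by positive factors. At an end,
  \<open>cofac2\<close> is up to sign the derivative of the quartic divided by the length of the
  interval, and \<open>hpoly'\<close> is positive at \<open>rootC c\<close> and negative at
  \<open>rootB c\<close>.\<close>

lemma double_q_pos:
  assumes c: "x_star < c" "c < 26/27" and m: "rC c \<le> m" "m \<le> rB c"
  shows "double_q (rC c) (rB c) c m > 0"
proof -
  have c': "1/6 < c" using c x_star_bounds by auto
  have C: "- (1/6) < rootC c" "rootC c < 0" "hpoly (rootC c) = c" using root_range_open(1)[OF c' c(2)] root_eq(1)[of c] c c' by auto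
  have B: "0 < rootB c" "rootB c < tau_star" "hpoly (rootB c) = c" using root_range_open(2)[OF c] root_eq(2)[of c] c by auto
  have CB: "rC c < rB c" by (rule rC_less_rB[OF c])
  have q: "quart (3 * c / 2) (rC c) = 0" "quart (3 * c / 2) (rB c) = 0" using quart_roots c c' by auto
  have qC: "cofac1 (3 * c / 2) (rB c) (rC c) = 0" and qB: "cofac1 (3 * c / 2) (rC c) (rB c) = 0"
    using double_q_eq(2)[OF q] double_q_eq(2)[OF q(2,1)] CB by auto
  have kp: "3 * c / 2 - m\<^sup>2 > 0"
  proof -
    have "m < kap c" "m \<ge> 0" using m rB_less_kap[OF c] rC_gt[OF c' c(2)] by auto
    then have "m\<^sup>2 < (kap c)\<^sup>2" by (intro power_strict_mono) auto
    then show ?thesis using kap_sq[of c] c' by simp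
  qed
  have "cofac2 (3 * c / 2) m (rC c) (rB c) > 0"
  proof -
    consider "m = rC c" | "m = rB c" | "rC c < m" "m < rB c" using m by fastforce
    then show ?thesis
    proof cases
      case 1
      have "0 < cofac1 (3 * c / 2) (rC c) (rC c)"
        using cofac1_double[of "rootC c"] C hpoly'_sign(1)[of "rootC c"] by (simp add: rC_def)
      then have "0 < (rB c - rC c) * cofac2 (3 * c / 2) (rC c) (rC c) (rB c)"
        using cofac1_diff[of "3 * c / 2" "rC c" "rC c" "rB c"] qC by (simp add: algebra_simps)
      then show ?thesis using CB 1 by (simp add: zero_less_mult_iff)
    next
      case 2
      have "cofac1 (3 * c / 2) (rB c) (rB c) < 0"
        using cofac1_double[of "rootB c"] B hpoly'_sign(2)[of "rootB c"] by (simp add: rB_def mult_pos_neg)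
      then have "0 < (rB c - rC c) * cofac2 (3 * c / 2) (rB c) (rB c) (rC c)"
        using cofac1_diff[of "3 * c / 2" "rB c" "rB c" "rC c"] qB by simp
      then show ?thesis using CB 2 by (simp add: zero_less_mult_iff cofac2_commute)
    next
      case 3
      have "m \<in> kern_support c"
        using 3 kern_support_mid(1)[of c] kern_support_high[of c] c by (cases "c < 2/3") auto
      then have "0 < (m - rC c) * (rB c - m) * double_q (rC c) (rB c) c m"
        using kern_support_pos[of m c] double_q_eq(1)[OF q less_imp_neq[OF CB], of m] by argo
      moreover have "0 < (m - rC c) * (rB c - m)" using 3 by simp
      ultimately have "double_q (rC c) (rB c) c m > 0" using zero_less_mult_pos by blast
      then show ?thesis using kp unfolding double_q_def by (simp add: zero_less_mult_iff)
    qed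
  qed
  then show ?thesis using kp by (simp add: double_q_def)
qed

section \<open>Period integrals and the density\<close>

text \<open>With \<open>m\<close> equal to the midpoint minus the half-length times
  \<open>cos \<theta>\<close>, the root of \<open>(m - r1) * (r2 - m)\<close> is exactly the
  derivative of the substitution and cancels.\<close>

lemma integral_Icc_transform:
  fixes Q :: "real \<Rightarrow> real"
  assumes r: "r1 < r2" and Q: "continuous_on UNIV Q" and pos: "\<And>m. r1 \<le> m \<Longrightarrow> m \<le> r2 \<Longrightarrow> 0 < Q m"
  shows "(\<integral>\<^sup>+m. ennreal (indicator {r1<..<r2} m * (1 / sqrt ((m - r1) * (r2 - m) * Q m))) \<partial>lborel) =
    ennreal (integral {0..pi} (\<lambda>\<theta>. 1 / sqrt (Q ((r1 + r2) / 2 - (r2 - r1) / 2 * cos \<theta>))))"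
proof -
  define h where "h = (r2 - r1) / 2"
  define g where "g \<theta> = (r1 + r2) / 2 - h * cos \<theta>" for \<theta>
  define f where "f m = 1 / sqrt ((m - r1) * (r2 - m) * Q m)" for m
  have h: "h > 0" using r by (simp add: h_def)
  have [measurable]: "Q \<in> borel_measurable borel" using Q by (rule borel_measurable_continuous_onI)
  have g0: "g 0 = r1" "g pi = r2" by (simp_all add: g_def h_def field_simps)
  have gr: "r1 \<le> g \<theta>" "g \<theta> \<le> r2" for \<theta>
  proof -
    have "\<bar>h * cos \<theta>\<bar> \<le> h * 1" unfolding abs_mult using h by (intro mult_mono) auto
    note b = abs_le_D1[OF this] abs_le_D2[OF this]
    show "r1 \<le> g \<theta>" "g \<theta> \<le> r2" using b g0 unfolding g_def by simp_all
  qed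
  have cq: "continuous_on {0..pi} (\<lambda>\<theta>. Q (g \<theta>))"
    unfolding g_def by (intro continuous_on_compose2[OF Q] continuous_intros) auto
  have "(\<integral>\<^sup>+m. ennreal (indicator {r1<..<r2} m * f m) \<partial>lborel) = (\<integral>\<^sup>+m. ennreal (f m) * indicator {g 0..g pi} m \<partial>lborel)"
  proof (rule nn_integral_cong)
    \<comment> \<open>At the end points \<open>f\<close> is \<open>1 / 0 = 0\<close>, so open and
      closed interval give the same integrand pointwise.\<close>
    fix m show "ennreal (indicator {r1<..<r2} m * f m) = ennreal (f m) * indicator {g 0..g pi} m"
      unfolding g0 by (cases "m = r1"; cases "m = r2") (auto simp: f_def indicator_def)
  qed
  also have "\<dots> = (\<integral>\<^sup>+\<theta>. ennreal (f (g \<theta>) * (h * sin \<theta>) * indicator {0..pi} \<theta>) \<partial>lborel)"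
  proof -
    have 1: "set_borel_measurable borel {g 0..g pi} f"
      unfolding set_borel_measurable_def f_def by measurable
    have 2: "(g has_real_derivative h * sin \<theta>) (at \<theta>)" for \<theta>
      unfolding g_def by (auto intro!: derivative_eq_intros)
    have 3: "continuous_on {0..pi} (\<lambda>\<theta>. h * sin \<theta>)" by (intro continuous_intros)
    have 4: "0 \<le> h * sin \<theta>" if "\<theta> \<in> {0..pi}" for \<theta> using that h by (simp add: sin_ge_zero)
    show ?thesis using nn_integral_substitution[OF 1 2 3 4] by (simp add: ennreal_indicator ennreal_mult'')
  qed
  also have "\<dots> = (\<integral>\<^sup>+\<theta>. ennreal (indicator {0..pi} \<theta> * (1 / sqrt (Q (g \<theta>)))) \<partial>lborel)"
  proof (rule nn_integral_cong_AE)
    have "AE \<theta> in lborel. \<theta> \<noteq> (0::real) \<and> \<theta> \<noteq> pi" using AE_lborel_singleton by auto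
    then show "AE \<theta> in lborel. ennreal (f (g \<theta>) * (h * sin \<theta>) * indicator {0..pi} \<theta>) = ennreal (indicator {0..pi} \<theta> * (1 / sqrt (Q (g \<theta>))))"
    proof (rule AE_mp, intro AE_I2 impI)
      fix \<theta> :: real assume ne: "\<theta> \<noteq> 0 \<and> \<theta> \<noteq> pi"
      have "f (g \<theta>) * (h * sin \<theta>) = 1 / sqrt (Q (g \<theta>))" if "\<theta> \<in> {0..pi}"
      proof -
        have s: "sin \<theta> > 0" using that ne by (intro sin_gt_zero) auto
        have "(g \<theta> - r1) * (r2 - g \<theta>) = (h - h * cos \<theta>) * (h + h * cos \<theta>)"
          by (simp add: g_def h_def field_simps)
        also have "\<dots> = h\<^sup>2 * (1 - (cos \<theta>)\<^sup>2)" by algebra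
        also have "\<dots> = (h * sin \<theta>)\<^sup>2" by (simp add: sin_squared_eq power_mult_distrib)
        finally have "sqrt ((g \<theta> - r1) * (r2 - g \<theta>)) = h * sin \<theta>" using h s by simp
        then show ?thesis using h s unfolding f_def real_sqrt_mult by simp
      qed
      then show "ennreal (f (g \<theta>) * (h * sin \<theta>) * indicator {0..pi} \<theta>) = ennreal (indicator {0..pi} \<theta> * (1 / sqrt (Q (g \<theta>))))"
        by (auto simp: indicator_def)
    qed
  qed
  also have "\<dots> = ennreal (integral {0..pi} (\<lambda>\<theta>. 1 / sqrt (Q (g \<theta>))))"
  proof (rule nn_integral_has_integral_lebesgue)
    have "continuous_on {0..pi} (\<lambda>\<theta>. 1 / sqrt (Q (g \<theta>)))"
    proof (intro continuous_intros cq ballI)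
      fix \<theta> show "sqrt (Q (g \<theta>)) \<noteq> 0" using pos[OF gr, of \<theta>] by simp
    qed
    then show "((\<lambda>\<theta>. 1 / sqrt (Q (g \<theta>))) has_integral integral {0..pi} (\<lambda>\<theta>. 1 / sqrt (Q (g \<theta>)))) {0..pi}"
      by (intro integrable_integral integrable_continuous_interval)
    show "0 \<le> 1 / sqrt (Q (g \<theta>))" for \<theta> using pos[OF gr, of \<theta>] by simp
  qed
  finally show ?thesis unfolding f_def g_def h_def .
qed

text \<open>Real counterpart of the tube lemma argument, for the critical values, where only
  one-sided limits of the end points are at hand.\<close>

lemma arcsine_integral_tendsto:
  fixes q :: "real \<Rightarrow> real \<Rightarrow> real \<Rightarrow> real \<Rightarrow> real"
  assumes cont: "continuous_on UNIV (\<lambda>(x, y, z, u). q x y z u)"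
    and pos: "\<And>\<theta>. 0 \<le> \<theta> \<Longrightarrow> \<theta> \<le> pi \<Longrightarrow> q x y z (cos \<theta>) > 0"
    and lim: "(a1 \<longlongrightarrow> x) F" "(a2 \<longlongrightarrow> y) F" "(a3 \<longlongrightarrow> z) F"
  shows "((\<lambda>w. integral {0..pi} (\<lambda>\<theta>. 1 / sqrt (q (a1 w) (a2 w) (a3 w) (cos \<theta>)))) \<longlongrightarrow>
    integral {0..pi} (\<lambda>\<theta>. 1 / sqrt (q x y z (cos \<theta>)))) F"
proof -
  define Q where "Q p \<theta> = q (fst p) (fst (snd p)) (snd (snd p)) (cos \<theta>)" for p \<theta>
  have cQ: "continuous_on UNIV (\<lambda>w. Q (fst w) (snd w))"
  proof -
    have "continuous_on UNIV (\<lambda>w :: (real \<times> real \<times> real) \<times> real. (fst (fst w), fst (snd (fst w)), snd (snd (fst w)), cos (snd w)))"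
      by (intro continuous_intros)
    from continuous_on_compose2[OF cont this] show ?thesis by (simp add: Q_def)
  qed
  define W where "W = {w. 0 < Q (fst w) (snd w)}"
  have "open W" unfolding W_def by (intro open_Collect_less cQ continuous_intros)
  then have "open ((\<lambda>w. (snd w, fst w)) -` W)"
    by (intro open_vimage) (auto intro!: continuous_intros)
  then have op: "openin (top_of_set ({0..pi} \<times> UNIV)) (({0..pi} \<times> UNIV) \<inter> (\<lambda>w. (snd w, fst w)) -` W)"
    by (rule openin_open_Int)
  have sub: "(\<lambda>\<theta>. (\<theta>, (x, y, z))) ` {0..pi} \<subseteq> ({0..pi} \<times> UNIV) \<inter> (\<lambda>w. (snd w, fst w)) -` W"
    using pos by (auto simp: W_def Q_def)
  obtain X where X: "openin (top_of_set UNIV) X" "(x, y, z) \<in> X"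
    "{0..pi} \<times> X \<subseteq> ({0..pi} \<times> UNIV) \<inter> (\<lambda>w. (snd w, fst w)) -` W"
    using tube_lemma[OF compact_Icc _ sub op] by auto
  have "open X" using X(1) by simp
  have XW: "0 < Q p \<theta>" if "p \<in> X" "\<theta> \<in> {0..pi}" for p \<theta>
  proof -
    have "(\<theta>, p) \<in> {0..pi} \<times> X" using that by blast
    from subsetD[OF X(3) this] show ?thesis by (simp add: W_def)
  qed
  have "continuous_on (X \<times> cbox 0 pi) (\<lambda>(p, \<theta>). 1 / sqrt (Q p \<theta>))"
    unfolding case_prod_beta'
  proof (intro continuous_intros continuous_on_subset[OF cQ] ballI)
    fix w assume "w \<in> X \<times> cbox 0 pi"
    then show "sqrt (Q (fst w) (snd w)) \<noteq> 0" using XW[of "fst w" "snd w"] by auto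
  qed simp
  from integral_continuous_on_param[OF this]
  have "continuous_on X (\<lambda>p. integral {0..pi} (\<lambda>\<theta>. 1 / sqrt (Q p \<theta>)))" by simp
  then have "isCont (\<lambda>p. integral {0..pi} (\<lambda>\<theta>. 1 / sqrt (Q p \<theta>))) (x, y, z)"
    using \<open>open X\<close> X(2) by (simp add: continuous_on_eq_continuous_at)
  from isCont_tendsto_compose[OF this tendsto_Pair[OF lim(1) tendsto_Pair[OF lim(2,3)]]]
  show ?thesis by (simp add: Q_def)
qed

section \<open>Periods and the fibre integral in the three regimes\<close>

definition single_period :: "real \<Rightarrow> real \<Rightarrow> real" where
  "single_period r k = integral {0..pi} (\<lambda>\<theta>. 1 / sqrt (single_q r k ((r + k) / 2 - (k - r) / 2 * cos \<theta>)))"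

definition double_period :: "real \<Rightarrow> real \<Rightarrow> real \<Rightarrow> real" where
  "double_period r r' c = integral {0..pi} (\<lambda>\<theta>. 1 / sqrt (double_q r r' c ((r + r') / 2 - (r' - r) / 2 * cos \<theta>)))"

lemma arcsine_range:
  fixes r r' :: real
  assumes "r \<le> r'"
  shows "r \<le> (r + r') / 2 - (r' - r) / 2 * cos \<theta>" "(r + r') / 2 - (r' - r) / 2 * cos \<theta> \<le> r'"
proof -
  have "\<bar>(r' - r) / 2 * cos \<theta>\<bar> \<le> (r' - r) / 2 * 1" unfolding abs_mult using assms by (intro mult_mono) auto
  note b = abs_le_D1[OF this] abs_le_D2[OF this]
  show "r \<le> (r + r') / 2 - (r' - r) / 2 * cos \<theta>" using b(1) by argo
  show "(r + r') / 2 - (r' - r) / 2 * cos \<theta> \<le> r'" using b(2) by argo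
qed

lemma period_nonneg:
  assumes "r \<le> r'" "\<And>m. r \<le> m \<Longrightarrow> m \<le> r' \<Longrightarrow> 0 < Q m"
  shows "0 \<le> integral {0..pi} (\<lambda>\<theta>. 1 / sqrt (Q ((r + r') / 2 - (r' - r) / 2 * cos \<theta>)))"
proof -
  have "0 \<le> 1 / sqrt (Q ((r + r') / 2 - (r' - r) / 2 * cos \<theta>))" for \<theta>
    using assms(2)[OF arcsine_range[OF assms(1), of \<theta>]] by simp
  \<comment> \<open>A non-integrable integrand would have integral \<open>0\<close>, so both cases
    are nonnegative and continuity is not consulted.\<close>
  then show ?thesis
    by (cases "(\<lambda>\<theta>. 1 / sqrt (Q ((r + r') / 2 - (r' - r) / 2 * cos \<theta>))) integrable_on {0..pi}")
      (auto intro: integral_nonneg simp: not_integrable_integral)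
qed

lemma kern_eq: "ennreal (kern c m) = ennreal (indicator (kern_support c) m * (1 / sqrt (cubic_b c m * cubic_disc c m)))"
  by (simp add: kern_def kern_support_def)

lemma single_q_continuous: "continuous_on UNIV (single_q r k :: real \<Rightarrow> real)"
  unfolding single_q_def cofac1_def by (intro continuous_intros) auto

lemma double_q_continuous: "continuous_on UNIV (double_q r r' c :: real \<Rightarrow> real)"
  unfolding double_q_def cofac2_def by (intro continuous_intros) auto

lemma nn_integral_single:
  assumes "r < kap c" "c \<ge> 0" "quart (3 * c / 2) r = 0" "\<And>m. r \<le> m \<Longrightarrow> m \<le> kap c \<Longrightarrow> single_q r (kap c) m > 0"
  shows "(\<integral>\<^sup>+m. ennreal (indicator {r<..<kap c} m * (1 / sqrt (cubic_b c m * cubic_disc c m))) \<partial>lborel)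
    = ennreal (single_period r (kap c))"
  unfolding single_q_eq[OF assms(2,3)] single_period_def
  by (intro integral_Icc_transform assms single_q_continuous)

lemma nn_integral_double:
  assumes c: "x_star < c" "c < 26/27"
  shows "(\<integral>\<^sup>+m. ennreal (indicator {rC c<..<rB c} m * (1 / sqrt (cubic_b c m * cubic_disc c m))) \<partial>lborel)
    = ennreal (double_period (rC c) (rB c) c)"
proof -
  have q: "quart (3 * c / 2) (rC c) = 0" "quart (3 * c / 2) (rB c) = 0" using quart_roots c x_star_bounds by auto
  show ?thesis
    unfolding double_q_eq(1)[OF q less_imp_neq[OF rC_less_rB[OF c]]] double_period_def
    by (intro integral_Icc_transform rC_less_rB[OF c] double_q_pos[OF c] double_q_continuous)
qed

lemma fiber_integral_low:
  assumes c: "1/6 < c" "c < x_star"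
  shows "fiber_integral c = ennreal (single_period (rC c) (kap c))"
  unfolding fiber_integral_def kern_eq kern_support_low[OF c]
  using c x_star_bounds by (intro nn_integral_single single_q_pos_low[OF c] quart_roots(1) rC_less_kap) auto

lemma fiber_integral_high:
  assumes c: "2/3 \<le> c" "c < 26/27"
  shows "fiber_integral c = ennreal (double_period (rC c) (rB c) c)"
  unfolding fiber_integral_def kern_eq kern_support_high[OF c]
  using c x_star_bounds by (intro nn_integral_double) auto

lemma double_period_nonneg:
  assumes c: "x_star < c" "c < 26/27"
  shows "0 \<le> double_period (rC c) (rB c) c"
  unfolding double_period_def using rC_less_rB[OF c] by (intro period_nonneg double_q_pos[OF c]) auto

lemma single_period_nonneg:
  shows "1/6 < c \<Longrightarrow> c < x_star \<Longrightarrow> 0 \<le> single_period (rC c) (kap c)"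
    and "x_star < c \<Longrightarrow> c < 2/3 \<Longrightarrow> 0 \<le> single_period (rA c) (kap c)"
proof -
  show "0 \<le> single_period (rC c) (kap c)" if c: "1/6 < c" "c < x_star"
    unfolding single_period_def using rC_less_kap[of c] x_star_bounds c
    by (intro period_nonneg single_q_pos_low[OF c]) auto
  show "0 \<le> single_period (rA c) (kap c)" if c: "x_star < c" "c < 2/3"
    unfolding single_period_def using rA_less_kap[OF c]
    by (intro period_nonneg single_q_pos_mid[OF c]) auto
qed

lemma fiber_integral_mid:
  assumes c: "x_star < c" "c < 2/3"
  shows "fiber_integral c = ennreal (double_period (rC c) (rB c) c + single_period (rA c) (kap c))"
proof -
  let ?g = "\<lambda>m. 1 / sqrt (cubic_b c m * cubic_disc c m)"
  have c': "c < 26/27" using c by simp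
  have [measurable]: "cubic_b c \<in> borel_measurable borel" "cubic_disc c \<in> borel_measurable borel"
    unfolding cubic_b_def[abs_def] cubic_disc_def[abs_def] disc3_1 by measurable
  have pos: "0 \<le> ?g m" if "m \<in> kern_support c" for m using kern_support_pos[OF that] by simp
  have "ennreal (kern c m) = ennreal (indicator {rC c<..<rB c} m * ?g m) + ennreal (indicator {rA c<..<kap c} m * ?g m)" for m
    unfolding kern_eq
  proof (cases "m \<in> {rC c<..<rB c}")
    case True
    then have "m \<in> kern_support c" "m \<notin> {rA c<..<kap c}" using kern_support_mid[OF c] by auto
    then show "ennreal (indicator (kern_support c) m * ?g m) = ennreal (indicator {rC c<..<rB c} m * ?g m) + ennreal (indicator {rA c<..<kap c} m * ?g m)"
      using True by simp
  next
    case False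
    then have "m \<in> kern_support c \<longleftrightarrow> m \<in> {rA c<..<kap c}" using kern_support_mid[OF c] by auto
    then show "ennreal (indicator (kern_support c) m * ?g m) = ennreal (indicator {rC c<..<rB c} m * ?g m) + ennreal (indicator {rA c<..<kap c} m * ?g m)"
      unfolding indicator_simps(2)[OF False] by (cases "m \<in> {rA c<..<kap c}") simp_all
  qed
  then have "fiber_integral c = (\<integral>\<^sup>+m. ennreal (indicator {rC c<..<rB c} m * ?g m) \<partial>lborel) + (\<integral>\<^sup>+m. ennreal (indicator {rA c<..<kap c} m * ?g m) \<partial>lborel)"
    unfolding fiber_integral_def by (simp add: nn_integral_add)
  also have "\<dots> = ennreal (double_period (rC c) (rB c) c) + ennreal (single_period (rA c) (kap c))"
    using c x_star_bounds nn_integral_double[OF c(1) c']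
    by (subst nn_integral_single) (auto intro!: single_q_pos_mid[OF c] quart_roots(3) rA_less_kap)
  finally show ?thesis using double_period_nonneg[OF c(1) c'] single_period_nonneg(2)[OF c] by simp
qed

lemma mval_real_analytic:
  assumes "real_analytic_at f c" shows "real_analytic_at (\<lambda>x. mval (f x)) c"
  by (rule real_analytic_at_compose[OF assms, of mval UNIV]) (auto simp: mval_def[abs_def] intro!: holomorphic_intros)

lemma kap_real_analytic: "c > 0 \<Longrightarrow> real_analytic_at kap c"
proof -
  assume c: "c > 0"
  have "real_analytic_at (\<lambda>x. sqrt (3 * x / 2)) c"
  proof (rule real_analytic_at_compose[OF real_analytic_at_ident, of "\<lambda>z. csqrt (3 * z / 2)" "{z. Re z > 0}"])
    show "(\<lambda>z. csqrt (3 * z / 2)) holomorphic_on {z. 0 < Re z}"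
      by (intro holomorphic_intros) (auto simp: complex_nonpos_Reals_iff)
    show "open {z. 0 < Re z}" by (rule open_halfspace_Re_gt)
    show "csqrt (3 * of_real y / 2) = complex_of_real (sqrt (3 * y / 2))" if "of_real y \<in> {z. 0 < Re z}" for y
      using that csqrt_of_real_nonneg[of "3 * y / 2"] by simp
  qed (use c in simp)
  then show ?thesis by (simp add: kap_def[abs_def])
qed

lemma single_period_real_analytic:
  assumes "real_analytic_at a c" "real_analytic_at k c" "a c < k c" "\<And>m. a c \<le> m \<Longrightarrow> m \<le> k c \<Longrightarrow> 0 < single_q (a c) (k c) m"
  shows "real_analytic_at (\<lambda>x. single_period (a x) (k x)) c"
  unfolding single_period_def
proof (rule real_analytic_at_arcsine_integral[where q = "\<lambda>r k z u. single_q r k ((r + k) / 2 - (k - r) / 2 * u)"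
      and qr = "\<lambda>r k z u. single_q r k ((r + k) / 2 - (k - r) / 2 * u)", OF assms(1,2) real_analytic_at_ident])
  show "continuous_on UNIV (\<lambda>(r, k, z, u). single_q r k ((r + k) / 2 - (k - r) / 2 * u) :: complex)"
    unfolding single_q_def cofac1_def case_prod_beta' by (intro continuous_intros) auto
  show "(\<lambda>z. single_q (h1 z) (h2 z) ((h1 z + h2 z) / 2 - (h2 z - h1 z) / 2 * u)) holomorphic_on S"
    if "h1 holomorphic_on S" "h2 holomorphic_on S" for h1 h2 :: "complex \<Rightarrow> complex" and u S
    unfolding single_q_def cofac1_def using that by (intro holomorphic_intros) auto
  show "single_q (complex_of_real x) (of_real y) ((of_real x + of_real y) / 2 - (of_real y - of_real x) / 2 * of_real u) =
    of_real (single_q x y ((x + y) / 2 - (y - x) / 2 * u))" for x y u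
    unfolding single_q_def cofac1_def by simp
  show "0 < single_q (a c) (k c) ((a c + k c) / 2 - (k c - a c) / 2 * cos \<theta>)" for \<theta>
    using assms(3) by (intro assms(4) arcsine_range) auto
qed

lemma double_period_real_analytic:
  assumes "real_analytic_at a c" "real_analytic_at b c" "a c < b c" "\<And>m. a c \<le> m \<Longrightarrow> m \<le> b c \<Longrightarrow> 0 < double_q (a c) (b c) c m"
  shows "real_analytic_at (\<lambda>x. double_period (a x) (b x) x) c"
  unfolding double_period_def
proof (rule real_analytic_at_arcsine_integral[where q = "\<lambda>r k z u. double_q r k z ((r + k) / 2 - (k - r) / 2 * u)"
      and qr = "\<lambda>r k z u. double_q r k z ((r + k) / 2 - (k - r) / 2 * u)", OF assms(1,2) real_analytic_at_ident])
  show "continuous_on UNIV (\<lambda>(r, k, z, u). double_q r k z ((r + k) / 2 - (k - r) / 2 * u) :: complex)"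
    unfolding double_q_def cofac2_def case_prod_beta' by (intro continuous_intros) auto
  show "(\<lambda>z. double_q (h1 z) (h2 z) (h3 z) ((h1 z + h2 z) / 2 - (h2 z - h1 z) / 2 * u)) holomorphic_on S"
    if "h1 holomorphic_on S" "h2 holomorphic_on S" "h3 holomorphic_on S" for h1 h2 h3 :: "complex \<Rightarrow> complex" and u S
    unfolding double_q_def cofac2_def using that by (intro holomorphic_intros) auto
  show "double_q (complex_of_real x) (of_real y) (of_real z) ((of_real x + of_real y) / 2 - (of_real y - of_real x) / 2 * of_real u) =
    of_real (double_q x y z ((x + y) / 2 - (y - x) / 2 * u))" for x y z u
    unfolding double_q_def cofac2_def by simp
  show "0 < double_q (a c) (b c) c ((a c + b c) / 2 - (b c - a c) / 2 * cos \<theta>)" for \<theta>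
    using assms(3) by (intro assms(4) arcsine_range) auto
qed

text \<open>When both ends tend to \<open>r\<close> the limiting integrand no longer depends on
  \<open>\<theta>\<close>, so the limit is \<open>pi\<close> times its value
  \<open>1 / sqrt (single_q r r r)\<close>.\<close>

lemma single_period_tendsto:
  assumes "(a \<longlongrightarrow> r) F" "(k \<longlongrightarrow> r) F" "single_q r r r = 1 / v\<^sup>2" "v > 0"
  shows "((\<lambda>x. single_period (a x) (k x)) \<longlongrightarrow> pi * v) F"
proof -
  have "((\<lambda>w. integral {0..pi} (\<lambda>\<theta>. 1 / sqrt (single_q (a w) (k w) ((a w + k w) / 2 - (k w - a w) / 2 * cos \<theta>))))
    \<longlongrightarrow> integral {0..pi} (\<lambda>\<theta>. 1 / sqrt (single_q r r ((r + r) / 2 - (r - r) / 2 * cos \<theta>)))) F"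
  proof (rule arcsine_integral_tendsto[where q = "\<lambda>r k z u. single_q r k ((r + k) / 2 - (k - r) / 2 * u)", OF _ _ assms(1,2) tendsto_const])
    show "continuous_on UNIV (\<lambda>(r, k, z, u). single_q r k ((r + k) / 2 - (k - r) / 2 * u) :: real)"
      unfolding single_q_def cofac1_def case_prod_beta' by (intro continuous_intros) auto
  qed (use assms in simp)
  moreover have "1 / sqrt (single_q r r r) = v" using assms(3,4) by (simp add: real_sqrt_divide)
  ultimately show ?thesis by (simp add: single_period_def)
qed

lemma double_period_tendsto:
  assumes "(a \<longlongrightarrow> r) F" "(b \<longlongrightarrow> r) F" "(d \<longlongrightarrow> c) F" "double_q r r c r = 1 / v\<^sup>2" "v > 0"
  shows "((\<lambda>x. double_period (a x) (b x) (d x)) \<longlongrightarrow> pi * v) F"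
proof -
  have "((\<lambda>w. integral {0..pi} (\<lambda>\<theta>. 1 / sqrt (double_q (a w) (b w) (d w) ((a w + b w) / 2 - (b w - a w) / 2 * cos \<theta>))))
    \<longlongrightarrow> integral {0..pi} (\<lambda>\<theta>. 1 / sqrt (double_q r r c ((r + r) / 2 - (r - r) / 2 * cos \<theta>)))) F"
  proof (rule arcsine_integral_tendsto[where q = "\<lambda>r k z u. double_q r k z ((r + k) / 2 - (k - r) / 2 * u)", OF _ _ assms(1,2,3)])
    show "continuous_on UNIV (\<lambda>(r, k, z, u). double_q r k z ((r + k) / 2 - (k - r) / 2 * u) :: real)"
      unfolding double_q_def cofac2_def case_prod_beta' by (intro continuous_intros) auto
  qed (use assms in simp)
  moreover have "1 / sqrt (double_q r r c r) = v" using assms(4,5) by (simp add: real_sqrt_divide)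
  ultimately show ?thesis by (simp add: double_period_def)
qed

text \<open>Here \<open>16 pi\<close> is the volume \<open>4/3 pi\<close> of the ball divided by the constant \<open>1/12\<close> of \<open>ball_law\<close>. The integral is
  infinite at \<open>x_star\<close>, where \<^const>\<open>enn2real\<close> returns \<open>0\<close>.\<close>

definition jb_density :: "real \<Rightarrow> real" where
  "jb_density c = enn2real (fiber_integral c) / (16 * pi)"

lemma jb_density_nonneg: "0 \<le> jb_density c"
  by (simp add: jb_density_def)

lemma jb_density_low: "1/6 < c \<Longrightarrow> c < x_star \<Longrightarrow> jb_density c = single_period (rC c) (kap c) / (16 * pi)"
  using single_period_nonneg(1)[of c] by (simp add: jb_density_def fiber_integral_low)

lemma jb_density_mid: "x_star < c \<Longrightarrow> c < 2/3 \<Longrightarrow>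
    jb_density c = (double_period (rC c) (rB c) c + single_period (rA c) (kap c)) / (16 * pi)"
  using single_period_nonneg(2)[of c] double_period_nonneg[of c]
  by (simp add: jb_density_def fiber_integral_mid del: ennreal_plus)

lemma jb_density_high: "2/3 \<le> c \<Longrightarrow> c < 26/27 \<Longrightarrow> jb_density c = double_period (rC c) (rB c) c / (16 * pi)"
  using double_period_nonneg[of c] x_star_bounds by (simp add: jb_density_def fiber_integral_high)

section \<open>Smoothness and one-sided limits of the density\<close>

lemma real_analytic_at_divide_const:
  assumes "real_analytic_at f c" shows "real_analytic_at (\<lambda>x. f x / a) c"
  by (rule real_analytic_at_compose[OF assms, of "\<lambda>z. z / of_real a" UNIV "\<lambda>x. x / a"])
    (auto simp: divide_inverse intro!: holomorphic_intros)

lemma double_period_analytic: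
  assumes c: "x_star < c" "c < 26/27"
  shows "real_analytic_at (\<lambda>x. double_period (rC x) (rB x) x) c"
proof (rule double_period_real_analytic)
  show "real_analytic_at rC c" unfolding rC_def[abs_def] using c x_star_bounds by (intro mval_real_analytic root_real_analytic) auto
  show "real_analytic_at rB c" unfolding rB_def[abs_def] using c by (intro mval_real_analytic root_real_analytic)
qed (use rC_less_rB[OF c] double_q_pos[OF c] in auto)

lemma jb_density_smooth: "infinitely_differentiable_on jb_density ({1/6<..<26/27} - {x_star, 2/3})"
proof (rule infinitely_differentiable_onI)
  fix c assume "c \<in> {1/6<..<26/27} - {x_star, 2/3}"
  then consider "1/6 < c" "c < x_star" | "x_star < c" "c < 2/3" | "2/3 < c" "c < 26/27" by fastforce
  then show "real_analytic_at jb_density c"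
  proof cases
    case 1
    have "real_analytic_at (\<lambda>x. single_period (rC x) (kap x)) c"
    proof (rule single_period_real_analytic)
      show "real_analytic_at rC c" unfolding rC_def[abs_def] using 1 x_star_bounds by (intro mval_real_analytic root_real_analytic) auto
      show "real_analytic_at kap c" using 1 by (intro kap_real_analytic) auto
      show "rC c < kap c" using 1 x_star_bounds by (intro rC_less_kap) auto
    qed (use single_q_pos_low[OF 1] in auto)
    then have "real_analytic_at (\<lambda>x. single_period (rC x) (kap x) / (16 * pi)) c" by (rule real_analytic_at_divide_const)
    moreover have "\<forall>\<^sub>F x in nhds c. x \<in> {1/6<..<x_star}" using 1 by (intro eventually_nhds_in_open) auto
    then have "\<forall>\<^sub>F x in nhds c. single_period (rC x) (kap x) / (16 * pi) = jb_density x"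
      by eventually_elim (simp add: jb_density_low)
    ultimately show ?thesis by (rule real_analytic_at_cong)
  next
    case 2
    have "real_analytic_at (\<lambda>x. single_period (rA x) (kap x)) c"
    proof (rule single_period_real_analytic)
      show "real_analytic_at rA c" unfolding rA_def[abs_def] using 2 x_star_bounds by (intro mval_real_analytic root_real_analytic) auto
      show "real_analytic_at kap c" using 2 x_star_bounds by (intro kap_real_analytic) auto
      show "rA c < kap c" using 2 by (intro rA_less_kap) auto
    qed (use single_q_pos_mid[OF 2] in auto)
    then have "real_analytic_at (\<lambda>x. (double_period (rC x) (rB x) x + single_period (rA x) (kap x)) / (16 * pi)) c"
      using 2 by (intro real_analytic_at_divide_const real_analytic_at_add double_period_analytic) auto
    moreover have "\<forall>\<^sub>F x in nhds c. x \<in> {x_star<..<2/3}" using 2 by (intro eventually_nhds_in_open) auto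
    then have "\<forall>\<^sub>F x in nhds c. (double_period (rC x) (rB x) x + single_period (rA x) (kap x)) / (16 * pi) = jb_density x"
      by eventually_elim (simp add: jb_density_mid)
    ultimately show ?thesis by (rule real_analytic_at_cong)
  next
    case 3
    have "real_analytic_at (\<lambda>x. double_period (rC x) (rB x) x / (16 * pi)) c"
      using 3 x_star_bounds by (intro real_analytic_at_divide_const double_period_analytic) auto
    moreover have "\<forall>\<^sub>F x in nhds c. x \<in> {2/3<..<26/27}" using 3 by (intro eventually_nhds_in_open) auto
    then have "\<forall>\<^sub>F x in nhds c. double_period (rC x) (rB x) x / (16 * pi) = jb_density x"
      by eventually_elim (simp add: jb_density_high)
    ultimately show ?thesis by (rule real_analytic_at_cong)
  qed
qed

lemma r_continuous_on:
  "continuous_on {1/6..26/27} rC" "continuous_on {x_star..26/27} rB" "continuous_on {x_star..2/3} rA"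
  unfolding rC_def[abs_def] rB_def[abs_def] rA_def[abs_def] mval_def
  by (intro continuous_intros root_continuous_on)+

lemma kap_tendsto: "(kap \<longlongrightarrow> kap c) (at c within S)"
proof -
  have "isCont kap c" unfolding kap_def[abs_def] by (intro continuous_intros) simp
  then show ?thesis unfolding isCont_def by (rule tendsto_within_subset) simp
qed

lemma r_end_values: "rC (1/6) = 1/2" "rA (2/3) = 1" "rC (26/27) = 1/3" "rB (26/27) = 1/3" "kap (1/6) = 1/2" "kap (2/3) = 1"
proof -
  have "rootC (1/6) = - (1/6)" using root_of_hpoly(1)[of "- (1/6)"] unfolding hpoly_vals by simp
  then show "rC (1/6) = 1/2" by (simp add: rC_def mval_def power2_eq_square)
  have "rootA (2/3) = 1/3" using root_of_hpoly(3)[of "1/3"] tau_star_bounds unfolding hpoly_vals by simp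
  then show "rA (2/3) = 1" unfolding rA_def mval_def by (simp only: power2_eq_square)
  have "rootC (26/27) = 0" using root_of_hpoly(1)[of 0] unfolding hpoly_vals by simp
  then show "rC (26/27) = 1/3" by (simp add: rC_def mval_def)
  have "rootB (26/27) = 0" using root_of_hpoly(2)[of 0] tau_star_bounds unfolding hpoly_vals by simp
  then show "rB (26/27) = 1/3" by (simp add: rB_def mval_def)
  have "sqrt ((1/2)\<^sup>2) = (1/2::real)" by (rule real_sqrt_unique) auto
  then show "kap (1/6) = 1/2" by (simp add: kap_def power2_eq_square)
  show "kap (2/3) = 1" by (simp add: kap_def)
qed

lemma jb_density_at_min: "(jb_density \<longlongrightarrow> 9/8) (at_right (1/6))"
proof -
  \<comment> \<open>Here \<open>single_q (1/2) (1/2) (1/2) = 1 / 18\<^sup>2\<close>, and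
    \<open>18 / 16 = 9/8\<close>.\<close>
  have "((\<lambda>c. single_period (rC c) (kap c)) \<longlongrightarrow> pi * 18) (at_right (1/6))"
  proof (rule single_period_tendsto)
    show "(rC \<longlongrightarrow> 1/2) (at_right (1/6))"
      using continuous_on_Icc_at_rightD[OF r_continuous_on(1)] r_end_values by simp
    show "(kap \<longlongrightarrow> 1/2) (at_right (1/6))" using kap_tendsto[of "1/6"] r_end_values by simp
  qed (simp_all add: single_q_def cofac1_def power2_eq_square power3_eq_cube)
  then have "((\<lambda>c. single_period (rC c) (kap c) / (16 * pi)) \<longlongrightarrow> pi * 18 / (16 * pi)) (at_right (1/6))"
    by (intro tendsto_intros) auto
  moreover have "\<forall>\<^sub>F c in at_right (1/6). c \<in> {1/6<..<x_star}"
    using x_star_bounds by (intro eventually_at_rightI[of _ x_star]) auto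
  then have "\<forall>\<^sub>F c in at_right (1/6). single_period (rC c) (kap c) / (16 * pi) = jb_density c"
    by eventually_elim (simp add: jb_density_low)
  ultimately have "(jb_density \<longlongrightarrow> pi * 18 / (16 * pi)) (at_right (1/6))" by (rule Lim_transform_eventually)
  then show ?thesis by simp
qed

lemma jb_density_at_max: "(jb_density \<longlongrightarrow> 27/64) (at_left (26/27))"
proof -
  \<comment> \<open>The reduced polynomial at the triple \<open>m = 1/3\<close> takes the value
    \<open>16 / 729\<close>, the inverse square of \<open>27/4\<close>.\<close>
  have "((\<lambda>c. double_period (rC c) (rB c) c) \<longlongrightarrow> pi * (27/4)) (at_left (26/27))"
  proof (rule double_period_tendsto)
    show "(rC \<longlongrightarrow> 1/3) (at_left (26/27))"
      using continuous_on_Icc_at_leftD[OF r_continuous_on(1)] r_end_values by simp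
    show "(rB \<longlongrightarrow> 1/3) (at_left (26/27))"
      using continuous_on_Icc_at_leftD[OF r_continuous_on(2)] r_end_values x_star_bounds by simp
    show "((\<lambda>c. c) \<longlongrightarrow> 26/27) (at_left (26/27))" by (rule tendsto_ident_at)
  qed (simp_all add: double_q_def cofac2_def power2_eq_square)
  then have "((\<lambda>c. double_period (rC c) (rB c) c / (16 * pi)) \<longlongrightarrow> pi * (27/4) / (16 * pi)) (at_left (26/27))"
    by (intro tendsto_intros) auto
  moreover have "\<forall>\<^sub>F c in at_left (26/27). c \<in> {2/3<..<26/27 :: real}"
    by (intro eventually_at_leftI[of "2/3 :: real"]) auto
  then have "\<forall>\<^sub>F c in at_left (26/27). double_period (rC c) (rB c) c / (16 * pi) = jb_density c"
    by eventually_elim (simp add: jb_density_high)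
  ultimately have "(jb_density \<longlongrightarrow> pi * (27/4) / (16 * pi)) (at_left (26/27))" by (rule Lim_transform_eventually)
  then show ?thesis by simp
qed

text \<open>The period over the first interval is analytic across \<open>2/3\<close>. The second
  interval, from \<open>rA c\<close> to \<open>kap c\<close>, shrinks to the point
  \<open>m = 1\<close> and is absent beyond; its limiting contribution
  \<open>9 * pi / (16 * pi)\<close> is the jump.\<close>

lemma jb_density_jump:
  "\<exists>l r. (jb_density \<longlongrightarrow> l) (at_left (2/3)) \<and> (jb_density \<longlongrightarrow> r) (at_right (2/3)) \<and> l - r = 9/16"
proof -
  define P where "P c = double_period (rC c) (rB c) c" for c
  have "isCont P (2/3)"
    using real_analytic_at_deriv(1)[OF double_period_analytic[of "2/3"]] x_star_bounds
    unfolding P_def by (intro differentiable_imp_continuous_within) auto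
  then have P: "(P \<longlongrightarrow> P (2/3)) (at (2/3) within S)" for S
    unfolding isCont_def by (rule tendsto_within_subset) simp
  have "((\<lambda>c. single_period (rA c) (kap c)) \<longlongrightarrow> pi * 9) (at_left (2/3))"
  proof (rule single_period_tendsto)
    show "(rA \<longlongrightarrow> 1) (at_left (2/3))"
      using continuous_on_Icc_at_leftD[OF r_continuous_on(3)] r_end_values x_star_bounds by simp
    show "(kap \<longlongrightarrow> 1) (at_left (2/3))" using kap_tendsto[of "2/3"] r_end_values by simp
  qed (simp_all add: single_q_def cofac1_def)
  then have "((\<lambda>c. (P c + single_period (rA c) (kap c)) / (16 * pi)) \<longlongrightarrow> (P (2/3) + pi * 9) / (16 * pi)) (at_left (2/3))"
    using P by (intro tendsto_intros) auto
  moreover have "\<forall>\<^sub>F c in at_left (2/3). c \<in> {x_star<..<2/3}"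
    using x_star_bounds by (intro eventually_at_leftI[of x_star]) auto
  then have "\<forall>\<^sub>F c in at_left (2/3). (P c + single_period (rA c) (kap c)) / (16 * pi) = jb_density c"
    by eventually_elim (simp add: jb_density_mid P_def)
  ultimately have L: "(jb_density \<longlongrightarrow> (P (2/3) + pi * 9) / (16 * pi)) (at_left (2/3))" by (rule Lim_transform_eventually)
  have "((\<lambda>c. P c / (16 * pi)) \<longlongrightarrow> P (2/3) / (16 * pi)) (at_right (2/3))"
    using P by (intro tendsto_intros) auto
  moreover have "\<forall>\<^sub>F c in at_right (2/3). c \<in> {2/3<..<26/27 :: real}"
    by (intro eventually_at_rightI[of _ "26/27 :: real"]) auto
  then have "\<forall>\<^sub>F c in at_right (2/3). P c / (16 * pi) = jb_density c"
    by eventually_elim (simp add: jb_density_high P_def)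
  ultimately have R: "(jb_density \<longlongrightarrow> P (2/3) / (16 * pi)) (at_right (2/3))" by (rule Lim_transform_eventually)
  have "(P (2/3) + pi * 9) / (16 * pi) - P (2/3) / (16 * pi) = 9/16" by (simp add: field_simps)
  then show ?thesis using L R by blast
qed

section \<open>Logarithmic singularity at the saddle value\<close>

text \<open>Model integrand with \<open>\<epsilon> = c - x_star\<close>: a positive
  \<open>\<epsilon>\<close> leaves a gap around \<open>v = 0\<close>, a negative one does not. One
  function thus covers both sides of the singularity.\<close>

definition inv_sqrt_gap :: "real \<Rightarrow> real \<Rightarrow> real" where
  "inv_sqrt_gap \<epsilon> v = (if \<epsilon> < v\<^sup>2 then 1 / sqrt (v\<^sup>2 - \<epsilon>) else 0)"

lemma inv_sqrt_gap_measurable [measurable]: "inv_sqrt_gap \<epsilon> \<in> borel_measurable borel"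
  unfolding inv_sqrt_gap_def[abs_def] by measurable

lemma inv_sqrt_gap_nonneg: "0 \<le> inv_sqrt_gap \<epsilon> v"
  by (simp add: inv_sqrt_gap_def)

lemma inv_sqrt_gap_minus: "inv_sqrt_gap \<epsilon> (- v) = inv_sqrt_gap \<epsilon> v"
  by (simp add: inv_sqrt_gap_def)

text \<open>The antiderivative \<open>ln (v + sqrt (v\<^sup>2 - \<epsilon>))\<close> has the value
  \<open>ln \<bar>\<epsilon>\<bar> / 2\<close> at the lower end for either sign of
  \<open>\<epsilon>\<close>. A further factor \<open>v\<close> makes the antiderivative
  \<open>sqrt (v\<^sup>2 - \<epsilon>)\<close>, which is why first-order errors cost only a
  constant.\<close>

lemma nn_integral_inv_sqrt_gap:
  assumes e: "\<epsilon> \<noteq> 0" "\<bar>\<epsilon>\<bar> < V\<^sup>2" and V: "0 < V"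
  shows "(\<integral>\<^sup>+v. ennreal (indicator {0..V} v * inv_sqrt_gap \<epsilon> v) \<partial>lborel) = ennreal (ln (V + sqrt (V\<^sup>2 - \<epsilon>)) - ln \<bar>\<epsilon>\<bar> / 2)"
    and "(\<integral>\<^sup>+v. ennreal (indicator {0..V} v * (v * inv_sqrt_gap \<epsilon> v)) \<partial>lborel) \<le> ennreal (sqrt (V\<^sup>2 - \<epsilon>))"
proof -
  \<comment> \<open>Inner edge of the support on the positive axis.\<close>
  define s where "s = (if \<epsilon> > 0 then sqrt \<epsilon> else 0)"
  have s0: "s \<ge> 0" by (simp add: s_def)
  have sV: "s \<le> V" using e V by (auto simp: s_def intro!: real_le_lsqrt)
  have gap: "v\<^sup>2 - \<epsilon> > 0" if "s < v" for v
  proof (cases "\<epsilon> > 0")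
    case True
    then have "sqrt \<epsilon> < v" using that by (simp add: s_def)
    then have "(sqrt \<epsilon>)\<^sup>2 < v\<^sup>2" using True by (intro power_strict_mono) auto
    then show ?thesis using True by simp
  next
    case False
    then show ?thesis using e by (simp add: add_nonneg_pos less_le_trans[OF _ zero_le_power2])
  qed
  have gs: "s\<^sup>2 - \<epsilon> = (if \<epsilon> > 0 then 0 else - \<epsilon>)" by (simp add: s_def)
  have ind: "indicator {0..V} v * inv_sqrt_gap \<epsilon> v = indicator {s..V} v * (1 / sqrt (v\<^sup>2 - \<epsilon>))" for v
  proof (cases "v < s")
    case True
    have "v\<^sup>2 < \<epsilon>" if "0 \<le> v"
    proof -
      have "\<epsilon> > 0" using True that by (auto simp: s_def split: if_splits)
      moreover have "v\<^sup>2 < s\<^sup>2" using True that by (intro power_strict_mono) auto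
      ultimately show ?thesis by (simp add: s_def)
    qed
    then show ?thesis using True by (auto simp: inv_sqrt_gap_def indicator_def)
  next
    case False
    show ?thesis
    proof (cases "v = s")
      case True
      then show ?thesis using s0 gs by (auto simp: inv_sqrt_gap_def indicator_def)
    next
      case F: False
      then show ?thesis using gap[of v] s0 False by (auto simp: inv_sqrt_gap_def indicator_def)
    qed
  qed
  have pos: "v + sqrt (v\<^sup>2 - \<epsilon>) > 0" if "s \<le> v" for v
  proof (cases "v = s")
    case True
    then show ?thesis using gs e s0 by (auto simp: s_def)
  next
    case False
    then have "s < v" using that by simp
    then show ?thesis using gap[OF \<open>s < v\<close>] s0 by (simp add: add_pos_nonneg)
  qed
  have D1: "((\<lambda>v. sqrt (v\<^sup>2 - \<epsilon>)) has_real_derivative v / sqrt (v\<^sup>2 - \<epsilon>)) (at v)" if "s < v" for v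
    using gap[OF that] by (auto intro!: derivative_eq_intros simp: field_simps)
  have D2: "((\<lambda>v. ln (v + sqrt (v\<^sup>2 - \<epsilon>))) has_real_derivative 1 / sqrt (v\<^sup>2 - \<epsilon>)) (at v)" if "s < v" for v
  proof -
    have "sqrt (v\<^sup>2 - \<epsilon>) > 0" "v + sqrt (v\<^sup>2 - \<epsilon>) > 0" using gap[OF that] pos[of v] that by simp_all
    then have eq: "(1 + v / sqrt (v\<^sup>2 - \<epsilon>)) / (v + sqrt (v\<^sup>2 - \<epsilon>)) = 1 / sqrt (v\<^sup>2 - \<epsilon>)"
      by (simp add: divide_simps)
    have "((\<lambda>v. v + sqrt (v\<^sup>2 - \<epsilon>)) has_real_derivative 1 + v / sqrt (v\<^sup>2 - \<epsilon>)) (at v)"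
      by (intro DERIV_add DERIV_ident D1 that)
    from DERIV_chain2[OF DERIV_ln_divide this] show ?thesis using pos[of v] that eq by simp
  qed
  have "((\<lambda>v. 1 / sqrt (v\<^sup>2 - \<epsilon>)) has_integral (ln (V + sqrt (V\<^sup>2 - \<epsilon>)) - ln (s + sqrt (s\<^sup>2 - \<epsilon>)))) {s..V}"
  proof (rule fundamental_theorem_of_calculus_interior[OF sV])
    show "continuous_on {s..V} (\<lambda>v. ln (v + sqrt (v\<^sup>2 - \<epsilon>)))"
    proof (intro continuous_intros ballI)
      fix v assume "v \<in> {s..V}" then show "v + sqrt (v\<^sup>2 - \<epsilon>) \<noteq> 0" using pos[of v] by auto
    qed
  qed (use D2 in \<open>auto simp: has_real_derivative_iff_has_vector_derivative\<close>)
  moreover have "ln (s + sqrt (s\<^sup>2 - \<epsilon>)) = ln \<bar>\<epsilon>\<bar> / 2" using e by (auto simp: gs s_def ln_sqrt)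
  ultimately have "((\<lambda>v. 1 / sqrt (v\<^sup>2 - \<epsilon>)) has_integral (ln (V + sqrt (V\<^sup>2 - \<epsilon>)) - ln \<bar>\<epsilon>\<bar> / 2)) {s..V}" by simp
  moreover have "0 \<le> 1 / sqrt (v\<^sup>2 - \<epsilon>)" if "v \<in> {s..V}" for v
    using that gap[of v] gs by (cases "v = s") auto
  ultimately show "(\<integral>\<^sup>+v. ennreal (indicator {0..V} v * inv_sqrt_gap \<epsilon> v) \<partial>lborel) = ennreal (ln (V + sqrt (V\<^sup>2 - \<epsilon>)) - ln \<bar>\<epsilon>\<bar> / 2)"
    unfolding ind by (intro nn_integral_has_integral_lebesgue)
  have "((\<lambda>v. v / sqrt (v\<^sup>2 - \<epsilon>)) has_integral (sqrt (V\<^sup>2 - \<epsilon>) - sqrt (s\<^sup>2 - \<epsilon>))) {s..V}"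
    by (rule fundamental_theorem_of_calculus_interior[OF sV])
      (use D1 in \<open>auto simp: has_real_derivative_iff_has_vector_derivative intro!: continuous_intros\<close>)
  moreover have "0 \<le> v / sqrt (v\<^sup>2 - \<epsilon>)" if "v \<in> {s..V}" for v
    using that gap[of v] gs s0 by (cases "v = s") auto
  ultimately have "(\<integral>\<^sup>+v. ennreal (indicator {s..V} v * (v / sqrt (v\<^sup>2 - \<epsilon>))) \<partial>lborel) = ennreal (sqrt (V\<^sup>2 - \<epsilon>) - sqrt (s\<^sup>2 - \<epsilon>))"
    by (intro nn_integral_has_integral_lebesgue)
  moreover have "indicator {0..V} v * (v * inv_sqrt_gap \<epsilon> v) = indicator {s..V} v * (v / sqrt (v\<^sup>2 - \<epsilon>))" for v
    using ind[of v] by (simp add: mult.left_commute divide_inverse)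
  moreover have "sqrt (s\<^sup>2 - \<epsilon>) \<ge> 0" using gs by simp
  ultimately show "(\<integral>\<^sup>+v. ennreal (indicator {0..V} v * (v * inv_sqrt_gap \<epsilon> v)) \<partial>lborel) \<le> ennreal (sqrt (V\<^sup>2 - \<epsilon>))"
    by (simp add: ennreal_leI)
qed

lemma nn_integral_reflect_Icc:
  assumes [measurable]: "f \<in> borel_measurable borel"
  shows "(\<integral>\<^sup>+v. ennreal (indicator {- V..0} v * f v) \<partial>lborel) = (\<integral>\<^sup>+v. ennreal (indicator {0..V::real} v * f (- v)) \<partial>lborel)"
proof -
  have "(\<integral>\<^sup>+v. ennreal (indicator {- V..0} v * f v) \<partial>lborel) = (\<integral>\<^sup>+v. ennreal (indicator {- V..0} (- v) * f (- v)) \<partial>lborel)"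
    using nn_integral_real_affine[of "\<lambda>v. ennreal (indicator {- V..0} v * f v)" "-1" 0] by simp
  also have "\<dots> = (\<integral>\<^sup>+v. ennreal (indicator {0..V::real} v * f (- v)) \<partial>lborel)"
    by (intro nn_integral_cong) (auto simp: indicator_def)
  finally show ?thesis .
qed

lemma nn_integral_split_0:
  assumes [measurable]: "f \<in> borel_measurable borel" and "x \<le> 0" "0 \<le> y"
  shows "(\<integral>\<^sup>+v. ennreal (indicator {x..y} v * f v) \<partial>lborel) =
    (\<integral>\<^sup>+v. ennreal (indicator {x..0} v * f v) \<partial>lborel) + (\<integral>\<^sup>+v. ennreal (indicator {0..y::real} v * f v) \<partial>lborel)"
proof -
  have "AE v in lborel. v \<noteq> (0::real)" using AE_lborel_singleton by auto
  then have "AE v in lborel. ennreal (indicator {x..y} v * f v) = ennreal (indicator {x..0} v * f v) + ennreal (indicator {0..y} v * f v)"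
    by (rule AE_mp) (use assms in \<open>auto simp: indicator_def\<close>)
  then show ?thesis by (subst nn_integral_add[symmetric]) (auto intro: nn_integral_cong_AE)
qed

lemma nn_integral_inv_sqrt_gap_two_sided:
  assumes e: "\<epsilon> \<noteq> 0" "\<bar>\<epsilon>\<bar> < V\<^sup>2" "\<bar>\<epsilon>\<bar> < W\<^sup>2" and V: "0 < V" "0 < W"
  shows "(\<integral>\<^sup>+v. ennreal (indicator {- V..W} v * inv_sqrt_gap \<epsilon> v) \<partial>lborel) =
      ennreal (ln (V + sqrt (V\<^sup>2 - \<epsilon>)) - ln \<bar>\<epsilon>\<bar> / 2) + ennreal (ln (W + sqrt (W\<^sup>2 - \<epsilon>)) - ln \<bar>\<epsilon>\<bar> / 2)"
    and "(\<integral>\<^sup>+v. ennreal (indicator {- V..W} v * (\<bar>v\<bar> * inv_sqrt_gap \<epsilon> v)) \<partial>lborel) \<le>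
      ennreal (sqrt (V\<^sup>2 - \<epsilon>)) + ennreal (sqrt (W\<^sup>2 - \<epsilon>))"
proof -
  show "(\<integral>\<^sup>+v. ennreal (indicator {- V..W} v * inv_sqrt_gap \<epsilon> v) \<partial>lborel) =
      ennreal (ln (V + sqrt (V\<^sup>2 - \<epsilon>)) - ln \<bar>\<epsilon>\<bar> / 2) + ennreal (ln (W + sqrt (W\<^sup>2 - \<epsilon>)) - ln \<bar>\<epsilon>\<bar> / 2)"
    using V nn_integral_inv_sqrt_gap(1)[OF e(1,2) V(1)] nn_integral_inv_sqrt_gap(1)[OF e(1,3) V(2)]
    by (subst nn_integral_split_0) (auto simp: nn_integral_reflect_Icc inv_sqrt_gap_minus)
  have abs: "(\<integral>\<^sup>+v. ennreal (indicator {0..U} v * (\<bar>v\<bar> * inv_sqrt_gap \<epsilon> v)) \<partial>lborel) =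
      (\<integral>\<^sup>+v. ennreal (indicator {0..U} v * (v * inv_sqrt_gap \<epsilon> v)) \<partial>lborel)" for U
    by (intro nn_integral_cong) (auto simp: indicator_def)
  show "(\<integral>\<^sup>+v. ennreal (indicator {- V..W} v * (\<bar>v\<bar> * inv_sqrt_gap \<epsilon> v)) \<partial>lborel) \<le>
      ennreal (sqrt (V\<^sup>2 - \<epsilon>)) + ennreal (sqrt (W\<^sup>2 - \<epsilon>))"
    using V nn_integral_inv_sqrt_gap(2)[OF e(1,2) V(1)] nn_integral_inv_sqrt_gap(2)[OF e(1,3) V(2)]
    by (subst nn_integral_split_0) (auto simp: nn_integral_reflect_Icc inv_sqrt_gap_minus abs intro!: add_mono)
qed

text \<open>The substitution \<open>v = v(t)\<close> turns the quadratic minimum of \<open>hpoly - c\<close> into \<open>v\<^sup>2 - \<epsilon>\<close>, whose integral is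
  elementary; a numerator that agrees with \<open>L * v'\<close> to first order contributes only a bounded error.\<close>

lemma log_singularity:
  fixes v v' p :: "real \<Rightarrow> real"
  assumes ab: "a \<le> b" and v: "\<And>t. t \<in> {a..b} \<Longrightarrow> (v has_real_derivative v' t) (at t)"
    and v': "continuous_on {a..b} v'" "\<And>t. t \<in> {a..b} \<Longrightarrow> 0 \<le> v' t"
    and ends: "v a = - V" "v b = W" "0 < V" "0 < W" "V \<le> 1" "W \<le> 1"
    and e: "\<epsilon> \<noteq> 0" "\<bar>\<epsilon>\<bar> < V\<^sup>2" "\<bar>\<epsilon>\<bar> < W\<^sup>2"
    and p: "\<And>t. t \<in> {a..b} \<Longrightarrow> 0 \<le> p t" "\<And>t. t \<in> {a..b} \<Longrightarrow> \<bar>p t - L * v' t\<bar> \<le> M * (\<bar>\<epsilon>\<bar> + \<bar>v t\<bar>) * v' t"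
    and meas: "set_borel_measurable borel {a..b} p" "set_borel_measurable borel {a..b} (\<lambda>t. inv_sqrt_gap \<epsilon> (v t))"
    and LM: "0 \<le> L" "0 \<le> M"
  defines "I \<equiv> \<integral>\<^sup>+t. ennreal (indicator {a..b} t * (p t * inv_sqrt_gap \<epsilon> (v t))) \<partial>lborel"
  shows "I \<le> ennreal (- L * ln \<bar>\<epsilon>\<bar> + (4 * L + 10 * M))"
    and "ennreal (- L * ln \<bar>\<epsilon>\<bar> + L * (ln V + ln W)) \<le> I + ennreal (10 * M)"
proof -
  let ?k = "inv_sqrt_gap \<epsilon>"
  let ?K = "\<integral>\<^sup>+v. ennreal (indicator {- V..W} v * ?k v) \<partial>lborel"
  let ?E = "\<integral>\<^sup>+v. ennreal (indicator {- V..W} v * ((\<bar>\<epsilon>\<bar> + \<bar>v\<bar>) * ?k v)) \<partial>lborel"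
  have subst: "(\<integral>\<^sup>+x. ennreal (indicator {- V..W} x * f x) \<partial>lborel) = (\<integral>\<^sup>+t. ennreal (indicator {a..b} t * (f (v t) * v' t)) \<partial>lborel)"
    if [measurable]: "f \<in> borel_measurable borel" for f :: "real \<Rightarrow> real"
  proof -
    have "set_borel_measurable borel {v a..v b} f" unfolding set_borel_measurable_def by measurable
    from nn_integral_substitution[OF this v v' ab] show ?thesis by (simp add: ends mult.commute)
  qed
  have e1: "\<bar>\<epsilon>\<bar> < 1" using e(2) ends power_le_one[of V 2] by linarith
  have le0: "ln \<bar>\<epsilon>\<bar> < 0" using e e1 by simp
  have up: "X + sqrt (X\<^sup>2 - \<epsilon>) \<le> 3" "sqrt (X\<^sup>2 - \<epsilon>) \<le> 2" "X \<le> X + sqrt (X\<^sup>2 - \<epsilon>)" if "0 < X" "X \<le> 1" "\<bar>\<epsilon>\<bar> < X\<^sup>2" for X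
  proof -
    have "X\<^sup>2 \<le> 1" using that by (simp add: power_le_one)
    then have "X\<^sup>2 - \<epsilon> \<le> 2\<^sup>2" using e1 by simp
    then show "sqrt (X\<^sup>2 - \<epsilon>) \<le> 2" by (intro real_le_lsqrt) auto
    then show "X + sqrt (X\<^sup>2 - \<epsilon>) \<le> 3" using that by simp
    show "X \<le> X + sqrt (X\<^sup>2 - \<epsilon>)" using that by simp
  qed
  have l3: "ln 3 \<le> (2::real)" using ln_le_minus_one[of "3::real"] by simp
  define A where "A = ln (V + sqrt (V\<^sup>2 - \<epsilon>)) + ln (W + sqrt (W\<^sup>2 - \<epsilon>))"
  have lnb: "ln X \<le> ln (X + sqrt (X\<^sup>2 - \<epsilon>))" "ln (X + sqrt (X\<^sup>2 - \<epsilon>)) \<le> 2" "ln (X + sqrt (X\<^sup>2 - \<epsilon>)) - ln \<bar>\<epsilon>\<bar> / 2 \<ge> 0"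
    if "0 < X" "X \<le> 1" "\<bar>\<epsilon>\<bar> < X\<^sup>2" for X
  proof -
    show 1: "ln X \<le> ln (X + sqrt (X\<^sup>2 - \<epsilon>))" using up(3)[OF that] that by (subst ln_le_cancel_iff) linarith+
    have "ln (X + sqrt (X\<^sup>2 - \<epsilon>)) \<le> ln 3" using up[OF that] that by (subst ln_le_cancel_iff) linarith+
    then show "ln (X + sqrt (X\<^sup>2 - \<epsilon>)) \<le> 2" using l3 by simp
    have "ln \<bar>\<epsilon>\<bar> \<le> ln (X\<^sup>2)" using that e by (subst ln_le_cancel_iff) auto
    then have "ln \<bar>\<epsilon>\<bar> \<le> 2 * ln X" using that by (simp add: ln_realpow)
    then show "ln (X + sqrt (X\<^sup>2 - \<epsilon>)) - ln \<bar>\<epsilon>\<bar> / 2 \<ge> 0" using 1 by simp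
  qed
  note lV = lnb[OF ends(3,5) e(2)] and lW = lnb[OF ends(4,6) e(3)]
  have A: "ln V + ln W \<le> A" "A \<le> 4" "0 \<le> A - ln \<bar>\<epsilon>\<bar>" using lV lW by (simp_all add: A_def)
  have K: "?K = ennreal (A - ln \<bar>\<epsilon>\<bar>)"
    using nn_integral_inv_sqrt_gap_two_sided(1)[OF e ends(3,4)] lV(3) lW(3)
    by (simp add: A_def flip: ennreal_plus)
  \<comment> \<open>\<open>?E\<close> measures the error of replacing \<open>p\<close> by
    \<open>L * v'\<close>. It is at most \<open>10\<close> uniformly in \<open>\<epsilon>\<close>:
    \<open>6\<close> from \<open>\<bar>\<epsilon>\<bar> * ?K\<close>, since
    \<open>\<bar>\<epsilon>\<bar> * ln \<bar>\<epsilon>\<bar>\<close> stays bounded, and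
    \<open>2\<close> from each half of the range of \<open>v\<close>.\<close>
  have "?E = (\<integral>\<^sup>+v. ennreal (\<bar>\<epsilon>\<bar> * (indicator {- V..W} v * ?k v)) + ennreal (indicator {- V..W} v * (\<bar>v\<bar> * ?k v)) \<partial>lborel)"
    by (intro nn_integral_cong) (simp add: inv_sqrt_gap_nonneg algebra_simps flip: ennreal_plus)
  also have "\<dots> = ennreal \<bar>\<epsilon>\<bar> * ?K + (\<integral>\<^sup>+v. ennreal (indicator {- V..W} v * (\<bar>v\<bar> * ?k v)) \<partial>lborel)"
    by (subst nn_integral_add) (auto simp: ennreal_mult' nn_integral_cmult)
  also have "\<dots> \<le> ennreal 6 + (ennreal 2 + ennreal 2)"
  proof (intro add_mono order_trans[OF nn_integral_inv_sqrt_gap_two_sided(2)[OF e ends(3,4)]] ennreal_leI)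
    have "- \<bar>\<epsilon>\<bar> * ln \<bar>\<epsilon>\<bar> \<le> 1"
    proof -
      have "ln (inverse \<bar>\<epsilon>\<bar>) \<le> inverse \<bar>\<epsilon>\<bar> - 1" using e by (intro ln_le_minus_one) auto
      then have "\<bar>\<epsilon>\<bar> * (- ln \<bar>\<epsilon>\<bar>) \<le> \<bar>\<epsilon>\<bar> * (inverse \<bar>\<epsilon>\<bar> - 1)" using e by (intro mult_left_mono) (auto simp: ln_inverse)
      also have "\<dots> \<le> 1" using e by (simp add: algebra_simps)
      finally show ?thesis by simp
    qed
    moreover have "\<bar>\<epsilon>\<bar> * A \<le> \<bar>\<epsilon>\<bar> * 4" using A by (intro mult_left_mono) auto
    ultimately have "\<bar>\<epsilon>\<bar> * (A - ln \<bar>\<epsilon>\<bar>) \<le> 6" using e1 by (simp add: algebra_simps)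
    moreover have "ennreal \<bar>\<epsilon>\<bar> * ?K = ennreal (\<bar>\<epsilon>\<bar> * (A - ln \<bar>\<epsilon>\<bar>))" unfolding K by (simp add: ennreal_mult')
    ultimately show "ennreal \<bar>\<epsilon>\<bar> * ?K \<le> ennreal 6" by (simp only: ennreal_leI)
  qed (use up(2)[OF ends(3,5) e(2)] up(2)[OF ends(4,6) e(3)] in auto)
  finally have E: "?E \<le> ennreal 10" by (simp flip: ennreal_plus)
  have ME: "ennreal M * ?E \<le> ennreal (10 * M)"
  proof -
    have "ennreal M * ?E \<le> ennreal M * ennreal 10" by (intro mult_left_mono E) simp
    also have "\<dots> = ennreal (10 * M)" using ennreal_mult'[OF LM(2), of 10] by (simp only: mult.commute)
    finally show ?thesis .
  qed
  have [measurable]: "(\<lambda>t. indicator {a..b} t * (p t * ?k (v t))) \<in> borel_measurable borel"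
    "(\<lambda>t. indicator {a..b} t * v' t) \<in> borel_measurable borel" "(\<lambda>t. indicator {a..b} t * ?k (v t)) \<in> borel_measurable borel"
    "(\<lambda>t. indicator {a..b} t * v t) \<in> borel_measurable borel"
  proof -
    have 1: "(\<lambda>t. indicator {a..b} t * p t) \<in> borel_measurable borel" "(\<lambda>t. indicator {a..b} t * ?k (v t)) \<in> borel_measurable borel"
      using meas by (simp_all add: set_borel_measurable_def)
    have "(\<lambda>t. indicator {a..b} t * (p t * ?k (v t))) = (\<lambda>t. (indicator {a..b} t * p t) * (indicator {a..b} t * ?k (v t)))"
      by (auto simp: indicator_def)
    then show "(\<lambda>t. indicator {a..b} t * (p t * ?k (v t))) \<in> borel_measurable borel"
      using borel_measurable_times[OF 1] by simp
    show "(\<lambda>t. indicator {a..b} t * ?k (v t)) \<in> borel_measurable borel" by (fact 1(2))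
    show "(\<lambda>t. indicator {a..b} t * v' t) \<in> borel_measurable borel"
      using borel_measurable_continuous_on_indicator[OF _ v'(1)] by simp
    have "continuous_on {a..b} v"
      using v by (intro continuous_at_imp_continuous_on ballI DERIV_isCont)
    then show "(\<lambda>t. indicator {a..b} t * v t) \<in> borel_measurable borel"
      using borel_measurable_continuous_on_indicator[of "{a..b}" v] by simp
  qed
  have m1 [measurable]: "(\<lambda>t. indicator {a..b} t * (?k (v t) * v' t)) \<in> borel_measurable borel"
    "(\<lambda>t. indicator {a..b} t * ((\<bar>\<epsilon>\<bar> + \<bar>v t\<bar>) * ?k (v t) * v' t)) \<in> borel_measurable borel"
  proof -
    have "(\<lambda>t. indicator {a..b} t * (?k (v t) * v' t)) = (\<lambda>t. (indicator {a..b} t * ?k (v t)) * (indicator {a..b} t * v' t))"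
      by (auto simp: indicator_def)
    then show "(\<lambda>t. indicator {a..b} t * (?k (v t) * v' t)) \<in> borel_measurable borel" by simp
    have "(\<lambda>t. indicator {a..b} t * ((\<bar>\<epsilon>\<bar> + \<bar>v t\<bar>) * ?k (v t) * v' t)) =
       (\<lambda>t. (\<bar>\<epsilon>\<bar> + \<bar>indicator {a..b} t * v t\<bar>) * (indicator {a..b} t * ?k (v t)) * (indicator {a..b} t * v' t))"
      by (auto simp: indicator_def)
    then show "(\<lambda>t. indicator {a..b} t * ((\<bar>\<epsilon>\<bar> + \<bar>v t\<bar>) * ?k (v t) * v' t)) \<in> borel_measurable borel" by simp
  qed
  have cm: "ennreal x * (\<integral>\<^sup>+t. ennreal (g t) \<partial>lborel) = (\<integral>\<^sup>+t. ennreal (x * g t) \<partial>lborel)"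
    if "0 \<le> x" and [measurable]: "g \<in> borel_measurable borel" for x and g :: "real \<Rightarrow> real"
    unfolding ennreal_mult'[OF that(1)] by (rule nn_integral_cmult[symmetric]) simp
  have Kt: "ennreal L * ?K = (\<integral>\<^sup>+t. ennreal (L * (indicator {a..b} t * (?k (v t) * v' t))) \<partial>lborel)"
    unfolding subst[OF inv_sqrt_gap_measurable] by (intro cm LM m1)
  have "(\<lambda>v. (\<bar>\<epsilon>\<bar> + \<bar>v\<bar>) * ?k v) \<in> borel_measurable borel" by measurable
  from subst[OF this] have Et: "ennreal M * ?E = (\<integral>\<^sup>+t. ennreal (M * (indicator {a..b} t * ((\<bar>\<epsilon>\<bar> + \<bar>v t\<bar>) * ?k (v t) * v' t))) \<partial>lborel)"
    using cm[OF LM(2) m1(2)] by simp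
  have b: "p t * ?k (v t) \<le> L * (?k (v t) * v' t) + M * ((\<bar>\<epsilon>\<bar> + \<bar>v t\<bar>) * ?k (v t) * v' t)"
      "L * (?k (v t) * v' t) \<le> p t * ?k (v t) + M * ((\<bar>\<epsilon>\<bar> + \<bar>v t\<bar>) * ?k (v t) * v' t)" if "t \<in> {a..b}" for t
  proof -
    have "p t \<le> L * v' t + M * (\<bar>\<epsilon>\<bar> + \<bar>v t\<bar>) * v' t" "L * v' t \<le> p t + M * (\<bar>\<epsilon>\<bar> + \<bar>v t\<bar>) * v' t" using p(2)[OF that] by linarith+
    from this[THEN mult_right_mono, OF inv_sqrt_gap_nonneg[of \<epsilon> "v t"]]
    show "p t * ?k (v t) \<le> L * (?k (v t) * v' t) + M * ((\<bar>\<epsilon>\<bar> + \<bar>v t\<bar>) * ?k (v t) * v' t)"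
      "L * (?k (v t) * v' t) \<le> p t * ?k (v t) + M * ((\<bar>\<epsilon>\<bar> + \<bar>v t\<bar>) * ?k (v t) * v' t)" by (simp_all add: algebra_simps)
  qed
  have LK: "ennreal L * ?K = ennreal (L * (A - ln \<bar>\<epsilon>\<bar>))" unfolding K using LM by (simp add: ennreal_mult')
  have "I \<le> (\<integral>\<^sup>+t. ennreal (L * (indicator {a..b} t * (?k (v t) * v' t))) + ennreal (M * (indicator {a..b} t * ((\<bar>\<epsilon>\<bar> + \<bar>v t\<bar>) * ?k (v t) * v' t))) \<partial>lborel)"
    unfolding I_def
  proof (rule nn_integral_mono)
    fix t show "ennreal (indicator {a..b} t * (p t * ?k (v t))) \<le> ennreal (L * (indicator {a..b} t * (?k (v t) * v' t))) + ennreal (M * (indicator {a..b} t * ((\<bar>\<epsilon>\<bar> + \<bar>v t\<bar>) * ?k (v t) * v' t)))"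
      using b(1)[of t] v'(2)[of t] LM
      by (cases "t \<in> {a..b}") (auto simp: inv_sqrt_gap_nonneg intro!: ennreal_leI simp flip: ennreal_plus)
  qed
  also have "\<dots> = ennreal L * ?K + ennreal M * ?E" unfolding Kt Et by (intro nn_integral_add) auto
  also have "\<dots> \<le> ennreal (L * (A - ln \<bar>\<epsilon>\<bar>)) + ennreal (10 * M)" unfolding LK using ME by (intro add_left_mono)
  also have "\<dots> = ennreal (L * (A - ln \<bar>\<epsilon>\<bar>) + 10 * M)"
    using mult_nonneg_nonneg[OF LM(1) A(3)] LM(2) by (intro ennreal_plus[symmetric]) auto
  also have "\<dots> \<le> ennreal (- L * ln \<bar>\<epsilon>\<bar> + (4 * L + 10 * M))"
    using mult_left_mono[OF A(2) LM(1)] by (intro ennreal_leI) (simp add: algebra_simps)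
  finally show "I \<le> ennreal (- L * ln \<bar>\<epsilon>\<bar> + (4 * L + 10 * M))" .
  have "ennreal (- L * ln \<bar>\<epsilon>\<bar> + L * (ln V + ln W)) \<le> ennreal L * ?K"
    unfolding LK using mult_left_mono[OF A(1) LM(1)] by (intro ennreal_leI) (simp add: algebra_simps)
  also have "\<dots> \<le> (\<integral>\<^sup>+t. ennreal (indicator {a..b} t * (p t * ?k (v t))) + ennreal (M * (indicator {a..b} t * ((\<bar>\<epsilon>\<bar> + \<bar>v t\<bar>) * ?k (v t) * v' t))) \<partial>lborel)"
    unfolding Kt
  proof (rule nn_integral_mono)
    fix t show "ennreal (L * (indicator {a..b} t * (?k (v t) * v' t))) \<le> ennreal (indicator {a..b} t * (p t * ?k (v t))) + ennreal (M * (indicator {a..b} t * ((\<bar>\<epsilon>\<bar> + \<bar>v t\<bar>) * ?k (v t) * v' t)))"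
      using b(2)[of t] v'(2)[of t] LM p(1)[of t]
      by (cases "t \<in> {a..b}") (auto simp: inv_sqrt_gap_nonneg intro!: ennreal_leI simp flip: ennreal_plus)
  qed
  also have "\<dots> = I + ennreal M * ?E" unfolding Et I_def by (intro nn_integral_add) auto
  also have "\<dots> \<le> I + ennreal (10 * M)" using ME by (intro add_left_mono)
  finally show "ennreal (- L * ln \<bar>\<epsilon>\<bar> + L * (ln V + ln W)) \<le> I + ennreal (10 * M)" .
qed

lemma nn_integral_inv_sqrt:
  assumes "r \<le> s"
  shows "(\<integral>\<^sup>+m. ennreal (indicator {r..s} m * (1 / sqrt (m - r))) \<partial>lborel) = ennreal (2 * sqrt (s - r))"
    and "(\<integral>\<^sup>+m. ennreal (indicator {r..s} m * (1 / sqrt (s - m))) \<partial>lborel) = ennreal (2 * sqrt (s - r))"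
proof -
  have D: "((\<lambda>m. 2 * sqrt (m - r)) has_real_derivative 1 / sqrt (m - r)) (at m)" if "r < m" for m
    using that by (auto intro!: derivative_eq_intros simp: field_simps)
  have "((\<lambda>m. 1 / sqrt (m - r)) has_integral (2 * sqrt (s - r) - 2 * sqrt (r - r))) {r..s}"
    by (rule fundamental_theorem_of_calculus_interior[OF assms])
      (use D in \<open>auto simp: has_real_derivative_iff_has_vector_derivative intro!: continuous_intros\<close>)
  from nn_integral_has_integral_lebesgue[OF _ this]
  show "(\<integral>\<^sup>+m. ennreal (indicator {r..s} m * (1 / sqrt (m - r))) \<partial>lborel) = ennreal (2 * sqrt (s - r))" by auto
  have D: "((\<lambda>m. - 2 * sqrt (s - m)) has_real_derivative 1 / sqrt (s - m)) (at m)" if "m < s" for m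
    using that by (auto intro!: derivative_eq_intros simp: field_simps)
  have "((\<lambda>m. 1 / sqrt (s - m)) has_integral (- 2 * sqrt (s - s) - (- 2 * sqrt (s - r)))) {r..s}"
    by (rule fundamental_theorem_of_calculus_interior[OF assms])
      (use D in \<open>auto simp: has_real_derivative_iff_has_vector_derivative intro!: continuous_intros\<close>)
  from nn_integral_has_integral_lebesgue[OF _ this]
  show "(\<integral>\<^sup>+m. ennreal (indicator {r..s} m * (1 / sqrt (s - m))) \<partial>lborel) = ennreal (2 * sqrt (s - r))" by auto
qed

section \<open>A square-root coordinate at the saddle value\<close>

definition hquot :: "real \<Rightarrow> real" where
  "hquot t = 24 * (t\<^sup>2 + 2 * tau_star * t + 3 * tau_star\<^sup>2) + 48 * (t + 2 * tau_star) - 64/3"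

text \<open>\<open>tau_star\<close> is critical, so \<open>hpoly - x_star\<close> has a double zero
  there: the remainder of the division is a multiple of the quadratic that \<open>tau_star\<close>
  satisfies.\<close>

lemma hpoly_quot: "hpoly t = x_star + (t - tau_star)\<^sup>2 * hquot t"
proof -
  have "hpoly t - hpoly u = (t - u)\<^sup>2 * (24 * (t\<^sup>2 + 2 * u * t + 3 * u\<^sup>2) + 48 * (t + 2 * u) - 64/3)"
    if "18 * u\<^sup>2 + 27 * u - 8 = 0" for u :: real
  proof -
    have "hpoly t - hpoly u - (t - u)\<^sup>2 * (24 * (t\<^sup>2 + 2 * u * t + 3 * u\<^sup>2) + 48 * (t + 2 * u) - 64/3)
      = (t - u) * u * (16/3) * (18 * u\<^sup>2 + 27 * u - 8)"
      unfolding hpoly_def by (simp add: field_simps power2_eq_square power3_eq_cube power4_eq_xxxx)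
    then show ?thesis using that by simp
  qed
  from this[OF tau_star_root] show ?thesis unfolding hpoly_tau_star hquot_def by simp
qed

lemma hquot_eq: "hquot t = 24 * t\<^sup>2 + 24 * (2 * tau_star * t) + 24 * (3 * tau_star\<^sup>2) + 48 * t + 96 * tau_star - 64/3"
  by (simp add: hquot_def algebra_simps)

lemma hquot_bounds: "0 \<le> t \<Longrightarrow> 4 \<le> hquot t"
proof -
  assume t: "0 \<le> t"
  have "0.2534\<^sup>2 \<le> tau_star\<^sup>2" using tau_star_bounds by (intro power_mono) auto
  then have "3 * tau_star\<^sup>2 \<ge> 9/50" by (simp add: power2_eq_square)
  moreover have "2 * tau_star * t \<ge> 0" "t\<^sup>2 \<ge> 0" using t tau_star_bounds by simp_all
  moreover have "tau_star \<ge> 1267/5000" using tau_star_bounds by simp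
  ultimately show ?thesis using t unfolding hquot_eq by linarith
qed

text \<open>The root of \<open>hpoly t - x_star\<close> that takes the sign of
  \<open>t - tau_star\<close>, hence smooth through the critical point.\<close>

definition vmap :: "real \<Rightarrow> real" where "vmap t = (t - tau_star) * sqrt (hquot t)"

definition vmap' :: "real \<Rightarrow> real" where
  "vmap' t = sqrt (hquot t) + (t - tau_star) * (24 * (t + tau_star + 1) / sqrt (hquot t))"

lemma vmap_sq: "0 \<le> t \<Longrightarrow> (vmap t)\<^sup>2 = hpoly t - x_star"
  using hquot_bounds[of t] by (simp add: vmap_def power_mult_distrib hpoly_quot)

lemma vmap_deriv: "0 \<le> t \<Longrightarrow> (vmap has_real_derivative vmap' t) (at t)"
proof -
  assume "0 \<le> t"
  then have h: "hquot t > 0" using hquot_bounds[of t] by simp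
  have "(hquot has_real_derivative 48 * (t + tau_star + 1)) (at t)"
    unfolding hquot_def[abs_def] by (auto intro!: derivative_eq_intros simp: algebra_simps)
  from DERIV_chain2[OF DERIV_real_sqrt[OF h] this]
  have D: "((\<lambda>t. sqrt (hquot t)) has_real_derivative inverse (sqrt (hquot t)) / 2 * (48 * (t + tau_star + 1))) (at t)" .
  have "inverse (sqrt (hquot t)) / 2 * (48 * (t + tau_star + 1)) = 24 * (t + tau_star + 1) / sqrt (hquot t)"
    using h by (simp add: field_simps)
  from D[unfolded this]
  have "((\<lambda>t. sqrt (hquot t)) has_real_derivative 24 * (t + tau_star + 1) / sqrt (hquot t)) (at t)" .
  from DERIV_mult'[OF DERIV_diff[OF DERIV_ident DERIV_const[of tau_star]] this]
  show ?thesis unfolding vmap_def[abs_def] vmap'_def by (simp add: add.commute)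
qed

lemma abs_le_vmap: "0 \<le> t \<Longrightarrow> \<bar>t - tau_star\<bar> \<le> \<bar>vmap t\<bar>"
proof -
  assume "0 \<le> t"
  then have "1 \<le> sqrt (hquot t)" using hquot_bounds[of t] by simp
  then have "\<bar>t - tau_star\<bar> * 1 \<le> \<bar>t - tau_star\<bar> * sqrt (hquot t)" by (intro mult_left_mono) auto
  then show ?thesis using hquot_bounds[of t] \<open>0 \<le> t\<close> by (simp add: vmap_def abs_mult)
qed

text \<open>The radius \<open>0.002\<close> makes the second term of \<open>vmap'\<close> at most
  \<open>0.002 * 24\<close>, against \<open>sqrt (hquot t) \<ge> 2\<close>, and keeps
  \<open>vmap\<close> within the range that \<open>log_singularity\<close> requires.\<close>

lemma near_tau_star:
  assumes "\<bar>t - tau_star\<bar> \<le> 0.002"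
  shows "0.25 < t" "t < 0.256" "1 \<le> vmap' t" "\<bar>vmap t\<bar> \<le> 1"
proof -
  show t: "0.25 < t" "t < 0.256" using abs_le_D1[OF assms] abs_le_D2[OF assms] tau_star_bounds by simp_all
  have h: "4 \<le> hquot t" using hquot_bounds[of t] t by simp
  have s2: "2 \<le> sqrt (hquot t)" using h real_le_rsqrt[of 2 "hquot t"] by simp
  have "24 * (t + tau_star + 1) / sqrt (hquot t) \<le> 48 / 2"
    using s2 t tau_star_bounds by (intro frac_le) simp_all
  moreover have "0 \<le> 24 * (t + tau_star + 1) / sqrt (hquot t)"
    using h t tau_star_bounds by (intro divide_nonneg_nonneg) simp_all
  ultimately have "\<bar>(t - tau_star) * (24 * (t + tau_star + 1) / sqrt (hquot t))\<bar> \<le> 0.002 * 24"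
    unfolding abs_mult using assms by (intro mult_mono) simp_all
  then have "\<bar>(t - tau_star) * (24 * (t + tau_star + 1) / sqrt (hquot t))\<bar> \<le> 1" by (rule order_trans) simp
  from abs_le_D2[OF this] show "1 \<le> vmap' t" using s2 unfolding vmap'_def by argo
  have "t\<^sup>2 \<le> 1" "tau_star\<^sup>2 \<le> 1" using t tau_star_bounds by (auto intro!: power_le_one)
  moreover have "tau_star * t \<le> 1" using t tau_star_bounds by (intro mult_le_one) auto
  moreover have "t \<le> 1" "tau_star \<le> 1" using t tau_star_bounds by simp_all
  ultimately have "hquot t \<le> 100\<^sup>2" unfolding hquot_eq by simp
  then have "sqrt (hquot t) \<le> 100" by (intro real_le_lsqrt) auto
  then have "\<bar>t - tau_star\<bar> * \<bar>sqrt (hquot t)\<bar> \<le> 0.002 * 100" using assms s2 by (intro mult_mono) auto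
  then show "\<bar>vmap t\<bar> \<le> 1" by (simp add: vmap_def abs_mult)
qed

text \<open>The part of \<open>P\<close> at \<open>mval t\<close> that stays positive at the saddle,
  after removal of \<open>hpoly t - c\<close>.\<close>

definition gap_factor :: "real \<Rightarrow> real \<Rightarrow> real" where
  "gap_factor c t = cubic_b c (mval t) * (3/64 * (c - hpoly (- t)))"

lemma gap_factor_pos:
  assumes c: "\<bar>c - x_star\<bar> \<le> 0.002" and t: "0.25 \<le> t" "t \<le> 0.256"
  shows "0 < cubic_b c (mval t)" "1 < c - hpoly (- t)" "0 < gap_factor c t"
proof -
  have "t\<^sup>2 \<le> 0.256\<^sup>2" using t by (intro power_mono) auto
  then have "mval t \<le> 0.73" by (simp add: mval_def power2_eq_square)
  moreover have "0 \<le> mval t" by (simp add: mval_def)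
  ultimately have "(mval t)\<^sup>2 \<le> 0.73\<^sup>2" by (intro power_mono)
  then have "(mval t)\<^sup>2 \<le> 0.54" by (simp add: power2_eq_square)
  then show b: "0 < cubic_b c (mval t)" using c x_star_bounds abs_le_D2[OF c] unfolding cubic_b_def by simp
  have "hpoly (- t) \<le> hpoly (- 0.25)" using t by (intro hpoly_mono(1)) auto
  also have "\<dots> < - (1::real)" by (simp add: hpoly_def power2_eq_square power3_eq_cube power4_eq_xxxx)
  finally show "1 < c - hpoly (- t)" using x_star_bounds abs_le_D2[OF c] by simp
  then show "0 < gap_factor c t" using b by (simp add: gap_factor_def)
qed

lemma kern_mval:
  assumes c: "\<bar>c - x_star\<bar> \<le> 0.002" and t: "0.25 \<le> t" "t \<le> 0.256"
  shows "kern c (mval t) = inv_sqrt_gap (c - x_star) (vmap t) / sqrt (gap_factor c t)"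
proof -
  note g = gap_factor_pos[OF c t]
  have "mval t < mval (1/3)" using t by (subst mval_less_iff) auto
  also have "mval (1/3) = (1::real)" by (simp add: mval_def power2_eq_square)
  finally have "kern c (mval t) = (if 0 < cubic_disc c (mval t) then 1 / sqrt (cubic_b c (mval t) * cubic_disc c (mval t)) else 0)"
    using g by (simp add: kern_def)
  moreover have "0 < cubic_disc c (mval t) \<longleftrightarrow> c - x_star < (vmap t)\<^sup>2"
    using cubic_disc_pos_iff[of t c] t g(2) vmap_sq[of t] by auto
  moreover have "cubic_b c (mval t) * cubic_disc c (mval t) = ((vmap t)\<^sup>2 - (c - x_star)) * gap_factor c t"
    using vmap_sq[of t] t unfolding cubic_disc_mval gap_factor_def by (simp add: algebra_simps)
  ultimately show ?thesis by (simp add: inv_sqrt_gap_def real_sqrt_mult)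
qed

text \<open>Since \<^const>\<open>jb_density\<close> carries the factor \<open>1 / (16 pi)\<close>, this is \<open>16 pi\<close> times \<open>12 / (pi sqrt \<bar>det_H_star\<bar>)\<close>.\<close>

definition log_coeff :: real where "log_coeff = 192 / sqrt \<bar>det_H_star\<bar>"

text \<open>An identity in \<open>sqrt 145\<close> modulo its square that expresses the local data
  of the integral through the Hessian. It reproduces the general rule for nondegenerate saddles on a
  surface: each of the 24 contributes \<open>- 2 / sqrt \<bar>det_H_star\<bar>\<close> times the
  logarithm, divided by the area \<open>4 * pi\<close>, which adds up to the factor
  \<open>12 / pi\<close>.\<close>

lemma det_H_star_gap: "- det_H_star * tau_star\<^sup>2 = 256 * (gap_factor x_star tau_star * hquot tau_star)"
proof -
  define s where "s = sqrt 145"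
  have s: "s\<^sup>2 - 145 = 0" by (simp add: s_def)
  have tau: "tau_star = (s - 9) / 12" by (simp add: tau_star_def s_def)
  have g: "gap_factor x_star u = (1/3 - u)\<^sup>2 * (1/3 + 2 * u) * (9/2 * u^3)" if "hpoly u = x_star" for u
  proof -
    have "hpoly u - hpoly (- u) = 96 * u^3" by (simp add: hpoly_def)
    then show ?thesis using cubic_b_root[of u] that by (simp add: gap_factor_def)
  qed
  have h: "hquot tau_star = 144 * tau_star\<^sup>2 + 144 * tau_star - 64/3"
    unfolding hquot_def by (simp add: power2_eq_square)
  have d: "det_H_star = (5286656 * s - 63660800) / 27" by (simp add: det_H_star_def s_def)
  have e: "1/3 - (s - 9) / 12 = (13 - s) / 12" "1/3 + 2 * ((s - 9) / 12) = (s - 7) / 6"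
    "144 * ((s - 9) / 12)\<^sup>2 + 144 * ((s - 9) / 12) - 64/3 = (3 * (s - 9)\<^sup>2 + 36 * (s - 9) - 64) / 3"
    by (simp_all add: power2_eq_square field_simps)
  have "- (5286656 * s - 63660800) * (s - 9)\<^sup>2 =
    (13 - s)\<^sup>2 * (s - 7) * (s - 9)^3 * (3 * (s - 9)\<^sup>2 + 36 * (s - 9) - 64)"
    using s by algebra
  moreover have "- (E / 27) * (F / 12\<^sup>2) = 256 * (A / 12\<^sup>2 * (B / 6) * (9/2 * (C / 12^3)) * (D / 3))"
    if "- E * F = A * B * C * D" for A B C D E F :: real
    using that by (simp add: field_simps)
  ultimately show ?thesis unfolding g[OF hpoly_tau_star] h d unfolding tau unfolding e unfolding power_divide by blast
qed

text \<open>The matching condition at the critical point: the numerator of the integral in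
  \<open>t\<close> equals \<open>log_coeff * vmap'\<close> there, so their difference vanishes to
  first order.\<close>

lemma log_coeff_eq: "12 * tau_star / sqrt (gap_factor x_star tau_star) = log_coeff * vmap' tau_star"
proof -
  let ?B = "gap_factor x_star tau_star" and ?h = "hquot tau_star"
  have t: "tau_star > 0" using tau_star_bounds by simp
  have B: "?B > 0" using gap_factor_pos(3)[of x_star tau_star] tau_star_bounds by simp
  have h: "?h > 0" using hquot_bounds[of tau_star] t by simp
  have "\<bar>det_H_star\<bar> = 16\<^sup>2 * (?B * ?h) / tau_star\<^sup>2"
    using det_H_star_gap det_H_star_neg t by (simp add: field_simps)
  then have "sqrt \<bar>det_H_star\<bar> = 16 * (sqrt ?B * sqrt ?h) / tau_star"
    using t by (simp add: real_sqrt_divide real_sqrt_mult)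
  then have lc: "log_coeff = 12 * tau_star / (sqrt ?B * sqrt ?h)" by (simp add: log_coeff_def)
  have "vmap' tau_star = sqrt ?h" by (simp add: vmap'_def)
  moreover have "sqrt ?h \<noteq> 0" using h by simp
  ultimately show ?thesis unfolding lc by simp
qed

lemma log_coeff_nonneg: "0 \<le> log_coeff"
  by (simp add: log_coeff_def)

lemma differentiable_local_lipschitz:
  fixes f :: "'a::real_normed_vector \<Rightarrow> real"
  assumes "f differentiable (at x)" "f x = 0"
  obtains K d where "0 \<le> K" "0 < d" "\<And>y. norm (y - x) < d \<Longrightarrow> \<bar>f y\<bar> \<le> K * norm (y - x)"
proof -
  obtain D where D: "(f has_derivative D) (at x)" using assms by (auto simp: differentiable_def)
  have bl: "bounded_linear D" using D by (rule has_derivative_bounded_linear)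
  obtain d where d: "d > 0" "\<And>y. norm (y - x) < d \<Longrightarrow> norm (f y - f x - D (y - x)) \<le> 1 * norm (y - x)"
    using D unfolding has_derivative_at_alt by (meson zero_less_one)
  show ?thesis
  proof (rule that[of "onorm D + 1" d])
    show "0 \<le> onorm D + 1" using onorm_pos_le[OF bl] by simp
    fix y assume y: "norm (y - x) < d"
    have "\<bar>f y\<bar> \<le> \<bar>D (y - x)\<bar> + \<bar>f y - D (y - x)\<bar>" by linarith
    also have "\<dots> \<le> onorm D * norm (y - x) + 1 * norm (y - x)"
      using onorm[OF bl, of "y - x"] d(2)[OF y] assms(2) by (intro add_mono) auto
    finally show "\<bar>f y\<bar> \<le> (onorm D + 1) * norm (y - x)" by (simp add: algebra_simps)
  qed (rule d(1))
qed

text \<open>By \<open>log_coeff_eq\<close> the difference is zero at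
  \<open>(x_star, tau_star)\<close>, and it is differentiable there jointly in \<open>c\<close> and
  \<open>t\<close>; this bounds it linearly by the distance to that point.\<close>

lemma numerator_lipschitz:
  obtains K d where "0 \<le> K" "0 < d"
    "\<And>c t. \<bar>c - x_star\<bar> < d \<Longrightarrow> \<bar>t - tau_star\<bar> < d \<Longrightarrow>
      \<bar>12 * t / sqrt (gap_factor c t) - log_coeff * vmap' t\<bar> \<le> K * (\<bar>c - x_star\<bar> + \<bar>t - tau_star\<bar>)"
proof -
  define H where "H z = 12 * snd z / sqrt (gap_factor (fst z) (snd z)) - log_coeff * vmap' (snd z)" for z
  let ?z = "(x_star, tau_star)"
  have B: "gap_factor x_star tau_star > 0" using gap_factor_pos(3)[of x_star tau_star] tau_star_bounds by simp
  have h: "hquot tau_star > 0" using hquot_bounds[of tau_star] tau_star_bounds by simp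
  have sq: "(\<lambda>z. sqrt (g z)) differentiable (at ?z)" if "g differentiable (at ?z)" "g ?z > 0" for g :: "real \<times> real \<Rightarrow> real"
  proof -
    obtain D where "(g has_derivative D) (at ?z)" using \<open>g differentiable (at ?z)\<close> by (auto simp: differentiable_def)
    from has_derivative_real_sqrt[OF that(2) this] show ?thesis by (auto simp: differentiable_def)
  qed
  have fs: "fst differentiable (at ?z)" "snd differentiable (at ?z)"
    using bounded_linear_imp_has_derivative[OF bounded_linear_fst, of "at ?z"]
      bounded_linear_imp_has_derivative[OF bounded_linear_snd, of "at ?z"] by (auto simp: differentiable_def)
  have d1: "(\<lambda>z. gap_factor (fst z) (snd z)) differentiable (at ?z)"
    unfolding gap_factor_def cubic_b_def mval_def hpoly_def by (intro derivative_intros fs) auto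
  have d2: "(\<lambda>z. hquot (snd z)) differentiable (at ?z)"
    unfolding hquot_def by (intro derivative_intros fs)
  have "H differentiable (at ?z)"
    unfolding H_def[abs_def] vmap'_def using B h by (intro derivative_intros fs sq d1 d2) auto
  moreover have "H ?z = 0" using log_coeff_eq by (simp add: H_def)
  ultimately obtain K d where K: "0 \<le> K" "0 < d" "\<And>y. norm (y - ?z) < d \<Longrightarrow> \<bar>H y\<bar> \<le> K * norm (y - ?z)"
    using differentiable_local_lipschitz by blast
  show ?thesis
  proof (rule that[of K "d / 2"])
    fix c t assume ct: "\<bar>c - x_star\<bar> < d / 2" "\<bar>t - tau_star\<bar> < d / 2"
    have n: "norm ((c, t) - ?z) \<le> \<bar>c - x_star\<bar> + \<bar>t - tau_star\<bar>"
      using norm_Pair_le[of "c - x_star" "t - tau_star"] by simp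
    have "\<bar>H (c, t)\<bar> \<le> K * norm ((c, t) - ?z)" using n ct by (intro K(3)) simp
    also have "\<dots> \<le> K * (\<bar>c - x_star\<bar> + \<bar>t - tau_star\<bar>)" using n K(1) by (intro mult_left_mono)
    finally show "\<bar>12 * t / sqrt (gap_factor c t) - log_coeff * vmap' t\<bar> \<le> K * (\<bar>c - x_star\<bar> + \<bar>t - tau_star\<bar>)"
      by (simp add: H_def)
  qed (use K in auto)
qed

lemma kern_measurable_snd [measurable]: "kern c \<in> borel_measurable borel"
proof -
  have "(\<lambda>m. (\<lambda>(c, m). kern c m) (c, m)) \<in> borel_measurable borel"
    by (rule measurable_compose[OF measurable_Pair1' kern_measurable]) simp
  then show ?thesis by simp
qed

lemma poly_measurable [measurable]:
  "(mval :: real \<Rightarrow> real) \<in> borel_measurable borel" "(hpoly :: real \<Rightarrow> real) \<in> borel_measurable borel" "hquot \<in> borel_measurable borel"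
  unfolding mval_def[abs_def] hquot_def[abs_def] hpoly_def[abs_def]
  by (intro borel_measurable_continuous_onI continuous_intros)+

lemma window_integral:
  assumes c: "\<bar>c - x_star\<bar> \<le> 0.002" and ab: "0.25 \<le> a" "a \<le> b" "b \<le> 0.256"
  shows "(\<integral>\<^sup>+m. ennreal (indicator {mval a..mval b} m * kern c m) \<partial>lborel) =
    (\<integral>\<^sup>+t. ennreal (indicator {a..b} t * (12 * t / sqrt (gap_factor c t) * inv_sqrt_gap (c - x_star) (vmap t))) \<partial>lborel)"
proof -
  have 1: "set_borel_measurable borel {mval a..mval b} (kern c)"
    unfolding set_borel_measurable_def by measurable
  have 2: "(mval has_real_derivative 12 * t) (at t)" for t
    unfolding mval_def[abs_def] by (auto intro!: derivative_eq_intros)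
  have 3: "continuous_on {a..b} (\<lambda>t. 12 * t)" by (intro continuous_intros)
  have 4: "0 \<le> 12 * t" if "t \<in> {a..b}" for t using that ab by simp
  have "(\<integral>\<^sup>+m. ennreal (indicator {mval a..mval b} m * kern c m) \<partial>lborel) =
      (\<integral>\<^sup>+t. ennreal (indicator {a..b} t * (kern c (mval t) * (12 * t))) \<partial>lborel)"
    using nn_integral_substitution[OF 1 2 3 4 ab(2)] by (simp add: mult.commute)
  also have "\<dots> = (\<integral>\<^sup>+t. ennreal (indicator {a..b} t * (12 * t / sqrt (gap_factor c t) * inv_sqrt_gap (c - x_star) (vmap t))) \<partial>lborel)"
  proof (rule nn_integral_cong)
    fix t show "ennreal (indicator {a..b} t * (kern c (mval t) * (12 * t))) =
      ennreal (indicator {a..b} t * (12 * t / sqrt (gap_factor c t) * inv_sqrt_gap (c - x_star) (vmap t)))"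
      using kern_mval[OF c, of t] ab by (cases "t \<in> {a..b}") (auto simp: mult.commute)
  qed
  finally show ?thesis .
qed

text \<open>Makes the vanishing of \<open>c - hpoly (- t)\<close> at \<open>rC c\<close>
  quantitative: growth at least linear in \<open>m\<close> leaves an integrable inverse square
  root.\<close>

lemma hpoly_minus_gap:
  fixes u t :: real
  assumes "0 \<le> u" "u \<le> t" "t \<le> 1/3"
  shows "hpoly (- u) - hpoly (- t) \<ge> 8/3 * (mval t - mval u)"
proof -
  have sq: "u\<^sup>2 \<le> 1/9" "t\<^sup>2 \<le> 1/9" using power_mono[of u "1/3" 2] power_mono[of t "1/3" 2] assms by (simp_all add: power2_eq_square)
  have cub: "u^3 \<le> t^3" using assms by (intro power_mono) auto
  have ut: "u\<^sup>2 \<le> t\<^sup>2" using assms by (intro power_mono) auto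
  have "hpoly (- u) - hpoly (- t) - 8/3 * (mval t - mval u) = (t\<^sup>2 - u\<^sup>2) * (16/3 - 24 * (t\<^sup>2 + u\<^sup>2)) + 48 * (t^3 - u^3)"
    unfolding hpoly_def mval_def by (simp add: field_simps power2_eq_square power3_eq_cube power4_eq_xxxx)
  moreover have "0 \<le> (t\<^sup>2 - u\<^sup>2) * (16/3 - 24 * (t\<^sup>2 + u\<^sup>2))" using sq ut by (intro mult_nonneg_nonneg) simp_all
  moreover have "0 \<le> 48 * (t^3 - u^3)" using cub by simp
  ultimately show ?thesis by argo
qed

text \<open>Away from \<open>mval tau_star\<close> the integrand only has the integrable singularities at the ends \<open>rC c\<close> and
  \<open>kap c\<close> of its support.\<close>

lemma kern_outer:
  assumes c: "\<bar>c - x_star\<bar> \<le> 0.002" and ab: "0.25 \<le> a" "a < tau_star" "tau_star < b" "b \<le> 0.256"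
    and d: "0 < d" "c + d \<le> hpoly a" "c + d \<le> hpoly b" and m: "m \<notin> {mval a..mval b}"
  shows "kern c m \<le> 100 / sqrt d * (indicator {rC c..1} m * (1 / sqrt (m - rC c)) + indicator {1/3..kap c} m * (1 / sqrt (kap c - m)))"
proof (cases "m \<in> kern_support c")
  case False
  moreover have "0 \<le> 100 / sqrt d * (indicator {rC c..1} m * (1 / sqrt (m - rC c)) + indicator {1/3..kap c} m * (1 / sqrt (kap c - m)))"
    using d by (auto simp: indicator_def)
  ultimately show ?thesis by (auto simp: kern_def kern_support_def)
next
  case True
  note cc = abs_le_D1[OF c] abs_le_D2[OF c] x_star_bounds
  have c0: "1/6 < c" "c < 26/27" "c < 2/3" using cc by simp_all
  obtain t where t: "0 < t" "t < 1/3" "m = mval t" "rC c < m" "m < kap c" "c < hpoly t"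
    using True unfolding mem_kern_support[OF c0(1,2)] by blast
  have m3: "1/3 < m" "m < 1" using t kap_less_1[OF c0(3)] by (simp_all add: mval_def)
  have ke: "kern c m = 1 / sqrt (cubic_b c m * (3/64 * (c - hpoly (- t)) * (hpoly t - c)))"
    using True cubic_disc_mval[of c t] unfolding kern_def kern_support_def t(3) by simp
  have C: "- (1/6) < rootC c" "rootC c < 0" "hpoly (rootC c) = c"
    using root_range_open(1)[of c] root_eq(1)[of c] c0 by auto
  have cm: "cubic_b c m = (kap c - m) * (kap c + m) / 36"
  proof -
    have "0 \<le> c" using c0 by simp
    then show ?thesis unfolding cubic_b_def kap_sq[OF \<open>0 \<le> c\<close>, symmetric] by algebra
  qed
  \<comment> \<open>Both cases below reduce to a linear lower bound for \<open>P\<close>, with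
    constants \<open>1 / 2000\<close> and \<open>1 / 2304\<close>; \<open>1 / 10000\<close> lies
    below both and has a rational root.\<close>
  have fin: "kern c m \<le> 100 / sqrt d * (1 / sqrt y)" if y: "0 < y" "d * y / 10000 \<le> cubic_b c m * (3/64 * (c - hpoly (- t)) * (hpoly t - c))" for y
  proof -
    have "kern c m \<le> 1 / sqrt (d * y / 10000)"
      unfolding ke
    proof (rule frac_le)
      show "0 < sqrt (d * y / 10000)" using y(1) d(1) by simp
    qed (use y(2) in simp_all)
    also have "sqrt (10000 :: real) = 100" by (rule real_sqrt_unique) simp_all
    then have "1 / sqrt (d * y / 10000) = 100 / sqrt d * (1 / sqrt y)" by (simp add: real_sqrt_divide real_sqrt_mult)
    finally show ?thesis .
  qed
  have "t < a \<or> b < t"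
  proof (rule ccontr)
    assume "\<not> (t < a \<or> b < t)"
    then have "a\<^sup>2 \<le> t\<^sup>2" "t\<^sup>2 \<le> b\<^sup>2" using ab t(1) by (auto intro!: power_mono)
    then show False using m unfolding t(3) by (simp add: mval_def)
  qed
  then show ?thesis
  proof
    \<comment> \<open>Left of the window the factor that can vanish is
      \<open>c - hpoly (- t)\<close>, at \<open>rC c\<close>; the other two are bounded
      below.\<close>
    assume ta: "t < a"
    have 1: "d \<le> hpoly t - c" using hpoly_decreasing[of t a] ta t ab d by simp
    have u: "0 \<le> - rootC c" "- rootC c \<le> t"
      using C t mval_less_iff[of "- rootC c" t] by (simp_all add: rC_def mval_minus)
    have 2: "8/3 * (m - rC c) \<le> c - hpoly (- t)"
      using hpoly_minus_gap[OF u] t C by (simp add: rC_def mval_minus)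
    have "t\<^sup>2 \<le> 0.256\<^sup>2" using t ta ab by (intro power_mono) auto
    then have "m \<le> 0.73" by (simp add: t(3) mval_def power2_eq_square)
    then have "m\<^sup>2 \<le> 0.73\<^sup>2" using m3 by (intro power_mono) auto
    then have "m\<^sup>2 \<le> 0.54" by (simp add: power2_eq_square)
    then have 3: "1/250 \<le> cubic_b c m" using cc unfolding cubic_b_def by simp
    have "1/250 * (3/64 * (8/3 * (m - rC c)) * d) \<le> cubic_b c m * (3/64 * (c - hpoly (- t)) * (hpoly t - c))"
      using 1 2 3 t d by (intro mult_mono mult_nonneg_nonneg) auto
    moreover have "d * (m - rC c) / 10000 \<le> 1/250 * (3/64 * (8/3 * (m - rC c)) * d)"
      using mult_nonneg_nonneg[of d "m - rC c"] d t by (simp add: mult.commute)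
    ultimately have "d * (m - rC c) / 10000 \<le> cubic_b c m * (3/64 * (c - hpoly (- t)) * (hpoly t - c))"
      by (rule order_trans[rotated])
    from fin[OF _ this] have "kern c m \<le> 100 / sqrt d * (1 / sqrt (m - rC c))" using t by simp
    also have "\<dots> \<le> 100 / sqrt d * (indicator {rC c..1} m * (1 / sqrt (m - rC c)) + indicator {1/3..kap c} m * (1 / sqrt (kap c - m)))"
      using t m3 d by (intro mult_left_mono) (auto simp: indicator_def)
    finally show ?thesis .
  next
    \<comment> \<open>Right of the window it is \<open>cubic_b\<close>, at
      \<open>kap c\<close>.\<close>
    assume tb: "b < t"
    have 1: "d \<le> hpoly t - c" using hpoly_increasing[of b t] tb t ab d by simp
    have "hpoly (- t) \<le> hpoly (- 0.25)" using t tb ab tau_star_bounds by (intro hpoly_mono(1)) auto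
    also have "\<dots> < - (1::real)" by (simp add: hpoly_def power2_eq_square power3_eq_cube power4_eq_xxxx)
    finally have 2: "1 \<le> c - hpoly (- t)" using cc by simp
    have "(kap c - m) * (1/3) / 36 \<le> cubic_b c m"
      unfolding cm using t m3 kap_nonneg[of c] c0 by (intro divide_right_mono mult_left_mono) auto
    then have "(kap c - m) * (1/3) / 36 * (3/64 * 1 * d) \<le> cubic_b c m * (3/64 * (c - hpoly (- t)) * (hpoly t - c))"
      using 1 2 t d by (intro mult_mono mult_nonneg_nonneg) auto
    moreover have "d * (kap c - m) / 10000 \<le> (kap c - m) * (1/3) / 36 * (3/64 * 1 * d)"
      using mult_nonneg_nonneg[of d "kap c - m"] d t by (simp add: mult.commute)
    ultimately have "d * (kap c - m) / 10000 \<le> cubic_b c m * (3/64 * (c - hpoly (- t)) * (hpoly t - c))"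
      by (rule order_trans[rotated])
    from fin[OF _ this] have "kern c m \<le> 100 / sqrt d * (1 / sqrt (kap c - m))" using t by simp
    also have "\<dots> \<le> 100 / sqrt d * (indicator {rC c..1} m * (1 / sqrt (m - rC c)) + indicator {1/3..kap c} m * (1 / sqrt (kap c - m)))"
      using t m3 d by (intro mult_left_mono) (auto simp: indicator_def)
    finally show ?thesis .
  qed
qed

text \<open>The two inverse square roots live on intervals of length at most \<open>1\<close> and
  integrate to at most \<open>2\<close> each, whence \<open>400 = 100 * (2 + 2)\<close>.\<close>

lemma fiber_integral_window:
  assumes c: "\<bar>c - x_star\<bar> \<le> 0.002" and ab: "0.25 \<le> a" "a < tau_star" "tau_star < b" "b \<le> 0.256"
    and d: "0 < d" "c + d \<le> hpoly a" "c + d \<le> hpoly b"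
  defines "I \<equiv> \<integral>\<^sup>+m. ennreal (indicator {mval a..mval b} m * kern c m) \<partial>lborel"
  shows "I \<le> fiber_integral c" "fiber_integral c \<le> I + ennreal (400 / sqrt d)"
proof -
  show "I \<le> fiber_integral c" unfolding I_def fiber_integral_def
    by (intro nn_integral_mono ennreal_leI) (auto simp: indicator_def kern_nonneg)
  note cc = abs_le_D1[OF c] abs_le_D2[OF c] x_star_bounds
  have c0: "1/6 < c" "c < 26/27" "c < 2/3" using cc by simp_all
  have r: "1/3 < rC c" "rC c < kap c" "kap c < 1" using rC_gt[OF c0(1,2)] rC_less_kap[OF c0(1,2)] kap_less_1[OF c0(3)] .
  let ?f = "\<lambda>m. indicator {rC c..1} m * (1 / sqrt (m - rC c))" and ?g = "\<lambda>m. indicator {1/3..kap c} m * (1 / sqrt (kap c - m))"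
  have nn: "0 \<le> ?f m" "0 \<le> ?g m" for m by (auto simp: indicator_def)
  have "fiber_integral c \<le> (\<integral>\<^sup>+m. ennreal (indicator {mval a..mval b} m * kern c m) + ennreal (100 / sqrt d) * (ennreal (?f m) + ennreal (?g m)) \<partial>lborel)"
    unfolding fiber_integral_def
  proof (rule nn_integral_mono)
    fix m
    have nn': "0 \<le> 100 / sqrt d" using d by simp
    show "ennreal (kern c m) \<le> ennreal (indicator {mval a..mval b} m * kern c m) + ennreal (100 / sqrt d) * (ennreal (?f m) + ennreal (?g m))"
    proof (cases "m \<in> {mval a..mval b}")
      case False
      have "ennreal (kern c m) \<le> ennreal (100 / sqrt d * (?f m + ?g m))"
        by (intro ennreal_leI kern_outer[OF c ab d False])
      also have "\<dots> = ennreal (100 / sqrt d) * (ennreal (?f m) + ennreal (?g m))"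
        using nn[of m] by (simp only: ennreal_mult'[OF nn'] ennreal_plus)
      finally show ?thesis using False by simp
    qed simp
  qed
  also have "\<dots> = I + ennreal (100 / sqrt d) * ((\<integral>\<^sup>+m. ennreal (?f m) \<partial>lborel) + (\<integral>\<^sup>+m. ennreal (?g m) \<partial>lborel))"
    unfolding I_def by (simp add: nn_integral_add nn_integral_cmult)
  also have "(\<integral>\<^sup>+m. ennreal (?f m) \<partial>lborel) = ennreal (2 * sqrt (1 - rC c))"
    using r by (intro nn_integral_inv_sqrt(1)) simp
  also have "(\<integral>\<^sup>+m. ennreal (?g m) \<partial>lborel) = ennreal (2 * sqrt (kap c - 1/3))"
    using r by (intro nn_integral_inv_sqrt(2)) simp
  also have "I + ennreal (100 / sqrt d) * (ennreal (2 * sqrt (1 - rC c)) + ennreal (2 * sqrt (kap c - 1/3))) \<le> I + ennreal (400 / sqrt d)"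
  proof (rule add_left_mono)
    have s: "sqrt (1 - rC c) \<le> 1" "sqrt (kap c - 1/3) \<le> 1" using r by (simp_all add: real_sqrt_le_1_iff)
    have "ennreal (100 / sqrt d) * (ennreal (2 * sqrt (1 - rC c)) + ennreal (2 * sqrt (kap c - 1/3))) =
      ennreal (100 / sqrt d * (2 * sqrt (1 - rC c) + 2 * sqrt (kap c - 1/3)))"
      using r d by (subst ennreal_mult') (auto simp: ennreal_plus)
    also have "100 / sqrt d * (2 * sqrt (1 - rC c) + 2 * sqrt (kap c - 1/3)) \<le> 100 / sqrt d * 4"
    proof (rule mult_left_mono)
      show "2 * sqrt (1 - rC c) + 2 * sqrt (kap c - 1/3) \<le> 4" using s by linarith
    qed (use d in simp)
    finally show "ennreal (100 / sqrt d) * (ennreal (2 * sqrt (1 - rC c)) + ennreal (2 * sqrt (kap c - 1/3))) \<le> ennreal (400 / sqrt d)"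
      by (simp add: ennreal_leI)
  qed
  finally show "fiber_integral c \<le> I + ennreal (400 / sqrt d)" .
qed

lemma log_coeff_ln: "0 < x \<Longrightarrow> x \<le> 1 \<Longrightarrow> 0 \<le> - log_coeff * ln x"
  using log_coeff_nonneg by (intro mult_nonpos_nonpos) auto

text \<open>The lower bound carries \<open>C\<close> on the right as well, because subtraction in
  \<open>ennreal\<close> truncates at zero.\<close>

lemma fiber_integral_log:
  obtains C e where "0 < e" "0 \<le> C"
    "\<And>c. c \<noteq> x_star \<Longrightarrow> \<bar>c - x_star\<bar> < e \<Longrightarrow> fiber_integral c \<le> ennreal (- log_coeff * ln \<bar>c - x_star\<bar> + C)"
    "\<And>c. c \<noteq> x_star \<Longrightarrow> \<bar>c - x_star\<bar> < e \<Longrightarrow> ennreal (- log_coeff * ln \<bar>c - x_star\<bar> - C) \<le> fiber_integral c + ennreal C"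
proof -
  obtain K d0 where K: "0 \<le> K" "0 < d0" "\<And>c t. \<bar>c - x_star\<bar> < d0 \<Longrightarrow> \<bar>t - tau_star\<bar> < d0 \<Longrightarrow>
      \<bar>12 * t / sqrt (gap_factor c t) - log_coeff * vmap' t\<bar> \<le> K * (\<bar>c - x_star\<bar> + \<bar>t - tau_star\<bar>)"
    using numerator_lipschitz by blast
  define \<eta> where "\<eta> = min 0.002 (d0 / 2)"
  have eta: "0 < \<eta>" "\<eta> \<le> 0.002" "\<eta> < d0" using K(2) by (auto simp: \<eta>_def)
  define a b where "a = tau_star - \<eta>" and "b = tau_star + \<eta>"
  have tn: "\<bar>t - tau_star\<bar> \<le> \<eta>" if "t \<in> {a..b}" for t using that by (auto simp: a_def b_def abs_le_iff)
  have near: "\<bar>t - tau_star\<bar> \<le> 0.002" if "t \<in> {a..b}" for t using tn[OF that] eta by linarith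
  have ab: "a < tau_star" "tau_star < b" "a < b" "0.25 \<le> a" "b \<le> 0.256" using eta near_tau_star(1)[OF near, of a] near_tau_star(2)[OF near, of b] by (simp_all add: a_def b_def)
  have mem: "a \<in> {a..b}" "b \<in> {a..b}" using ab by auto
  define V W where "V = - vmap a" and "W = vmap b"
  have VW: "0 < V" "0 < W" "V \<le> 1" "W \<le> 1"
  proof -
    have h: "0 < hquot a" "0 < hquot b" using hquot_bounds[of a] hquot_bounds[of b] ab by auto
    then show "0 < V" "0 < W" using eta by (simp_all add: V_def W_def vmap_def a_def b_def)
    show "V \<le> 1" "W \<le> 1" using near_tau_star(4)[OF near[OF mem(1)]] near_tau_star(4)[OF near[OF mem(2)]] by (simp_all add: V_def W_def abs_le_iff)
  qed
  \<comment> \<open>Half the height of \<open>hpoly\<close> above \<open>x_star\<close> at the lower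
    end of the window: for \<open>\<bar>c - x_star\<bar> < d\<close> both window ends still clear
    the level \<open>c\<close> by \<open>d\<close>.\<close>
  define d where "d = min (V\<^sup>2) (W\<^sup>2) / 2"
  have d: "0 < d" "2 * d \<le> V\<^sup>2" "2 * d \<le> W\<^sup>2" using VW by (auto simp: d_def)
  have hp: "hpoly a = x_star + V\<^sup>2" "hpoly b = x_star + W\<^sup>2"
    using vmap_sq[of a] vmap_sq[of b] ab by (auto simp: V_def W_def)
  define e where "e = min \<eta> d"
  define C where "C = 4 * log_coeff + 10 * K + 400 / sqrt d + log_coeff * \<bar>ln V + ln W\<bar>"
  have e: "0 < e" using eta d by (simp add: e_def)
  have nonneg: "0 \<le> 4 * log_coeff" "0 \<le> 10 * K" "0 \<le> 400 / sqrt d" "0 \<le> log_coeff * \<bar>ln V + ln W\<bar>"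
    using log_coeff_nonneg K d by auto
  have main: "fiber_integral c \<le> ennreal (- log_coeff * ln \<bar>c - x_star\<bar> + C)"
      "ennreal (- log_coeff * ln \<bar>c - x_star\<bar> - C) \<le> fiber_integral c + ennreal C"
    if c: "c \<noteq> x_star" "\<bar>c - x_star\<bar> < e" for c
  proof -
    let ?\<epsilon> = "c - x_star"
    have c2: "\<bar>c - x_star\<bar> \<le> 0.002" "\<bar>c - x_star\<bar> < d" "\<bar>c - x_star\<bar> < d0" using c eta by (auto simp: e_def)
    have gp: "0 < gap_factor c t" if "t \<in> {a..b}" for t
      using gap_factor_pos(3)[OF c2(1), of t] that ab by auto
    define I where "I = (\<integral>\<^sup>+m. ennreal (indicator {mval a..mval b} m * kern c m) \<partial>lborel)"
    have cd: "c + d \<le> hpoly a" "c + d \<le> hpoly b" using c2(2) d unfolding hp by linarith+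
    note F = fiber_integral_window[OF c2(1) ab(4,1,2,5) d(1) cd, folded I_def]
    have I: "I = (\<integral>\<^sup>+t. ennreal (indicator {a..b} t * (12 * t / sqrt (gap_factor c t) * inv_sqrt_gap ?\<epsilon> (vmap t))) \<partial>lborel)"
      unfolding I_def using ab by (intro window_integral c2) auto
    have L: "I \<le> ennreal (- log_coeff * ln \<bar>?\<epsilon>\<bar> + (4 * log_coeff + 10 * K))"
      "ennreal (- log_coeff * ln \<bar>?\<epsilon>\<bar> + log_coeff * (ln V + ln W)) \<le> I + ennreal (10 * K)"
    proof -
      have n1: "(vmap has_real_derivative vmap' t) (at t)" if "t \<in> {a..b}" for t
        using that ab by (intro vmap_deriv) auto
      have n2: "continuous_on {a..b} vmap'"
        unfolding vmap'_def[abs_def] hquot_def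
      proof (intro continuous_intros ballI)
        fix t assume "t \<in> {a..b}"
        then have "4 \<le> hquot t" using ab by (intro hquot_bounds) auto
        then show "sqrt (24 * (t\<^sup>2 + 2 * tau_star * t + 3 * tau_star\<^sup>2) + 48 * (t + 2 * tau_star) - 64 / 3) \<noteq> 0"
          unfolding hquot_def by simp
      qed
      have n3: "0 \<le> vmap' t" if "t \<in> {a..b}" for t using near_tau_star(3)[OF near[OF that]] by simp
      have n4: "\<bar>?\<epsilon>\<bar> < V\<^sup>2" "\<bar>?\<epsilon>\<bar> < W\<^sup>2" using c2 d by auto
      have n6: "0 \<le> 12 * t / sqrt (gap_factor c t)" if "t \<in> {a..b}" for t
        using gp[OF that] that ab by auto
      have n7: "\<bar>12 * t / sqrt (gap_factor c t) - log_coeff * vmap' t\<bar> \<le> K * (\<bar>?\<epsilon>\<bar> + \<bar>vmap t\<bar>) * vmap' t" if t: "t \<in> {a..b}" for t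
      proof -
        have "\<bar>12 * t / sqrt (gap_factor c t) - log_coeff * vmap' t\<bar> \<le> K * (\<bar>?\<epsilon>\<bar> + \<bar>t - tau_star\<bar>)"
          using K(3)[OF c2(3)] tn[OF t] eta by auto
        also have "\<dots> \<le> K * (\<bar>?\<epsilon>\<bar> + \<bar>vmap t\<bar>)"
          using abs_le_vmap[of t] t ab K(1) by (intro mult_left_mono add_left_mono) auto
        also have "\<dots> * 1 \<le> K * (\<bar>?\<epsilon>\<bar> + \<bar>vmap t\<bar>) * vmap' t"
          using near_tau_star(3)[OF near[OF t]] K(1) by (intro mult_left_mono) auto
        finally show ?thesis by simp
      qed
      have n8: "set_borel_measurable borel {a..b} (\<lambda>t. 12 * t / sqrt (gap_factor c t))"
        unfolding set_borel_measurable_def gap_factor_def cubic_b_def by measurable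
      have n9: "set_borel_measurable borel {a..b} (\<lambda>t. inv_sqrt_gap ?\<epsilon> (vmap t))"
        unfolding set_borel_measurable_def vmap_def by measurable
      have ends: "vmap a = - V" "vmap b = W" by (simp_all add: V_def W_def)
      have "?\<epsilon> \<noteq> 0" using c by simp
      note L = log_singularity[OF less_imp_le[OF ab(3)] n1 n2 n3 ends VW this n4 n6 n7 n8 n9 log_coeff_nonneg K(1), folded I]
      show "I \<le> ennreal (- log_coeff * ln \<bar>?\<epsilon>\<bar> + (4 * log_coeff + 10 * K))" by (rule L(1))
      show "ennreal (- log_coeff * ln \<bar>?\<epsilon>\<bar> + log_coeff * (ln V + ln W)) \<le> I + ennreal (10 * K)" by (rule L(2))
    qed
    have ln0: "0 \<le> - log_coeff * ln \<bar>?\<epsilon>\<bar>"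
      using c(1) c2(1) by (intro log_coeff_ln) auto
    have "fiber_integral c \<le> ennreal (- log_coeff * ln \<bar>?\<epsilon>\<bar> + (4 * log_coeff + 10 * K)) + ennreal (400 / sqrt d)"
      by (rule order_trans[OF F(2) add_right_mono[OF L(1)]])
    also have "\<dots> = ennreal (- log_coeff * ln \<bar>?\<epsilon>\<bar> + (4 * log_coeff + 10 * K) + 400 / sqrt d)"
      using ln0 nonneg by (intro ennreal_plus[symmetric]) auto
    also have "\<dots> \<le> ennreal (- log_coeff * ln \<bar>c - x_star\<bar> + C)"
      using nonneg by (intro ennreal_leI) (simp add: C_def)
    finally show "fiber_integral c \<le> ennreal (- log_coeff * ln \<bar>c - x_star\<bar> + C)" .
    have "- (log_coeff * (ln V + ln W)) \<le> log_coeff * \<bar>ln V + ln W\<bar>"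
      using mult_left_mono[OF abs_ge_minus_self[of "ln V + ln W"] log_coeff_nonneg] unfolding mult_minus_right .
    then have "ennreal (- log_coeff * ln \<bar>c - x_star\<bar> - C) \<le> ennreal (- log_coeff * ln \<bar>?\<epsilon>\<bar> + log_coeff * (ln V + ln W))"
      using nonneg unfolding C_def by (intro ennreal_leI) linarith
    also have "\<dots> \<le> I + ennreal (10 * K)" by (rule L(2))
    also have "\<dots> \<le> fiber_integral c + ennreal C"
      using F(1) nonneg by (intro add_mono ennreal_leI) (simp_all add: C_def)
    finally show "ennreal (- log_coeff * ln \<bar>c - x_star\<bar> - C) \<le> fiber_integral c + ennreal C" .
  qed
  show ?thesis
    by (rule that[OF e _ main]) (use nonneg in \<open>simp add: C_def\<close>)
qed

lemma jb_density_log: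
  "(\<lambda>x. jb_density x - (- (12 / (pi * \<bar>det_H_star\<bar> powr (1/2))) * ln \<bar>x - x_star\<bar>)) \<in> O[at x_star](\<lambda>_. 1)"
proof -
  obtain e C where C: "0 < e" "0 \<le> C"
    "\<And>c. c \<noteq> x_star \<Longrightarrow> \<bar>c - x_star\<bar> < e \<Longrightarrow> fiber_integral c \<le> ennreal (- log_coeff * ln \<bar>c - x_star\<bar> + C)"
    "\<And>c. c \<noteq> x_star \<Longrightarrow> \<bar>c - x_star\<bar> < e \<Longrightarrow> ennreal (- log_coeff * ln \<bar>c - x_star\<bar> - C) \<le> fiber_integral c + ennreal C"
    by (rule fiber_integral_log) (rule that)
  have coeff: "12 / (pi * \<bar>det_H_star\<bar> powr (1/2)) = log_coeff / (16 * pi)"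
    by (simp add: log_coeff_def powr_half_sqrt)
  have "\<forall>\<^sub>F x in at x_star. norm (jb_density x - (- (12 / (pi * \<bar>det_H_star\<bar> powr (1/2))) * ln \<bar>x - x_star\<bar>)) \<le> (2 * C / (16 * pi)) * norm (1::real)"
    unfolding eventually_at
  proof (intro exI[of _ "min e 1"] conjI ballI impI)
    fix c assume "c \<noteq> x_star \<and> dist c x_star < min e 1"
    then have c: "c \<noteq> x_star" "\<bar>c - x_star\<bar> < e" "\<bar>c - x_star\<bar> < 1" by (auto simp: dist_real_def)
    define F where "F = enn2real (fiber_integral c)"
    define l where "l = - log_coeff * ln \<bar>c - x_star\<bar>"
    have l: "0 \<le> l" unfolding l_def using c by (intro log_coeff_ln) auto
    \<comment> \<open>Finiteness is needed before passing to \<open>enn2real\<close>, which would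
      turn an infinite value into \<open>0\<close>.\<close>
    have "fiber_integral c < \<infinity>" using C(3)[OF c(1,2)] by (auto intro: le_less_trans)
    then have F: "fiber_integral c = ennreal F" "0 \<le> F" by (auto simp: F_def)
    have "F \<le> l + C" using C(3)[OF c(1,2)] l C(2) unfolding F l_def by (simp add: ennreal_le_iff)
    moreover have "l - C \<le> F + C"
      using C(4)[OF c(1,2)] C(2) F(2) unfolding F(1) l_def by (simp add: ennreal_le_iff flip: ennreal_plus)
    ultimately have "\<bar>F - l\<bar> \<le> 2 * C" using C(2) by (simp add: abs_le_iff)
    then have "\<bar>F - l\<bar> / (16 * pi) \<le> 2 * C / (16 * pi)" by (intro divide_right_mono) auto
    moreover have "jb_density c - (- (12 / (pi * \<bar>det_H_star\<bar> powr (1/2))) * ln \<bar>c - x_star\<bar>) = (F - l) / (16 * pi)"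
      unfolding coeff jb_density_def F_def l_def by (simp add: diff_divide_distrib add_divide_distrib)
    ultimately show "norm (jb_density c - (- (12 / (pi * \<bar>det_H_star\<bar> powr (1/2))) * ln \<bar>c - x_star\<bar>)) \<le> (2 * C / (16 * pi)) * norm (1::real)"
      by (simp add: abs_divide)
  qed (use C in auto)
  then show ?thesis by (rule bigoI)
qed

section \<open>Proof of the proposition\<close>

lemma JB4_sgn:
  fixes x :: "real^3"
  assumes "x \<noteq> 0"
  shows "JB4 (hyp (sgn x)) = elem_jb (elem_map x)"
proof -
  define r where "r = x \<bullet> x"
  have r: "r > 0" using assms by (simp add: r_def)
  have s: "r = (x$1)\<^sup>2 + (x$2)\<^sup>2 + (x$3)\<^sup>2"
    by (simp add: r_def inner_vec_def sum_3 power2_eq_square)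
  have nr: "(norm x)\<^sup>2 = r" by (simp add: r_def dot_square_norm)
  have comp: "(sgn x $ i)\<^sup>2 = (x $ i)\<^sup>2 / r" for i
    by (simp add: sgn_div_norm power_mult_distrib power_inverse nr divide_inverse)
  have "sgn x \<bullet> sgn x = 1" using assms by (simp add: dot_square_norm norm_sgn)
  then have J: "JB4 (hyp (sgn x)) = 24 * ((x$1)\<^sup>2 / r * ((x$2)\<^sup>2 / r) * ((x$3)\<^sup>2 / r)) +
      2/3 * (((x$1)\<^sup>2 / r)\<^sup>2 + ((x$2)\<^sup>2 / r)\<^sup>2 + ((x$3)\<^sup>2 / r)\<^sup>2)\<^sup>2"
    by (simp add: JB4_sphere comp)
  have "(a / r)\<^sup>2 + (b / r)\<^sup>2 + (c / r)\<^sup>2 = 1 - 2 * (a * b + a * c + b * c) / r\<^sup>2" if "r = a + b + c" for a b c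
  proof -
    have "(a / r)\<^sup>2 + (b / r)\<^sup>2 + (c / r)\<^sup>2 = (a\<^sup>2 + b\<^sup>2 + c\<^sup>2) / r\<^sup>2"
      by (simp add: power_divide add_divide_distrib)
    also have "a\<^sup>2 + b\<^sup>2 + c\<^sup>2 = r\<^sup>2 - 2 * (a * b + a * c + b * c)" unfolding that by algebra
    finally show ?thesis using r by (simp add: diff_divide_distrib)
  qed
  from this[OF s] show ?thesis
    unfolding J by (simp add: elem_jb_def elem_map_def s[symmetric] power3_eq_cube)
qed

lemma emeasure_unit_ball3: "emeasure lborel (ball (0::real^3) 1) = ennreal (4/3 * pi)"
  by (simp add: emeasure_ball unit_ball_vol_3)

text \<open>The total mass is bounded by the volume of the ball, so infinite values occupy a null
  set only.\<close>

lemma fiber_integral_finite: "AE c in lborel. fiber_integral c \<noteq> \<infinity>"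
proof (rule nn_integral_PInf_AE)
  show "fiber_integral \<in> borel_measurable lborel" by simp
  have "emeasure lborel (weyl_set UNIV) \<le> emeasure lborel (ball (0::real^3) 1)"
    by (intro emeasure_mono weyl_set_measurable) auto
  then have "ennreal (1/12) * (\<integral>\<^sup>+c. fiber_integral c \<partial>lborel) \<le> ennreal (4/3 * pi)"
    using ball_law[of UNIV] by (simp add: emeasure_unit_ball3)
  also have "\<dots> < \<infinity>" by simp
  finally show "(\<integral>\<^sup>+c. fiber_integral c \<partial>lborel) \<noteq> \<infinity>"
    by (auto simp: ennreal_mult_top)
qed

lemma distributed_jb_density: "distributed uniform_Omega4 lborel JB4 (\<lambda>x. ennreal (jb_density x))"
proof -
  let ?B = "ball (0::real^3) 1"
  let ?U = "uniform_measure lborel ?B"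
  have "linear hyp" by (rule linear_hyperplane_iso)
  then have [measurable]: "hyp \<in> borel_measurable borel"
    by (simp add: linear_continuous_on linear_linear borel_measurable_continuous_onI)
  have [measurable]: "(sgn :: real^3 \<Rightarrow> real^3) \<in> borel_measurable borel"
    unfolding sgn_div_norm by measurable
  have [measurable]: "jb_density \<in> borel_measurable borel"
    unfolding jb_density_def[abs_def] by measurable
  have D: "distr uniform_Omega4 lborel JB4 = distr ?U lborel (\<lambda>x. JB4 (hyp (sgn x)))"
    unfolding uniform_Omega4_def by (subst distr_distr) (auto simp: comp_def)
  have "distr uniform_Omega4 lborel JB4 = density lborel (\<lambda>x. ennreal (jb_density x))"
  proof (rule measure_eqI)
    fix A assume "A \<in> sets (distr uniform_Omega4 lborel JB4)"
    then have A: "A \<in> sets borel" by simp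
    have V: "(\<lambda>x. JB4 (hyp (sgn x))) -` A \<in> sets borel" using measurable_sets_borel[OF _ A] by measurable
    have "emeasure (distr uniform_Omega4 lborel JB4) A = emeasure ?U ((\<lambda>x. JB4 (hyp (sgn x))) -` A)"
      unfolding D using A by (subst emeasure_distr) auto
    also have "\<dots> = emeasure lborel (?B \<inter> (\<lambda>x. JB4 (hyp (sgn x))) -` A) / ennreal (4/3 * pi)"
      using V by (simp add: emeasure_unit_ball3)
    \<comment> \<open>The two events can differ only at the origin, which has no direction.\<close>
    also have "emeasure lborel (?B \<inter> (\<lambda>x. JB4 (hyp (sgn x))) -` A) = emeasure lborel (weyl_set A)"
    proof (rule emeasure_eq_AE)
      have "AE x in lborel. x \<noteq> (0::real^3)" using AE_lborel_singleton by auto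
      then show "AE x in lborel. (x \<in> ?B \<inter> (\<lambda>x. JB4 (hyp (sgn x))) -` A) = (x \<in> weyl_set A)"
      proof (rule AE_mp, intro AE_I2 impI)
        fix x :: "real^3" assume "x \<noteq> 0"
        moreover have "x \<in> ?B \<longleftrightarrow> (x$1)\<^sup>2 + (x$2)\<^sup>2 + (x$3)\<^sup>2 < 1"
        proof -
          have "(norm x)\<^sup>2 = (x$1)\<^sup>2 + (x$2)\<^sup>2 + (x$3)\<^sup>2"
            unfolding power2_norm_eq_inner by (simp add: inner_vec_def sum_3 power2_eq_square)
          moreover have "norm x < 1 \<longleftrightarrow> (norm x)\<^sup>2 < 1" using abs_square_less_1[of "norm x"] by simp
          ultimately show ?thesis by simp
        qed
        ultimately show "(x \<in> ?B \<inter> (\<lambda>x. JB4 (hyp (sgn x))) -` A) = (x \<in> weyl_set A)"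
          by (simp add: weyl_set_def JB4_sgn)
      qed
    qed (use V weyl_set_measurable[OF A] in auto)
    also have "emeasure lborel (weyl_set A) / ennreal (4/3 * pi) = ennreal (1 / (16 * pi)) * (\<integral>\<^sup>+c. indicator A c * fiber_integral c \<partial>lborel)"
    proof -
      have "ennreal (1/12) * X / ennreal (4/3 * pi) = ennreal (1 / (16 * pi)) * X" for X :: ennreal
      proof -
        have "ennreal (1/12) * X / ennreal (4/3 * pi) = (ennreal (1/12) / ennreal (4/3 * pi)) * X"
          by (simp only: divide_ennreal_def mult_ac)
        also have "ennreal (1/12) / ennreal (4/3 * pi) = ennreal ((1/12) / (4/3 * pi))"
          by (intro divide_ennreal) auto
        also have "(1/12) / (4/3 * pi) = 1 / (16 * pi)" by simp
        finally show ?thesis .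
      qed
      then show ?thesis unfolding ball_law[OF A] .
    qed
    also have "\<dots> = (\<integral>\<^sup>+c. ennreal (1 / (16 * pi)) * (indicator A c * fiber_integral c) \<partial>lborel)"
      using A by (intro nn_integral_cmult[symmetric]) auto
    also have "\<dots> = (\<integral>\<^sup>+c. ennreal (jb_density c) * indicator A c \<partial>lborel)"
    \<comment> \<open>The density agrees with the scaled fibre integral where the latter is finite,
      hence almost everywhere.\<close>
    proof (rule nn_integral_cong_AE)
      show "AE c in lborel. ennreal (1 / (16 * pi)) * (indicator A c * fiber_integral c) = ennreal (jb_density c) * indicator A c"
      proof (rule AE_mp[OF fiber_integral_finite], intro AE_I2 impI)
        fix c assume "fiber_integral c \<noteq> \<infinity>"
        then obtain F where F: "fiber_integral c = ennreal F" "0 \<le> F" by (cases "fiber_integral c") auto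
        have "ennreal (1 / (16 * pi)) * ennreal F = ennreal (1 / (16 * pi) * F)"
          using F by (intro ennreal_mult[symmetric]) auto
        then have d: "ennreal (jb_density c) = ennreal (1 / (16 * pi)) * fiber_integral c"
          using F by (simp add: jb_density_def)
        show "ennreal (1 / (16 * pi)) * (indicator A c * fiber_integral c) = ennreal (jb_density c) * indicator A c"
          unfolding d by (simp only: mult_ac)
      qed
    qed
    also have "\<dots> = emeasure (density lborel (\<lambda>x. ennreal (jb_density x))) A"
      using A by (intro emeasure_density[symmetric]) auto
    finally show "emeasure (distr uniform_Omega4 lborel JB4) A = emeasure (density lborel (\<lambda>x. ennreal (jb_density x))) A" .
  qed simp
  moreover have "JB4 \<in> measurable uniform_Omega4 lborel" by (simp add: uniform_Omega4_def)
  ultimately show ?thesis by (simp add: distributed_def)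
qed

section \<open>Numerical bounds\<close>

lemma arctan_taylor_bounds:
  assumes "0 \<le> (x::real)"
  shows "x - x^3 / 3 \<le> arctan x" "arctan x \<le> x - x^3 / 3 + x^5 / 5"
proof -
  have p: "1 + t\<^sup>2 > 0" for t :: real by (simp add: add_pos_nonneg)
  have "(\<lambda>t. arctan t - (t - t^3 / 3)) 0 \<le> (\<lambda>t. arctan t - (t - t^3 / 3)) x"
  proof (rule DERIV_nonneg_imp_nondecreasing[OF assms])
    fix t :: real
    have "((\<lambda>t. t - t^3 / 3) has_real_derivative 1 - t\<^sup>2) (at t)"
      by (auto intro!: derivative_eq_intros)
    from DERIV_diff[OF DERIV_arctan this]
    have "((\<lambda>t. arctan t - (t - t^3 / 3)) has_real_derivative inverse (1 + t\<^sup>2) - (1 - t\<^sup>2)) (at t)" .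
    moreover have "inverse (1 + t\<^sup>2) - (1 - t\<^sup>2) = t^4 / (1 + t\<^sup>2)"
      using p[of t] by (simp add: field_simps power2_eq_square power4_eq_xxxx)
    moreover have "0 \<le> t^4 / (1 + t\<^sup>2)" using p[of t] by simp
    ultimately show "\<exists>y. ((\<lambda>t. arctan t - (t - t^3 / 3)) has_real_derivative y) (at t) \<and> 0 \<le> y" by metis
  qed
  then show "x - x^3 / 3 \<le> arctan x" by simp
  have "(\<lambda>t. (t - t^3 / 3 + t^5 / 5) - arctan t) 0 \<le> (\<lambda>t. (t - t^3 / 3 + t^5 / 5) - arctan t) x"
  proof (rule DERIV_nonneg_imp_nondecreasing[OF assms])
    fix t :: real
    have "((\<lambda>t. t - t^3 / 3 + t^5 / 5) has_real_derivative 1 - t\<^sup>2 + t^4) (at t)"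
      by (auto intro!: derivative_eq_intros)
    from DERIV_diff[OF this DERIV_arctan]
    have "((\<lambda>t. (t - t^3 / 3 + t^5 / 5) - arctan t) has_real_derivative (1 - t\<^sup>2 + t^4) - inverse (1 + t\<^sup>2)) (at t)" .
    moreover have "(1 - t\<^sup>2 + t^4) - inverse (1 + t\<^sup>2) = t^6 / (1 + t\<^sup>2)"
      using p[of t] by (simp add: field_simps power2_eq_square power4_eq_xxxx eval_nat_numeral)
    moreover have "0 \<le> t^6 / (1 + t\<^sup>2)" using p[of t] by simp
    ultimately show "\<exists>y. ((\<lambda>t. (t - t^3 / 3 + t^5 / 5) - arctan t) has_real_derivative y) (at t) \<and> 0 \<le> y" by metis
  qed
  then show "arctan x \<le> x - x^3 / 3 + x^5 / 5" by simp
qed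

text \<open>Machin's formula with short Taylor polynomials; the accuracy is chosen to suffice for
  three decimals of the logarithmic coefficient.\<close>

lemma pi_bounds: "3.1404 < pi" "pi < 3.1425"
proof -
  have 1: "0.19733 < arctan (1/5 :: real)" "arctan (1/5 :: real) < 0.1974"
    using arctan_taylor_bounds[of "1/5"] by (simp_all add: eval_nat_numeral)
  have 2: "0.004 < arctan (1/239 :: real)" "arctan (1/239 :: real) < 0.0042"
    using arctan_taylor_bounds[of "1/239"] by (simp_all add: eval_nat_numeral)
  show "3.1404 < pi" "pi < 3.1425" using machin 1 2 by simp_all
qed

lemma log_coefficient_approx: "\<bar>12 / (pi * \<bar>det_H_star\<bar> powr (1/2)) - 0.618\<bar> < 5 / 10^4"
proof -
  define q where "q = sqrt \<bar>det_H_star\<bar>"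
  have d: "38.213 < \<bar>det_H_star\<bar>" "\<bar>det_H_star\<bar> < 38.214"
    using det_H_star_approx by (simp_all add: abs_less_iff abs_if split: if_splits)
  have q1: "6.181 < q" unfolding q_def by (rule real_less_rsqrt) (use d in \<open>simp add: power2_eq_square\<close>)
  have q2: "q < 6.182" unfolding q_def by (rule real_less_lsqrt) (use d in \<open>simp_all add: power2_eq_square\<close>)
  note q = q1 q2
  have "3.1404 * 6.181 < pi * q" using pi_bounds q by (intro mult_strict_mono) auto
  moreover have "pi * q < 3.1425 * 6.182" using pi_bounds q by (intro mult_strict_mono) auto
  ultimately have b: "12 / (pi * q) < 0.6184" "0.6176 < 12 / (pi * q)"
    using pi_bounds q by (simp_all add: divide_simps)
  define y where "y = 12 / (pi * q)"
  have "y < 0.6184" "0.6176 < y" using b by (simp_all only: y_def)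
  then have "\<bar>y - 0.618\<bar> < 5 / 10^4" by (simp add: abs_if)
  then show ?thesis by (simp add: powr_half_sqrt q_def y_def)
qed

theorem proposition5:
  shows
   "\<bar>x_star - 0.47309\<bar> < 5 / 10^6 \<and>
    stationary_points JB4 =
        perms ((1 / sqrt 2) *\<^sub>R vector [0, 0, 1, -1])
      \<union> saddle_points JB4
      \<union> perms ((1/2) *\<^sub>R vector [1, 1, -1, -1])
      \<union> (perms ((1 / sqrt 12) *\<^sub>R vector [3, -1, -1, -1])
          \<union> perms (- ((1 / sqrt 12) *\<^sub>R vector [3, -1, -1, -1]))) \<and>
    card (stationary_points JB4) = 50 \<and>
    (\<forall>u\<in>stationary_points JB4. nondegenerate JB4 u) \<and>

    card (perms ((1 / sqrt 2) *\<^sub>R vector [0, 0, 1, -1])) = 12 \<and>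
    (\<forall>u\<in>perms ((1 / sqrt 2) *\<^sub>R vector [0, 0, 1, -1]).
        (\<forall>w\<in>Omega4. JB4 u \<le> JB4 w) \<and> JB4 u = 1/6 \<and>
        hess_eigenvalues JB4 u = {8/3, 32/3}) \<and>

    card (saddle_points JB4) = 24 \<and>
    (\<forall>u\<in>saddle_points JB4. JB4 u = x_star \<and> hess_det JB4 u = det_H_star) \<and>
    \<bar>det_H_star - (- 38.2137)\<bar> < 5 / 10^5 \<and>

    card (perms ((1/2) *\<^sub>R vector [1, 1, -1, -1])) = 6 \<and>
    (\<forall>u\<in>perms ((1/2) *\<^sub>R vector [1, 1, -1, -1]).
        local_max_on Omega4 JB4 u \<and> JB4 u = 2/3 \<and>
        (\<forall>v\<in>tangent4 u. riem_hess JB4 u v = (- 16/3) *\<^sub>R v)) \<and>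

    card (perms ((1 / sqrt 12) *\<^sub>R vector [3, -1, -1, -1])
          \<union> perms (- ((1 / sqrt 12) *\<^sub>R vector [3, -1, -1, -1]))) = 8 \<and>
    (\<forall>u\<in>perms ((1 / sqrt 12) *\<^sub>R vector [3, -1, -1, -1])
          \<union> perms (- ((1 / sqrt 12) *\<^sub>R vector [3, -1, -1, -1])).
        (\<forall>w\<in>Omega4. JB4 w \<le> JB4 u) \<and> JB4 u = 26/27 \<and>
        (\<forall>v\<in>tangent4 u. riem_hess JB4 u v = (- 256/27) *\<^sub>R v)) \<and>

    (\<exists>f :: real \<Rightarrow> real.
        (\<forall>x. 0 \<le> f x) \<and>
        distributed uniform_Omega4 lborel JB4 (\<lambda>x. ennreal (f x)) \<and>
        infinitely_differentiable_on f ({1/6<..<26/27} - {x_star, 2/3}) \<and>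
        (f \<longlongrightarrow> 9/8) (at_right (1/6)) \<and>
        (\<exists>l r. (f \<longlongrightarrow> l) (at_left (2/3)) \<and> (f \<longlongrightarrow> r) (at_right (2/3)) \<and> l - r = 9/16) \<and>
        (f \<longlongrightarrow> 27/64) (at_left (26/27)) \<and>
        (\<lambda>x. f x - (- (12 / (pi * \<bar>det_H_star\<bar> powr (1/2))) * ln \<bar>x - x_star\<bar>))
          \<in> O[at x_star](\<lambda>_. 1)) \<and>
    \<bar>12 / (pi * \<bar>det_H_star\<bar> powr (1/2)) - 0.618\<bar> < 5 / 10^4"
proof (intro conjI)
  note types = perms_minima perms_local_maxima perms_maxima
  show "stationary_points JB4 =
        perms ((1 / sqrt 2) *\<^sub>R vector [0, 0, 1, -1])
      \<union> saddle_points JB4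
      \<union> perms ((1/2) *\<^sub>R vector [1, 1, -1, -1])
      \<union> (perms ((1 / sqrt 12) *\<^sub>R vector [3, -1, -1, -1])
          \<union> perms (- ((1 / sqrt 12) *\<^sub>R vector [3, -1, -1, -1])))"
    unfolding types saddle_points_JB4 stationary_points_JB4 by auto
  show "\<forall>u\<in>stationary_points JB4. nondegenerate JB4 u" using nondegenerate_stationary by blast
  show "\<forall>u\<in>perms ((1 / sqrt 2) *\<^sub>R vector [0, 0, 1, -1]).
        (\<forall>w\<in>Omega4. JB4 u \<le> JB4 w) \<and> JB4 u = 1/6 \<and> hess_eigenvalues JB4 u = {8/3, 32/3}"
    unfolding types by (intro ballI minima_JB4)
  show "\<forall>u\<in>saddle_points JB4. JB4 u = x_star \<and> hess_det JB4 u = det_H_star"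
    by (intro ballI saddles_JB4)
  show "card (saddle_points JB4) = 24" unfolding saddle_points_JB4 by (simp add: card_hyp_image card_sq_type)
  show "\<forall>u\<in>perms ((1/2) *\<^sub>R vector [1, 1, -1, -1]).
        local_max_on Omega4 JB4 u \<and> JB4 u = 2/3 \<and>
        (\<forall>v\<in>tangent4 u. riem_hess JB4 u v = (- 16/3) *\<^sub>R v)"
    unfolding types by (intro ballI local_maxima_JB4)
  show "\<forall>u\<in>perms ((1 / sqrt 12) *\<^sub>R vector [3, -1, -1, -1])
          \<union> perms (- ((1 / sqrt 12) *\<^sub>R vector [3, -1, -1, -1])).
        (\<forall>w\<in>Omega4. JB4 w \<le> JB4 u) \<and> JB4 u = 26/27 \<and>
        (\<forall>v\<in>tangent4 u. riem_hess JB4 u v = (- 256/27) *\<^sub>R v)"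
    unfolding types by (intro ballI maxima_JB4)
  show "\<exists>f :: real \<Rightarrow> real.
        (\<forall>x. 0 \<le> f x) \<and>
        distributed uniform_Omega4 lborel JB4 (\<lambda>x. ennreal (f x)) \<and>
        infinitely_differentiable_on f ({1/6<..<26/27} - {x_star, 2/3}) \<and>
        (f \<longlongrightarrow> 9/8) (at_right (1/6)) \<and>
        (\<exists>l r. (f \<longlongrightarrow> l) (at_left (2/3)) \<and> (f \<longlongrightarrow> r) (at_right (2/3)) \<and> l - r = 9/16) \<and>
        (f \<longlongrightarrow> 27/64) (at_left (26/27)) \<and>
        (\<lambda>x. f x - (- (12 / (pi * \<bar>det_H_star\<bar> powr (1/2))) * ln \<bar>x - x_star\<bar>)) \<in> O[at x_star](\<lambda>_. 1)"
    using jb_density_nonneg distributed_jb_density jb_density_smooth jb_density_at_min jb_density_jump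
      jb_density_at_max jb_density_log by (intro exI[of _ jb_density] conjI allI)
qed (fact x_star_approx card_stationary_points card_perms_minima det_H_star_approx card_perms_local_maxima
    card_perms_maxima log_coefficient_approx)+

end
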